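(* Let $\mathfrak{M}=M(\mathfrak{g},\sigma_1,\dots,\sigma_n,m_1,\dots,m_n)$ be a multiloop algebra. Then the map $\mathcal{E}\to\mathcal{S}$, $\Psi\mapsto\mathrm{ev}_\Psi$, is a bijection. In particular, all irreducible finite-dimensional representations of $\mathfrak{M}$ are evaluation representations.
   Context: $k$ is an algebraically closed field of characteristic zero; all tensor products are over $k$. Multiloop algebras: let $n,m_1,\dots,m_n$ be positive integers, $\mathfrak{g}$ a finite-dimensional semisimple Lie algebra over $k$, and $\sigma_1,\dots,\sigma_n$ commuting automorphisms of $\mathfrak{g}$ with $\sigma_i^{m_i}=\mathrm{id}$. Let $\Gamma=\langle g_1,\dots,g_n: g_i^{m_i}=1,\ g_ig_j=g_jg_i\rangle\cong\prod_i\mathbb{Z}/m_i\mathbb{Z}$ act on $\mathfrak{g}$ with $g_i$ acting by $\sigma_i$. For each $i$ let $\xi_i\in k$ be a primitive $m_i$-th root of unity, and let $\Gamma$ act on $X=(k^\times)^n=\operatorname{Spec}A$, $A=k[t_1^{\pm1},\dots,t_n^{\pm1}]$, by $g_i\cdot(z_1,\dots,z_n)=(z_1,\dots,z_{i-1},\xi_iz_i,z_{i+1},\dots,z_n)$. Then $M(\mathfrak{g},\sigma_1,\dots,\sigma_n,m_1,\dots,m_n):=M(X,\mathfrak{g})^\Gamma$, the Lie algebra of $\Gamma$-equivariant regular maps $X\to\mathfrak{g}$ with pointwise operations; equivalently $(\mathfrak{g}\otimes A)^\Gamma$ for the diagonal action (with $\Gamma$ acting on $A$ by $g\cdot f=f\circ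 g^{-1}$) and bracket $[u\otimes f,v\otimes h]=[u,v]\otimes fh$. $X_{\rm rat}=(k^\times)^n$ is the set of $k$-rational points of $X$. For $x\in X_{\rm rat}$ let $\Gamma_x$ be its stabilizer in $\Gamma$ and $\mathfrak{g}^x=\{u\in\mathfrak{g}:g\cdot u=u\ \forall g\in\Gamma_x\}$ (here $\Gamma_x$ is trivial and $\mathfrak{g}^x=\mathfrak{g}$). For a finite subset $\mathbf{x}\subseteq X_{\rm rat}$ let $\mathrm{ev}_{\mathbf x}:\mathfrak{M}\to\bigoplus_{x\in\mathbf{x}}\mathfrak{g}^x$, $\alpha\mapsto(\alpha(x))_{x\in\mathbf{x}}$. Given representations $\rho_x:\mathfrak{g}^x\to\operatorname{End}_kV_x$ ($x\in\mathbf{x}$), the evaluation representation $\mathrm{ev}_{\mathbf x}(\rho_x)_{x\in\mathbf{x}}$ of $\mathfrak{M}$ on $\bigotimes_{x\in\mathbf x}V_x$ is the composition of $\mathrm{ev}_{\mathbf x}$ with the tensor product representation of $\bigoplus_{x\in\mathbf{x}}\mathfrak{g}^x$. $\mathcal{R}_x$ is the set of isomorphism classes of irreducible finite-dimensional representations of $\mathfrak{g}^x$, and $\mathcal{R}_X=\bigsqcup_{x\in X_{\rm rat}}\mathcal{R}_x$, with $\Gamma$ acting by $g\cdot[\rho]=[\rho\circ g^{-1}]\in\mathcal{R}_{g\cdot x}$ for $[\rho]\in\mathcal{R}_x$. $\mathcal{E}$ is the set of finitely supported $\Gamma$-equivariant functions $\Psi:X_{\rm rat}\to\mathcal{R}_X$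 with $\Psi(x)\in\mathcal{R}_x$, where $\operatorname{supp}\Psi=\{x:\Psi(x)\neq0\}$ and $0$ denotes the class of the one-dimensional trivial representation. For $\Psi\in\mathcal{E}$, $\mathrm{ev}_\Psi$ is the isomorphism class of $\mathrm{ev}_{\mathbf x}(\Psi(x))_{x\in\mathbf{x}}$, where $\mathbf{x}$ contains exactly one element of each $\Gamma$-orbit in $\operatorname{supp}\Psi$ (independent of the choice); if $\operatorname{supp}\Psi=\emptyset$, it is the class of the trivial representation. $\mathcal{S}$ is the set of isomorphism classes of irreducible finite-dimensional representations of $\mathfrak{M}$. *)

theory Defs
  imports
    "HOL-Library.Function_Algebras"
    "HOL-Computational_Algebra.Polynomial"
    "HOL-Algebra.Product_Groups"
    "HOL-Algebra.Group_Action"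
begin

definition linear_on ::
  "('k::field \<Rightarrow> 'v::ab_group_add \<Rightarrow> 'v) \<Rightarrow> ('k \<Rightarrow> 'w::ab_group_add \<Rightarrow> 'w)
    \<Rightarrow> 'v set \<Rightarrow> 'w set \<Rightarrow> ('v \<Rightarrow> 'w) \<Rightarrow> bool" where
  "linear_on sV sW V W f \<longleftrightarrow>
     (\<forall>v\<in>V. f v \<in> W) \<and>
     (\<forall>u\<in>V. \<forall>v\<in>V. f (u + v) = f u + f v) \<and>
     (\<forall>c. \<forall>v\<in>V. f (sV c v) = sW c (f v))"

definition fin_dim :: "('k::field \<Rightarrow> 'v::ab_group_add \<Rightarrow> 'v) \<Rightarrow> 'v set \<Rightarrow> bool" where
  "fin_dim sV V \<longleftrightarrow> (\<exists>B. finite B \<and> module.span sV B = V)"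

definition fun_scale :: "('k \<Rightarrow> 'v \<Rightarrow> 'v) \<Rightarrow> 'k \<Rightarrow> ('x \<Rightarrow> 'v) \<Rightarrow> 'x \<Rightarrow> 'v" where
  "fun_scale sV c f = (\<lambda>x. sV c (f x))"

text \<open>
  HOL cannot quantify over all vector spaces inside a formula, so a set of isomorphism classes
  needs a fixed ambient space.  We take the space of sequences over \<open>k\<close>: every
  finite-dimensional space is isomorphic to a subspace of it.
\<close>

type_synonym 'k seq = "nat \<Rightarrow> 'k"

abbreviation seq_scale :: "'k::field \<Rightarrow> 'k seq \<Rightarrow> 'k seq" where
  "seq_scale \<equiv> fun_scale (*)"

definition multilinear_on ::
  "'i set \<Rightarrow> ('k::field \<Rightarrow> 'v::ab_group_add \<Rightarrow> 'v) \<Rightarrow> ('k \<Rightarrow> 'w::ab_group_add \<Rightarrow> 'w)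
    \<Rightarrow> ('i \<Rightarrow> 'v set) \<Rightarrow> 'w set \<Rightarrow> (('i \<Rightarrow> 'v) \<Rightarrow> 'w) \<Rightarrow> bool" where
  "multilinear_on I sV sW V W f \<longleftrightarrow>
     (\<forall>v\<in>Pi\<^sub>E I V. f v \<in> W) \<and>
     (\<forall>v\<in>Pi\<^sub>E I V. \<forall>i\<in>I. linear_on sV sW (V i) W (\<lambda>a. f (v(i := a))))"

text \<open>
  \<open>W\<close> together with the multilinear map \<open>t\<close> is a tensor product of the spaces \<open>V i\<close>, by
  the universal property.  For \<open>I = {}\<close> this says that \<open>W\<close> is one-dimensional.
\<close>

definition is_tensor_product ::
  "'i set \<Rightarrow> ('k::field \<Rightarrow> 'v::ab_group_add \<Rightarrow> 'v) \<Rightarrow> ('k \<Rightarrow> 'w::ab_group_add \<Rightarrow> 'w)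
    \<Rightarrow> ('i \<Rightarrow> 'v set) \<Rightarrow> 'w set \<Rightarrow> (('i \<Rightarrow> 'v) \<Rightarrow> 'w) \<Rightarrow> bool" where
  "is_tensor_product I sV sW V W t \<longleftrightarrow>
     multilinear_on I sV sW V W t \<and>
     (\<forall>f. multilinear_on I sV seq_scale V (UNIV :: 'k seq set) f \<longrightarrow>
        (\<exists>!h. h \<in> extensional W \<and> linear_on sW seq_scale W (UNIV :: 'k seq set) h \<and>
              (\<forall>v\<in>Pi\<^sub>E I V. h (t v) = f v)))"

locale lie_algebra = vector_space scale
  for scale :: "'k::field \<Rightarrow> 'g::ab_group_add \<Rightarrow> 'g" +
  fixes bracket :: "'g \<Rightarrow> 'g \<Rightarrow> 'g"
  assumes bracket_linear_left: "Vector_Spaces.linear scale scale (\<lambda>a. bracket a b)"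
    and bracket_linear_right: "Vector_Spaces.linear scale scale (\<lambda>b. bracket a b)"
    and bracket_self: "bracket a a = 0"
    and jacobi:
      "bracket a (bracket b c) + bracket b (bracket c a) + bracket c (bracket a b) = 0"
begin

definition lie_ideal :: "'g set \<Rightarrow> bool" where
  "lie_ideal I \<longleftrightarrow> subspace I \<and> (\<forall>a. \<forall>b\<in>I. bracket a b \<in> I)"

definition derived :: "'g set \<Rightarrow> 'g set" where
  "derived L = span {bracket a b | a b. a \<in> L \<and> b \<in> L}"

definition solvable :: "'g set \<Rightarrow> bool" where
  "solvable L \<longleftrightarrow> (\<exists>r. (derived ^^ r) L = {0})"

definition semisimple :: bool where
  "semisimple \<longleftrightarrow> (\<forall>I. lie_ideal I \<and> solvable I \<longrightarrow> I = {0})"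

definition lie_automorphism :: "('g \<Rightarrow> 'g) \<Rightarrow> bool" where
  "lie_automorphism f \<longleftrightarrow>
     Vector_Spaces.linear scale scale f \<and> bij f \<and>
     (\<forall>a b. f (bracket a b) = bracket (f a) (f b))"

end

text \<open>
  In the following, \<open>L\<close> is a Lie subalgebra of the ambient Lie algebra given by \<open>br\<close>, and a
  representation of \<open>L\<close> is a pair \<open>(V, \<rho>)\<close>; only the values \<open>\<rho> a v\<close> with \<open>a \<in> L\<close> and
  \<open>v \<in> V\<close> are meaningful.
\<close>

definition lie_rep ::
  "('k::field \<Rightarrow> 'l::ab_group_add \<Rightarrow> 'l) \<Rightarrow> ('l \<Rightarrow> 'l \<Rightarrow> 'l) \<Rightarrow> 'l set
    \<Rightarrow> ('k \<Rightarrow> 'v::ab_group_add \<Rightarrow> 'v) \<Rightarrow> 'v set \<times> ('l \<Rightarrow> 'v \<Rightarrow> 'v) \<Rightarrow> bool" where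
  "lie_rep sL br L sV = (\<lambda>(V, \<rho>).
     vector_space sV \<and> module.subspace sV V \<and>
     (\<forall>a\<in>L. linear_on sV sV V V (\<rho> a)) \<and>
     (\<forall>v\<in>V. linear_on sL sV L V (\<lambda>a. \<rho> a v)) \<and>
     (\<forall>a\<in>L. \<forall>b\<in>L. \<forall>v\<in>V. \<rho> (br a b) v = \<rho> a (\<rho> b v) - \<rho> b (\<rho> a v)))"

definition irreducible_rep ::
  "'l set \<Rightarrow> ('k::field \<Rightarrow> 'v::ab_group_add \<Rightarrow> 'v) \<Rightarrow> 'v set \<times> ('l \<Rightarrow> 'v \<Rightarrow> 'v) \<Rightarrow> bool" where
  "irreducible_rep L sV = (\<lambda>(V, \<rho>).
     V \<noteq> {0} \<and>
     (\<forall>U. module.subspace sV U \<and> U \<subseteq> V \<and> (\<forall>a\<in>L. \<forall>u\<in>U. \<rho> a u \<in> U)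
        \<longrightarrow> U = {0} \<or> U = V))"

definition iso_rep ::
  "'l set \<Rightarrow> ('k::field \<Rightarrow> 'v::ab_group_add \<Rightarrow> 'v) \<Rightarrow> ('k \<Rightarrow> 'w::ab_group_add \<Rightarrow> 'w)
    \<Rightarrow> 'v set \<times> ('l \<Rightarrow> 'v \<Rightarrow> 'v) \<Rightarrow> 'w set \<times> ('l \<Rightarrow> 'w \<Rightarrow> 'w) \<Rightarrow> bool" where
  "iso_rep L sV sW = (\<lambda>(V, \<rho>) (W, \<tau>).
     \<exists>T. linear_on sV sW V W T \<and> bij_betw T V W \<and>
         (\<forall>a\<in>L. \<forall>v\<in>V. T (\<rho> a v) = \<tau> a (T v)))"

type_synonym ('l, 'k) seq_rep = "'k seq set \<times> ('l \<Rightarrow> 'k seq \<Rightarrow> 'k seq)"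

definition fd_rep ::
  "('k::field \<Rightarrow> 'l::ab_group_add \<Rightarrow> 'l) \<Rightarrow> ('l \<Rightarrow> 'l \<Rightarrow> 'l) \<Rightarrow> 'l set \<Rightarrow> ('l, 'k) seq_rep \<Rightarrow> bool" where
  "fd_rep sL br L R \<longleftrightarrow> lie_rep sL br L seq_scale R \<and> fin_dim seq_scale (fst R)"

definition rep_class ::
  "('k::field \<Rightarrow> 'l::ab_group_add \<Rightarrow> 'l) \<Rightarrow> ('l \<Rightarrow> 'l \<Rightarrow> 'l) \<Rightarrow> 'l set
    \<Rightarrow> ('l, 'k) seq_rep \<Rightarrow> ('l, 'k) seq_rep set" where
  "rep_class sL br L R = {R'. fd_rep sL br L R' \<and> iso_rep L seq_scale seq_scale R R'}"

definition irrep_classes ::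
  "('k::field \<Rightarrow> 'l::ab_group_add \<Rightarrow> 'l) \<Rightarrow> ('l \<Rightarrow> 'l \<Rightarrow> 'l) \<Rightarrow> 'l set
    \<Rightarrow> ('l, 'k) seq_rep set set" where
  "irrep_classes sL br L =
     {rep_class sL br L R | R. fd_rep sL br L R \<and> irreducible_rep L seq_scale R}"

definition trivial_rep :: "('l, 'k::field) seq_rep" where
  "trivial_rep = (module.span seq_scale {(\<lambda>i. if i = 0 then 1 else 0)}, \<lambda>a v. 0)"

text \<open>
  The acting Lie algebra is the direct sum of the \<open>L i\<close> over the finite set \<open>I\<close>.  The vectors
  \<open>t v\<close> span \<open>W\<close>, so the formula determines \<open>\<tau> a\<close> on all of \<open>W\<close>.
\<close>

definition is_tensor_rep ::
  "'i set \<Rightarrow> ('i \<Rightarrow> 'l set) \<Rightarrow> ('k::field \<Rightarrow> 'v::ab_group_add \<Rightarrow> 'v)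
    \<Rightarrow> ('k \<Rightarrow> 'w::ab_group_add \<Rightarrow> 'w) \<Rightarrow> ('i \<Rightarrow> 'v set \<times> ('l \<Rightarrow> 'v \<Rightarrow> 'v))
    \<Rightarrow> 'w set \<times> (('i \<Rightarrow> 'l) \<Rightarrow> 'w \<Rightarrow> 'w) \<Rightarrow> bool" where
  "is_tensor_rep I L sV sW R = (\<lambda>(W, \<tau>).
     \<exists>t. is_tensor_product I sV sW (\<lambda>i. fst (R i)) W t \<and>
         (\<forall>a\<in>Pi\<^sub>E I L. linear_on sW sW W W (\<tau> a) \<and>
            (\<forall>v\<in>(\<Pi>\<^sub>E i\<in>I. fst (R i)).
               \<tau> a (t v) = (\<Sum>i\<in>I. t (v(i := snd (R i) (a i) (v i)))))))"

definition primitive_root_of_unity :: "nat \<Rightarrow> 'k::field \<Rightarrow> bool" where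
  "primitive_root_of_unity r z \<longleftrightarrow> z ^ r = 1 \<and> (\<forall>j. 0 < j \<and> j < r \<longrightarrow> z ^ j \<noteq> 1)"

text \<open>The indices \<open>1, \<dots>, n\<close> are shifted to \<open>0, \<dots>, n - 1\<close>.\<close>

locale multiloop = lie_algebra scale bracket
  for scale :: "'k::{alg_closed_field, field_char_0} \<Rightarrow> 'g::ab_group_add \<Rightarrow> 'g" and bracket +
  fixes n :: nat and m :: "nat \<Rightarrow> nat" and \<sigma> :: "nat \<Rightarrow> 'g \<Rightarrow> 'g" and \<xi> :: "nat \<Rightarrow> 'k"
  assumes finite_dimensional: "fin_dim scale (UNIV :: 'g set)"
    and semisimple: semisimple
    and n_pos: "n > 0"
    and m_pos: "i < n \<Longrightarrow> m i > 0"
    and automorphism: "i < n \<Longrightarrow> lie_automorphism (\<sigma> i)"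
    and commute: "\<lbrakk>i < n; j < n\<rbrakk> \<Longrightarrow> \<sigma> i \<circ> \<sigma> j = \<sigma> j \<circ> \<sigma> i"
    and finite_order: "i < n \<Longrightarrow> \<sigma> i ^^ m i = id"
    and primitive_root: "i < n \<Longrightarrow> primitive_root_of_unity (m i) (\<xi> i)"
begin

text \<open>\<open>c \<in> \<Gamma>\<close> stands for the product of the powers \<open>g\<^sub>i ^ c i\<close>.\<close>

definition \<Gamma> :: "(nat \<Rightarrow> int) monoid" where
  "\<Gamma> = product_group {..<n} (\<lambda>i. integer_mod_group (m i))"

definition X :: "(nat \<Rightarrow> 'k) set" where
  "X = {..<n} \<rightarrow>\<^sub>E - {0}"

definition act_X :: "(nat \<Rightarrow> int) \<Rightarrow> (nat \<Rightarrow> 'k) \<Rightarrow> (nat \<Rightarrow> 'k)" where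
  "act_X c z = (\<lambda>i\<in>{..<n}. \<xi> i powi c i * z i)"

definition act_g :: "(nat \<Rightarrow> int) \<Rightarrow> 'g \<Rightarrow> 'g" where
  "act_g c = foldr (\<lambda>i f. (\<sigma> i ^^ nat (c i)) \<circ> f) [0..<n] id"

text \<open>
  Functions on \<open>X\<close> are represented as functions that vanish outside \<open>X\<close>, so that functions
  on \<open>X\<close> form a vector space under the pointwise operations.
\<close>

definition monomial :: "(nat \<Rightarrow> int) \<Rightarrow> (nat \<Rightarrow> 'k) \<Rightarrow> 'k" where
  "monomial e z = (if z \<in> X then \<Prod>i<n. z i powi e i else 0)"

definition regular_functions :: "((nat \<Rightarrow> 'k) \<Rightarrow> 'k) set" where
  "regular_functions = module.span (fun_scale (*)) (range monomial)"

definition regular_maps :: "((nat \<Rightarrow> 'k) \<Rightarrow> 'g) set" where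
  "regular_maps =
     module.span (fun_scale scale) {(\<lambda>z. scale (f z) u) | f u. f \<in> regular_functions}"

definition M :: "((nat \<Rightarrow> 'k) \<Rightarrow> 'g) set" where
  "M = {\<alpha> \<in> regular_maps. \<forall>c\<in>carrier \<Gamma>. \<forall>z\<in>X. \<alpha> (act_X c z) = act_g c (\<alpha> z)}"

definition M_scale :: "'k \<Rightarrow> ((nat \<Rightarrow> 'k) \<Rightarrow> 'g) \<Rightarrow> (nat \<Rightarrow> 'k) \<Rightarrow> 'g" where
  "M_scale = fun_scale scale"

definition M_bracket ::
  "((nat \<Rightarrow> 'k) \<Rightarrow> 'g) \<Rightarrow> ((nat \<Rightarrow> 'k) \<Rightarrow> 'g) \<Rightarrow> (nat \<Rightarrow> 'k) \<Rightarrow> 'g" where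
  "M_bracket \<alpha> \<beta> = (\<lambda>z. bracket (\<alpha> z) (\<beta> z))"

definition g_at :: "(nat \<Rightarrow> 'k) \<Rightarrow> 'g set" where
  "g_at x = {u. \<forall>c\<in>stabilizer \<Gamma> act_X x. act_g c u = u}"

definition is_evaluation_rep ::
  "('k \<Rightarrow> 'w::ab_group_add \<Rightarrow> 'w) \<Rightarrow> (nat \<Rightarrow> 'k) set \<Rightarrow> ((nat \<Rightarrow> 'k) \<Rightarrow> ('g, 'k) seq_rep)
    \<Rightarrow> 'w set \<times> (((nat \<Rightarrow> 'k) \<Rightarrow> 'g) \<Rightarrow> 'w \<Rightarrow> 'w) \<Rightarrow> bool" where
  "is_evaluation_rep sW xs R = (\<lambda>(W, \<tau>).
     \<exists>\<tau>'. is_tensor_rep xs g_at seq_scale sW R (W, \<tau>') \<and>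
          (\<forall>\<alpha>\<in>M. \<forall>w\<in>W. \<tau> \<alpha> w = \<tau>' (restrict \<alpha> xs) w))"

definition R_at :: "(nat \<Rightarrow> 'k) \<Rightarrow> ('g, 'k) seq_rep set set" where
  "R_at x = irrep_classes scale bracket (g_at x)"

definition zero_at :: "(nat \<Rightarrow> 'k) \<Rightarrow> ('g, 'k) seq_rep set" where
  "zero_at x = rep_class scale bracket (g_at x) trivial_rep"

definition act_class :: "(nat \<Rightarrow> int) \<Rightarrow> ('g, 'k) seq_rep set \<Rightarrow> ('g, 'k) seq_rep set" where
  "act_class c C = (\<lambda>(V, \<rho>). (V, \<lambda>u. \<rho> (act_g (inv\<^bsub>\<Gamma>\<^esub> c) u))) ` C"

definition supp :: "((nat \<Rightarrow> 'k) \<Rightarrow> ('g, 'k) seq_rep set) \<Rightarrow> (nat \<Rightarrow> 'k) set" where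
  "supp \<Psi> = {x \<in> X. \<Psi> x \<noteq> zero_at x}"

text \<open>
  A function into the disjoint union of the \<open>R_at x\<close> sending each \<open>x\<close> into \<open>R_at x\<close> is
  rendered as an element of the dependent product.
\<close>

definition E :: "((nat \<Rightarrow> 'k) \<Rightarrow> ('g, 'k) seq_rep set) set" where
  "E = {\<Psi> \<in> Pi\<^sub>E X R_at. finite (supp \<Psi>) \<and>
          (\<forall>c\<in>carrier \<Gamma>. \<forall>x\<in>X. \<Psi> (act_X c x) = act_class c (\<Psi> x))}"

text \<open>
  All models of the evaluation representations obtained from all choices of orbit
  representatives \<open>xs\<close> and of representations in the classes \<open>\<Psi> x\<close> are collected.  That
  this is a single isomorphism class is thus part of any claim that it lies in \<open>S\<close>.
  The case of empty support is the empty tensor product, the trivial representation.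
\<close>

definition ev_class ::
  "((nat \<Rightarrow> 'k) \<Rightarrow> ('g, 'k) seq_rep set) \<Rightarrow> ((nat \<Rightarrow> 'k) \<Rightarrow> 'g, 'k) seq_rep set" where
  "ev_class \<Psi> = {Q. fd_rep M_scale M_bracket M Q \<and>
     (\<exists>xs R. xs \<subseteq> supp \<Psi> \<and>
        (\<forall>x\<in>supp \<Psi>. \<exists>!y. y \<in> xs \<and> y \<in> orbit \<Gamma> act_X x) \<and>
        (\<forall>x\<in>xs. R x \<in> \<Psi> x) \<and>
        is_evaluation_rep seq_scale xs R Q)}"

definition S :: "((nat \<Rightarrow> 'k) \<Rightarrow> 'g, 'k) seq_rep set set" where
  "S = irrep_classes M_scale M_bracket M"

end

end

theory Submission
  imports Defs
begin

text \<open>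
  Write \<open>M\<close> for the multiloop algebra, \<open>A\<close> for the ring of regular functions on the torus \<open>X\<close> and
  \<open>B = A\<^sup>\<Gamma>\<close>.  The group \<open>\<Gamma>\<close> acts freely on \<open>X\<close>, so every stabilizer is trivial and every
  \<open>\<gg>\<^sup>x\<close> is all of \<open>\<gg>\<close>.

  Every finite-dimensional irreducible representation \<open>(W, \<tau>)\<close> of \<open>M\<close> is an evaluation
  representation.  Let \<open>K\<close> be its kernel and \<open>J = {b \<in> B. b M \<subseteq> K}\<close>.  Averaging over \<open>\<Gamma>\<close> and the
  perfectness of \<open>\<gg>\<close> (\<open>semisimple_perfect\<close>) show that every element of \<open>M\<close> is a sum of
  brackets of finitely many fixed elements with further elements of \<open>M\<close> (\<open>strong_perfect\<close>).  Two consequences follow.  First, \<open>J\<close> contains a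
  nonzero polynomial in each invariant function \<open>t\<^sub>i ^ m\<^sub>i\<close>, because only finitely many linear
  conditions have to be met (\<open>finite_codim\<close>).  Second, \<open>J\<close> is a radical ideal: if \<open>b\<^sup>2 \<in> J\<close> then \<open>b M\<close>
  is an ideal with commuting image, its elements act by generalized scalars of trace zero, and so it
  acts by zero (\<open>abelian_ideal_trivial\<close>).  Hence \<open>J\<close> contains, for each \<open>i\<close>, a polynomial in
  \<open>t\<^sub>i ^ m\<^sub>i\<close> with simple nonzero roots; the common zeros form a finite \<open>\<Gamma>\<close>-stable grid, and an element
  of \<open>M\<close> vanishing on that grid lies in \<open>K\<close> (\<open>grid_ideal\<close>, \<open>M_grid\<close>).  So \<open>\<tau>\<close> factors through the values
  at finitely many points \<open>xs\<close> in distinct orbits (\<open>factor_through_points\<close>).  Elements of \<open>M\<close> with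
  prescribed values on \<open>xs\<close> exist (\<open>site_elements\<close>), so \<open>\<tau>\<close> becomes a family of pairwise commuting
  actions of \<open>\<gg>\<close>, one for each point, and the density theorem splits \<open>W\<close> into a tensor product of
  irreducible factors (\<open>commuting_tensor_decomposition\<close>, \<open>is_evaluation\<close>).

  Conversely a tensor product of irreducible representations at points in distinct orbits is
  irreducible (\<open>tensor_irreducible\<close>, \<open>ev_struct_exists\<close>).  Equivariance of \<open>\<Psi>\<close> and of the elements of
  \<open>M\<close> lets one slide each point along its orbit without changing the representation
  (\<open>ev_struct_move\<close>), so all models collected in \<open>ev_class \<Psi>\<close> form one isomorphism class
  (\<open>ev_class_eq\<close>).  A representation determines the class at each point \<open>x\<close>: one tensor factor embeds
  equivariantly and another one, for a second function with the same image, is an equivariant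
  quotient; composing an embedding with a suitable quotient map gives a nonzero map between
  irreducible representations of \<open>\<gg>\<close> (\<open>site_determined\<close>, \<open>ev_class_inj\<close>).  Surjectivity
  (\<open>ev_class_surj\<close>) extends the classes found at the points of a set of orbit representatives to an
  equivariant function, which is possible because the action is free.
\<close>

section \<open>Linear algebra in finite dimension\<close>

abbreviation linear_op :: "('k::field \<Rightarrow> 'v::ab_group_add \<Rightarrow> 'v) \<Rightarrow> ('v \<Rightarrow> 'v) \<Rightarrow> bool" where
  "linear_op s \<equiv> Vector_Spaces.linear s s"

abbreviation seq_linear_on :: "'k::field seq set \<Rightarrow> 'k seq set \<Rightarrow> ('k seq \<Rightarrow> 'k seq) \<Rightarrow> bool" where
  "seq_linear_on \<equiv> linear_on seq_scale seq_scale"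

lemma sum_fun_apply: "(sum f A) x = (\<Sum>a\<in>A. f a x)"
  by (induction A rule: infinite_finite_induct) auto

text \<open>
  A locale of its own for statements about total linear operators on a space given by an explicit
  scalar multiplication.  Finite-dimensional subspaces are given by \<open>fin_dim\<close>.
\<close>

locale lin_space = vector_space scale
  for scale :: "'a::field \<Rightarrow> 'b::ab_group_add \<Rightarrow> 'b"
begin

lemma fin_dim_basis:
  assumes "fin_dim scale W"
  obtains B where "finite B" "independent B" "span B = W" "B \<subseteq> W"
proof -
  from assms obtain F where F: "finite F" "span F = W" by (auto simp: fin_dim_def)
  obtain B where B: "B \<subseteq> W" "independent B" "W \<subseteq> span B" "card B = dim W"
    using basis_exists by metis
  have "finite B" using independent_span_bound[OF F(1) B(2)] B(1) F(2) by blast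
  moreover have "span B = W" using B(1,3) F(2) span_minimal[OF B(1)] subspace_span by blast
  ultimately show ?thesis using that B by blast
qed

lemma fin_dim_subspace: "fin_dim scale W \<Longrightarrow> subspace W"
  by (auto simp: fin_dim_def)

lemma fin_dim_mono:
  assumes W: "fin_dim scale W" and U: "subspace U" "U \<subseteq> W"
  shows "fin_dim scale U"
proof -
  obtain F where F: "finite F" "independent F" "span F = W" using fin_dim_basis[OF W] by metis
  obtain B where B: "B \<subseteq> U" "independent B" "U \<subseteq> span B" using basis_exists by metis
  have "finite B" using independent_span_bound[OF F(1) B(2)] B(1) F(3) U(2) by blast
  moreover have "span B = U" using B U(1) span_minimal by blast
  ultimately show ?thesis by (auto simp: fin_dim_def)
qed

lemma fin_dim_dim_less:
  assumes W: "fin_dim scale W" and U: "subspace U" "U \<subseteq> W" "U \<noteq> W"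
  shows "dim U < dim W"
proof -
  obtain B where B: "finite B" "independent B" "span B = U" "B \<subseteq> U"
    using fin_dim_basis[OF fin_dim_mono[OF W U(1,2)]] by metis
  obtain w where w: "w \<in> W" "w \<notin> U" using U(2,3) by blast
  obtain F where F: "finite F" "independent F" "span F = W" using fin_dim_basis[OF W] by metis
  have ind: "independent (insert w B)" using B(2,3) w(2) independent_insertI by blast
  have "insert w B \<subseteq> span F" using B(4) U(2) F(3) w(1) by blast
  then have "card (insert w B) \<le> card F" using independent_span_bound[OF F(1) ind] by blast
  moreover have "w \<notin> B" using w B(4) by blast
  ultimately have "card B < card F" using B(1) by simp
  then show ?thesis using dim_span_eq_card_independent[OF B(2)] dim_span_eq_card_independent[OF F(2)] B(3) F(3)
    by simp
qed

lemma fin_dim_minimal_subspace: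
  assumes W: "fin_dim scale W" "W \<noteq> {0}" and P: "P W"
  obtains Z where "subspace Z" "Z \<subseteq> W" "Z \<noteq> {0}" "P Z"
    "\<And>Z'. subspace Z' \<Longrightarrow> Z' \<subseteq> Z \<Longrightarrow> Z' \<noteq> {0} \<Longrightarrow> P Z' \<Longrightarrow> Z' = Z"
proof -
  let ?Q = "\<lambda>Z. subspace Z \<and> Z \<subseteq> W \<and> Z \<noteq> {0} \<and> P Z"
  have "?Q W" using W P fin_dim_subspace by blast
  then obtain Z where Z: "?Q Z" and min: "\<And>Y. ?Q Y \<Longrightarrow> dim Z \<le> dim Y"
    using ex_has_least_nat[of ?Q W dim] by blast
  have "Z' = Z" if "subspace Z'" "Z' \<subseteq> Z" "Z' \<noteq> {0}" "P Z'" for Z'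
  proof (rule ccontr)
    assume "Z' \<noteq> Z"
    then have "dim Z' < dim Z" using fin_dim_dim_less[of Z Z'] fin_dim_mono[OF W(1)] Z that by blast
    moreover have "dim Z \<le> dim Z'" using min[of Z'] that Z by blast
    ultimately show False by simp
  qed
  then show ?thesis using that Z by blast
qed

lemma subspace_projection:
  assumes "subspace W"
  obtains p where "linear_op scale p" "\<And>v. p v \<in> W" "\<And>w. w \<in> W \<Longrightarrow> p w = w"
proof -
  interpret vp: vector_space_pair scale scale by unfold_locales
  obtain B where B: "B \<subseteq> W" "independent B" "W \<subseteq> span B" using basis_exists by metis
  have sB: "span B = W" using B assms span_minimal by blast
  obtain g where g: "linear_op scale g" "\<And>x. x \<in> B \<Longrightarrow> g x = id x" "range g = span (id ` B)"
    using vp.linear_independent_extend_subspace[OF B(2), of id] by blast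
  have "g w = w" if "w \<in> W" for w
    using vp.linear_eq_on[OF g(1) linear_id[unfolded id_def], of w B] g(2) that sB by auto
  moreover have "g v \<in> W" for v using g(3) sB by auto
  ultimately show ?thesis using that g(1) by blast
qed

text \<open>
  Fewer functionals than dimensions have a common zero: a polynomial of a large degree, or a vector
  orthogonal to a proper subspace, will be found in this way.  The joint values lie in a space of dimension
  at most \<open>card F\<close>, so the joint map is not injective on the span of \<open>P\<close>.
\<close>

lemma common_zero:
  assumes F: "finite F" and lin: "\<And>d. d \<in> F \<Longrightarrow> Vector_Spaces.linear scale (*) (\<phi> d)"
    and P: "independent P" "finite P" "card F < card P"
  obtains v where "v \<in> span P" "v \<noteq> 0" "\<And>d. d \<in> F \<Longrightarrow> \<phi> d v = (0::'a)"
proof -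
  let ?s = "fun_scale (*) :: 'a \<Rightarrow> ('c \<Rightarrow> 'a) \<Rightarrow> 'c \<Rightarrow> 'a"
  interpret f: vector_space ?s
    by unfold_locales (auto simp: fun_scale_def plus_fun_def algebra_simps)
  interpret vp: vector_space_pair scale ?s by unfold_locales
  define \<Phi> where "\<Phi> = (\<lambda>v d. if d \<in> F then \<phi> d v else 0)"
  have add: "\<phi> d (u + v) = \<phi> d u + \<phi> d v" and sc: "\<phi> d (scale c v) = c * \<phi> d v" if "d \<in> F" for d u v c
    using lin[OF that] by (auto simp: Vector_Spaces.linear_iff)
  have \<Phi>: "Vector_Spaces.linear scale ?s \<Phi>"
    unfolding Vector_Spaces.linear_iff
    by (intro conjI allI vector_space_axioms f.vector_space_axioms)
      (auto simp: \<Phi>_def fun_scale_def plus_fun_def add sc fun_eq_iff)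
  show ?thesis
  proof (cases "inj_on \<Phi> (span P)")
    case True
    define e :: "'c \<Rightarrow> 'c \<Rightarrow> 'a" where "e = (\<lambda>d d'. if d' = d then 1 else 0)"
    have ind: "f.independent (\<Phi> ` P)"
      by (rule vp.linear_independent_injective_image[OF \<Phi> P(1) True])
    have sub: "\<Phi> ` P \<subseteq> f.span (e ` F)"
    proof
      fix y assume "y \<in> \<Phi> ` P"
      then obtain v where v: "y = \<Phi> v" by blast
      have "y = (\<Sum>d\<in>F. ?s (\<phi> d v) (e d))"
        using F by (auto simp: v \<Phi>_def e_def fun_scale_def fun_eq_iff sum_fun_apply if_distrib cong: if_cong)
      then show "y \<in> f.span (e ` F)"
        by (simp only:) (intro f.span_sum f.span_scale f.span_base imageI)
    qed
    have "card (\<Phi> ` P) \<le> card (e ` F)"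
      using f.independent_span_bound[OF _ ind sub] F by blast
    also have "\<dots> \<le> card F" by (rule card_image_le[OF F])
    finally have "card P \<le> card F"
      using card_image[OF inj_on_subset[OF True span_superset]] by simp
    then show ?thesis using P(3) by simp
  next
    case False
    then have "\<exists>v\<in>span P. \<Phi> v = 0 \<and> v \<noteq> 0"
      using vp.linear_inj_on_iff_eq_0[OF \<Phi> subspace_span] by simp
    then obtain v where "v \<in> span P" "\<Phi> v = 0" "v \<noteq> 0" by metis
    moreover have "\<phi> d v = 0" if "d \<in> F" for d
      using fun_cong[OF \<open>\<Phi> v = 0\<close>, of d] that by (simp add: \<Phi>_def)
    ultimately show ?thesis using that by blast
  qed
qed

lemma coordinate_functionals:
  assumes "fin_dim scale W"
  obtains C :: "'b set" and \<phi> where "finite C" "\<And>c. Vector_Spaces.linear scale (*) (\<phi> c)"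
    "\<And>w. w \<in> W \<Longrightarrow> (\<And>c. c \<in> C \<Longrightarrow> \<phi> c w = (0::'a)) \<Longrightarrow> w = 0"
proof -
  obtain C where C: "finite C" "independent C" "span C = W" using fin_dim_basis[OF assms] by metis
  let ?E = "extend_basis C"
  have E: "independent ?E" "span ?E = UNIV" "C \<subseteq> ?E"
    using independent_extend_basis[OF C(2)] span_extend_basis[OF C(2)] extend_basis_superset[OF C(2)] by auto
  have vs: "vector_space ((*)::'a \<Rightarrow> 'a \<Rightarrow> 'a)"
    by unfold_locales (auto simp: algebra_simps)
  have "Vector_Spaces.linear scale (*) (\<lambda>w. representation ?E w c)" for c
    unfolding Vector_Spaces.linear_iff using E
    by (auto simp: vector_space_axioms vs representation_add representation_scale)
  moreover have "w = 0" if "w \<in> W" "\<And>c. c \<in> C \<Longrightarrow> representation ?E w c = 0" for w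
  proof -
    have "representation C w = representation ?E w"
      using representation_extend[OF E(1), of w C] that(1) C(3) E(3) by auto
    moreover have "(\<Sum>b\<in>C. scale (representation C w b) b) = w"
      using sum_representation_eq[OF C(2), of w C] that(1) C by auto
    ultimately show ?thesis using that(2) by simp
  qed
  ultimately show ?thesis using that[of C "\<lambda>c w. representation ?E w c"] C(1) by blast
qed

text \<open>
  The polynomial \<open>q\<close> evaluated at the operator \<open>T\<close>, by Horner's scheme.
\<close>

definition poly_op :: "('b \<Rightarrow> 'b) \<Rightarrow> 'a poly \<Rightarrow> 'b \<Rightarrow> 'b" where
  "poly_op T q = fold_coeffs (\<lambda>a g v. scale a v + g (T v)) q (\<lambda>_. 0)"

lemma poly_op_0 [simp]: "poly_op T 0 (v::'b) = 0"
  by (simp add: poly_op_def)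

lemma poly_op_pCons [simp]: "poly_op T (pCons (a::'a) q) v = scale a v + poly_op T q (T v)"
  by (cases "a = 0 \<and> q = 0") (auto simp: poly_op_def)

lemma poly_op_add: "poly_op T (p + q) v = poly_op T p v + poly_op T q v"
  by (induction p q arbitrary: v rule: poly_induct2) (auto simp: scale_left_distrib)

lemma poly_op_smult: "poly_op T (smult c p) v = scale c (poly_op T p v)"
  by (induction p arbitrary: v) (auto simp: scale_right_distrib)

end

lemma vector_space_smult: "vector_space (smult :: 'a::field \<Rightarrow> 'a poly \<Rightarrow> 'a poly)"
  by unfold_locales (auto simp: smult_add_right smult_add_left)

lemma finite_functionals_poly:
  fixes \<phi> :: "'i \<Rightarrow> 'a::field poly \<Rightarrow> 'a"
  assumes "finite F" "\<And>d. d \<in> F \<Longrightarrow> Vector_Spaces.linear smult (*) (\<phi> d)"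
  obtains q where "q \<noteq> 0" "\<And>d. d \<in> F \<Longrightarrow> \<phi> d q = 0"
proof -
  interpret P: lin_space "smult :: 'a \<Rightarrow> 'a poly \<Rightarrow> 'a poly" by (simp add: lin_space_def vector_space_smult)
  let ?m = "\<lambda>i. monom (1::'a) i"
  let ?P = "?m ` {..card F}"
  have inj: "inj_on ?m A" for A by (auto simp: inj_on_def monom_eq_iff')
  have ind: "P.independent ?P"
  proof (rule P.independent_if_scalars_zero)
    show "finite ?P" by simp
    fix f x assume s: "(\<Sum>x\<in>?P. smult (f x) x) = 0" and "x \<in> ?P"
    then obtain j where j: "x = ?m j" "j \<le> card F" by auto
    have "0 = coeff (\<Sum>x\<in>?P. smult (f x) x) j" using s by simp
    also have "\<dots> = (\<Sum>i\<le>card F. coeff (smult (f (?m i)) (?m i)) j)"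
      by (simp add: sum.reindex[OF inj] coeff_sum)
    also have "\<dots> = f x" using j by (simp add: if_distrib cong: if_cong)
    finally show "f x = 0" by simp
  qed
  have "card F < card ?P" by (simp add: card_image[OF inj])
  then show ?thesis using P.common_zero[of F \<phi> ?P] assms ind that by blast
qed

context lin_space
begin

lemma linearD:
  assumes "linear_op scale T"
  shows "T (u + v) = T u + T v" "T (scale c v) = scale c (T v)" "T 0 = 0" "T (- v) = - T v"
    "T (u - v) = T u - T v" "T (sum f A) = (\<Sum>x\<in>A. T (f x))"
proof -
  interpret T: Vector_Spaces.linear scale scale T by fact
  show "T (u + v) = T u + T v" "T (scale c v) = scale c (T v)" "T 0 = 0" "T (- v) = - T v"
    "T (u - v) = T u - T v" "T (sum f A) = (\<Sum>x\<in>A. T (f x))"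
    by (rule T.add T.scale T.zero T.neg T.diff T.sum)+
qed

lemma linearI:
  assumes "\<And>u v. T (u + v) = T u + T v" "\<And>c v. T (scale c v) = scale c (T v)"
  shows "linear_op scale T"
  unfolding Vector_Spaces.linear_iff using assms by (auto simp: vector_space_axioms)

lemma poly_op_linear:
  assumes "linear_op scale T"
  shows "poly_op T q (u + v) = poly_op T q u + poly_op T q v"
    "poly_op T q (scale c v) = scale c (poly_op T q v)"
  by (induction q arbitrary: u v)
    (auto simp: linearD[OF assms] scale_right_distrib mult.commute)

lemma poly_op_factor:
  assumes T: "linear_op scale T"
  shows "poly_op T ([:-a, 1:] * q) v = poly_op T q (T v - scale a v)"
proof -
  have "[:-a, 1:] * q = pCons 0 q + smult (-a) q" by simp
  then have "poly_op T ([:-a, 1:] * q) v = poly_op T q (T v) + scale (-a) (poly_op T q v)"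
    by (simp only: poly_op_add poly_op_smult) simp
  also have "\<dots> = poly_op T q (T v + scale (-a) v)"
    by (simp only: poly_op_linear[OF T])
  finally show ?thesis by simp
qed

lemma poly_op_in_subspace:
  assumes "subspace W" "\<And>w. w \<in> W \<Longrightarrow> T w \<in> W" "v \<in> W"
  shows "poly_op T q v \<in> W"
  using assms(3) by (induction q arbitrary: v) (auto intro: assms subspace_add subspace_scale subspace_0)

text \<open>
  The powers \<open>T\<^sup>j v\<close> stay in \<open>W\<close>; finitely many coordinates of \<open>q(T) v\<close> are linear functionals of \<open>q\<close>,
  and the space of polynomials is infinite-dimensional.
\<close>

lemma annihilating_poly:
  assumes W: "fin_dim scale W" and T: "\<And>w. w \<in> W \<Longrightarrow> T w \<in> W"
    and v: "v \<in> W"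
  obtains q where "q \<noteq> 0" "poly_op T q v = 0"
proof -
  obtain C :: "'b set" and \<phi> where C: "finite C" "\<And>c. Vector_Spaces.linear scale (*) (\<phi> c)"
    "\<And>w. w \<in> W \<Longrightarrow> (\<And>c. c \<in> C \<Longrightarrow> \<phi> c w = (0::'a)) \<Longrightarrow> w = 0"
    using coordinate_functionals[OF W] by metis
  have vs: "vector_space ((*)::'a \<Rightarrow> 'a \<Rightarrow> 'a)"
    by unfold_locales (auto simp: algebra_simps)
  have "Vector_Spaces.linear smult (*) (\<lambda>q. \<phi> c (poly_op T q v))" for c
    unfolding Vector_Spaces.linear_iff using C(2)[of c]
    by (auto simp: vector_space_smult vs Vector_Spaces.linear_iff poly_op_add poly_op_smult)
  then obtain q where q: "q \<noteq> 0" "\<And>c. c \<in> C \<Longrightarrow> \<phi> c (poly_op T q v) = 0"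
    using finite_functionals_poly[OF C(1), of "\<lambda>c q. \<phi> c (poly_op T q v)"] by blast
  have "poly_op T q v \<in> W" using poly_op_in_subspace T v fin_dim_subspace[OF W] by blast
  then show ?thesis using that q C(3) by blast
qed

end

context lin_space
begin

lemma linear_funpow:
  "linear_op scale T \<Longrightarrow> linear_op scale (T ^^ k)"
proof (induction k)
  case 0
  show ?case by (rule linearI) auto
next
  case (Suc k)
  then show ?case by (intro linearI) (auto simp: linearD)
qed

definition shift :: "('b \<Rightarrow> 'b) \<Rightarrow> 'a \<Rightarrow> 'b \<Rightarrow> 'b" where
  "shift T a v = T v - scale a v"

definition gen_eig :: "('b \<Rightarrow> 'b) \<Rightarrow> 'a \<Rightarrow> 'b set" where
  "gen_eig T a = {v. \<exists>k. (shift T a ^^ k) v = 0}"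

lemma linear_shift:
  "linear_op scale T \<Longrightarrow> linear_op scale (shift T a)"
  by (rule linearI) (auto simp: shift_def linearD scale_right_distrib scale_right_diff_distrib mult.commute)

lemma funpow_eq_0_mono:
  assumes "linear_op scale T" "(T ^^ k) v = 0" "k \<le> l"
  shows "(T ^^ l) v = 0"
proof -
  have "(T ^^ l) v = (T ^^ (l - k)) ((T ^^ k) v)"
    using assms(3) by (simp flip: funpow_add comp_apply[of "T ^^ (l-k)"])
  then show ?thesis using linearD(3)[OF linear_funpow[OF assms(1)]] assms(2) by simp
qed

context
  fixes T assumes T: "linear_op scale T"
begin

lemma shift_commute: "shift T a (shift T b v) = shift T b (shift T a v)"
  by (simp add: shift_def linearD[OF T] algebra_simps scale_right_diff_distrib)

lemma shift_funpow_commute: "(shift T a ^^ k) (shift T b v) = shift T b ((shift T a ^^ k) v)"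
  by (induction k arbitrary: v) (auto simp: shift_commute)

lemma subspace_gen_eig: "subspace (gen_eig T a)"
proof (rule subspaceI)
  note l = linear_funpow[OF linear_shift[OF T]]
  show "0 \<in> gen_eig T a" by (auto simp: gen_eig_def intro!: exI[of _ 0])
  fix u v assume "u \<in> gen_eig T a" "v \<in> gen_eig T a"
  then obtain k l where "(shift T a ^^ k) u = 0" "(shift T a ^^ l) v = 0" by (auto simp: gen_eig_def)
  then have "(shift T a ^^ max k l) u = 0" "(shift T a ^^ max k l) v = 0"
    using funpow_eq_0_mono[OF linear_shift[OF T]] by (meson max.cobounded1 max.cobounded2)+
  then have "(shift T a ^^ max k l) (u + v) = 0" by (simp add: linearD[OF l])
  then show "u + v \<in> gen_eig T a" by (auto simp: gen_eig_def)
next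
  note l = linear_funpow[OF linear_shift[OF T]]
  fix c u assume "u \<in> gen_eig T a"
  then show "scale c u \<in> gen_eig T a" by (auto simp: gen_eig_def linearD[OF l])
qed

lemma shift_gen_eig: "v \<in> gen_eig T b \<Longrightarrow> shift T a v \<in> gen_eig T b"
proof -
  assume "v \<in> gen_eig T b"
  then obtain k where "(shift T b ^^ k) v = 0" by (auto simp: gen_eig_def)
  then have "(shift T b ^^ k) (shift T a v) = 0"
    by (simp add: shift_funpow_commute linearD[OF linear_shift[OF T]])
  then show ?thesis by (auto simp: gen_eig_def)
qed

lemma gen_eig_invariant: "v \<in> gen_eig T a \<Longrightarrow> T v \<in> gen_eig T a"
  using subspace_add[OF subspace_gen_eig shift_gen_eig[of v a a] subspace_scale[OF subspace_gen_eig], of v a]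
  by (simp add: shift_def)

lemma shift_inj_gen_eig:
  assumes v: "v \<in> gen_eig T b" and ab: "a \<noteq> b" and 0: "shift T a v = 0"
  shows "v = 0"
proof -
  have "T v = scale a v" using 0 by (simp add: shift_def)
  then have "shift T b v = scale (a - b) v" by (simp add: shift_def scale_left_diff_distrib)
  then have "(shift T b ^^ k) v = scale ((a - b) ^ k) v" for k
    by (induction k) (auto simp: linearD[OF linear_shift[OF T]] mult.commute)
  then show ?thesis using v ab by (auto simp: gen_eig_def)
qed

lemma shift_funpow_gen_eig: "v \<in> gen_eig T b \<Longrightarrow> (shift T a ^^ k) v \<in> gen_eig T b"
  by (induction k) (auto intro: shift_gen_eig)

lemma shift_funpow_inj_gen_eig:
  assumes "v \<in> gen_eig T b" "a \<noteq> b" "(shift T a ^^ k) v = 0"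
  shows "v = 0"
  using assms(3)
proof (induction k)
  case (Suc k)
  then show ?case
    using shift_inj_gen_eig[OF shift_funpow_gen_eig[OF assms(1)] assms(2)] by simp
qed simp

lemma gen_eig_independent:
  assumes "finite \<Lambda>" "\<And>a. a \<in> \<Lambda> \<Longrightarrow> w a \<in> gen_eig T a" "(\<Sum>a\<in>\<Lambda>. w a) = 0" "a \<in> \<Lambda>"
  shows "w a = 0"
  using assms
proof (induction \<Lambda> arbitrary: w a rule: finite_induct)
  case (insert b \<Lambda>)
  obtain k where k: "(shift T b ^^ k) (w b) = 0" using insert.prems(1) by (auto simp: gen_eig_def)
  note l = linear_funpow[OF linear_shift[OF T]]
  have "(\<Sum>a\<in>\<Lambda>. (shift T b ^^ k) (w a)) = (shift T b ^^ k) (\<Sum>a\<in>insert b \<Lambda>. w a)"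
    using insert.hyps k by (simp add: linearD[OF l])
  also have "\<dots> = 0" using insert.prems(2) by (simp add: linearD[OF l])
  finally have "(\<Sum>a\<in>\<Lambda>. (shift T b ^^ k) (w a)) = 0" .
  then have "(shift T b ^^ k) (w c) = 0" if "c \<in> \<Lambda>" for c
    using insert.IH[of "\<lambda>a. (shift T b ^^ k) (w a)" c] insert.prems(1) shift_funpow_gen_eig that by blast
  then have *: "w c = 0" if "c \<in> \<Lambda>" for c
    using shift_funpow_inj_gen_eig[of "w c" c b k] insert.prems(1) insert.hyps(2) that by (cases "b = c") auto
  then have "w b = 0" using insert.prems(2) insert.hyps by simp
  then show ?case using * insert.prems(3) by blast
qed simp

text \<open>
  On the generalized eigenspace for \<open>b\<close> the operator \<open>T - a\<close> is the sum of the nonzero scalar \<open>b - a\<close> and a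
  nilpotent operator, so it is invertible there; the induction is on the nilpotency exponent.
\<close>

lemma shift_surj_gen_eig:
  assumes W: "subspace W" "\<And>w. w \<in> W \<Longrightarrow> T w \<in> W" and ab: "a \<noteq> b"
    and w: "w \<in> gen_eig T b" "w \<in> W"
  shows "\<exists>w'\<in>gen_eig T b \<inter> W. shift T a w' = w"
proof -
  from w(1) obtain k where "(shift T b ^^ k) w = 0" by (auto simp: gen_eig_def)
  then show ?thesis using w
  proof (induction k arbitrary: w)
    case 0
    then show ?case using linearD(3)[OF linear_shift[OF T]] by (intro bexI[of _ w]) auto
  next
    case (Suc k)
    have "shift T b w \<in> W" using W Suc.prems by (auto simp: shift_def intro: subspace_diff subspace_scale)
    moreover have "(shift T b ^^ k) (shift T b w) = 0" using Suc.prems(1) by (simp add: funpow_swap1)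
    ultimately obtain w' where w': "w' \<in> gen_eig T b \<inter> W" "shift T a w' = shift T b w"
      using Suc.IH[of "shift T b w"] Suc.prems(2) shift_gen_eig by blast
    have "shift T a (w - w') = scale (b - a) w"
      by (simp add: linearD[OF linear_shift[OF T]] w') (simp add: shift_def scale_left_diff_distrib)
    then have "shift T a (scale (inverse (b - a)) (w - w')) = w"
      using ab by (simp add: linearD[OF linear_shift[OF T]])
    moreover have "scale (inverse (b - a)) (w - w') \<in> gen_eig T b \<inter> W"
      using w' Suc.prems W(1) subspace_gen_eig by (auto intro: subspace_scale subspace_diff)
    ultimately show ?case by blast
  qed
qed

text \<open>
  One step of the decomposition into generalized eigenspaces: if the image of \<open>v\<close> under a linear
  factor \<open>T - a\<close> decomposes, then \<open>v\<close> does.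
\<close>

lemma span_gen_eig_shift:
  assumes W: "subspace W" "\<And>w. w \<in> W \<Longrightarrow> T w \<in> W" and v: "v \<in> W"
    and s: "shift T a v \<in> span (\<Union>b. gen_eig T b \<inter> W)" (is "_ \<in> span ?G")
  shows "v \<in> span ?G"
proof -
  have sub: "subspace (gen_eig T b \<inter> W)" for b using W(1) subspace_gen_eig subspace_inter by blast
  note l = linear_shift[OF T]
  \<comment> \<open>split off the component for \<open>a\<close>; the operator is onto the other components\<close>
  have "\<exists>v'\<in>span ?G. shift T a v' - u \<in> gen_eig T a \<inter> W" if "u \<in> span ?G" for u
    using that
  proof (induction u rule: span_induct_alt)
    case base
    have "shift T a 0 - 0 \<in> gen_eig T a \<inter> W" using subspace_0[OF sub] by (simp add: linearD[OF l])
    then show ?case using span_zero by blast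
  next
    case (step c x y)
    then obtain v' where v': "v' \<in> span ?G" "shift T a v' - y \<in> gen_eig T a \<inter> W" by blast
    from step obtain b where b: "x \<in> gen_eig T b \<inter> W" by blast
    obtain x' where x': "x' \<in> span ?G" "shift T a x' - x \<in> gen_eig T a \<inter> W"
    proof (cases "a = b")
      case True
      have "shift T a 0 - x \<in> gen_eig T a \<inter> W"
        using subspace_neg[OF sub b] True by (simp add: linearD[OF l])
      then show ?thesis using that span_zero by blast
    next
      case False
      then obtain x' where "x' \<in> gen_eig T b \<inter> W" "shift T a x' = x"
        using shift_surj_gen_eig[OF W, of a b x] b by blast
      then show ?thesis using that[of x'] subspace_0[OF sub] span_base[of x' ?G] by auto
    qed
    have "shift T a (scale c x' + v') - (scale c x + y)
      = scale c (shift T a x' - x) + (shift T a v' - y)"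
      by (simp add: linearD[OF l] scale_right_diff_distrib)
    also have "\<dots> \<in> gen_eig T a \<inter> W" by (intro subspace_add[OF sub] subspace_scale[OF sub] x' v')
    finally show ?case using x'(1) v'(1) by (intro bexI[of _ "scale c x' + v'"]) (auto intro: span_add span_scale)
  qed
  from this[OF s] obtain v' where v': "v' \<in> span ?G" "shift T a v' - shift T a v \<in> gen_eig T a \<inter> W" by blast
  have "v' \<in> W" using v'(1) span_minimal[of ?G W] W(1) by blast
  have "shift T a (v' - v) \<in> gen_eig T a" using v'(2) by (simp add: linearD[OF l])
  then obtain k where "(shift T a ^^ Suc k) (v' - v) = 0"
    by (auto simp: gen_eig_def funpow_swap1)
  then have "v' - v \<in> gen_eig T a \<inter> W"
    using \<open>v' \<in> W\<close> v W(1) subspace_diff by (auto simp: gen_eig_def simp del: funpow.simps)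
  then have "v' - v \<in> span ?G" by (auto intro: span_base)
  then have "v' - (v' - v) \<in> span ?G" using v'(1) span_diff by blast
  then show ?thesis by simp
qed

end

end

locale alg_closed_space = lin_space scale
  for scale :: "'a::alg_closed_field \<Rightarrow> 'b::ab_group_add \<Rightarrow> 'b"
begin

text \<open>
  Over an algebraically closed field a polynomial annihilating \<open>v\<close> is a product of linear factors;
  they are removed one by one by means of \<open>span_gen_eig_shift\<close>.
\<close>

lemma gen_eig_span:
  assumes T: "linear_op scale T"
    and W: "fin_dim scale W" "\<And>w. w \<in> W \<Longrightarrow> T w \<in> W"
  shows "W \<subseteq> span (\<Union>a. gen_eig T a \<inter> W)"
proof
  fix v assume v: "v \<in> W"
  note sW = fin_dim_subspace[OF W(1)]
  obtain q where q: "q \<noteq> 0" "poly_op T q v = 0" by (rule annihilating_poly[OF W v])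
  then show "v \<in> span (\<Union>a. gen_eig T a \<inter> W)" using v
  proof (induction "degree q" arbitrary: q v rule: less_induct)
    case less
    show ?case
    proof (cases "degree q = 0")
      case True
      then obtain c where "q = [:c:]" using degree_eq_zeroE by blast
      then have "v = 0" using less.prems(1,2) by simp
      then show ?thesis by (simp add: span_zero)
    next
      case False
      then obtain a where "poly q a = 0" using alg_closed_imp_poly_has_root by blast
      then obtain q' where q': "q = [:-a, 1:] * q'" using poly_eq_0_iff_dvd by blast
      have ne: "q' \<noteq> 0" using q' less.prems(1) by auto
      have deg: "degree q = Suc (degree q')" using ne by (simp add: q' degree_mult_eq del: mult_pCons_left)
      have "poly_op T q' (shift T a v) = 0"
        using less.prems(2) poly_op_factor[OF T, of a q' v] by (simp add: q' shift_def del: mult_pCons_left)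
      moreover have "shift T a v \<in> W"
        using sW W(2) less.prems(3) by (auto simp: shift_def intro: subspace_diff subspace_scale)
      ultimately have "shift T a v \<in> span (\<Union>b. gen_eig T b \<inter> W)"
        using less.hyps[of q'] deg ne by simp
      then show ?thesis using span_gen_eig_shift[OF T sW W(2) less.prems(3)] by blast
    qed
  qed
qed

lemma eigenvector_exists:
  assumes T: "linear_op scale T"
    and W: "fin_dim scale W" "\<And>w. w \<in> W \<Longrightarrow> T w \<in> W" "W \<noteq> {0}"
  obtains a v where "v \<in> W" "v \<noteq> 0" "T v = scale a v"
proof -
  have "\<exists>a. \<exists>v \<in> gen_eig T a \<inter> W. v \<noteq> 0"
  proof (rule ccontr)
    assume "\<not> ?thesis"
    then have "(\<Union>a. gen_eig T a \<inter> W) \<subseteq> {0}" by blast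
    then have "span (\<Union>a. gen_eig T a \<inter> W) \<subseteq> {0}" by (intro span_minimal) auto
    then show False using gen_eig_span[OF T W(1,2)] W(3) subspace_0[OF fin_dim_subspace[OF W(1)]] by blast
  qed
  then obtain a v k where v: "v \<in> W" "v \<noteq> 0" "(shift T a ^^ k) v = 0" by (auto simp: gen_eig_def)
  then show ?thesis
  proof (induction k arbitrary: v)
    case (Suc k)
    show ?case
    proof (cases "shift T a v = 0")
      case True
      then show ?thesis using that[of v a] Suc.prems by (simp add: shift_def)
    next
      case False
      moreover have "shift T a v \<in> W" using Suc.prems(1) W(2) fin_dim_subspace[OF W(1)]
        by (auto simp: shift_def intro: subspace_diff subspace_scale)
      moreover have "(shift T a ^^ k) (shift T a v) = 0" using Suc.prems(3) by (simp add: funpow_swap1)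
      ultimately show ?thesis using Suc.IH by blast
    qed
  qed simp
qed

end

section \<open>Traces\<close>

context lin_space
begin

text \<open>
  The trace of an operator preserving the span of the independent set \<open>C\<close>.
\<close>

definition tr :: "'b set \<Rightarrow> ('b \<Rightarrow> 'b) \<Rightarrow> 'a" where
  "tr C A = (\<Sum>c\<in>C. representation C (A c) c)"

context
  fixes C assumes C: "finite C" "independent C"
begin

lemma tr_add:
  assumes "\<And>c. c \<in> C \<Longrightarrow> A c \<in> span C" "\<And>c. c \<in> C \<Longrightarrow> B c \<in> span C"
  shows "tr C (\<lambda>v. A v + B v) = tr C A + tr C B"
  using assms C by (simp add: tr_def representation_add sum.distrib)

lemma tr_scale:
  assumes "\<And>c. c \<in> C \<Longrightarrow> A c \<in> span C"
  shows "tr C (\<lambda>v. scale r (A v)) = r * tr C A"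
  using assms C by (simp add: tr_def representation_scale sum_distrib_left)

lemma tr_ident: "tr C (\<lambda>v. v) = of_nat (card C)"
  using C by (simp add: tr_def representation_basis)

lemma linear_expand:
  assumes "linear_op scale A" "v \<in> span C"
  shows "A v = (\<Sum>d\<in>C. scale (representation C v d) (A d))"
proof -
  have "A v = A (\<Sum>d\<in>C. scale (representation C v d) d)"
    using sum_representation_eq[OF C(2) assms(2) C(1)] by simp
  then show ?thesis by (simp only: linearD[OF assms(1)])
qed

lemma tr_comp_commute:
  assumes A: "linear_op scale A" "\<And>c. c \<in> C \<Longrightarrow> A c \<in> span C"
    and B: "linear_op scale B" "\<And>c. c \<in> C \<Longrightarrow> B c \<in> span C"
  shows "tr C (\<lambda>v. A (B v)) = tr C (\<lambda>v. B (A v))"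
proof -
  have *: "tr C (\<lambda>v. A (B v)) = (\<Sum>c\<in>C. \<Sum>d\<in>C. representation C (B c) d * representation C (A d) c)"
    if "linear_op scale A" "\<And>c. c \<in> C \<Longrightarrow> A c \<in> span C"
      "linear_op scale B" "\<And>c. c \<in> C \<Longrightarrow> B c \<in> span C" for A B
    unfolding tr_def using that
    by (auto intro!: sum.cong simp: linear_expand[of A "B _"] representation_sum[OF C(2)]
        representation_scale[OF C(2)] span_scale)
  have "tr C (\<lambda>v. A (B v)) = (\<Sum>c\<in>C. \<Sum>d\<in>C. representation C (B c) d * representation C (A d) c)"
    by (rule *[OF A B])
  also have "\<dots> = (\<Sum>d\<in>C. \<Sum>c\<in>C. representation C (A d) c * representation C (B c) d)"
    by (subst sum.swap) (simp add: mult.commute)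
  also have "\<dots> = tr C (\<lambda>v. B (A v))" by (rule *[OF B A, symmetric])
  finally show ?thesis .
qed

text \<open>
  The trace does not depend on the basis; this is what allows one to choose bases adapted to kernels.
\<close>

lemma tr_basis_indep:
  assumes D: "finite D" "independent D" "span D = span C"
    and A: "linear_op scale A" "\<And>c. c \<in> span C \<Longrightarrow> A c \<in> span C"
  shows "tr C A = tr D A"
proof -
  have "tr C A = (\<Sum>c\<in>C. \<Sum>d\<in>D. representation D c d * representation C (A d) c)"
    unfolding tr_def
  proof (rule sum.cong[OF refl])
    fix c assume c: "c \<in> C"
    have "A c = A (\<Sum>d\<in>D. scale (representation D c d) d)"
      using sum_representation_eq[OF D(2) _ D(1)] D(3) c span_base by simp
    then have e: "A c = (\<Sum>d\<in>D. scale (representation D c d) (A d))" by (simp only: linearD[OF A(1)])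
    have in': "A d \<in> span C" if "d \<in> D" for d using A(2) that D(3) span_base by blast
    show "representation C (A c) c = (\<Sum>d\<in>D. representation D c d * representation C (A d) c)"
      unfolding e using in' by (simp add: representation_sum[OF C(2)] representation_scale[OF C(2)] span_scale)
  qed
  also have "\<dots> = (\<Sum>d\<in>D. \<Sum>c\<in>C. representation D c d * representation C (A d) c)" by (rule sum.swap)
  also have "\<dots> = tr D A"
    unfolding tr_def
  proof (rule sum.cong[OF refl])
    fix d assume d: "d \<in> D"
    have "A d \<in> span C" using A(2) d D(3) span_base by blast
    then have e: "A d = (\<Sum>c\<in>C. scale (representation C (A d) c) c)"
      using sum_representation_eq[OF C(2) _ C(1)] by simp
    have in': "c \<in> span D" if "c \<in> C" for c using that D(3) span_base by blast
    have "representation D (A d) d = (\<Sum>c\<in>C. representation C (A d) c * representation D c d)"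
      by (subst e) (use in' in \<open>simp add: representation_sum[OF D(2)] representation_scale[OF D(2)] span_scale\<close>)
    then show "(\<Sum>c\<in>C. representation D c d * representation C (A d) c) = representation D (A d) d"
      by (simp add: mult.commute)
  qed
  finally show ?thesis .
qed

end

text \<open>
  In a basis extending a basis of the image of \<open>A\<close> only the part belonging to the image contributes to the
  trace, and on the image the nilpotency exponent is smaller.
\<close>

lemma tr_nilpotent:
  assumes A: "linear_op scale A"
    and C: "finite C" "independent C" "\<And>c. c \<in> span C \<Longrightarrow> A c \<in> span C"
    and nil: "\<And>c. c \<in> span C \<Longrightarrow> (A ^^ k) c = 0"
  shows "tr C A = 0"
  using C nil
proof (induction k arbitrary: C)
  case 0
  then have "C \<subseteq> {0}" using span_base by auto
  moreover have "0 \<notin> C" using 0 dependent_zero by blast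
  ultimately have "C = {}" by blast
  then show ?case by (simp add: tr_def)
next
  case (Suc k)
  interpret A: Vector_Spaces.linear scale scale A by (rule A)
  have im: "span (A ` C) = A ` span C" by (rule A.span_image)
  have fd: "fin_dim scale (A ` span C)" using im Suc.prems(1) by (auto simp: fin_dim_def intro!: exI[of _ "A ` C"])
  obtain C' where C': "finite C'" "independent C'" "span C' = A ` span C" "C' \<subseteq> A ` span C"
    using fin_dim_basis[OF fd] by metis
  have sub: "A ` span C \<subseteq> span C" using Suc.prems(3) by blast
  obtain D where D: "C' \<subseteq> D" "D \<subseteq> span C" "independent D" "span C \<subseteq> span D"
    using maximal_independent_subset_extend[OF subset_trans[OF C'(4) sub] C'(2)] by metis
  have fD: "finite D" using independent_span_bound[OF Suc.prems(1) D(3,2)] by blast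
  have sD: "span D = span C" using D span_minimal[OF D(2)] by auto
  have "tr C A = tr D A"
    by (rule tr_basis_indep[OF Suc.prems(1,2) fD D(3) sD A Suc.prems(3)])
  also have "\<dots> = (\<Sum>d\<in>D. representation C' (A d) d)"
    unfolding tr_def
  proof (rule sum.cong[OF refl])
    fix d assume "d \<in> D"
    then have "A d \<in> span C'" using C'(3) D(2) by blast
    then show "representation D (A d) d = representation C' (A d) d"
      using representation_extend[OF D(3) _ D(1)] by simp
  qed
  also have "\<dots> = (\<Sum>d\<in>C'. representation C' (A d) d)"
    by (rule sum.mono_neutral_right) (use fD D(1) representation_ne_zero in auto)
  also have "\<dots> = tr C' A" by (simp add: tr_def)
  also have "\<dots> = 0"
  proof (rule Suc.IH[OF C'(1,2)])
    fix c assume "c \<in> span C'"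
    then show "A c \<in> span C'" using C'(3) sub by blast
    from \<open>c \<in> span C'\<close> obtain c0 where c0: "c = A c0" "c0 \<in> span C" using C'(3) by blast
    show "(A ^^ k) c = 0" using Suc.prems(4)[OF c0(2)] c0(1) by (simp add: funpow_swap1)
  qed
  finally show ?case .
qed

lemma tr_gen_eig:
  assumes A: "linear_op scale A"
    and C: "finite C" "independent C" "\<And>c. c \<in> span C \<Longrightarrow> A c \<in> span C"
    and ev: "C \<subseteq> gen_eig A a"
  shows "tr C A = a * of_nat (card C)"
proof -
  note ls = linear_shift[OF A, of a]
  have "\<exists>k. \<forall>c\<in>C. (shift A a ^^ k) c = 0"
  proof -
    have "\<forall>c\<in>C. \<exists>k. (shift A a ^^ k) c = 0" using ev by (auto simp: gen_eig_def)
    then obtain k where k: "\<And>c. c \<in> C \<Longrightarrow> (shift A a ^^ k c) c = 0" by metis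
    have "(shift A a ^^ (\<Sum>c\<in>C. k c)) c = 0" if "c \<in> C" for c
      using funpow_eq_0_mono[OF ls k[OF that]] member_le_sum[OF that _ C(1), of k] by simp
    then show ?thesis by blast
  qed
  then obtain k where k: "\<And>c. c \<in> C \<Longrightarrow> (shift A a ^^ k) c = 0" by blast
  have k': "(shift A a ^^ k) c = 0" if "c \<in> span C" for c
    using linear_expand[OF C(1,2) linear_funpow[OF ls] that, of k] k by simp
  have inv: "shift A a c \<in> span C" if "c \<in> span C" for c
    using C(3)[OF that] that by (auto simp: shift_def intro: span_diff span_scale)
  have "A = (\<lambda>v. shift A a v + scale a v)" by (auto simp: shift_def)
  then have "tr C A = tr C (\<lambda>v. shift A a v + scale a v)" by simp
  also have "\<dots> = tr C (shift A a) + tr C (\<lambda>v. scale a v)"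
    by (rule tr_add[OF C(1,2)]) (auto intro: inv span_base span_scale)
  also have "tr C (shift A a) = 0" by (rule tr_nilpotent[OF ls C(1,2) inv k'])
  also have "tr C (\<lambda>v. scale a v) = a * of_nat (card C)"
    using tr_scale[OF C(1,2), of "\<lambda>v. v" a] tr_ident[OF C(1,2)] span_base by simp
  finally show ?thesis by simp
qed

end

text \<open>
  In characteristic zero \<open>k\<close> is a vector space over the rationals, so there is an additive map to the
  rationals that does not vanish at a given nonzero element.  It replaces complex conjugation in
  the classical argument for the Killing form.
\<close>

lemma rational_functional:
  fixes a0 :: "'k::field_char_0"
  assumes "a0 \<noteq> 0"
  obtains f :: "'k \<Rightarrow> rat" where "\<And>x y. f (x + y) = f x + f y" "\<And>q x. f (of_rat q * x) = q * f x" "f a0 \<noteq> 0"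
proof -
  have v1: "vector_space (\<lambda>(q::rat) (x::'k). of_rat q * x)"
    by unfold_locales (auto simp: algebra_simps of_rat_add of_rat_mult)
  have v2: "vector_space ((*) :: rat \<Rightarrow> rat \<Rightarrow> rat)"
    by unfold_locales (auto simp: algebra_simps)
  interpret vp: vector_space_pair "\<lambda>(q::rat) (x::'k). of_rat q * x" "(*) :: rat \<Rightarrow> rat \<Rightarrow> rat"
    using v1 v2 by (simp add: vector_space_pair_def)
  have "vp.vs1.independent {a0}" using assms by (simp add: vp.vs1.dependent_single)
  from vp.linear_independent_extend[OF this, of "\<lambda>_. 1"] obtain f where
    f: "Vector_Spaces.linear (\<lambda>(q::rat) (x::'k). of_rat q * x) ((*) :: rat \<Rightarrow> rat \<Rightarrow> rat) f" "f a0 = 1"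
    by auto
  show ?thesis by (rule that[of f]) (use f in \<open>auto simp: Vector_Spaces.linear_iff\<close>)
qed

context alg_closed_space
begin

lemma gen_eig_basis:
  assumes T: "linear_op scale T" and fd: "fin_dim scale (UNIV :: 'b set)"
  obtains C ev where "finite C" "independent C" "span C = UNIV" "\<And>c. c \<in> C \<Longrightarrow> c \<in> gen_eig T (ev c)"
    "\<And>a v. v \<in> gen_eig T a \<Longrightarrow> v \<in> span {c \<in> C. ev c = a}"
proof -
  obtain C where C: "C \<subseteq> (\<Union>a. gen_eig T a)" "independent C" "(\<Union>a. gen_eig T a) \<subseteq> span C"
    using maximal_independent_subset[of "\<Union>a. gen_eig T a"] by metis
  have "UNIV \<subseteq> span (\<Union>a. gen_eig T a \<inter> UNIV)" by (rule gen_eig_span[OF T fd]) simp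
  then have sC: "span C = UNIV" using C(3) span_mono[OF C(3)] by (auto simp: span_span)
  obtain B :: "'b set" where B: "finite B" "independent B" "span B = UNIV"
    using fd by (rule fin_dim_basis)
  have fC: "finite C" using independent_span_bound[OF B(1) C(2)] B(3) by auto
  have "\<forall>c\<in>C. \<exists>a. c \<in> gen_eig T a" using C(1) by blast
  then obtain ev where ev: "\<And>c. c \<in> C \<Longrightarrow> c \<in> gen_eig T (ev c)" by metis
  have sp: "v \<in> span {c \<in> C. ev c = a}" if v: "v \<in> gen_eig T a" for a v
  proof -
    define w where "w = (\<lambda>b. \<Sum>c\<in>{c\<in>C. ev c = b}. scale (representation C v c) c)"
    let ?L = "insert a (ev ` C)"
    have "v = (\<Sum>c\<in>C. scale (representation C v c) c)"
      using sum_representation_eq[OF C(2) _ fC] sC by simp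
    also have "\<dots> = (\<Sum>b\<in>?L. w b)"
      unfolding w_def by (rule sum.group[symmetric]) (use fC in auto)
    finally have v_eq: "v = (\<Sum>b\<in>?L. w b)" .
    have w: "w b \<in> gen_eig T b" for b unfolding w_def
      using ev by (auto intro!: subspace_sum[OF subspace_gen_eig[OF T]] subspace_scale[OF subspace_gen_eig[OF T]])
    let ?w = "\<lambda>b. w b - (if b = a then v else 0)"
    have "(\<Sum>b\<in>?L. ?w b) = (\<Sum>b\<in>?L. w b) - (\<Sum>b\<in>?L. if b = a then v else 0)"
      by (rule sum_subtractf)
    also have "\<dots> = 0" using fC by (simp add: v_eq[symmetric])
    finally have "(\<Sum>b\<in>?L. ?w b) = 0" .
    moreover have "?w b \<in> gen_eig T b" for b
      using w v subspace_diff[OF subspace_gen_eig[OF T]] subspace_0[OF subspace_gen_eig[OF T]] by auto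
    ultimately have "?w a = 0"
      using gen_eig_independent[OF T, of ?L ?w a] fC by simp
    then have "v = w a" by simp
    moreover have "w a \<in> span {c \<in> C. ev c = a}"
      unfolding w_def by (intro span_sum span_scale span_base)
    ultimately show ?thesis by simp
  qed
  show ?thesis by (rule that[OF fC C(2) sC ev sp])
qed

text \<open>
  The operator \<open>S\<close> multiplies each generalized eigenspace of \<open>T\<close> by a freely chosen function of the
  eigenvalue; the trace of \<open>T S\<close> can be read off from the eigenvalues because \<open>T\<close> is triangular on each
  generalized eigenspace.
\<close>

lemma gen_eig_multiplier:
  assumes T: "linear_op scale T" and fd: "fin_dim scale (UNIV :: 'b set)"
  obtains C ev where "finite C" "independent C" "span C = UNIV" "\<And>c. c \<in> C \<Longrightarrow> c \<in> gen_eig T (ev c)"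
    "\<And>f. \<exists>S. linear_op scale S \<and> (\<forall>a. \<forall>v\<in>gen_eig T a. S v = scale (f a) v) \<and>
       tr C (\<lambda>v. T (S v)) = (\<Sum>c\<in>C. ev c * f (ev c))"
proof -
  obtain C ev where C: "finite C" "independent C" "span C = UNIV" "\<And>c. c \<in> C \<Longrightarrow> c \<in> gen_eig T (ev c)"
    and sp: "\<And>a v. v \<in> gen_eig T a \<Longrightarrow> v \<in> span {c \<in> C. ev c = a}"
    by (rule gen_eig_basis[OF T fd]) (rule that)
  interpret vp: vector_space_pair scale scale by unfold_locales
  have S: "\<exists>S. linear_op scale S \<and> (\<forall>a. \<forall>v\<in>gen_eig T a. S v = scale (f a) v) \<and>
       tr C (\<lambda>v. T (S v)) = (\<Sum>c\<in>C. ev c * f (ev c))" for f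
  proof -
    obtain S where S: "linear_op scale S" "\<And>c. c \<in> C \<Longrightarrow> S c = scale (f (ev c)) c"
      using vp.linear_independent_extend[OF C(2), of "\<lambda>c. scale (f (ev c)) c"] by blast
    have 1: "S v = scale (f a) v" if "v \<in> gen_eig T a" for a v
      using vp.linear_eq_on[OF S(1) linear_scale_self sp[OF that], of "f a"] S(2) by auto
    let ?C = "\<lambda>a. {c \<in> C. ev c = a}"
    have indC: "independent (?C a)" for a using independent_mono[OF C(2)] by auto
    have TC: "T c \<in> span (?C a)" if "c \<in> span (?C a)" for c a
    proof -
      have "span (?C a) \<subseteq> gen_eig T a"
        by (rule span_minimal) (use C(4) subspace_gen_eig[OF T] in auto)
      then show ?thesis using gen_eig_invariant[OF T] sp that by blast
    qed
    have "tr C (\<lambda>v. T (S v)) = (\<Sum>c\<in>C. f (ev c) * representation (?C (ev c)) (T c) c)"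
      unfolding tr_def
    proof (rule sum.cong[OF refl])
      fix c assume c: "c \<in> C"
      then have "T c \<in> span (?C (ev c))" by (intro TC span_base) (use c in auto)
      then have "representation C (T c) = representation (?C (ev c)) (T c)"
        by (rule representation_extend[OF C(2)]) auto
      then show "representation C (T (S c)) c = f (ev c) * representation (?C (ev c)) (T c) c"
        using C(2,3) S(2)[OF c] by (simp add: linearD[OF T] representation_scale)
    qed
    also have "\<dots> = (\<Sum>a\<in>ev ` C. \<Sum>c\<in>?C a. f (ev c) * representation (?C (ev c)) (T c) c)"
      by (rule sum.group[symmetric]) (use C(1) in auto)
    also have "\<dots> = (\<Sum>a\<in>ev ` C. f a * tr (?C a) T)"
      by (auto intro!: sum.cong simp: tr_def sum_distrib_left)
    also have "\<dots> = (\<Sum>a\<in>ev ` C. f a * (a * of_nat (card (?C a))))"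
    proof (rule sum.cong[OF refl])
      fix a
      have "tr (?C a) T = a * of_nat (card (?C a))"
        by (rule tr_gen_eig[OF T _ indC TC]) (use C(1,4) in auto)
      then show "f a * tr (?C a) T = f a * (a * of_nat (card (?C a)))" by simp
    qed
    also have "\<dots> = (\<Sum>a\<in>ev ` C. \<Sum>c\<in>?C a. ev c * f (ev c))"
      by (auto intro!: sum.cong simp: mult_ac)
    also have "\<dots> = (\<Sum>c\<in>C. ev c * f (ev c))"
      by (rule sum.group) (use C(1) in auto)
    finally show ?thesis using S(1) 1 by blast
  qed
  show ?thesis by (rule that[OF C S])
qed

end

section \<open>Semisimple Lie algebras are perfect\<close>

locale fd_lie_algebra = lie_algebra scale bracket
  for scale :: "'k::{alg_closed_field, field_char_0} \<Rightarrow> 'g::ab_group_add \<Rightarrow> 'g" and bracket +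
  assumes fin_dim_UNIV: "fin_dim scale (UNIV :: 'g set)"
begin

sublocale alg_closed_space scale ..

lemma bracket_simps:
  "bracket (a + b) c = bracket a c + bracket b c" "bracket a (b + c) = bracket a b + bracket a c"
  "bracket (scale r a) c = scale r (bracket a c)" "bracket a (scale r c) = scale r (bracket a c)"
  "bracket 0 a = 0" "bracket a 0 = 0"
  "bracket (- a) c = - bracket a c" "bracket a (- c) = - bracket a c"
  "bracket (a - b) c = bracket a c - bracket b c" "bracket a (b - c) = bracket a b - bracket a c"
  "bracket (sum f A) c = (\<Sum>x\<in>A. bracket (f x) c)" "bracket a (sum f A) = (\<Sum>x\<in>A. bracket a (f x))"
  by (rule linearD[OF bracket_linear_left] linearD[OF bracket_linear_right])+

lemma bracket_anti: "bracket a b = - bracket b a"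
proof -
  have "bracket a b + bracket b a = 0"
    using bracket_self[of "a + b"] unfolding bracket_simps(1,2) by (simp add: bracket_self add.commute)
  then show ?thesis by (simp add: eq_neg_iff_add_eq_0)
qed

lemma bracket_jacobi: "bracket a (bracket b c) = bracket (bracket a b) c + bracket b (bracket a c)"
  using jacobi[of a b c] bracket_anti[of c a] bracket_anti[of c "bracket a b"]
  by (simp add: bracket_simps algebra_simps)

lemmas ad_linear = bracket_linear_right

text \<open>
  Since \<open>ad x\<close> is a derivation, \<open>ad x - a - b\<close> applied to \<open>[v, w]\<close> is
  \<open>[(ad x - a) v, w] + [v, (ad x - b) w]\<close>, and high powers kill one of the two entries.
\<close>

lemma ad_gen_eig_bracket:
  assumes "v \<in> gen_eig (bracket x) a" "w \<in> gen_eig (bracket x) b"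
  shows "bracket v w \<in> gen_eig (bracket x) (a + b)"
proof -
  let ?s = "shift (bracket x)" and ?G = "gen_eig (bracket x)"
  have *: "?s (a + b) (bracket v w) = bracket (?s a v) w + bracket v (?s b w)" for v w
    by (simp add: shift_def bracket_jacobi[of x v w] bracket_simps scale_left_distrib)
  obtain k l where "(?s a ^^ k) v = 0" "(?s b ^^ l) w = 0" using assms by (auto simp: gen_eig_def)
  then show ?thesis
  proof (induction "k + l" arbitrary: k l v w)
    case 0
    then show ?case using subspace_0[OF subspace_gen_eig[OF ad_linear]] by (simp add: bracket_simps)
  next
    case (Suc n)
    note sub = subspace_gen_eig[OF ad_linear, of x "a + b"]
    show ?case
    proof (cases "k = 0 \<or> l = 0")
      case True
      then have "bracket v w = 0" using Suc.prems by (auto simp: bracket_simps)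
      then show ?thesis using subspace_0[OF sub] by simp
    next
      case False
      then obtain k' l' where kl: "k = Suc k'" "l = Suc l'" by (metis not0_implies_Suc)
      have 1: "bracket (?s a v) w \<in> ?G (a + b)"
        using Suc.hyps(1)[of k' l "?s a v" w] Suc.hyps(2) Suc.prems kl by (simp add: funpow_swap1)
      have 2: "bracket v (?s b w) \<in> ?G (a + b)"
        using Suc.hyps(1)[of k l' v "?s b w"] Suc.hyps(2) Suc.prems kl by (simp add: funpow_swap1)
      have "?s (a + b) (bracket v w) \<in> ?G (a + b)" unfolding * by (rule subspace_add[OF sub 1 2])
      then obtain m where "(?s (a + b) ^^ Suc m) (bracket v w) = 0"
        by (auto simp: gen_eig_def funpow_swap1)
      then show ?thesis unfolding gen_eig_def by blast
    qed
  qed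
qed

lemma abelian_ideal_zero:
  assumes "semisimple" "lie_ideal Z" "\<And>a b. a \<in> Z \<Longrightarrow> b \<in> Z \<Longrightarrow> bracket a b = 0"
  shows "Z = {0}"
proof -
  have "0 \<in> Z" using assms(2) subspace_0 by (auto simp: lie_ideal_def)
  then have "{bracket a b |a b. a \<in> Z \<and> b \<in> Z} = {0}" using assms(3) by fastforce
  then have "(derived ^^ 1) Z = {0}" by (simp add: derived_def)
  then show ?thesis using assms(1,2) unfolding semisimple_def solvable_def by blast
qed

definition subalgebra :: "'g set \<Rightarrow> bool" where
  "subalgebra L \<longleftrightarrow> subspace L \<and> (\<forall>a\<in>L. \<forall>b\<in>L. bracket a b \<in> L)"

text \<open>
  Engel's theorem in the adjoint representation, relative to a pair \<open>W \<subset> V\<close> of \<open>L\<close>-stable subspaces.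
  The relative form avoids quotient spaces: it is applied to \<open>V = L\<close> and \<open>W\<close> a subalgebra, to find an
  element normalizing a maximal proper subalgebra \<open>K\<close>, and then to the original pair and \<open>K\<close>.
\<close>

lemma engel:
  assumes "subalgebra L" "\<And>x v. x \<in> L \<Longrightarrow> \<exists>k. (bracket x ^^ k) v = 0"
    and "subspace V" "subspace W" "W \<subset> V"
    and "\<And>x v. x \<in> L \<Longrightarrow> v \<in> V \<Longrightarrow> bracket x v \<in> V" "\<And>x v. x \<in> L \<Longrightarrow> v \<in> W \<Longrightarrow> bracket x v \<in> W"
  shows "\<exists>v\<in>V - W. \<forall>x\<in>L. bracket x v \<in> W"
  using assms
proof (induction "dim L" arbitrary: L V W rule: less_induct)
  case less
  note L = less.prems(1) and nil = less.prems(2) and V = less.prems(3) and W = less.prems(4,5)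
    and inv = less.prems(6,7)
  have sL: "subspace L" and bL: "\<And>a b. a \<in> L \<Longrightarrow> b \<in> L \<Longrightarrow> bracket a b \<in> L"
    using L by (auto simp: subalgebra_def)
  have fdL: "fin_dim scale L" by (rule fin_dim_mono[OF fin_dim_UNIV sL]) simp
  show ?case
  proof (cases "L = {0}")
    case True
    then show ?thesis using W subspace_0[OF W(1)] by (auto simp: bracket_simps)
  next
    case False
    let ?Q = "\<lambda>K. subalgebra K \<and> K \<subset> L"
    have dlt: "dim K < dim L" if "?Q K" for K
      using fin_dim_dim_less[OF fdL, of K] that by (auto simp: subalgebra_def)
    have "?Q {0}" using False subspace_0[OF sL] by (auto simp: subalgebra_def bracket_simps)
    then have "\<exists>K. ?Q K \<and> (\<forall>K'. ?Q K' \<longrightarrow> dim K' \<le> dim K)"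
      by (rule ex_has_greatest_nat[where b="dim L"]) (use dlt in force)
    then obtain K where K: "?Q K" and max: "\<And>K'. ?Q K' \<Longrightarrow> dim K' \<le> dim K" by blast
    have sK: "subspace K" and bK: "\<And>a b. a \<in> K \<Longrightarrow> b \<in> K \<Longrightarrow> bracket a b \<in> K" and KL: "K \<subset> L"
      using K by (auto simp: subalgebra_def)
    have "\<exists>v\<in>L - K. \<forall>x\<in>K. bracket x v \<in> K"
      by (rule less.hyps[OF dlt[OF K]]) (use K sL sK nil bL bK KL in auto)
    then obtain x where x: "x \<in> L" "x \<notin> K" "\<And>y. y \<in> K \<Longrightarrow> bracket y x \<in> K" by blast
    let ?K' = "span (insert x K)"
    have subK': "?K' \<subseteq> L" using x(1) KL sL by (intro span_minimal) auto
    have KK': "K \<subseteq> ?K'" "x \<in> ?K'" using span_superset[of "insert x K"] by auto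
    have br: "bracket a b \<in> K" if a: "a \<in> ?K'" and b: "b \<in> ?K'" for a b
    proof -
      from a obtain r where r: "a - scale r x \<in> span K" by (auto simp: span_breakdown_eq)
      from b obtain s where s: "b - scale s x \<in> span K" by (auto simp: span_breakdown_eq)
      define a' b' where "a' = a - scale r x" and "b' = b - scale s x"
      have ab: "a = a' + scale r x" "b = b' + scale s x" "a' \<in> K" "b' \<in> K"
        using r s sK by (auto simp: a'_def b'_def span_eq_iff[THEN iffD2])
      have "bracket x b' \<in> K" using x(3)[OF ab(4)] bracket_anti[of x b'] subspace_neg[OF sK] by simp
      then show ?thesis
        using ab x(3)[OF ab(3)] bK[OF ab(3,4)]
        by (auto simp: bracket_simps bracket_self intro!: subspace_add[OF sK] subspace_scale[OF sK])
    qed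
    have "subalgebra ?K'" using br KK' by (auto simp: subalgebra_def)
    \<comment> \<open>a maximal proper subalgebra has codimension one\<close>
    have "?K' = L"
    proof (rule ccontr)
      assume "?K' \<noteq> L"
      then have "dim ?K' \<le> dim K" using max[of ?K'] \<open>subalgebra ?K'\<close> subK' by blast
      moreover have "dim K < dim ?K'"
        by (rule fin_dim_dim_less[OF fin_dim_mono[OF fdL subspace_span subK'] sK KK'(1)]) (use x(2) KK'(2) in blast)
      ultimately show False by simp
    qed
    define U where "U = {v \<in> V. \<forall>k\<in>K. bracket k v \<in> W}"
    have "\<exists>v\<in>V - W. \<forall>x\<in>K. bracket x v \<in> W"
      by (rule less.hyps[OF dlt[OF K]]) (use K V W nil inv KL in auto)
    then obtain u where u: "u \<in> U" "u \<notin> W" by (auto simp: U_def)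
    have xU: "bracket x v \<in> U" if "v \<in> U" for v
    proof -
      have "bracket k (bracket x v) \<in> W" if "k \<in> K" for k
        unfolding bracket_jacobi[of k x v]
        using x(3)[OF that] \<open>v \<in> U\<close> that inv(2)[OF x(1)] by (auto simp: U_def intro!: subspace_add[OF W(1)])
      then show ?thesis using that inv(1)[OF x(1)] by (auto simp: U_def)
    qed
    have pU: "(bracket x ^^ k) u \<in> U" for k by (induction k) (use u xU in auto)
    obtain k0 where "(bracket x ^^ k0) u = 0" using nil[OF x(1)] by blast
    then have ex: "(bracket x ^^ k0) u \<in> W" using subspace_0[OF W(1)] by simp
    \<comment> \<open>the last vector of the chain \<open>u, [x, u], \<dots>\<close> outside \<open>W\<close> is killed modulo \<open>W\<close> by \<open>K\<close> and by \<open>x\<close>\<close>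
    define k where "k = (LEAST k. (bracket x ^^ k) u \<in> W)"
    have k: "(bracket x ^^ k) u \<in> W" unfolding k_def using ex by (rule LeastI)
    have "k \<noteq> 0"
    proof
      assume "k = 0" then show False using k u(2) by simp
    qed
    then obtain j where j: "k = Suc j" using not0_implies_Suc by blast
    have "(bracket x ^^ j) u \<notin> W" using not_less_Least[of j "\<lambda>k. (bracket x ^^ k) u \<in> W"] j k_def by simp
    moreover have "bracket y ((bracket x ^^ j) u) \<in> W" if "y \<in> L" for y
    proof -
      let ?v = "(bracket x ^^ j) u"
      have "subspace {y. bracket y ?v \<in> W}"
        by (rule subspaceI) (use W(1) in \<open>auto simp: bracket_simps subspace_0 subspace_add subspace_scale\<close>)
      moreover have "insert x K \<subseteq> {y. bracket y ?v \<in> W}"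
        using k j pU[of j] by (auto simp: U_def)
      ultimately have "?K' \<subseteq> {y. bracket y ?v \<in> W}" by (rule span_minimal[rotated])
      then show ?thesis using that \<open>?K' = L\<close> by blast
    qed
    ultimately show ?thesis using pU[of j] by (intro bexI[of _ "(bracket x ^^ j) u"]) (auto simp: U_def)
  qed
qed

definition basis0 :: "'g set" where
  "basis0 = (SOME B. finite B \<and> independent B \<and> span B = UNIV)"

lemma basis0: "finite basis0" "independent basis0" "span basis0 = UNIV"
proof -
  obtain B :: "'g set" where "finite B" "independent B" "span B = UNIV"
    using fin_dim_UNIV by (rule fin_dim_basis)
  then have "\<exists>B. finite B \<and> independent B \<and> span B = (UNIV :: 'g set)" by blast
  then have "finite basis0 \<and> independent basis0 \<and> span basis0 = UNIV"
    unfolding basis0_def by (rule someI_ex)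
  then show "finite basis0" "independent basis0" "span basis0 = UNIV" by auto
qed

definition Tr :: "('g \<Rightarrow> 'g) \<Rightarrow> 'k" where "Tr = tr basis0"

lemma Tr_add: "Tr (\<lambda>v. A v + B v) = Tr A + Tr B"
  unfolding Tr_def by (rule tr_add[OF basis0(1,2)]) (auto simp: basis0)

lemma Tr_scale: "Tr (\<lambda>v. scale r (A v)) = r * Tr A"
  unfolding Tr_def by (rule tr_scale[OF basis0(1,2)]) (auto simp: basis0)

lemma Tr_diff: "Tr (\<lambda>v. A v - B v) = Tr A - Tr B"
  using Tr_add[of A "\<lambda>v. scale (-1) (B v)"] Tr_scale[of "-1" B] by simp

lemma Tr_commute:
  assumes "linear_op scale A" "linear_op scale B"
  shows "Tr (\<lambda>v. A (B v)) = Tr (\<lambda>v. B (A v))"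
  unfolding Tr_def by (rule tr_comp_commute[OF basis0(1,2)]) (use assms in \<open>auto simp: basis0\<close>)

definition killing :: "'g \<Rightarrow> 'g \<Rightarrow> 'k" where
  "killing x y = Tr (\<lambda>v. bracket x (bracket y v))"

lemma killing_linear:
  "killing (a + b) c = killing a c + killing b c" "killing (scale r a) c = r * killing a c"
  "killing c (a + b) = killing c a + killing c b" "killing c (scale r a) = r * killing c a"
  unfolding killing_def by (simp_all add: bracket_simps Tr_add Tr_scale)

lemma linear_comp: 
  "linear_op scale A \<Longrightarrow> linear_op scale B
    \<Longrightarrow> linear_op scale (\<lambda>v. A (B v))"
  by (rule linearI) (auto simp: linearD)

lemma killing_invariant: "killing (bracket x y) z = killing x (bracket y z)"
proof -
  have 1: "bracket (bracket a b) v = bracket a (bracket b v) - bracket b (bracket a v)" for a b v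
    using bracket_jacobi[of a b v] by simp
  have "Tr (\<lambda>v. bracket y (bracket x (bracket z v))) = Tr (\<lambda>v. bracket x (bracket z (bracket y v)))"
    by (rule Tr_commute) (auto intro: ad_linear linear_comp)
  then show ?thesis by (simp add: killing_def 1 bracket_simps Tr_diff)
qed

definition derivation :: "('g \<Rightarrow> 'g) \<Rightarrow> bool" where
  "derivation S \<longleftrightarrow> linear_op scale S \<and>
     (\<forall>a b. S (bracket a b) = bracket (S a) b + bracket a (S b))"

text \<open>
  For a derivation \<open>S\<close> the commutator of \<open>ad b\<close> with \<open>S\<close> is \<open>- ad (S b)\<close>; cyclicity of the trace does the rest.
\<close>

lemma Tr_bracket_derivation:
  assumes "derivation S"
  shows "Tr (\<lambda>v. bracket (bracket a b) (S v)) = - killing a (S b)"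
proof -
  have S: "linear_op scale S" and d: "\<And>a b. bracket (S a) b = S (bracket a b) - bracket a (S b)"
    using assms by (auto simp: derivation_def)
  have 1: "bracket (bracket a b) v = bracket a (bracket b v) - bracket b (bracket a v)" for a b v
    using bracket_jacobi[of a b v] by simp
  have "Tr (\<lambda>v. bracket b (bracket a (S v))) = Tr (\<lambda>v. bracket a (S (bracket b v)))"
    by (rule Tr_commute) (auto intro: ad_linear linear_comp S)
  then show ?thesis by (simp add: killing_def 1 d bracket_simps Tr_diff)
qed

definition killing_radical :: "'g set" where
  "killing_radical = {x. \<forall>y. killing x y = 0}"

lemma killing_radical_ideal: "lie_ideal killing_radical"
proof -
  have s: "subspace killing_radical"
    by (rule subspaceI) (auto simp: killing_radical_def killing_linear killing_linear(2)[of 0 0, simplified])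
  moreover have "bracket a b \<in> killing_radical" if "b \<in> killing_radical" for a b
    using that subspace_neg[OF s, of "bracket b a"] bracket_anti[of a b]
    by (auto simp: killing_radical_def killing_invariant)
  ultimately show ?thesis by (auto simp: lie_ideal_def)
qed

text \<open>
  Cartan's criterion.  If \<open>ad x\<close> had a nonzero eigenvalue, choose a rational functional \<open>f\<close> of the
  eigenvalues not vanishing there.  The operator \<open>S\<close> acting by \<open>f(a)\<close> on the generalized eigenspace for
  \<open>a\<close> is a derivation, so the trace of \<open>ad x S\<close>, a sum of values of the Killing form on the radical, is
  zero.  It equals the sum of \<open>a f(a)\<close>; applying \<open>f\<close> gives a vanishing sum of squares of rationals.
\<close>

lemma derived_killing_radical_nilpotent:
  assumes "x \<in> derived killing_radical"
  shows "\<exists>k. (bracket x ^^ k) v = 0"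
proof -
  obtain C ev where C: "finite C" "independent C" "span C = UNIV" "\<And>c. c \<in> C \<Longrightarrow> c \<in> gen_eig (bracket x) (ev c)"
    and S: "\<And>f. \<exists>S. linear_op scale S \<and> (\<forall>a. \<forall>v\<in>gen_eig (bracket x) a. S v = scale (f a) v) \<and>
       tr C (\<lambda>v. bracket x (S v)) = (\<Sum>c\<in>C. ev c * f (ev c))"
    using ad_linear fin_dim_UNIV by (rule gen_eig_multiplier) (rule that)
  have ev0: "ev c0 = 0" if "c0 \<in> C" for c0
  proof (rule ccontr)
    assume "ev c0 \<noteq> 0"
    then obtain f :: "'k \<Rightarrow> rat" where f: "\<And>x y. f (x + y) = f x + f y" "\<And>q x. f (of_rat q * x) = q * f x" "f (ev c0) \<noteq> 0"
      using rational_functional[of "ev c0"] by metis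
    obtain S where S: "linear_op scale S"
      "\<And>a v. v\<in>gen_eig (bracket x) a \<Longrightarrow> S v = scale (of_rat (f a)) v"
      "tr C (\<lambda>v. bracket x (S v)) = (\<Sum>c\<in>C. ev c * of_rat (f (ev c)))"
      using S[of "\<lambda>a. of_rat (f a)"] by blast
    have der1: "S (bracket v w) = bracket (S v) w + bracket v (S w)" if "v \<in> C" "w \<in> C" for v w
      using S(2)[OF ad_gen_eig_bracket[OF C(4)[OF that(1)] C(4)[OF that(2)]]]
        S(2)[OF C(4)[OF that(1)]] S(2)[OF C(4)[OF that(2)]]
      by (simp add: bracket_simps f(1) of_rat_add scale_left_distrib)
    have der2: "S (bracket v w) = bracket (S v) w + bracket v (S w)" if "v \<in> C" for v w
    proof -
      have "w \<in> span C" using C(3) by simp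
      then show ?thesis
        by (induction w rule: span_induct_alt)
          (use der1[OF that] in \<open>auto simp: bracket_simps linearD[OF S(1)] scale_right_distrib\<close>)
    qed
    have der3: "S (bracket v w) = bracket (S v) w + bracket v (S w)" for v w
    proof -
      have "v \<in> span C" using C(3) by simp
      then show ?thesis
        by (induction v rule: span_induct_alt)
          (use der2 in \<open>auto simp: bracket_simps linearD[OF S(1)] scale_right_distrib\<close>)
    qed
    then have der: "derivation S" using S(1) by (simp add: derivation_def)
    have "Tr (\<lambda>v. bracket y (S v)) = 0" if "y \<in> derived killing_radical" for y
      using that unfolding derived_def
    proof (induction y rule: span_induct_alt)
      case base
      show ?case using Tr_scale[of 0 "\<lambda>_. 0"] by (simp add: bracket_simps)
    next
      case (step c y z)
      then show ?case
        by (auto simp: bracket_simps Tr_add Tr_scale Tr_bracket_derivation[OF der] killing_radical_def)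
    qed
    then have "Tr (\<lambda>v. bracket x (S v)) = 0" using assms by blast
    moreover have "Tr (\<lambda>v. bracket x (S v)) = tr C (\<lambda>v. bracket x (S v))"
      unfolding Tr_def by (rule tr_basis_indep[OF basis0(1,2) C(1,2)])
        (use C(3) basis0(3) S(1) in \<open>auto intro: linear_comp ad_linear\<close>)
    ultimately have s0: "(\<Sum>c\<in>C. ev c * of_rat (f (ev c))) = 0" using S(3) by simp
    have f0: "f 0 = 0" using f(1)[of 0 0] by simp
    have fsum: "f (\<Sum>c\<in>A. g c) = (\<Sum>c\<in>A. f (g c))" for g and A :: "'g set"
      by (induction A rule: infinite_finite_induct) (auto simp: f f0)
    have "0 = f (\<Sum>c\<in>C. ev c * of_rat (f (ev c)))" using s0 f0 by simp
    also have "\<dots> = (\<Sum>c\<in>C. f (ev c) ^ 2)"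
      unfolding fsum by (rule sum.cong) (auto simp: mult.commute[of _ "of_rat _"] f(2) power2_eq_square)
    finally have "(\<Sum>c\<in>C. f (ev c) ^ 2) = 0" by simp
    then have "f (ev c0) ^ 2 = 0" using sum_nonneg_eq_0_iff[OF C(1), of "\<lambda>c. f (ev c) ^ 2"] that by simp
    then show False using f(3) by simp
  qed
  have "C \<subseteq> gen_eig (bracket x) 0" using C(4) ev0 by force
  then have "span C \<subseteq> gen_eig (bracket x) 0" by (rule span_minimal[OF _ subspace_gen_eig[OF ad_linear]])
  then have "v \<in> gen_eig (bracket x) 0" using C(3) by blast
  moreover have "shift (bracket x) 0 = bracket x" by (auto simp: shift_def)
  ultimately show ?thesis by (auto simp: gen_eig_def)
qed

lemma derived_ideal: "lie_ideal I \<Longrightarrow> lie_ideal (derived I)"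
proof -
  assume I: "lie_ideal I"
  have "bracket a b \<in> derived I" if "b \<in> derived I" for a b
    using that unfolding derived_def
  proof (induction b rule: span_induct_alt)
    case (step c x y)
    then obtain u v where uv: "x = bracket u v" "u \<in> I" "v \<in> I" by blast
    have "bracket a x = bracket (bracket a u) v + bracket u (bracket a v)" by (simp add: uv bracket_jacobi[of a u v])
    also have "\<dots> \<in> span {bracket a b |a b. a \<in> I \<and> b \<in> I}"
      using I uv(2,3) unfolding lie_ideal_def by (intro span_add span_base) blast+
    finally show ?case using step by (auto simp: bracket_simps intro: span_add span_scale)
  qed (simp add: bracket_simps span_zero)
  then show ?thesis by (auto simp: lie_ideal_def derived_def)
qed

text \<open>
  The derived algebra of the radical consists of ad-nilpotent elements, so by Engel's theorem it has a
  nonzero centre unless it is zero, and that centre would be an abelian ideal.  Hence the radical is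
  itself an abelian ideal.
\<close>

lemma killing_nondegenerate:
  assumes ss: semisimple
  shows "killing_radical = {0}"
proof (rule abelian_ideal_zero[OF ss killing_radical_ideal])
  let ?P = "derived killing_radical"
  have id: "lie_ideal ?P" by (rule derived_ideal[OF killing_radical_ideal])
  have sP: "subspace ?P" using id by (simp add: lie_ideal_def)
  have bP: "\<And>a b. b \<in> ?P \<Longrightarrow> bracket a b \<in> ?P" using id by (simp add: lie_ideal_def)
  have "?P = {0}"
  proof (rule ccontr)
    assume ne: "?P \<noteq> {0}"
    define Z where "Z = {v \<in> ?P. \<forall>x\<in>?P. bracket x v = 0}"
    have "\<exists>v\<in>?P - {0}. \<forall>x\<in>?P. bracket x v \<in> {0}"
      by (rule engel) (use derived_killing_radical_nilpotent sP bP ne subspace_0[OF sP] in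
          \<open>auto simp: subalgebra_def bracket_simps\<close>)
    then have "Z \<noteq> {0}" by (auto simp: Z_def)
    moreover have "Z = {0}"
    proof (rule abelian_ideal_zero[OF ss])
      have "subspace Z" unfolding Z_def
        by (rule subspaceI) (use sP in \<open>auto simp: subspace_0 subspace_add subspace_scale bracket_simps\<close>)
      moreover have "bracket a b \<in> Z" if "b \<in> Z" for a b
      proof -
        have "bracket x (bracket a b) = 0" if "x \<in> ?P" for x
          using \<open>b \<in> Z\<close> that bP[OF that, of a] bracket_anti[of x a] subspace_neg[OF sP]
          by (auto simp: Z_def bracket_jacobi[of x a b] bracket_simps)
        then show ?thesis using that bP by (auto simp: Z_def)
      qed
      ultimately show "lie_ideal Z" by (simp add: lie_ideal_def)
    qed (auto simp: Z_def)
    ultimately show False by simp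
  qed
  then have "span {bracket a b |a b. a \<in> killing_radical \<and> b \<in> killing_radical} = {0}" by (simp add: derived_def)
  then show "bracket a b = 0" if "a \<in> killing_radical" "b \<in> killing_radical" for a b
    using span_base[of "bracket a b" "{bracket a b |a b. a \<in> killing_radical \<and> b \<in> killing_radical}"] that
    by blast
qed

text \<open>
  If the derived algebra were proper, some \<open>v \<noteq> 0\<close> would be orthogonal to it for the Killing form.  By
  invariance every \<open>[v, y]\<close> is then in the radical, so \<open>v\<close> is central, which is impossible.
\<close>

theorem semisimple_perfect:
  assumes ss: semisimple
  shows "span {bracket a b |a b. True} = UNIV"
proof (rule ccontr)
  let ?D = "span {bracket a b |a b. True}"
  assume ne: "?D \<noteq> UNIV"
  have fd: "fin_dim scale ?D" by (rule fin_dim_mono[OF fin_dim_UNIV]) auto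
  obtain D where D: "finite D" "independent D" "span D = ?D" using fd by (rule fin_dim_basis)
  have "dim ?D < dim (UNIV :: 'g set)" by (rule fin_dim_dim_less[OF fin_dim_UNIV _ _ ne]) auto
  then have "card D < card basis0"
    using dim_span_eq_card_independent[OF D(2)] dim_span_eq_card_independent[OF basis0(2)] D(3) basis0(3) by simp
  have vs: "vector_space ((*)::'k \<Rightarrow> 'k \<Rightarrow> 'k)" by unfold_locales (auto simp: algebra_simps)
  have "Vector_Spaces.linear scale (*) (\<lambda>v. killing v d)" for d
    unfolding Vector_Spaces.linear_iff by (auto simp: killing_linear vs vector_space_axioms)
  then obtain v where v: "v \<in> span basis0" "v \<noteq> 0" "\<And>d. d \<in> D \<Longrightarrow> killing v d = 0"
    by (rule common_zero[OF D(1) _ basis0(2,1) \<open>card D < card basis0\<close>]) (rule that)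
  have k0: "killing v y = 0" if "y \<in> ?D" for y
    using that unfolding D(3)[symmetric]
    by (induction y rule: span_induct_alt) (use v(3) in \<open>auto simp: killing_linear killing_linear(4)[of _ 0 0, simplified]\<close>)
  have "bracket v y \<in> killing_radical" for y
    unfolding killing_radical_def killing_invariant
    by (auto simp: killing_invariant intro!: k0 span_base)
  then have vc: "bracket v y = 0" for y using killing_nondegenerate[OF ss] by blast
  define Z where "Z = {v. \<forall>y. bracket v y = 0}"
  have "Z = {0}"
  proof (rule abelian_ideal_zero[OF ss])
    have "subspace Z" by (rule subspaceI) (auto simp: Z_def bracket_simps)
    moreover have "bracket a b \<in> Z" if "b \<in> Z" for a b
      using that bracket_anti[of a b] by (auto simp: Z_def bracket_simps)
    ultimately show "lie_ideal Z" by (simp add: lie_ideal_def)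
  qed (auto simp: Z_def)
  then show False using v(2) vc by (auto simp: Z_def)
qed

end

section \<open>Irreducible families of operators\<close>

context alg_closed_space
begin

definition invariant :: "('b \<Rightarrow> 'b) set \<Rightarrow> 'b set \<Rightarrow> bool" where
  "invariant \<Phi> U \<longleftrightarrow> (\<forall>\<phi>\<in>\<Phi>. \<forall>u\<in>U. \<phi> u \<in> U)"

definition irreducible_under :: "('b \<Rightarrow> 'b) set \<Rightarrow> 'b set \<Rightarrow> bool" where
  "irreducible_under \<Phi> V \<longleftrightarrow> subspace V \<and> V \<noteq> {0} \<and> invariant \<Phi> V \<and>
     (\<forall>U. subspace U \<and> U \<subseteq> V \<and> invariant \<Phi> U \<longrightarrow> U = {0} \<or> U = V)"

lemma irreducible_under_invariant: "irreducible_under \<Phi> V \<Longrightarrow> invariant \<Phi> V"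
  by (simp add: irreducible_under_def)

lemma irreducible_underD:
  assumes "irreducible_under \<Phi> V"
  shows "subspace V" "V \<noteq> {0}" "\<And>\<phi> v. \<phi> \<in> \<Phi> \<Longrightarrow> v \<in> V \<Longrightarrow> \<phi> v \<in> V"
    "\<And>U u. subspace U \<Longrightarrow> U \<subseteq> V \<Longrightarrow> (\<And>\<phi> u. \<phi> \<in> \<Phi> \<Longrightarrow> u \<in> U \<Longrightarrow> \<phi> u \<in> U) \<Longrightarrow> u \<in> U \<Longrightarrow> u \<noteq> 0 \<Longrightarrow> U = V"
proof -
  show "subspace V" "V \<noteq> {0}" "\<And>\<phi> v. \<phi> \<in> \<Phi> \<Longrightarrow> v \<in> V \<Longrightarrow> \<phi> v \<in> V"
    using assms by (auto simp: irreducible_under_def invariant_def)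
  fix U u assume "subspace U" "U \<subseteq> V" "\<And>\<phi> u. \<phi> \<in> \<Phi> \<Longrightarrow> u \<in> U \<Longrightarrow> \<phi> u \<in> U" "u \<in> U" "u \<noteq> 0"
  then show "U = V" using assms unfolding irreducible_under_def invariant_def by blast
qed

text \<open>
  The unital associative algebra generated by \<open>\<Phi>\<close>.
\<close>

inductive_set op_alg :: "('b \<Rightarrow> 'b) set \<Rightarrow> ('b \<Rightarrow> 'b) set" for \<Phi> where
  ident: "(\<lambda>v. v) \<in> op_alg \<Phi>"
| comp: "\<phi> \<in> \<Phi> \<Longrightarrow> a \<in> op_alg \<Phi> \<Longrightarrow> (\<lambda>v. \<phi> (a v)) \<in> op_alg \<Phi>"
| add: "a \<in> op_alg \<Phi> \<Longrightarrow> b \<in> op_alg \<Phi> \<Longrightarrow> (\<lambda>v. a v + b v) \<in> op_alg \<Phi>"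
| scale: "a \<in> op_alg \<Phi> \<Longrightarrow> (\<lambda>v. scale c (a v)) \<in> op_alg \<Phi>"

lemma op_alg_diff: "a \<in> op_alg \<Phi> \<Longrightarrow> b \<in> op_alg \<Phi> \<Longrightarrow> (\<lambda>v. a v - b v) \<in> op_alg \<Phi>"
  using op_alg.add[OF _ op_alg.scale[of b _ "-1"], of a] by simp

lemma op_alg_zero: "(\<lambda>v. 0) \<in> op_alg \<Phi>"
  using op_alg.scale[OF op_alg.ident, of 0] by simp

lemma op_alg_sum: "(\<And>x. x \<in> A \<Longrightarrow> a x \<in> op_alg \<Phi>) \<Longrightarrow> (\<lambda>v. \<Sum>x\<in>A. a x v) \<in> op_alg \<Phi>"
  by (induction A rule: infinite_finite_induct) (auto intro: op_alg_zero op_alg.add)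

lemma op_alg_base: "\<phi> \<in> \<Phi> \<Longrightarrow> \<phi> \<in> op_alg \<Phi>"
  using op_alg.comp[OF _ op_alg.ident] by simp

lemma op_alg_comp: "a \<in> op_alg \<Phi> \<Longrightarrow> b \<in> op_alg \<Phi> \<Longrightarrow> (\<lambda>v. a (b v)) \<in> op_alg \<Phi>"
  by (induction a rule: op_alg.induct) (auto intro: op_alg.intros)

lemma op_alg_linear:
  assumes "a \<in> op_alg \<Phi>" "\<And>\<phi>. \<phi> \<in> \<Phi> \<Longrightarrow> linear_op scale \<phi>"
  shows "linear_op scale a"
  using assms(1)
proof induction
  case (comp \<phi> a)
  then show ?case using assms(2) by (intro linearI) (auto simp: linearD)
qed (auto intro!: linearI simp: linearD scale_right_distrib mult.commute)

lemma op_alg_invariant: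
  assumes "a \<in> op_alg \<Phi>" "subspace U" "invariant \<Phi> U" "u \<in> U"
  shows "a u \<in> U"
  using assms(1) by induction (use assms in \<open>auto simp: invariant_def intro: subspace_add subspace_scale\<close>)

lemma op_alg_commute:
  assumes "a \<in> op_alg \<Phi>" "linear_op scale T"
    and W: "subspace W" "invariant \<Phi> W" "w \<in> W"
    and comm: "\<And>\<phi> u. \<phi> \<in> \<Phi> \<Longrightarrow> u \<in> W \<Longrightarrow> \<phi> (T u) = T (\<phi> u)"
  shows "a (T w) = T (a w)"
  using assms(1)
proof induction
  case (comp \<phi> a)
  then show ?case using comm op_alg_invariant[OF comp(2) W] by simp
qed (auto simp: linearD[OF assms(2)])

lemma schur:
  assumes irr: "irreducible_under \<Phi> V" and fd: "fin_dim scale V"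
    and lin: "\<And>\<phi>. \<phi> \<in> \<Phi> \<Longrightarrow> linear_op scale \<phi>"
    and T: "linear_on scale scale V V T" "\<And>\<phi> v. \<phi> \<in> \<Phi> \<Longrightarrow> v \<in> V \<Longrightarrow> \<phi> (T v) = T (\<phi> v)"
  obtains c where "\<And>v. v \<in> V \<Longrightarrow> T v = scale c v"
proof -
  note V = irreducible_underD[OF irr]
  obtain p where p: "linear_op scale p" "\<And>v. p v \<in> V" "\<And>w. w \<in> V \<Longrightarrow> p w = w"
    using V(1) by (rule subspace_projection) (rule that)
  have TV: "\<And>v. v \<in> V \<Longrightarrow> T v \<in> V" "\<And>u v. u \<in> V \<Longrightarrow> v \<in> V \<Longrightarrow> T (u + v) = T u + T v"
    "\<And>c v. v \<in> V \<Longrightarrow> T (scale c v) = scale c (T v)"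
    using T(1) by (auto simp: linear_on_def)
  have lT: "linear_op scale (\<lambda>v. T (p v))"
    by (rule linearI) (auto simp: linearD[OF p(1)] TV p(2))
  obtain c v where cv: "v \<in> V" "v \<noteq> 0" "T (p v) = scale c v"
    by (rule eigenvector_exists[OF lT fd _ V(2)]) (use TV(1) p(2) in auto)
  let ?U = "{v \<in> V. T v = scale c v}"
  have "?U = V"
  proof (rule V(4))
    show "subspace ?U"
      using TV(3)[of 0 0] subspace_0[OF V(1)]
      by (intro subspaceI) (auto simp: TV V(1) subspace_0 subspace_add subspace_scale scale_right_distrib mult.commute)
    show "\<phi> u \<in> ?U" if "\<phi> \<in> \<Phi>" "u \<in> ?U" for \<phi> u
      using that V(3)[OF that(1)] T(2)[OF that(1), symmetric] linearD[OF lin[OF that(1)]] by auto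
    show "v \<in> ?U" using cv p(3) by auto
  qed (use cv in auto)
  then show ?thesis using that by blast
qed

text \<open>
  The orbit of \<open>a x\<close> under the algebra is a nonzero invariant subspace, hence everything.
\<close>

lemma density_from_separation:
  assumes irr: "irreducible_under \<Phi> V" and lin: "\<And>\<phi>. \<phi> \<in> \<Phi> \<Longrightarrow> linear_op scale \<phi>"
    and a: "a \<in> op_alg \<Phi>" "a x \<noteq> 0" "\<And>b. b \<in> B \<Longrightarrow> a b = 0" and x: "x \<in> V" and w: "w \<in> V"
  shows "\<exists>a\<in>op_alg \<Phi>. a x = w \<and> (\<forall>b\<in>B. a b = 0)"
proof -
  note V = irreducible_underD[OF irr]
  let ?U = "{c (a x) | c. c \<in> op_alg \<Phi>}"
  have "?U = V"
  proof (rule V(4))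
    show "subspace ?U"
    proof (rule subspaceI)
      show "0 \<in> ?U" using op_alg_zero by force
      show "u + v \<in> ?U" if "u \<in> ?U" "v \<in> ?U" for u v using that op_alg.add by force
      show "scale c u \<in> ?U" if "u \<in> ?U" for c u using that op_alg.scale by force
    qed
    show "?U \<subseteq> V" using op_alg_invariant[OF _ V(1) irreducible_under_invariant[OF irr]] a(1) x by blast
    show "\<phi> u \<in> ?U" if "\<phi> \<in> \<Phi>" "u \<in> ?U" for \<phi> u using that op_alg.comp by force
    show "a x \<in> ?U" using op_alg.ident by force
  qed (rule a(2))
  then obtain c where c: "c \<in> op_alg \<Phi>" "c (a x) = w" using w by blast
  have "c 0 = 0" using linearD(3)[OF op_alg_linear[OF c(1) lin]] .
  then show ?thesis using op_alg_comp[OF c(1) a(1)] c(2) a(3) by (intro bexI[of _ "\<lambda>v. c (a v)"]) auto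
qed

text \<open>
  The induction step is the classical one: if every operator killing \<open>B\<close> kills \<open>v\<close>, then the value at \<open>v\<close> of an
  operator is determined by its values on \<open>B\<close>.  By Schur's lemma each coordinate contributes a
  scalar, and the identity operator exhibits \<open>v\<close> as a combination of \<open>B\<close>.
\<close>

lemma separation:
  assumes irr: "irreducible_under \<Phi> V" and fd: "fin_dim scale V"
    and lin: "\<And>\<phi>. \<phi> \<in> \<Phi> \<Longrightarrow> linear_op scale \<phi>"
  shows "finite B \<Longrightarrow> independent B \<Longrightarrow> B \<subseteq> V \<Longrightarrow> v \<in> V \<Longrightarrow> v \<notin> span B
    \<Longrightarrow> \<exists>a\<in>op_alg \<Phi>. (\<forall>b\<in>B. a b = 0) \<and> a v \<noteq> 0"
proof (induction "card B" arbitrary: B v rule: less_induct)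
  case less
  note V = irreducible_underD[OF irr]
  note B = less.prems
  have e: "\<exists>a\<in>op_alg \<Phi>. a b = w \<and> (\<forall>b'\<in>B - {b}. a b' = 0)" if b: "b \<in> B" and w: "w \<in> V" for b w
  proof -
    have "b \<notin> span (B - {b})" using B(2) b by (auto simp: dependent_def)
    moreover have "card (B - {b}) < card B" by (rule card_Diff1_less[OF B(1) b])
    ultimately have "\<exists>a\<in>op_alg \<Phi>. (\<forall>b'\<in>B - {b}. a b' = 0) \<and> a b \<noteq> 0"
      by (intro less.hyps) (use B b independent_mono[OF B(2), of "B - {b}"] in auto)
    then obtain a where "a \<in> op_alg \<Phi>" "\<And>b'. b' \<in> B - {b} \<Longrightarrow> a b' = 0" "a b \<noteq> 0" by auto
    then show ?thesis using density_from_separation[OF irr lin, of a b "B - {b}" w] B(3) b w by blast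
  qed
  show ?case
  proof (rule ccontr)
    assume "\<not> ?case"
    then have contra: "a v = 0" if "a \<in> op_alg \<Phi>" "\<And>b. b \<in> B \<Longrightarrow> a b = 0" for a using that by blast
    have wd: "a v = a' v" if "a \<in> op_alg \<Phi>" "a' \<in> op_alg \<Phi>" "\<And>b. b \<in> B \<Longrightarrow> a b = a' b" for a a'
      using contra[OF op_alg_diff[OF that(1,2)]] that(3) by simp
    from e have "\<forall>b\<in>B. \<forall>w\<in>V. \<exists>a. a\<in>op_alg \<Phi> \<and> a b = w \<and> (\<forall>b'\<in>B - {b}. a b' = 0)" by blast
    then obtain E where E: "\<And>b w. b \<in> B \<Longrightarrow> w \<in> V \<Longrightarrow> E b w \<in> op_alg \<Phi> \<and> E b w b = w \<and> (\<forall>b'\<in>B - {b}. E b w b' = 0)"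
      by metis
    have Ev: "E b w b' = (if b' = b then w else 0)" if "b \<in> B" "w \<in> V" "b' \<in> B" for b w b'
      using E[OF that(1,2)] that(3) by auto
    have EA: "E b w \<in> op_alg \<Phi>" if "b \<in> B" "w \<in> V" for b w using E[OF that] by blast
    have "\<exists>c. \<forall>w\<in>V. E b w v = scale c w" if b: "b \<in> B" for b
    proof -
      have "linear_on scale scale V V (\<lambda>w. E b w v)"
        unfolding linear_on_def
      proof (intro conjI ballI allI)
        show "E b w v \<in> V" if "w \<in> V" for w
          using op_alg_invariant[OF _ V(1) irreducible_under_invariant[OF irr] B(4)] E[OF b that] by blast
        show "E b (u + w) v = E b u v + E b w v" if "u \<in> V" "w \<in> V" for u w
          by (rule wd[of "E b (u + w)" "\<lambda>v. E b u v + E b w v"])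
            (use EA[OF b] Ev[OF b] subspace_add[OF V(1)] that in \<open>auto intro: op_alg.add\<close>)
        show "E b (scale c w) v = scale c (E b w v)" if "w \<in> V" for c w
          by (rule wd[of "E b (scale c w)" "\<lambda>v. scale c (E b w v)"])
            (use EA[OF b] Ev[OF b] subspace_scale[OF V(1)] that in \<open>auto intro: op_alg.scale\<close>)
      qed
      moreover have "\<phi> (E b w v) = E b (\<phi> w) v" if "\<phi> \<in> \<Phi>" "w \<in> V" for \<phi> w
        by (rule wd[of "\<lambda>v. \<phi> (E b w v)" "E b (\<phi> w)"])
          (use EA[OF b] Ev[OF b] V(3)[OF that] that linearD(3)[OF lin[OF that(1)]] in \<open>auto intro: op_alg.comp\<close>)
      ultimately obtain c where "\<And>w. w \<in> V \<Longrightarrow> E b w v = scale c w"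
        using schur[OF irr fd lin, of "\<lambda>w. E b w v"] by metis
      then show ?thesis by blast
    qed
    then obtain c where c: "\<And>b w. b \<in> B \<Longrightarrow> w \<in> V \<Longrightarrow> E b w v = scale (c b) w" by metis
    have Eb: "E b b \<in> op_alg \<Phi>" "E b b b = b" "\<And>b'. b' \<in> B \<Longrightarrow> b' \<noteq> b \<Longrightarrow> E b b b' = 0" if "b \<in> B" for b
      using E[OF that, of b] B(3) that by auto
    have "v = (\<Sum>b\<in>B. E b b v)"
    proof (rule wd[OF op_alg.ident op_alg_sum])
      fix b' assume b': "b' \<in> B"
      have "(\<Sum>b\<in>B. E b b b') = (\<Sum>b\<in>B. if b = b' then b' else 0)"
        by (rule sum.cong) (use Eb b' in auto)
      then show "b' = (\<Sum>b\<in>B. E b b b')" using b' B(1) by simp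
    qed (use Eb in auto)
    also have "\<dots> = (\<Sum>b\<in>B. scale (c b) b)" using c B(3) by (auto intro!: sum.cong)
    also have "\<dots> \<in> span B" by (auto intro: span_sum span_scale span_base)
    finally show False using B(5) by blast
  qed
qed

text \<open>
  The theorem of Burnside and Jacobson, in the form of operators acting as matrix units.
\<close>

theorem density:
  assumes irr: "irreducible_under \<Phi> V" and fd: "fin_dim scale V"
    and lin: "\<And>\<phi>. \<phi> \<in> \<Phi> \<Longrightarrow> linear_op scale \<phi>"
    and B: "finite B" "independent B" "B \<subseteq> V" "x \<in> B" "w \<in> V"
  obtains a where "a \<in> op_alg \<Phi>" "a x = w" "\<And>b. b \<in> B \<Longrightarrow> b \<noteq> x \<Longrightarrow> a b = 0"
proof -
  have "x \<notin> span (B - {x})" using B by (auto simp: dependent_def)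
  then have "\<exists>a\<in>op_alg \<Phi>. (\<forall>b\<in>B - {x}. a b = 0) \<and> a x \<noteq> 0"
    by (intro separation[OF irr fd lin]) (use B independent_mono[OF B(2), of "B - {x}"] in auto)
  then obtain a where "a \<in> op_alg \<Phi>" "\<And>b. b \<in> B - {x} \<Longrightarrow> a b = 0" "a x \<noteq> 0" by blast
  then have "\<exists>a\<in>op_alg \<Phi>. a x = w \<and> (\<forall>b\<in>B - {x}. a b = 0)"
    using density_from_separation[OF irr lin, of a x "B - {x}" w] B by blast
  then show ?thesis using that by blast
qed

end

lemma sum_PiE_insert:
  assumes "x \<notin> I"
  shows "(\<Sum>f\<in>Pi\<^sub>E (insert x I) B. g f) = (\<Sum>b\<in>B x. \<Sum>f\<in>Pi\<^sub>E I B. g (f(x := b)))"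
proof -
  have "(\<Sum>f\<in>Pi\<^sub>E (insert x I) B. g f) = (\<Sum>f\<in>(\<lambda>(b, f). f(x := b)) ` (B x \<times> Pi\<^sub>E I B). g f)"
    by (simp add: PiE_insert_eq)
  also have "\<dots> = (\<Sum>(b, f)\<in>B x \<times> Pi\<^sub>E I B. g (f(x := b)))"
    by (subst sum.reindex[OF inj_combinator[OF assms]]) (simp add: case_prod_beta)
  also have "\<dots> = (\<Sum>b\<in>B x. \<Sum>f\<in>Pi\<^sub>E I B. g (f(x := b)))"
    by (simp add: sum.cartesian_product)
  finally show ?thesis .
qed

lemma PiE_restrict_insert:
  assumes "v \<in> Pi\<^sub>E (insert x I) V"
  shows "restrict v I \<in> Pi\<^sub>E I V" "v x \<in> V x"
  using assms by (auto simp: PiE_def)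

definition free_family :: "('k::field \<Rightarrow> 'w::ab_group_add \<Rightarrow> 'w) \<Rightarrow> 'b set \<Rightarrow> ('b \<Rightarrow> 'w) \<Rightarrow> bool" where
  "free_family s P t \<longleftrightarrow> (\<forall>c. (\<Sum>b\<in>P. s (c b) (t b)) = 0 \<longrightarrow> (\<forall>b\<in>P. c b = 0))"

context alg_closed_space
begin

text \<open>
  Induction on the index set.  Pick a minimal \<open>\<Phi> x\<close>-invariant subspace \<open>V\<close>.  An element of the algebra
  generated by \<open>\<Phi> x\<close> is determined by its restriction to \<open>V\<close>, since it commutes with the remaining
  operators, so by density this algebra contains matrix units for \<open>V\<close>.  The image \<open>H\<close> of a diagonal one
  is the multiplicity space: it is irreducible under the remaining families, and \<open>W\<close> is the tensor
  product of \<open>V\<close> and \<open>H\<close>.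
\<close>

theorem commuting_tensor_decomposition:
  fixes \<Phi> :: "'i \<Rightarrow> ('b \<Rightarrow> 'b) set"
  assumes "finite I" "fin_dim scale W"
    and "\<And>i \<phi>. i \<in> I \<Longrightarrow> \<phi> \<in> \<Phi> i \<Longrightarrow> linear_op scale \<phi>"
    and "\<And>i j \<phi> \<psi> w. i \<in> I \<Longrightarrow> j \<in> I \<Longrightarrow> i \<noteq> j \<Longrightarrow> \<phi> \<in> \<Phi> i \<Longrightarrow> \<psi> \<in> \<Phi> j \<Longrightarrow> w \<in> W \<Longrightarrow> \<phi> (\<psi> w) = \<psi> (\<phi> w)"
    and "irreducible_under (\<Union>i\<in>I. \<Phi> i) W"
  shows "\<exists>V B t. (\<forall>i\<in>I. irreducible_under (\<Phi> i) (V i) \<and> V i \<subseteq> W \<and> finite (B i) \<and> independent (B i)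
        \<and> span (B i) = V i) \<and>
      multilinear_on I scale scale V W t \<and> free_family scale (Pi\<^sub>E I B) t \<and> W \<subseteq> span (t ` Pi\<^sub>E I B) \<and>
      (\<forall>i\<in>I. \<forall>\<phi>\<in>\<Phi> i. \<forall>v\<in>Pi\<^sub>E I V. \<phi> (t v) = t (v(i := \<phi> (v i))))"
  using assms
proof (induction I arbitrary: W rule: finite_induct)
  case empty
  note W = irreducible_underD[OF empty.prems(4)]
  obtain w where w: "w \<in> W" "w \<noteq> 0" using W(1,2) subspace_0 by blast
  have "span {w} = W" by (rule W(4)) (use w W(1) in \<open>auto intro: span_base span_minimal[THEN subsetD]\<close>)
  then show ?case using w
    by (intro exI[of _ "\<lambda>_. {}"] exI[of _ "\<lambda>_. w"]) (auto simp: multilinear_on_def free_family_def)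
next
  case (insert x I)
  note W = irreducible_underD[OF insert.prems(4)] and fdW = insert.prems(1)
  note lin = insert.prems(2) and comm = insert.prems(3)
  have linx: "\<And>\<phi>. \<phi> \<in> \<Phi> x \<Longrightarrow> linear_op scale \<phi>" using lin by blast
  have invW: "\<And>i \<phi> w. i \<in> insert x I \<Longrightarrow> \<phi> \<in> \<Phi> i \<Longrightarrow> w \<in> W \<Longrightarrow> \<phi> w \<in> W" using W(3) by blast
  obtain V where V: "subspace V" "V \<subseteq> W" "V \<noteq> {0}" "invariant (\<Phi> x) V"
      "\<And>U. subspace U \<Longrightarrow> U \<subseteq> V \<Longrightarrow> U \<noteq> {0} \<Longrightarrow> invariant (\<Phi> x) U \<Longrightarrow> U = V"
  proof (rule fin_dim_minimal_subspace[OF fdW W(2), of "invariant (\<Phi> x)"])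
    show "invariant (\<Phi> x) W" using invW by (auto simp: invariant_def)
  qed (rule that)
  have fdV: "fin_dim scale V" by (rule fin_dim_mono[OF fdW V(1,2)])
  have irrV: "irreducible_under (\<Phi> x) V" using V unfolding irreducible_under_def by blast
  obtain B where B: "finite B" "independent B" "span B = V" "B \<subseteq> V" using fdV by (rule fin_dim_basis)
  have "B \<noteq> {}" using B(3) V(3) by auto
  then obtain b0 where b0: "b0 \<in> B" by blast
  define A where "A = op_alg (\<Phi> x)"
  have linA: "a \<in> A \<Longrightarrow> linear_op scale a" for a
    unfolding A_def by (rule op_alg_linear[OF _ linx])
  have AW: "a w \<in> W" if "a \<in> A" "w \<in> W" for a w
    using op_alg_invariant[OF that(1)[unfolded A_def] W(1) _ that(2)] invW by (auto simp: invariant_def)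
  have AV: "a v \<in> V" if "a \<in> A" "v \<in> V" for a v
    by (rule op_alg_invariant[OF that(1)[unfolded A_def] V(1,4) that(2)])
  have Acomm: "a (\<psi> w) = \<psi> (a w)" if "a \<in> A" "i \<in> I" "\<psi> \<in> \<Phi> i" "w \<in> W" for a i \<psi> w
  proof -
    have "x \<noteq> i" using that(2) insert.hyps(2) by blast
    then show ?thesis
    by (intro op_alg_commute[OF that(1)[unfolded A_def] lin[OF _ that(3)] W(1)])
      (use that invW comm[of x i] in \<open>auto simp: invariant_def\<close>)
  qed
  \<comment> \<open>an element of the algebra is determined by its restriction to \<open>V\<close>\<close>
  have key0: "a w = 0" if a: "a \<in> A" "\<And>v. v \<in> V \<Longrightarrow> a v = 0" and w: "w \<in> W" for a w
  proof -
    let ?Z = "{w \<in> W. \<forall>a\<in>A. (\<forall>v\<in>V. a v = 0) \<longrightarrow> a w = 0}"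
    obtain v where v: "v \<in> V" "v \<noteq> 0" using V(1,3) subspace_0 by blast
    have "?Z = W"
    proof (rule W(4))
      show "subspace ?Z"
        by (rule subspaceI) (use W(1) in \<open>auto simp: subspace_0 subspace_add subspace_scale linearD[OF linA]\<close>)
      fix \<phi> u assume "\<phi> \<in> (\<Union>i\<in>insert x I. \<Phi> i)" and u: "u \<in> ?Z"
      then obtain i where i: "i \<in> insert x I" "\<phi> \<in> \<Phi> i" by blast
      have "a (\<phi> u) = 0" if a: "a \<in> A" "\<forall>v\<in>V. a v = 0" for a
      proof (cases "i = x")
        case True
        then have "(\<lambda>v. a (\<phi> v)) \<in> A" "\<forall>v\<in>V. a (\<phi> v) = 0"
          using i a op_alg_comp[OF _ op_alg_base, of a "\<Phi> x" \<phi>] V(4) by (auto simp: A_def invariant_def)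
        then show ?thesis using u by fast
      next
        case False
        then have iI: "i \<in> I" using i by blast
        have "a (\<phi> u) = \<phi> (a u)" using Acomm[OF a(1) iI i(2)] u by blast
        also have "a u = 0" using u a by blast
        finally show ?thesis using linearD(3)[OF lin[OF i]] by simp
      qed
      then show "\<phi> u \<in> ?Z" using u invW[OF i] by blast
    qed (use v V(2) in auto)
    then show ?thesis using a w by blast
  qed
  have key: "a w = a' w" if "a \<in> A" "a' \<in> A" "\<And>b. b \<in> B \<Longrightarrow> a b = a' b" "w \<in> W" for a a' w
  proof -
    interpret vp: vector_space_pair scale scale by unfold_locales
    note eq = vp.linear_eq_on[OF linA[OF that(1)] linA[OF that(2)] _ that(3)]
    have "a v - a' v = 0" if "v \<in> V" for v
      using eq[of v B] that B(3) by simp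
    then show ?thesis using key0[OF op_alg_diff[OF that(1,2)[unfolded A_def], folded A_def] _ that(4)] by simp
  qed
  \<comment> \<open>\<open>\<theta> v\<close> below sends \<open>b0\<close> to \<open>v\<close>, and \<open>\<mu> d\<close> sends \<open>d\<close> to \<open>b0\<close>; both kill the other basis vectors\<close>
  have dens: "\<exists>a\<in>A. a b = v \<and> (\<forall>b'\<in>B - {b}. a b' = 0)" if bv: "b \<in> B" "v \<in> V" for b v
  proof -
    obtain a where "a \<in> op_alg (\<Phi> x)" "a b = v" "\<And>b'. b' \<in> B \<Longrightarrow> b' \<noteq> b \<Longrightarrow> a b' = 0"
      by (rule density[OF irrV fdV linx B(1,2,4) bv], assumption) (rule that)
    then show ?thesis unfolding A_def by blast
  qed
  then have "\<forall>v\<in>V. \<exists>a. a \<in> A \<and> a b0 = v \<and> (\<forall>b'\<in>B - {b0}. a b' = 0)" using b0 by blast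
  then obtain \<theta> where \<theta>: "\<And>v. v \<in> V \<Longrightarrow> \<theta> v \<in> A \<and> \<theta> v b0 = v \<and> (\<forall>b'\<in>B - {b0}. \<theta> v b' = 0)"
    by metis
  have "\<forall>d\<in>B. \<exists>a. a \<in> A \<and> a d = b0 \<and> (\<forall>b'\<in>B - {d}. a b' = 0)" using dens b0 B(4) by blast
  then obtain \<mu> where \<mu>: "\<And>d. d \<in> B \<Longrightarrow> \<mu> d \<in> A \<and> \<mu> d d = b0 \<and> (\<forall>b'\<in>B - {d}. \<mu> d b' = 0)"
    by metis
  have b0V: "b0 \<in> V" using b0 B(4) by blast
  have \<theta>_add: "\<theta> (u + v) w = \<theta> u w + \<theta> v w" if "u \<in> V" "v \<in> V" "w \<in> W" for u v w
  proof (rule key[of _ "\<lambda>w. \<theta> u w + \<theta> v w"])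
    show "\<theta> (u + v) b = \<theta> u b + \<theta> v b" if "b \<in> B" for b
      using \<theta>[OF subspace_add[OF V(1) \<open>u \<in> V\<close> \<open>v \<in> V\<close>]] \<theta>[OF \<open>u \<in> V\<close>] \<theta>[OF \<open>v \<in> V\<close>] that by (cases "b = b0") auto
  qed (use \<theta> that subspace_add[OF V(1)] in \<open>auto simp: A_def intro: op_alg.add\<close>)
  have \<theta>_scale: "\<theta> (scale c v) w = scale c (\<theta> v w)" if "v \<in> V" "w \<in> W" for c v w
  proof (rule key[of _ "\<lambda>w. scale c (\<theta> v w)"])
    show "\<theta> (scale c v) b = scale c (\<theta> v b)" if "b \<in> B" for b
      using \<theta>[OF subspace_scale[OF V(1) \<open>v \<in> V\<close>, of c]] \<theta>[OF \<open>v \<in> V\<close>] that by (cases "b = b0") auto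
  qed (use \<theta> that subspace_scale[OF V(1)] in \<open>auto simp: A_def intro: op_alg.scale\<close>)
  have Vx: "\<phi> v \<in> V" if "\<phi> \<in> \<Phi> x" "v \<in> V" for \<phi> v using V(4) that by (auto simp: invariant_def)
  have \<theta>_act: "\<phi> (\<theta> v w) = \<theta> (\<phi> v) w" if "\<phi> \<in> \<Phi> x" "v \<in> V" "w \<in> W" for \<phi> v w
  proof (rule key[of "\<lambda>w. \<phi> (\<theta> v w)"])
    show "\<phi> (\<theta> v b) = \<theta> (\<phi> v) b" if "b \<in> B" for b
      using \<theta>[OF \<open>v \<in> V\<close>] \<theta>[OF Vx[OF \<open>\<phi> \<in> \<Phi> x\<close> \<open>v \<in> V\<close>]] linearD(3)[OF linx[OF \<open>\<phi> \<in> \<Phi> x\<close>]] that by (cases "b = b0") auto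
  qed (use \<theta> that Vx in \<open>auto simp: A_def intro: op_alg.comp\<close>)
  have \<mu>_\<theta>: "\<mu> d (\<theta> v w) = scale (representation B v d) (\<theta> b0 w)" if "d \<in> B" "v \<in> V" "w \<in> W" for d v w
  proof (rule key[of "\<lambda>w. \<mu> d (\<theta> v w)"])
    have "\<mu> d v = (\<Sum>b\<in>B. scale (representation B v b) (\<mu> d b))"
      by (rule linear_expand[OF B(1,2) linA]) (use \<mu> that B(3) in auto)
    also have "\<dots> = (\<Sum>b\<in>B. if b = d then scale (representation B v d) b0 else 0)"
      by (rule sum.cong) (use \<mu>[OF that(1)] in auto)
    also have "\<dots> = scale (representation B v d) b0" using that(1) B(1) by simp
    finally have mv: "\<mu> d v = scale (representation B v d) b0" .
    show "\<mu> d (\<theta> v b) = scale (representation B v d) (\<theta> b0 b)" if "b \<in> B" for b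
      using \<theta>[OF \<open>v \<in> V\<close>] \<theta>[OF b0V] mv linearD(3)[OF linA[of "\<mu> d"]] \<mu>[OF \<open>d \<in> B\<close>] that by (cases "b = b0") auto
  qed (use \<theta> \<mu> that b0V in \<open>auto simp: A_def intro: op_alg.scale op_alg_comp\<close>)
  \<comment> \<open>an idempotent that projects \<open>W\<close> onto the multiplicity space\<close>
  define e where "e = \<theta> b0"
  have eA: "e \<in> A" using \<theta>[OF b0V] by (simp add: e_def)
  have e_\<mu>: "e w = \<mu> b0 w" if "w \<in> W" for w
  proof (rule key[of e "\<mu> b0"])
    show "e b = \<mu> b0 b" if "b \<in> B" for b
      using \<mu>[OF b0] \<theta>[OF b0V] that by (cases "b = b0") (auto simp: e_def)
  qed (use eA \<mu>[OF b0] that in auto)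
  have e_\<theta>: "e (\<theta> v w) = scale (representation B v b0) (e w)" if "v \<in> V" "w \<in> W" for v w
    using \<mu>_\<theta>[OF b0 that] e_\<mu>[OF AW[OF _ that(2)], of "\<theta> v"] \<theta>[OF that(1)] by (simp add: e_def)
  have ee: "e (e w) = e w" if "w \<in> W" for w
    using e_\<theta>[OF b0V that] representation_basis[OF B(2) b0] by (simp add: e_def)
  define H where "H = e ` W"
  have HW: "H \<subseteq> W" using AW[OF eA] by (auto simp: H_def)
  have eH: "e h = h" if "h \<in> H" for h using that ee by (auto simp: H_def)
  interpret e: Vector_Spaces.linear scale scale e by (rule linA[OF eA])
  have sH: "subspace H" unfolding H_def by (rule e.subspace_image[OF W(1)])
  have fdH: "fin_dim scale H" by (rule fin_dim_mono[OF fdW sH HW])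
  have invH: "\<psi> h \<in> H" if "i \<in> I" "\<psi> \<in> \<Phi> i" "h \<in> H" for i \<psi> h
  proof -
    have "e (\<psi> h) = \<psi> h" using Acomm[OF eA that(1,2)] that(3) HW eH by auto
    moreover have "\<psi> h \<in> W" using invW that HW by blast
    ultimately show ?thesis unfolding H_def by (metis imageI)
  qed
  \<comment> \<open>\<open>\<theta> v u\<close> plays the role of the tensor of \<open>v\<close> and \<open>u\<close>; an invariant part of \<open>H\<close> generates all of \<open>W\<close>\<close>
  have gen: "span {\<theta> v u | v u. v \<in> V \<and> u \<in> U} = W"
    if U: "U \<subseteq> H" "\<And>i \<psi> u. i \<in> I \<Longrightarrow> \<psi> \<in> \<Phi> i \<Longrightarrow> u \<in> U \<Longrightarrow> \<psi> u \<in> U" "u0 \<in> U" "u0 \<noteq> 0" for U u0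
  proof (rule W(4))
    let ?G = "{\<theta> v u | v u. v \<in> V \<and> u \<in> U}"
    have GW: "?G \<subseteq> W" using \<theta> AW U(1) HW by blast
    show "span ?G \<subseteq> W" by (rule span_minimal[OF GW W(1)])
    have "\<theta> b0 u0 = u0" using eH U(1,3) by (auto simp: e_def)
    then show "u0 \<in> span ?G" using b0V U(3) by (intro span_base) (force intro: sym)
    fix \<phi> y assume "\<phi> \<in> (\<Union>i\<in>insert x I. \<Phi> i)" and y: "y \<in> span ?G"
    then obtain i where i: "i \<in> insert x I" "\<phi> \<in> \<Phi> i" by blast
    have "\<phi> g \<in> ?G" if g: "g \<in> ?G" for g
    proof -
      from g obtain v u where vu: "g = \<theta> v u" "v \<in> V" "u \<in> U" by blast
      have uW: "u \<in> W" using vu(3) U(1) HW by blast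
      show ?thesis
      proof (cases "i = x")
        case True
        then have "\<phi> g = \<theta> (\<phi> v) u" using \<theta>_act[OF _ vu(2) uW] i(2) vu(1) by blast
        then show ?thesis using Vx[OF _ vu(2)] i(2) True vu(3) by blast
      next
        case False
        then have iI: "i \<in> I" using i by blast
        have "\<phi> g = \<theta> v (\<phi> u)" using Acomm[OF _ iI i(2) uW] \<theta>[OF vu(2)] vu(1) by metis
        then show ?thesis using vu(2) U(2)[OF iI i(2) vu(3)] by blast
      qed
    qed
    then have "\<phi> ` ?G \<subseteq> span ?G" using span_superset by blast
    moreover have "\<phi> y \<in> span (\<phi> ` ?G)"
    proof -
      interpret \<phi>: Vector_Spaces.linear scale scale \<phi> by (rule lin[OF i])
      show ?thesis using y by (simp add: \<phi>.span_image)
    qed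
    ultimately show "\<phi> y \<in> span ?G" using span_minimal[OF _ subspace_span] by blast
  qed (use that in auto)
  obtain h0 where h0: "h0 \<in> H" "h0 \<noteq> 0"
  proof -
    have "e b0 = b0" using \<theta>[OF b0V] by (simp add: e_def)
    moreover have "b0 \<noteq> 0" using b0 B(2) dependent_zero by blast
    moreover have "b0 \<in> W" using b0V V(2) by blast
    ultimately show ?thesis using that[of b0] unfolding H_def by (metis imageI)
  qed
  have irrH: "irreducible_under (\<Union>i\<in>I. \<Phi> i) H"
    unfolding irreducible_under_def
  proof (intro conjI allI impI)
    show "H \<noteq> {0}" using h0 by blast
    show "invariant (\<Union>i\<in>I. \<Phi> i) H" using invH by (auto simp: invariant_def)
    fix U assume U: "subspace U \<and> U \<subseteq> H \<and> invariant (\<Union>i\<in>I. \<Phi> i) U"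
    have "H \<subseteq> U" if ne: "U \<noteq> {0}"
    proof -
      obtain u0 where u0: "u0 \<in> U" "u0 \<noteq> 0" using ne U subspace_0 by blast
      let ?G = "{\<theta> v u | v u. v \<in> V \<and> u \<in> U}"
      have "span ?G = W" by (rule gen) (use U u0 in \<open>auto simp: invariant_def\<close>)
      then have "H = span (e ` ?G)" by (simp add: H_def e.span_image)
      also have "\<dots> \<subseteq> U"
      proof (rule span_minimal)
        show "e ` ?G \<subseteq> U"
        proof clarify
          fix v u assume "v \<in> V" "u \<in> U"
          then have "e (\<theta> v u) = scale (representation B v b0) u" using e_\<theta>[of v u] eH[of u] U HW by (metis subsetD)
          then show "e (\<theta> v u) \<in> U" using U \<open>u \<in> U\<close> subspace_scale[of U u] by metis
        qed
      qed (use U in simp)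
      finally show ?thesis .
    qed
    then show "U = {0} \<or> U = H" using U by blast
  qed (rule sH)
  have "\<exists>V B t. (\<forall>i\<in>I. irreducible_under (\<Phi> i) (V i) \<and> V i \<subseteq> H \<and> finite (B i) \<and> independent (B i)
        \<and> span (B i) = V i) \<and>
      multilinear_on I scale scale V H t \<and> free_family scale (Pi\<^sub>E I B) t \<and> H \<subseteq> span (t ` Pi\<^sub>E I B) \<and>
      (\<forall>i\<in>I. \<forall>\<phi>\<in>\<Phi> i. \<forall>v\<in>Pi\<^sub>E I V. \<phi> (t v) = t (v(i := \<phi> (v i))))"
    by (rule insert.IH[OF fdH _ _ irrH]) (use lin comm HW in blast)+
  then obtain V' B' t' where IH0: "\<forall>i\<in>I. irreducible_under (\<Phi> i) (V' i) \<and> V' i \<subseteq> H \<and> finite (B' i)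
        \<and> independent (B' i) \<and> span (B' i) = V' i"
      "multilinear_on I scale scale V' H t'" "free_family scale (Pi\<^sub>E I B') t'" "H \<subseteq> span (t' ` Pi\<^sub>E I B')"
      "\<forall>i\<in>I. \<forall>\<phi>\<in>\<Phi> i. \<forall>v\<in>Pi\<^sub>E I V'. \<phi> (t' v) = t' (v(i := \<phi> (v i)))"
    by (elim exE conjE) (rule that)
  note IH = IH0(1)[rule_format] IH0(2-4) IH0(5)[rule_format]
  have xI: "x \<notin> I" by (rule insert.hyps(2))
  define V2 B2 where "V2 = V'(x := V)" and "B2 = B'(x := B)"
  define t where "t = (\<lambda>v. \<theta> (v x) (t' (restrict v I)))"
  have PV: "Pi\<^sub>E I V2 = Pi\<^sub>E I V'" and PB: "Pi\<^sub>E I B2 = Pi\<^sub>E I B'"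
    using xI by (auto intro!: PiE_cong simp: V2_def B2_def split: if_splits)
  have tH: "t' v \<in> H" if "v \<in> Pi\<^sub>E I V'" for v using IH(2) that by (auto simp: multilinear_on_def)
  have split1: "restrict v I \<in> Pi\<^sub>E I V'" if "v \<in> Pi\<^sub>E (insert x I) V2" for v
    using PiE_restrict_insert(1)[OF that] unfolding PV .
  have split2: "v x \<in> V" if "v \<in> Pi\<^sub>E (insert x I) V2" for v
    using PiE_restrict_insert(2)[OF that] by (simp add: V2_def)
  note split = split1 split2
  have upd_x: "restrict (v(x := a)) I = restrict v I" for v and a :: 'b using xI by auto
  have upd_i: "restrict (v(i := a)) I = (restrict v I)(i := a)" if "i \<in> I" for v i and a :: 'b
    using that by auto
  have B'V': "Pi\<^sub>E I B' \<subseteq> Pi\<^sub>E I V'" using IH(1) span_superset by (intro PiE_mono) blast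
  have t_ins: "t (f(x := b)) = \<theta> b (t' f)" if "f \<in> Pi\<^sub>E I B'" for f b
  proof -
    have "restrict (f(x := b)) I = f" unfolding upd_x using that by (auto simp: PiE_def extensional_def restrict_def)
    then show ?thesis by (simp add: t_def)
  qed
  have c1: "\<forall>i\<in>insert x I. irreducible_under (\<Phi> i) (V2 i) \<and> V2 i \<subseteq> W \<and> finite (B2 i) \<and> independent (B2 i)
        \<and> span (B2 i) = V2 i"
  proof
    fix i assume i: "i \<in> insert x I"
    show "irreducible_under (\<Phi> i) (V2 i) \<and> V2 i \<subseteq> W \<and> finite (B2 i) \<and> independent (B2 i)
        \<and> span (B2 i) = V2 i"
    proof (cases "i = x")
      case True
      then show ?thesis using irrV V(2) B by (simp add: V2_def B2_def)
    next
      case False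
      then show ?thesis using IH(1)[of i] i HW by (auto simp: V2_def B2_def)
    qed
  qed
  have c2: "multilinear_on (insert x I) scale scale V2 W t"
    unfolding multilinear_on_def
  proof (intro conjI ballI)
    fix v assume v: "v \<in> Pi\<^sub>E (insert x I) V2"
    note s = split[OF v]
    show "t v \<in> W" using \<theta>[OF s(2)] AW tH[OF s(1)] HW by (auto simp: t_def)
    fix i assume i: "i \<in> insert x I"
    show "linear_on scale scale (V2 i) W (\<lambda>a. t (v(i := a)))"
    proof (cases "i = x")
      case True
      show ?thesis unfolding linear_on_def True t_def upd_x
        using \<theta> AW tH[OF s(1)] HW \<theta>_add \<theta>_scale by (auto simp: V2_def)
    next
      case False
      then have iI: "i \<in> I" using i by blast
      have l: "linear_on scale scale (V' i) H (\<lambda>a. t' ((restrict v I)(i := a)))"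
        using IH(2) s(1) iI by (auto simp: multilinear_on_def)
      have V2i: "V2 i = V' i" using False by (simp add: V2_def)
      have tx: "(v(i := a)) x = v x" for a using False by simp
      show ?thesis unfolding linear_on_def t_def upd_i[OF iI] tx V2i
        using l \<theta>[OF s(2)] AW HW linearD[OF linA[of "\<theta> (v x)"]] by (auto simp: linear_on_def)
    qed
  qed
  \<comment> \<open>\<open>\<mu> d\<close> extracts the component at the basis vector \<open>d\<close> of the factor at \<open>x\<close>\<close>
  have c3: "free_family scale (Pi\<^sub>E (insert x I) B2) t"
    unfolding free_family_def
  proof (intro allI impI ballI)
    fix c F assume c: "(\<Sum>b\<in>Pi\<^sub>E (insert x I) B2. scale (c b) (t b)) = 0" and F: "F \<in> Pi\<^sub>E (insert x I) B2"
    have Fx: "F x \<in> B" using PiE_restrict_insert(2)[OF F] by (simp add: B2_def)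
    have FI: "restrict F I \<in> Pi\<^sub>E I B'" using PiE_restrict_insert(1)[OF F] unfolding PB .
    have c': "(\<Sum>b\<in>B. \<Sum>f\<in>Pi\<^sub>E I B'. scale (c (f(x := b))) (\<theta> b (t' f))) = 0"
      using c unfolding sum_PiE_insert[OF xI] PB by (simp add: B2_def t_ins)
    let ?d = "F x"
    have "\<mu> ?d \<in> A" using \<mu>[OF Fx] by blast
    note lm = linearD[OF linA[OF this]]
    have "0 = \<mu> ?d (\<Sum>b\<in>B. \<Sum>f\<in>Pi\<^sub>E I B'. scale (c (f(x := b))) (\<theta> b (t' f)))"
      unfolding c' by (rule lm(3)[symmetric])
    also have "\<dots> = (\<Sum>b\<in>B. \<Sum>f\<in>Pi\<^sub>E I B'. scale (c (f(x := b))) (\<mu> ?d (\<theta> b (t' f))))"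
      by (simp only: lm(6,2))
    also have "\<dots> = (\<Sum>b\<in>B. if b = ?d then \<Sum>f\<in>Pi\<^sub>E I B'. scale (c (f(x := ?d))) (t' f) else 0)"
    proof (rule sum.cong[OF refl])
      fix b assume b: "b \<in> B"
      have "\<mu> ?d (\<theta> b (t' f)) = (if b = ?d then t' f else 0)" if "f \<in> Pi\<^sub>E I B'" for f
      proof -
        have "t' f \<in> H" using tH that B'V' by blast
        then have "\<mu> ?d (\<theta> b (t' f)) = scale (representation B b ?d) (t' f)"
          using \<mu>_\<theta>[OF Fx, of b "t' f"] b B(4) HW eH by (auto simp: e_def)
        then show ?thesis using representation_basis[OF B(2) b] by simp
      qed
      then show "(\<Sum>f\<in>Pi\<^sub>E I B'. scale (c (f(x := b))) (\<mu> ?d (\<theta> b (t' f)))) =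
         (if b = ?d then \<Sum>f\<in>Pi\<^sub>E I B'. scale (c (f(x := ?d))) (t' f) else 0)"
        by (auto intro!: sum.cong sum.neutral)
    qed
    also have "\<dots> = (\<Sum>f\<in>Pi\<^sub>E I B'. scale (c (f(x := ?d))) (t' f))" using Fx B(1) by simp
    finally have "c ((restrict F I)(x := ?d)) = 0"
      using IH(3) FI unfolding free_family_def by metis
    moreover have "(restrict F I)(x := ?d) = F"
      using F by (auto simp: PiE_def extensional_def restrict_def fun_eq_iff)
    ultimately show "c F = 0" by simp
  qed
  have c4: "W \<subseteq> span (t ` Pi\<^sub>E (insert x I) B2)"
  proof -
    let ?S = "span (t ` Pi\<^sub>E (insert x I) B2)"
    have s1: "\<theta> v (t' f) \<in> ?S" if f: "f \<in> Pi\<^sub>E I B'" and v: "v \<in> span B" for f v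
    proof -
      have t'W: "t' f \<in> W" using tH f B'V' HW by blast
      have "v \<in> V \<and> \<theta> v (t' f) \<in> ?S" using v
    proof (induction v rule: span_induct_alt)
      case base
      have "\<theta> 0 (t' f) = 0"
        using \<theta>_scale[OF b0V t'W, of 0] by simp
      then show ?case using subspace_0[OF V(1)] by (simp add: span_zero)
    next
      case (step c b y)
      have *: "t' f \<in> W" "b \<in> V" "y \<in> V" using t'W step B by auto
      have "\<theta> (scale c b + y) (t' f) = scale c (\<theta> b (t' f)) + \<theta> y (t' f)"
        using \<theta>_add[OF subspace_scale[OF V(1) *(2)] *(3,1)] \<theta>_scale[OF *(2,1)] by simp
      moreover have "\<theta> b (t' f) = t (f(x := b))" using t_ins[OF f] by simp
      moreover have "f(x := b) \<in> Pi\<^sub>E (insert x I) B2"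
        using f step(1) PB by (intro PiE_fun_upd) (auto simp: B2_def)
      ultimately show ?case using step * by (auto intro!: subspace_add[OF V(1)] subspace_scale[OF V(1)] span_add span_scale intro: span_base)
    qed
    then show ?thesis by blast
    qed
    have s2: "\<theta> v h \<in> ?S" if v: "v \<in> V" and h: "h \<in> H" for v h
    proof -
      interpret \<theta>: Vector_Spaces.linear scale scale "\<theta> v" by (rule linA) (use \<theta>[OF v] in blast)
      have "\<theta> v h \<in> span (\<theta> v ` (t' ` Pi\<^sub>E I B'))" using h IH(4) by (auto simp: \<theta>.span_image)
      also have "\<dots> \<subseteq> ?S" by (rule span_minimal) (use s1 v B(3) in auto)
      finally show ?thesis .
    qed
    have "span {\<theta> v u | v u. v \<in> V \<and> u \<in> H} = W" by (rule gen) (use invH h0 in auto)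
    moreover have "span {\<theta> v u | v u. v \<in> V \<and> u \<in> H} \<subseteq> ?S" by (rule span_minimal) (use s2 in auto)
    ultimately show ?thesis by simp
  qed
  have c5: "\<forall>i\<in>insert x I. \<forall>\<phi>\<in>\<Phi> i. \<forall>v\<in>Pi\<^sub>E (insert x I) V2. \<phi> (t v) = t (v(i := \<phi> (v i)))"
  proof (intro ballI)
    fix i \<phi> v assume i: "i \<in> insert x I" "\<phi> \<in> \<Phi> i" and v: "v \<in> Pi\<^sub>E (insert x I) V2"
    note s = split[OF v]
    have tW: "t' (restrict v I) \<in> W" using tH[OF s(1)] HW by blast
    show "\<phi> (t v) = t (v(i := \<phi> (v i)))"
    proof (cases "i = x")
      case True
      then show ?thesis unfolding t_def using \<theta>_act[OF _ s(2) tW] i(2) upd_x by simp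
    next
      case False
      then have iI: "i \<in> I" using i by blast
      have "\<phi> (t v) = \<theta> (v x) (\<phi> (t' (restrict v I)))"
        unfolding t_def using Acomm[OF _ iI i(2) tW, of "\<theta> (v x)"] \<theta>[OF s(2)] by simp
      also have "\<phi> (t' (restrict v I)) = t' ((restrict v I)(i := \<phi> (v i)))"
        using IH(5)[OF iI i(2) s(1)] iI by simp
      finally show ?thesis unfolding t_def upd_i[OF iI] using False by simp
    qed
  qed
  show ?case using c1 c2 c3 c4 c5 by blast
qed

end

section \<open>Tensor products of finite families\<close>

lemma vector_space_fun_scale:
  assumes "vector_space s" shows "vector_space (fun_scale s)"
proof -
  interpret vector_space s by fact
  show ?thesis
    by unfold_locales (auto simp: fun_scale_def plus_fun_def fun_eq_iff scale_right_distrib scale_left_distrib)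
qed

lemma vector_space_seq: "vector_space (seq_scale :: 'k::field \<Rightarrow> _)"
  by (rule vector_space_fun_scale) (unfold_locales, auto simp: algebra_simps)

lemma linear_on_eq_on_span:
  assumes sV: "vector_space sV" and V: "module.subspace sV V" "B \<subseteq> V"
    and f: "linear_on sV sW V W f" and g: "linear_on sV sW V W' g"
    and eq: "\<And>b. b \<in> B \<Longrightarrow> f b = g b" and v: "v \<in> module.span sV B"
    and sW: "vector_space sW"
  shows "f v = g v"
proof -
  interpret lin_space sV using sV by (simp add: lin_space_def)
  interpret w: lin_space sW using sW by (simp add: lin_space_def)
  have fD: "\<And>u v. u \<in> V \<Longrightarrow> v \<in> V \<Longrightarrow> f (u + v) = f u + f v" "\<And>c v. v \<in> V \<Longrightarrow> f (sV c v) = sW c (f v)"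
    using f by (auto simp: linear_on_def)
  have gD: "\<And>u v. u \<in> V \<Longrightarrow> v \<in> V \<Longrightarrow> g (u + v) = g u + g v" "\<And>c v. v \<in> V \<Longrightarrow> g (sV c v) = sW c (g v)"
    using g by (auto simp: linear_on_def)
  note 0 = subspace_0[OF V(1)]
  have "v \<in> V \<and> f v = g v" using v
  proof (induction v rule: span_induct_alt)
    case base
    show ?case using fD(2)[OF 0, of 0] gD(2)[OF 0, of 0] 0 by simp
  next
    case (step c x y)
    then have x: "x \<in> V" and y: "y \<in> V" "f y = g y" using V(2) by auto
    have cx: "sV c x \<in> V" by (rule subspace_scale[OF V(1) x])
    show ?case using fD(1)[OF cx y(1)] gD(1)[OF cx y(1)] fD(2)[OF x] gD(2)[OF x] eq[OF step(1)] y
        subspace_add[OF V(1) cx y(1)] by simp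
  qed
  then show ?thesis by blast
qed

lemma multilinear_onD:
  assumes "multilinear_on I sV sW V W f"
  shows "\<And>v. v \<in> Pi\<^sub>E I V \<Longrightarrow> f v \<in> W"
    "\<And>v i. v \<in> Pi\<^sub>E I V \<Longrightarrow> i \<in> I \<Longrightarrow> linear_on sV sW (V i) W (\<lambda>a. f (v(i := a)))"
  using assms by (auto simp: multilinear_on_def)

lemma multilinear_zero:
  assumes "multilinear_on I sV sW V W f" "vector_space sV" "vector_space sW"
    "v \<in> Pi\<^sub>E I V" "i \<in> I" "v i = 0"
  shows "f v = 0"
proof -
  interpret v: lin_space sV using assms(2) by (simp add: lin_space_def)
  interpret w: lin_space sW using assms(3) by (simp add: lin_space_def)
  have "0 \<in> V i" using assms(4-6) by (metis PiE_mem)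
  then have "f (v(i := sV 0 0)) = sW 0 (f (v(i := 0)))"
    using multilinear_onD(2)[OF assms(1,4,5)] unfolding linear_on_def by blast
  then have "f (v(i := 0)) = 0" by simp
  moreover have "v(i := 0) = v" using assms(6) by auto
  ultimately show ?thesis by simp
qed

text \<open>
  Replace basis vectors by arbitrary vectors in one slot after the other.
\<close>

lemma multilinear_eq_on_bases:
  assumes sV: "vector_space sV" and sW: "vector_space sW" and I: "finite I"
    and f: "multilinear_on I sV sW V W f" and g: "multilinear_on I sV sW V W' g"
    and B: "\<And>i. i \<in> I \<Longrightarrow> module.span sV (B i) = V i"
    and eq: "\<And>b. b \<in> Pi\<^sub>E I B \<Longrightarrow> f b = g b" and v: "v \<in> Pi\<^sub>E I V"
  shows "f v = g v"
proof -
  interpret lin_space sV using sV by (simp add: lin_space_def)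
  have BV: "B i \<subseteq> V i" if "i \<in> I" for i using B[OF that] span_superset by blast
  have sub: "subspace (V i)" if "i \<in> I" for i using B[OF that] subspace_span by metis
  have "f v = g v" if "finite J" "J \<subseteq> I" "v \<in> (\<Pi>\<^sub>E i\<in>I. if i \<in> J then V i else B i)" for v J
    using that
  proof (induction J arbitrary: v rule: finite_induct)
    case empty
    then show ?case using eq by simp
  next
    case (insert j J)
    have j: "j \<in> I" using insert.prems(1) by blast
    have vV: "v \<in> Pi\<^sub>E I V" using insert.prems BV by (auto simp: PiE_iff split: if_splits)
    have "f (v(j := a)) = g (v(j := a))" if "a \<in> B j" for a
      using insert.prems j that insert.hyps(2)
      by (intro insert.IH) (auto simp: PiE_iff extensional_def split: if_splits)
    moreover have "v j \<in> span (B j)" using vV j B by auto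
    ultimately have "f (v(j := v j)) = g (v(j := v j))"
      using linear_on_eq_on_span[OF sV sub[OF j] BV[OF j] multilinear_onD(2)[OF f vV j] multilinear_onD(2)[OF g vV j] _ _ sW]
      by blast
    then show ?case by simp
  qed
  from this[OF I subset_refl] show ?thesis using v by (simp cong: PiE_cong)
qed

lemma multilinear_compose:
  assumes "multilinear_on I sV sW V W f" "linear_on sW sU W U h"
  shows "multilinear_on I sV sU V U (\<lambda>v. h (f v))"
proof -
  have "linear_on sV sU (V i) U (\<lambda>a. h (f (v(i := a))))" if "v \<in> Pi\<^sub>E I V" "i \<in> I" for v i
    using multilinear_onD(2)[OF assms(1) that] assms(2) by (auto simp: linear_on_def)
  then show ?thesis using multilinear_onD(1)[OF assms(1)] assms(2)
    unfolding multilinear_on_def linear_on_def by blast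
qed

lemma linear_on_restrict:
  assumes "vector_space sW" "module.subspace sW W" "linear_on sW sU W U h"
  shows "linear_on sW sU W U (restrict h W)"
proof -
  interpret lin_space sW using assms(1) by (simp add: lin_space_def)
  show ?thesis using assms(3) subspace_add[OF assms(2)] subspace_scale[OF assms(2)]
    by (auto simp: linear_on_def)
qed

lemma free_family_inj:
  assumes sW: "vector_space sW" and P: "finite P" and free: "free_family sW P t"
  shows "inj_on t P" "\<not> module.dependent sW (t ` P)"
proof -
  interpret w: lin_space sW using sW by (simp add: lin_space_def)
  show inj: "inj_on t P"
  proof (rule inj_onI, rule ccontr)
    fix b b' assume b: "b \<in> P" "b' \<in> P" "t b = t b'" "b \<noteq> b'"
    let ?c = "\<lambda>x. if x = b then 1 else if x = b' then -1 else 0"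
    have "(\<Sum>x\<in>P. sW (?c x) (t x)) = (\<Sum>x\<in>P. (if x = b then t b else 0) - (if x = b' then t b' else 0))"
      by (rule sum.cong) (use b in auto)
    also have "\<dots> = 0" using b P by (simp add: sum_subtractf)
    finally show False using free b(1) unfolding free_family_def by fastforce
  qed
  show "w.independent (t ` P)"
  proof (rule w.independent_if_scalars_zero)
    fix f y assume "(\<Sum>x\<in>t ` P. sW (f x) x) = 0" "y \<in> t ` P"
    then show "f y = 0" using free unfolding free_family_def sum.reindex[OF inj]
      by (auto dest: spec[of _ "\<lambda>b. f (t b)"])
  qed (use P in simp)
qed

text \<open>
  A multilinear map is a tensor product as soon as it sends the product of bases to a basis: a
  multilinear map is determined by its values there, and a linear map may be prescribed there.
\<close>

lemma tensor_product_of_basis: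
  fixes sV :: "'k::field \<Rightarrow> 'v::ab_group_add \<Rightarrow> 'v" and sW :: "'k \<Rightarrow> 'w::ab_group_add \<Rightarrow> 'w"
  assumes sV: "vector_space sV" and sW: "vector_space sW" and I: "finite I"
    and B: "\<And>i. i \<in> I \<Longrightarrow> finite (B i)" "\<And>i. i \<in> I \<Longrightarrow> module.span sV (B i) = V i"
    and t: "multilinear_on I sV sW V W t" and W: "module.subspace sW W"
    and free: "free_family sW (Pi\<^sub>E I B) t" and span: "W \<subseteq> module.span sW (t ` Pi\<^sub>E I B)"
  shows "is_tensor_product I sV sW V W t"
  unfolding is_tensor_product_def
proof (intro conjI t allI impI)
  interpret v: lin_space sV using sV by (simp add: lin_space_def)
  interpret w: lin_space sW using sW by (simp add: lin_space_def)
  let ?P = "Pi\<^sub>E I B"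
  have finP: "finite ?P" using I B(1) by (rule finite_PiE)
  have BV: "B i \<subseteq> V i" if "i \<in> I" for i using B(2)[OF that] v.span_superset by blast
  have PV: "?P \<subseteq> Pi\<^sub>E I V" using BV by (rule PiE_mono)
  note inj = free_family_inj(1)[OF sW finP free] and ind = free_family_inj(2)[OF sW finP free]
  interpret vp: vector_space_pair sW seq_scale
    using sW vector_space_seq by (simp add: vector_space_pair_def)
  fix f :: "('a \<Rightarrow> 'v) \<Rightarrow> 'k seq" assume f: "multilinear_on I sV seq_scale V UNIV f"
  obtain h0 where h0: "Vector_Spaces.linear sW seq_scale h0" "\<And>y. y \<in> t ` ?P \<Longrightarrow> h0 y = f (inv_into ?P t y)"
    using vp.linear_independent_extend[OF ind, of "\<lambda>y. f (inv_into ?P t y)"] by blast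
  have h0_lin: "linear_on sW seq_scale W UNIV h0"
    using h0(1) by (auto simp: linear_on_def Vector_Spaces.linear_iff)
  define h where "h = restrict h0 W"
  have h_lin: "linear_on sW seq_scale W UNIV h" unfolding h_def by (rule linear_on_restrict[OF sW W h0_lin])
  have ht: "h (t v) = f v" if "v \<in> Pi\<^sub>E I V" for v
  proof (rule multilinear_eq_on_bases[OF sV vector_space_seq I multilinear_compose[OF t h_lin] f B(2) _ that])
    fix b assume b: "b \<in> ?P"
    then have "t b \<in> W" using PV multilinear_onD(1)[OF t] by blast
    then show "h (t b) = f b" using h0(2)[of "t b"] inv_into_f_f[OF inj b] b by (simp add: h_def)
  qed
  show "\<exists>!h. h \<in> extensional W \<and> linear_on sW seq_scale W (UNIV :: 'k seq set) h \<and>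
              (\<forall>v\<in>Pi\<^sub>E I V. h (t v) = f v)"
  proof (rule ex1I[of _ h])
    show "h \<in> extensional W \<and> linear_on sW seq_scale W UNIV h \<and> (\<forall>v\<in>Pi\<^sub>E I V. h (t v) = f v)"
      using h_lin ht by (auto simp: h_def)
    fix h' assume h': "h' \<in> extensional W \<and> linear_on sW seq_scale W UNIV h' \<and> (\<forall>v\<in>Pi\<^sub>E I V. h' (t v) = f v)"
    have "h' w = h w" if "w \<in> W" for w
    proof (rule linear_on_eq_on_span[OF sW W _ _ h_lin _ _ vector_space_seq])
      show "t ` ?P \<subseteq> W" using PV multilinear_onD(1)[OF t] by blast
      show "h' b = h b" if "b \<in> t ` ?P" for b using that h' ht PV by auto
    qed (use h' span that in auto)
    then show "h' = h" using h' by (auto simp: h_def extensional_def fun_eq_iff)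
  qed
qed

lemma tensor_hom_exists:
  assumes "is_tensor_product I sV sW V W t" "multilinear_on I sV seq_scale V UNIV f"
  obtains h where "linear_on sW seq_scale W UNIV h" "\<And>v. v \<in> Pi\<^sub>E I V \<Longrightarrow> h (t v) = f v"
  using assms unfolding is_tensor_product_def by metis

lemma tensor_hom_unique:
  assumes sW: "vector_space sW" and W: "module.subspace sW W" and t: "is_tensor_product I sV sW V W t"
    and h: "linear_on sW seq_scale W UNIV h" "linear_on sW seq_scale W UNIV h'"
    and eq: "\<And>v. v \<in> Pi\<^sub>E I V \<Longrightarrow> h (t v) = h' (t v)" and w: "w \<in> W"
  shows "h w = h' w"
proof -
  have m: "multilinear_on I sV sW V W t" using t by (simp add: is_tensor_product_def)
  have "multilinear_on I sV seq_scale V UNIV (\<lambda>v. h (t v))" by (rule multilinear_compose[OF m h(1)])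
  then have "\<exists>!g. g \<in> extensional W \<and> linear_on sW seq_scale W UNIV g \<and> (\<forall>v\<in>Pi\<^sub>E I V. g (t v) = h (t v))"
    using t unfolding is_tensor_product_def by blast
  moreover have "restrict g W \<in> extensional W \<and> linear_on sW seq_scale W UNIV (restrict g W)
    \<and> (\<forall>v\<in>Pi\<^sub>E I V. restrict g W (t v) = h (t v))"
    if "linear_on sW seq_scale W UNIV g" "\<And>v. v \<in> Pi\<^sub>E I V \<Longrightarrow> g (t v) = h (t v)" for g
    using linear_on_restrict[OF sW W that(1)] that(2) multilinear_onD(1)[OF m] by auto
  ultimately have "restrict h W = restrict h' W" using h eq by metis
  then show ?thesis using w by (metis restrict_apply')
qed

lemma multilinear_reindex:
  assumes pq: "\<And>i. i \<in> I \<Longrightarrow> p i \<in> J \<and> q (p i) = i" "\<And>j. j \<in> J \<Longrightarrow> q j \<in> I \<and> p (q j) = j"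
    and T: "\<And>j. j \<in> J \<Longrightarrow> linear_on sU sV (U j) (V (q j)) (T j)"
    and f: "multilinear_on I sV sW V W f"
  shows "multilinear_on J sU sW U W (\<lambda>u. f (\<lambda>i\<in>I. T (p i) (u (p i))))"
  unfolding multilinear_on_def
proof (intro conjI ballI)
  fix u assume u: "u \<in> Pi\<^sub>E J U"
  let ?m = "\<lambda>u. \<lambda>i\<in>I. T (p i) (u (p i))"
  have m: "?m u \<in> Pi\<^sub>E I V"
  proof (rule PiE_I)
    fix i assume i: "i \<in> I"
    then have "u (p i) \<in> U (p i)" using u pq(1) by blast
    then show "?m u i \<in> V i" using T[of "p i"] pq(1)[OF i] i by (auto simp: linear_on_def)
  qed auto
  show "f (?m u) \<in> W" by (rule multilinear_onD(1)[OF f m])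
  fix j assume j: "j \<in> J"
  have upd: "?m (u(j := a)) = (?m u)(q j := T j a)" for a
  proof
    fix i
    have "i \<in> I \<Longrightarrow> p i = j \<longleftrightarrow> i = q j" using pq j by metis
    then show "?m (u(j := a)) i = ((?m u)(q j := T j a)) i" using pq(2)[OF j] by (auto simp: restrict_def)
  qed
  have "linear_on sV sW (V (q j)) W (\<lambda>a. f ((?m u)(q j := a)))"
    using multilinear_onD(2)[OF f m] pq(2)[OF j] by blast
  then show "linear_on sU sW (U j) W (\<lambda>a. f (?m (u(j := a))))"
    unfolding upd using T[OF j] by (auto simp: linear_on_def)
qed

text \<open>
  A tensor product may be transported along a bijection of index sets and isomorphisms of the
  factors; it is used for moving points along orbits and for passing to spaces of sequences.
\<close>

lemma tensor_product_reindex: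
  assumes pq: "\<And>i. i \<in> I \<Longrightarrow> p i \<in> J \<and> q (p i) = i" "\<And>j. j \<in> J \<Longrightarrow> q j \<in> I \<and> p (q j) = j"
    and T: "\<And>i. i \<in> I \<Longrightarrow> linear_on sV sU (V i) (U (p i)) (T i)"
    and T': "\<And>j. j \<in> J \<Longrightarrow> linear_on sU sV (U j) (V (q j)) (T' j)"
    and TT': "\<And>i v. i \<in> I \<Longrightarrow> v \<in> V i \<Longrightarrow> T' (p i) (T i v) = v"
      "\<And>j u. j \<in> J \<Longrightarrow> u \<in> U j \<Longrightarrow> T (q j) (T' j u) = u"
    and t: "is_tensor_product I sV sW V W t"
  shows "is_tensor_product J sU sW U W (\<lambda>u. t (\<lambda>i\<in>I. T' (p i) (u (p i))))"
  unfolding is_tensor_product_def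
proof (intro conjI allI impI)
  let ?m = "\<lambda>u. \<lambda>i\<in>I. T' (p i) (u (p i))" and ?r = "\<lambda>v. \<lambda>j\<in>J. T (q j) (v (q j))"
  have tm: "multilinear_on I sV sW V W t" using t by (simp add: is_tensor_product_def)
  show "multilinear_on J sU sW U W (\<lambda>u. t (?m u))"
    by (rule multilinear_reindex[OF pq T' tm])
  fix f assume f: "multilinear_on J sU seq_scale U UNIV f"
  have T2: "linear_on sV sU (V i) (U (p i)) (T i)" if "i \<in> I" for i by (rule T[OF that])
  have fr: "multilinear_on I sV seq_scale V UNIV (\<lambda>v. f (?r v))"
    by (rule multilinear_reindex[OF pq(2,1) T f])
  have m: "?m u \<in> Pi\<^sub>E I V" if u: "u \<in> Pi\<^sub>E J U" for u
  proof (rule PiE_I)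
    fix i assume i: "i \<in> I"
    then have "u (p i) \<in> U (p i)" using u pq(1) by blast
    then show "?m u i \<in> V i" using T'[of "p i"] pq(1)[OF i] i by (auto simp: linear_on_def)
  qed auto
  have r: "?r v \<in> Pi\<^sub>E J U" if v: "v \<in> Pi\<^sub>E I V" for v
  proof (rule PiE_I)
    fix j assume j: "j \<in> J"
    then have "v (q j) \<in> V (q j)" using v pq(2) by blast
    then show "?r v j \<in> U j" using T[of "q j"] pq(2)[OF j] j by (auto simp: linear_on_def)
  qed auto
  have rm: "?r (?m u) = u" if u: "u \<in> Pi\<^sub>E J U" for u
  proof
    fix j show "?r (?m u) j = u j"
      using u pq(2)[of j] TT'(2)[of j "u j"] by (cases "j \<in> J") (auto simp: PiE_iff extensional_def)
  qed
  have mr: "?m (?r v) = v" if v: "v \<in> Pi\<^sub>E I V" for v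
  proof
    fix i show "?m (?r v) i = v i"
      using v pq(1)[of i] TT'(1)[of i "v i"] by (cases "i \<in> I") (auto simp: PiE_iff extensional_def)
  qed
  have eq: "(\<forall>v\<in>Pi\<^sub>E I V. h (t v) = f (?r v)) \<longleftrightarrow> (\<forall>u\<in>Pi\<^sub>E J U. h (t (?m u)) = f u)" for h
  proof (intro iffI ballI)
    fix u assume *: "\<forall>v\<in>Pi\<^sub>E I V. h (t v) = f (?r v)" and u: "u \<in> Pi\<^sub>E J U"
    show "h (t (?m u)) = f u" using bspec[OF * m[OF u]] unfolding rm[OF u] .
  next
    fix v assume *: "\<forall>u\<in>Pi\<^sub>E J U. h (t (?m u)) = f u" and v: "v \<in> Pi\<^sub>E I V"
    show "h (t v) = f (?r v)" using bspec[OF * r[OF v]] unfolding mr[OF v] .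
  qed
  have "\<exists>!h. h \<in> extensional W \<and> linear_on sW seq_scale W UNIV h \<and> (\<forall>v\<in>Pi\<^sub>E I V. h (t v) = f (?r v))"
    using t fr unfolding is_tensor_product_def by blast
  then show "\<exists>!h. h \<in> extensional W \<and> linear_on sW seq_scale W UNIV h \<and>
              (\<forall>v\<in>Pi\<^sub>E J U. h (t (?m v)) = f v)"
    unfolding eq .
qed

text \<open>
  If all pure tensors were zero, the identity and the zero map would be two extensions of the same
  multilinear map.
\<close>

lemma tensor_product_nonzero:
  fixes sV :: "'k::field \<Rightarrow> 'v::ab_group_add \<Rightarrow> 'v"
  assumes t: "is_tensor_product I sV seq_scale V W t" and W: "module.subspace seq_scale W" "W \<noteq> {0}"
  obtains v where "v \<in> Pi\<^sub>E I V" "t v \<noteq> 0"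
proof -
  interpret s: lin_space "seq_scale :: 'k \<Rightarrow> _" using vector_space_seq by (simp add: lin_space_def)
  obtain w where w: "w \<in> W" "w \<noteq> 0" using W s.subspace_0 by blast
  have "\<exists>v\<in>Pi\<^sub>E I V. t v \<noteq> 0"
  proof (rule ccontr)
    assume "\<not> ?thesis"
    then have 0: "t v = 0" if "v \<in> Pi\<^sub>E I V" for v using that by blast
    have "seq_linear_on W (UNIV :: 'k seq set) (\<lambda>v. v)"
      "seq_linear_on W (UNIV :: 'k seq set) (\<lambda>v. 0)"
      by (auto simp: linear_on_def)
    from tensor_hom_unique[OF vector_space_seq W(1) t this 0 w(1)] have "w = 0" by (simp add: zero_fun_def)
    then show False using w by simp
  qed
  then show ?thesis using that by blast
qed

lemma span_image_combination:
  assumes "vector_space s" "finite P" "w \<in> module.span s (t ` P)"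
  obtains c where "w = (\<Sum>b\<in>P. s (c b) (t b))"
proof -
  interpret lin_space s using assms(1) by (simp add: lin_space_def)
  have "\<exists>c. w = (\<Sum>b\<in>P. s (c b) (t b))" using assms(3)
  proof (induction w rule: span_induct_alt)
    case base
    show ?case by (rule exI[of _ "\<lambda>_. 0"]) simp
  next
    case (step r x y)
    then obtain b c where b: "b \<in> P" "x = t b" and c: "y = (\<Sum>b\<in>P. s (c b) (t b))" by blast
    have "s r x = (\<Sum>b'\<in>P. s (if b' = b then r else 0) (t b'))"
      using assms(2) b by (simp add: if_distrib[of "\<lambda>r. s r _"] cong: if_cong)
    then have "s r x + y = (\<Sum>b'\<in>P. s ((if b' = b then r else 0) + c b') (t b'))"
      by (simp only: c scale_left_distrib sum.distrib)
    then show ?case by (rule exI[of _ "\<lambda>b'. (if b' = b then r else 0) + c b'"])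
  qed
  then show ?thesis using that by blast
qed

text \<open>
  The model is the space of functions on the product of the bases, enumerated by natural numbers; a
  pure tensor is the product of the coordinates of its factors.
\<close>

lemma tensor_exists:
  fixes sV :: "'k::field \<Rightarrow> 'v::ab_group_add \<Rightarrow> 'v"
  assumes sV: "vector_space sV" and I: "finite I"
    and B: "\<And>i. i \<in> I \<Longrightarrow> finite (B i)" "\<And>i. i \<in> I \<Longrightarrow> \<not> module.dependent sV (B i)"
      "\<And>i. i \<in> I \<Longrightarrow> module.span sV (B i) = V i"
  obtains W :: "'k seq set" and t where "fin_dim seq_scale W" "multilinear_on I sV seq_scale V W t"
    "free_family seq_scale (Pi\<^sub>E I B) t" "W = module.span seq_scale (t ` Pi\<^sub>E I B)"
proof -
  interpret v: lin_space sV using sV by (simp add: lin_space_def)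
  interpret s: lin_space "seq_scale :: 'k \<Rightarrow> _" using vector_space_seq by (simp add: lin_space_def)
  let ?P = "Pi\<^sub>E I B"
  have finP: "finite ?P" using I B(1) by (rule finite_PiE)
  obtain g where g: "bij_betw g {0..<card ?P} ?P" using ex_bij_betw_nat_finite[OF finP] by blast
  define co where "co = (\<lambda>v b. \<Prod>i\<in>I. v.representation (B i) (v i) (b i))"
  define t where "t = (\<lambda>v j. if j < card ?P then co v (g j) else 0)"
  define W where "W = s.span (t ` ?P)"
  have gP: "g j \<in> ?P" if "j < card ?P" for j using g that by (auto simp: bij_betw_def)
  have co_basis: "co b b' = (if b = b' then 1 else 0)" if b: "b \<in> ?P" "b' \<in> ?P" for b b'
  proof (cases "b = b'")
    case True
    have "v.representation (B i) (b i) (b i) = 1" if "i \<in> I" for i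
      using v.representation_basis[OF B(2)[OF that]] b(1) that by (metis PiE_mem)
    then show ?thesis using True by (simp add: co_def)
  next
    case False
    then obtain i where i: "i \<in> I" "b i \<noteq> b' i" using b by (metis PiE_ext)
    have "v.representation (B i) (b i) (b' i) = 0"
      using v.representation_basis[OF B(2)[OF i(1)]] b(1) i by (metis PiE_mem)
    then show ?thesis using False i I by (auto simp: co_def)
  qed
  have t_sum: "(\<Sum>b\<in>?P. seq_scale (c b) (t b)) = (\<lambda>j. if j < card ?P then c (g j) else 0)" for c
  proof
    fix j
    have "(\<Sum>b\<in>?P. seq_scale (c b) (t b)) j = (\<Sum>b\<in>?P. c b * t b j)" by (simp add: sum_fun_apply fun_scale_def)
    also have "\<dots> = (if j < card ?P then c (g j) else 0)"
    proof (cases "j < card ?P")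
      case True
      have "(\<Sum>b\<in>?P. c b * t b j) = (\<Sum>b\<in>?P. if b = g j then c (g j) else 0)"
        by (rule sum.cong) (use co_basis gP[OF True] True in \<open>auto simp: t_def\<close>)
      then show ?thesis using finP gP[OF True] True by simp
    qed (simp add: t_def)
    finally show "(\<Sum>b\<in>?P. seq_scale (c b) (t b)) j = (if j < card ?P then c (g j) else 0)" .
  qed
  have free: "free_family seq_scale ?P t"
    unfolding free_family_def
  proof (intro allI impI ballI)
    fix c b assume 0: "(\<Sum>b\<in>?P. seq_scale (c b) (t b)) = 0" and b: "b \<in> ?P"
    have "b \<in> g ` {0..<card ?P}" using g b by (simp add: bij_betw_def)
    then obtain j where j: "j < card ?P" "b = g j" by auto
    show "c b = 0" using fun_cong[OF 0[unfolded t_sum], of j] j by simp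
  qed
  have tW: "t v \<in> W" for v
  proof -
    have "t v = (\<Sum>b\<in>?P. seq_scale (co v b) (t b))" unfolding t_sum by (simp add: t_def)
    also have "\<dots> \<in> W" unfolding W_def by (intro s.span_sum s.span_scale s.span_base imageI)
    finally show ?thesis .
  qed
  have co_upd: "co (v(i := a)) b = v.representation (B i) a (b i) * (\<Prod>i'\<in>I - {i}. v.representation (B i') (v i') (b i'))"
    if "i \<in> I" for v i a b
    unfolding co_def using prod.remove[OF I that, of "\<lambda>i'. v.representation (B i') ((v(i := a)) i') (b i')"] by simp
  have "multilinear_on I sV seq_scale V W t"
    unfolding multilinear_on_def
  proof (intro conjI ballI tW)
    fix v i assume i: "i \<in> I"
    show "linear_on sV seq_scale (V i) W (\<lambda>a. t (v(i := a)))"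
      unfolding linear_on_def
    proof (intro conjI ballI allI tW)
      show "t (v(i := a + b)) = t (v(i := a)) + t (v(i := b))" if "a \<in> V i" "b \<in> V i" for a b
      proof -
        have "v.representation (B i) (a + b) x = v.representation (B i) a x + v.representation (B i) b x" for x
          using v.representation_add[OF B(2)[OF i], of b a] that B(3)[OF i] by simp
        then show ?thesis by (auto simp: t_def co_upd[OF i] fun_eq_iff distrib_right)
      qed
      show "t (v(i := sV c a)) = seq_scale c (t (v(i := a)))" if "a \<in> V i" for a c
      proof -
        have "v.representation (B i) (sV c a) x = c * v.representation (B i) a x" for x
          using v.representation_scale[OF B(2)[OF i], of a c] that B(3)[OF i] by simp
        then show ?thesis by (auto simp: t_def co_upd[OF i] fun_eq_iff fun_scale_def)
      qed
    qed
  qed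
  moreover have "fin_dim seq_scale W" unfolding W_def fin_dim_def using finP by blast
  ultimately show ?thesis using that free W_def by blast
qed

lemma multilinear_single_site:
  assumes t: "multilinear_on I sV sW V W t" and i: "i \<in> I" and A: "linear_on sV sV (V i) (V i) A"
  shows "multilinear_on I sV sW V W (\<lambda>v. t (v(i := A (v i))))"
  unfolding multilinear_on_def
proof (intro conjI ballI)
  fix v assume v: "v \<in> Pi\<^sub>E I V"
  have "A (v i) \<in> V i" using A v i by (auto simp: linear_on_def)
  then have v': "v(i := A (v i)) \<in> Pi\<^sub>E I V" using v i by (auto simp: PiE_iff extensional_def)
  then show "t (v(i := A (v i))) \<in> W" by (rule multilinear_onD(1)[OF t])
  fix k assume k: "k \<in> I"
  show "linear_on sV sW (V k) W (\<lambda>a. t ((v(k := a))(i := A ((v(k := a)) i))))"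
  proof (cases "k = i")
    case True
    then show ?thesis using multilinear_onD(2)[OF t v i] A by (simp add: linear_on_def)
  next
    case False
    then have "(v(k := a))(i := A ((v(k := a)) i)) = (v(i := A (v i)))(k := a)" for a by auto
    then show ?thesis using multilinear_onD(2)[OF t v' k] by simp
  qed
qed

lemma multilinear_sum:
  assumes sW: "vector_space sW" and W: "module.subspace sW W"
    and f: "\<And>k. k \<in> K \<Longrightarrow> multilinear_on I sV sW V W (f k)"
  shows "multilinear_on I sV sW V W (\<lambda>v. \<Sum>k\<in>K. f k v)"
proof -
  interpret lin_space sW using sW by (simp add: lin_space_def)
  have "linear_on sV sW (V i) W (\<lambda>a. \<Sum>k\<in>K. f k (v(i := a)))" if "v \<in> Pi\<^sub>E I V" "i \<in> I" for v i
    unfolding linear_on_def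
  proof (intro conjI ballI allI)
    note l = multilinear_onD(2)[OF f that, unfolded linear_on_def]
    show "(\<Sum>k\<in>K. f k (v(i := a))) \<in> W" if "a \<in> V i" for a
      by (rule subspace_sum[OF W]) (use l that in blast)
    show "(\<Sum>k\<in>K. f k (v(i := a + b))) = (\<Sum>k\<in>K. f k (v(i := a))) + (\<Sum>k\<in>K. f k (v(i := b)))"
      if "a \<in> V i" "b \<in> V i" for a b
      unfolding sum.distrib[symmetric] by (rule sum.cong) (use l that in auto)
    show "(\<Sum>k\<in>K. f k (v(i := sV c a))) = sW c (\<Sum>k\<in>K. f k (v(i := a)))" if "a \<in> V i" for a c
      unfolding scale_sum_right by (rule sum.cong) (use l that in auto)
  qed
  moreover have "(\<Sum>k\<in>K. f k v) \<in> W" if "v \<in> Pi\<^sub>E I V" for v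
    by (rule subspace_sum[OF W]) (rule multilinear_onD(1)[OF f that])
  ultimately show ?thesis unfolding multilinear_on_def by blast
qed

context alg_closed_space
begin

text \<open>
  Operators of the algebra at one site act on the tensor product through that site.  The coordinate
  projections provided by density reduce a nonzero element of \<open>U\<close> to a single basis tensor, and moving
  its factors one by one then produces every other basis tensor.
\<close>

lemma tensor_irreducible:
  fixes sW :: "'a \<Rightarrow> 'w::ab_group_add \<Rightarrow> 'w" and \<Phi> :: "'i \<Rightarrow> ('b \<Rightarrow> 'b) set"
  assumes sW: "vector_space sW" and I: "finite I"
    and B: "\<And>i. i \<in> I \<Longrightarrow> finite (B i)" "\<And>i. i \<in> I \<Longrightarrow> independent (B i)" "\<And>i. i \<in> I \<Longrightarrow> span (B i) = V i"
    and irr: "\<And>i. i \<in> I \<Longrightarrow> irreducible_under (\<Phi> i) (V i)"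
    and lin: "\<And>i \<phi>. i \<in> I \<Longrightarrow> \<phi> \<in> \<Phi> i \<Longrightarrow> linear_op scale \<phi>"
    and t: "multilinear_on I scale sW V W t" and sub: "module.subspace sW W"
    and W: "W \<subseteq> module.span sW (t ` Pi\<^sub>E I B)"
    and U: "module.subspace sW U" "U \<subseteq> W" "U \<noteq> {0}"
    and lift: "\<And>i \<phi>. i \<in> I \<Longrightarrow> \<phi> \<in> \<Phi> i \<Longrightarrow> \<exists>h. linear_on sW sW W W h \<and>
        (\<forall>v\<in>Pi\<^sub>E I V. h (t v) = t (v(i := \<phi> (v i)))) \<and> (\<forall>u\<in>U. h u \<in> U)"
  shows "U = W"
proof -
  interpret w: lin_space sW using sW by (simp add: lin_space_def)
  let ?P = "Pi\<^sub>E I B"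
  have finP: "finite ?P" using I B(1) by (rule finite_PiE)
  have BV: "B i \<subseteq> V i" if "i \<in> I" for i using B(3)[OF that] span_superset by blast
  have PV: "?P \<subseteq> Pi\<^sub>E I V" using BV by (rule PiE_mono)
  have fdV: "fin_dim scale (V i)" if "i \<in> I" for i using B(1,3)[OF that] by (auto simp: fin_dim_def)
  have sV: "vector_space scale" by (rule vector_space_axioms)
  have lift_alg: "\<exists>h. linear_on sW sW W W h \<and> (\<forall>v\<in>Pi\<^sub>E I V. h (t v) = t (v(i := a (v i)))) \<and> (\<forall>u\<in>U. h u \<in> U)"
    if i: "i \<in> I" and a: "a \<in> op_alg (\<Phi> i)" for i a
    using a
  proof induction
    case ident
    show ?case by (rule exI[of _ "\<lambda>w. w"]) (auto simp: linear_on_def)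
  next
    case (comp \<phi> a)
    obtain h where h: "linear_on sW sW W W h" "\<forall>v\<in>Pi\<^sub>E I V. h (t v) = t (v(i := a (v i)))" "\<forall>u\<in>U. h u \<in> U"
      using comp.IH by blast
    obtain k where k: "linear_on sW sW W W k" "\<forall>v\<in>Pi\<^sub>E I V. k (t v) = t (v(i := \<phi> (v i)))" "\<forall>u\<in>U. k u \<in> U"
      using lift[OF i comp.hyps(1)] by blast
    have "k (h (t v)) = t (v(i := \<phi> (a (v i))))" if v: "v \<in> Pi\<^sub>E I V" for v
    proof -
      have "a (v i) \<in> V i"
        using op_alg_invariant[OF comp.hyps(2) irreducible_underD(1)[OF irr[OF i]] irreducible_under_invariant[OF irr[OF i]]] v i
        by blast
      then have "v(i := a (v i)) \<in> Pi\<^sub>E I V" using v i by (auto simp: PiE_iff extensional_def)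
      from bspec[OF k(2) this] show ?thesis using h(2) v by simp
    qed
    moreover have "linear_on sW sW W W (\<lambda>w. k (h w))" using h(1) k(1) by (auto simp: linear_on_def)
    ultimately show ?case using h(3) k(3) by (intro exI[of _ "\<lambda>w. k (h w)"]) blast
  next
    case (add a b)
    obtain h where h: "linear_on sW sW W W h" "\<forall>v\<in>Pi\<^sub>E I V. h (t v) = t (v(i := a (v i)))" "\<forall>u\<in>U. h u \<in> U"
      using add.IH(1) by blast
    obtain k where k: "linear_on sW sW W W k" "\<forall>v\<in>Pi\<^sub>E I V. k (t v) = t (v(i := b (v i)))" "\<forall>u\<in>U. k u \<in> U"
      using add.IH(2) by blast
    have "h (t v) + k (t v) = t (v(i := a (v i) + b (v i)))" if v: "v \<in> Pi\<^sub>E I V" for v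
    proof -
      note inv = op_alg_invariant[OF _ irreducible_underD(1)[OF irr[OF i]] irreducible_under_invariant[OF irr[OF i]]]
      have "a (v i) \<in> V i" "b (v i) \<in> V i"
        using inv[OF add.hyps(1)] inv[OF add.hyps(2)] v i by blast+
      then show ?thesis using h(2) k(2) v multilinear_onD(2)[OF t v i] by (simp add: linear_on_def)
    qed
    moreover have "linear_on sW sW W W (\<lambda>w. h w + k w)"
      using h(1) k(1) w.subspace_add[OF sub] by (auto simp: linear_on_def w.scale_right_distrib)
    ultimately show ?case using h(3) k(3) w.subspace_add[OF U(1)] by (intro exI[of _ "\<lambda>w. h w + k w"]) blast
  next
    case (scale a c)
    obtain h where h: "linear_on sW sW W W h" "\<forall>v\<in>Pi\<^sub>E I V. h (t v) = t (v(i := a (v i)))" "\<forall>u\<in>U. h u \<in> U"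
      using scale.IH by blast
    have "sW c (h (t v)) = t (v(i := scale c (a (v i))))" if v: "v \<in> Pi\<^sub>E I V" for v
    proof -
      have "a (v i) \<in> V i"
        using op_alg_invariant[OF scale.hyps irreducible_underD(1)[OF irr[OF i]] irreducible_under_invariant[OF irr[OF i]]] v i
        by blast
      then show ?thesis using h(2) v multilinear_onD(2)[OF t v i] by (simp add: linear_on_def)
    qed
    moreover have "linear_on sW sW W W (\<lambda>w. sW c (h w))"
      using h(1) w.subspace_scale[OF sub] by (auto simp: linear_on_def w.scale_right_distrib mult.commute)
    ultimately show ?case using h(3) w.subspace_scale[OF U(1)] by (intro exI[of _ "\<lambda>w. sW c (h w)"]) blast
  qed
  obtain u where u: "u \<in> U" "u \<noteq> 0" using U(1,3) w.subspace_0 by blast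
  obtain c where c: "u = (\<Sum>b\<in>?P. sW (c b) (t b))"
  proof -
    have "u \<in> module.span sW (t ` ?P)" using W U(2) u(1) by blast
    then show ?thesis by (rule span_image_combination[OF sW finP]) (rule that)
  qed
  have "\<exists>d\<in>?P. c d \<noteq> 0"
  proof (rule ccontr)
    assume "\<not> ?thesis"
    then have "u = 0" unfolding c by (intro sum.neutral) auto
    then show False using u(2) by blast
  qed
  then obtain d where d: "d \<in> ?P" "c d \<noteq> 0" by blast
  have tP: "t b \<in> W" if "b \<in> ?P" for b using multilinear_onD(1)[OF t] PV that by blast
  have hsum: "h (\<Sum>b\<in>Q. sW (r b) (t b)) = (\<Sum>b\<in>Q. sW (r b) (h (t b)))"
    if h: "linear_on sW sW W W h" and Q: "Q \<subseteq> ?P" for h r Q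
  proof -
    have "finite Q" using Q finP finite_subset by blast
    then show ?thesis using Q
    proof (induction Q rule: finite_induct)
      case empty
      have "h (sW 0 0) = sW 0 (h 0)" using h w.subspace_0[OF sub] unfolding linear_on_def by blast
      then show ?case by simp
    next
      case (insert b Q)
      have "(\<Sum>b\<in>Q. sW (r b) (t b)) \<in> W" "sW (r b) (t b) \<in> W"
        using insert.prems tP by (auto intro!: w.subspace_sum[OF sub] w.subspace_scale[OF sub])
      then show ?case using insert h tP by (simp add: linear_on_def)
    qed
  qed
  \<comment> \<open>project to the coordinate \<open>d\<close>, one tensor factor at a time\<close>
  have "(\<Sum>b\<in>{b\<in>?P. \<forall>j\<in>J. b j = d j}. sW (c b) (t b)) \<in> U" if "finite J" "J \<subseteq> I" for J
    using that
  proof (induction J rule: finite_induct)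
    case empty
    then show ?case using u(1) c by simp
  next
    case (insert j J)
    have j: "j \<in> I" using insert.prems by blast
    have dj: "d j \<in> B j" using d(1) j by blast
    have djV: "d j \<in> V j" using dj BV[OF j] by blast
    have "\<exists>a. a \<in> op_alg (\<Phi> j) \<and> a (d j) = d j \<and> (\<forall>b\<in>B j. b \<noteq> d j \<longrightarrow> a b = 0)"
      by (rule density[OF irr[OF j] fdV[OF j] lin[OF j] B(1,2)[OF j] BV[OF j] dj djV]) blast+
    then obtain a where a: "a \<in> op_alg (\<Phi> j)" "a (d j) = d j" "\<And>b. b \<in> B j \<Longrightarrow> b \<noteq> d j \<Longrightarrow> a b = 0" by blast
    obtain h where h: "linear_on sW sW W W h" "\<forall>v\<in>Pi\<^sub>E I V. h (t v) = t (v(j := a (v j)))" "\<forall>u\<in>U. h u \<in> U"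
      using lift_alg[OF j a(1)] by blast
    let ?Q = "{b\<in>?P. \<forall>j\<in>J. b j = d j}"
    have hb: "h (t b) = (if b j = d j then t b else 0)" if b: "b \<in> ?P" for b
    proof (cases "b j = d j")
      case True
      then have "b(j := a (b j)) = b" using a(2) by auto
      then show ?thesis using h(2) b PV True by auto
    next
      case False
      then have "a (b j) = 0" using a(3) b j by blast
      moreover have "b(j := 0) \<in> Pi\<^sub>E I V" using b PV j subspace_0[OF irreducible_underD(1)[OF irr[OF j]]]
        by (auto simp: PiE_iff extensional_def subset_iff)
      ultimately show ?thesis using h(2) b PV False multilinear_zero[OF t sV sW _ j, of "b(j := 0)"] by auto
    qed
    have "h (\<Sum>b\<in>?Q. sW (c b) (t b)) = (\<Sum>b\<in>?Q. if b j = d j then sW (c b) (t b) else 0)"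
      by (subst hsum[OF h(1)]) (auto intro!: sum.cong simp: hb)
    also have "\<dots> = (\<Sum>b\<in>{b\<in>?Q. b j = d j}. sW (c b) (t b))"
      by (rule sum.inter_filter[symmetric]) (use finP in simp)
    also have "{b\<in>?Q. b j = d j} = {b\<in>?P. \<forall>j\<in>insert j J. b j = d j}" by auto
    finally show ?case using h(3) insert by auto
  qed
  from this[OF I subset_refl] have "(\<Sum>b\<in>{b\<in>?P. \<forall>j\<in>I. b j = d j}. sW (c b) (t b)) \<in> U" .
  moreover have "{b\<in>?P. \<forall>j\<in>I. b j = d j} = {d}" using d(1) by (auto intro: PiE_ext)
  ultimately have "sW (c d) (t d) \<in> U" by simp
  then have "sW (inverse (c d)) (sW (c d) (t d)) \<in> U" by (rule w.subspace_scale[OF U(1)])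
  then have tdU: "t d \<in> U" using d(2) by simp
  \<comment> \<open>move from \<open>d\<close> to any other basis tensor, one tensor factor at a time\<close>
  have "t b \<in> U" if b: "b \<in> ?P" for b
  proof -
    have "t (\<lambda>i. if i \<in> J then b i else d i) \<in> U" if "finite J" "J \<subseteq> I" for J
      using that
    proof (induction J rule: finite_induct)
      case empty
      then show ?case using tdU by simp
    next
      case (insert j J)
      have j: "j \<in> I" using insert.prems by blast
      have dj: "d j \<in> B j" using d(1) j by blast
      have bj: "b j \<in> V j" using b j BV[OF j] by blast
      have "\<exists>a. a \<in> op_alg (\<Phi> j) \<and> a (d j) = b j"
        by (rule density[OF irr[OF j] fdV[OF j] lin[OF j] B(1,2)[OF j] BV[OF j] dj bj]) blast+
      then obtain a where a: "a \<in> op_alg (\<Phi> j)" "a (d j) = b j" by blast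
      obtain h where h: "\<forall>v\<in>Pi\<^sub>E I V. h (t v) = t (v(j := a (v j)))" "\<forall>u\<in>U. h u \<in> U"
        using lift_alg[OF j a(1)] by blast
      let ?m = "\<lambda>i. if i \<in> J then b i else d i"
      have "?m \<in> Pi\<^sub>E I V" using b d(1) PV insert.prems by (auto simp: PiE_iff extensional_def subset_iff)
      then have "h (t ?m) = t (?m(j := b j))" using h(1) insert.hyps(2) a(2) by simp
      moreover have "?m(j := b j) = (\<lambda>i. if i \<in> insert j J then b i else d i)" by auto
      ultimately show ?case using h(2) insert by auto
    qed
    from this[OF I subset_refl] have "t (\<lambda>i. if i \<in> I then b i else d i) \<in> U" .
    moreover have "(\<lambda>i. if i \<in> I then b i else d i) = b" using b d(1) by (auto simp: PiE_iff extensional_def)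
    ultimately show ?thesis by simp
  qed
  then have "module.span sW (t ` ?P) \<subseteq> U" by (intro w.span_minimal U(1)) auto
  then show ?thesis using W U(2) by blast
qed

end

section \<open>Roots of unity and interpolation\<close>

lemma primitive_root_inj:
  assumes "primitive_root_of_unity m \<xi>"
  shows "inj_on (\<lambda>j. \<xi> ^ j) {..<m}"
proof (rule linorder_inj_onI)
  fix i j assume ij: "i < j" "j \<in> {..<m}"
  show "\<xi> ^ i \<noteq> \<xi> ^ j"
  proof
    assume eq: "\<xi> ^ i = \<xi> ^ j"
    have "m > 0" using ij by simp
    then have "\<xi> \<noteq> 0" using assms by (auto simp: primitive_root_of_unity_def zero_power)
    moreover have "\<xi> ^ j = \<xi> ^ i * \<xi> ^ (j - i)" using ij by (simp flip: power_add)
    ultimately have "\<xi> ^ (j - i) = 1" using eq by simp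
    moreover have "\<xi> ^ (j - i) \<noteq> 1" using assms ij unfolding primitive_root_of_unity_def by auto
    ultimately show False by simp
  qed
qed auto

lemma root_of_unity_power:
  assumes \<xi>: "primitive_root_of_unity m (\<xi> :: 'k::field)" and m: "m > 0" and w: "w ^ m = 1"
  obtains j where "j < m" "w = \<xi> ^ j"
proof -
  let ?p = "monom 1 m - 1 :: 'k poly"
  have "coeff ?p m = 1" using m by (simp add: coeff_1)
  then have p: "?p \<noteq> 0" by (metis coeff_0 zero_neq_one)
  have deg: "degree ?p \<le> m" by (intro degree_diff_le degree_monom_le) simp
  let ?R = "{x. poly ?p x = 0}" and ?Q = "(\<lambda>j. \<xi> ^ j) ` {..<m}"
  have fR: "finite ?R" by (rule poly_roots_finite[OF p])
  have QR: "?Q \<subseteq> ?R"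
  proof clarify
    fix j
    have "(\<xi> ^ j) ^ m = (\<xi> ^ m) ^ j" by (simp flip: power_mult add: mult.commute)
    then show "poly ?p (\<xi> ^ j) = 0" using \<xi> by (simp add: primitive_root_of_unity_def poly_monom)
  qed
  have "card ?R \<le> m" using card_poly_roots_bound[OF p] deg by linarith
  also have "m = card ?Q" using card_image[OF primitive_root_inj[OF \<xi>]] by simp
  finally have "?Q = ?R" using card_seteq[OF fR QR] by simp
  moreover have "w \<in> ?R" using w by (simp add: poly_monom)
  ultimately show ?thesis using that by blast
qed

lemma card_roots:
  fixes r :: "'k::alg_closed_field"
  assumes \<xi>: "primitive_root_of_unity m (\<xi> :: 'k)" and m: "m > 0" and r: "r \<noteq> 0"
  shows "finite {a. a ^ m = r}" "card {a. a ^ m = r} = m"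
proof -
  obtain a0 where a0: "a0 ^ m = r" using nth_root_exists[OF m] by blast
  have a0': "a0 \<noteq> 0" using a0 r m by auto
  have eq: "{a. a ^ m = r} = (\<lambda>x. a0 * x) ` ((\<lambda>j. \<xi> ^ j) ` {..<m})"
  proof (intro subset_antisym subsetI)
    fix a assume "a \<in> {a. a ^ m = r}"
    then have "(a / a0) ^ m = 1" using a0 r by (simp add: power_divide)
    then obtain j where "j < m" "a / a0 = \<xi> ^ j" using root_of_unity_power[OF \<xi> m] by blast
    then have "a = a0 * \<xi> ^ j" using a0' by (simp add: field_simps)
    then show "a \<in> (\<lambda>x. a0 * x) ` ((\<lambda>j. \<xi> ^ j) ` {..<m})" using \<open>j < m\<close> by blast
  next
    fix a assume "a \<in> (\<lambda>x. a0 * x) ` ((\<lambda>j. \<xi> ^ j) ` {..<m})"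
    then obtain j where "a = a0 * \<xi> ^ j" by blast
    moreover have "(\<xi> ^ j) ^ m = (\<xi> ^ m) ^ j" by (simp flip: power_mult add: mult.commute)
    ultimately show "a \<in> {a. a ^ m = r}" using a0 \<xi> by (simp add: power_mult_distrib primitive_root_of_unity_def)
  qed
  show "finite {a. a ^ m = r}" unfolding eq by simp
  have "inj_on (\<lambda>x. a0 * x) A" for A using a0' by (auto simp: inj_on_def)
  then show "card {a. a ^ m = r} = m"
    unfolding eq using card_image[OF primitive_root_inj[OF \<xi>]] by (subst card_image) auto
qed

definition root_poly :: "'k::field set \<Rightarrow> 'k poly" where
  "root_poly S = (\<Prod>r\<in>S. [:-r, 1:])"

lemma root_poly_degree:
  "finite S \<Longrightarrow> degree (root_poly S) = card S \<and> coeff (root_poly S) (card S) = 1"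
proof (induction S rule: finite_induct)
  case (insert x S)
  have e: "root_poly (insert x S) = [:-x, 1:] * root_poly S"
    using insert.hyps by (simp add: root_poly_def del: mult_pCons_left)
  have "root_poly S \<noteq> 0" using insert.IH by auto
  then have d: "degree (root_poly (insert x S)) = Suc (card S)"
    using insert.IH unfolding e by (subst degree_mult_eq) auto
  moreover have "lead_coeff (root_poly (insert x S)) = 1"
    using insert.IH unfolding e lead_coeff_mult by simp
  ultimately show ?case using insert.hyps unfolding d by simp
qed (simp add: root_poly_def)

lemma poly_root_poly_eq_0: "finite S \<Longrightarrow> poly (root_poly S) x = 0 \<longleftrightarrow> x \<in> S"
  by (auto simp: root_poly_def poly_prod)

text \<open>
  The polynomial \<open>x\<^sup>m - r\<close> with \<open>r \<noteq> 0\<close> has \<open>m\<close> simple roots, permuted by the roots of unity.  Both sides are monic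
  of the same degree, and the right-hand one has distinct roots, all of which are roots of the left one.
\<close>

lemma root_poly_pcompose_power:
  fixes S :: "'k::alg_closed_field set"
  assumes \<xi>: "primitive_root_of_unity m (\<xi> :: 'k)" and m: "m > 0" and S: "finite S" "0 \<notin> S"
  shows "finite {a. a ^ m \<in> S}" "pcompose (root_poly S) (monom 1 m) = root_poly {a. a ^ m \<in> S}"
proof -
  let ?D = "{a. a ^ m \<in> S}"
  have D: "?D = (\<Union>r\<in>S. {a. a ^ m = r})" by auto
  have cr: "finite {a. a ^ m = r}" "card {a. a ^ m = r} = m" if "r \<in> S" for r
    using card_roots[OF \<xi> m, of r] that S(2) by auto
  show fD: "finite ?D" unfolding D using S(1) cr by blast
  have cD: "card ?D = m * card S"
    unfolding D using S(1) cr by (subst card_UN_disjoint) auto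
  have dm: "degree (monom (1::'k) m) = m" "lead_coeff (monom (1::'k) m) = 1" by (simp_all add: degree_monom_eq)
  let ?p = "pcompose (root_poly S) (monom 1 m)"
  have dp: "degree ?p = m * card S" using root_poly_degree[OF S(1)] dm by (simp add: degree_pcompose)
  have "lead_coeff ?p = lead_coeff (root_poly S) * lead_coeff (monom 1 m) ^ degree (root_poly S)"
    by (rule lead_coeff_comp) (use dm m in simp)
  then have "lead_coeff ?p = 1" using root_poly_degree[OF S(1)] dm by simp
  then have lp: "coeff ?p (m * card S) = 1" using dp by simp
  have lq: "coeff (root_poly ?D) (m * card S) = 1" using root_poly_degree[OF fD] cD by simp
  show "?p = root_poly ?D"
  proof (rule poly_eqI_degree_lead_coeff[of _ "m * card S" _ ?D])
    fix z assume "z \<in> ?D"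
    then have "poly ?p z = 0" "poly (root_poly ?D) z = 0"
      using poly_root_poly_eq_0[OF S(1)] poly_root_poly_eq_0[OF fD] by (auto simp: poly_pcompose poly_monom)
    then show "poly ?p z = poly (root_poly ?D) z" by simp
  qed (use lp lq cD dp root_poly_degree[OF fD] in auto)
qed

text \<open>
  The Lagrange basis polynomials: \<open>el a\<close> is a multiple of the product of the factors for the other points.
\<close>

lemma lagrange_idempotents:
  fixes D :: "'k::field set"
  assumes D: "finite D" "D \<noteq> {}"
  obtains el where "(\<Sum>a\<in>D. el a) = 1" "\<And>a. a \<in> D \<Longrightarrow> \<exists>c. [:-a, 1:] * el a = smult c (root_poly D)"
proof -
  define el where "el = (\<lambda>a. smult (inverse (poly (root_poly (D - {a})) a)) (root_poly (D - {a})))"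
  have "(\<Sum>a\<in>D. el a) = 1"
  proof (rule poly_eqI_degree[of D])
    fix x assume x: "x \<in> D"
    have "poly (el a) x = (if a = x then 1 else 0)" if "a \<in> D" for a
      using D(1) x poly_root_poly_eq_0[of "D - {a}" x] poly_root_poly_eq_0[of "D - {a}" a]
      by (auto simp: el_def)
    then have "(\<Sum>a\<in>D. poly (el a) x) = (\<Sum>a\<in>D. if a = x then 1 else 0)" by (intro sum.cong) auto
    then show "poly (\<Sum>a\<in>D. el a) x = poly 1 x" using D(1) x by (simp add: poly_sum)
  next
    have "degree (el a) \<le> card D - 1" if "a \<in> D" for a
      using root_poly_degree[of "D - {a}"] D that by (auto simp: el_def intro: order_trans[OF degree_smult_le])
    then have "degree (\<Sum>a\<in>D. el a) \<le> card D - 1" by (intro degree_sum_le D(1))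
    moreover have "card D > 0" using D by (simp add: card_gt_0_iff)
    ultimately show "degree (\<Sum>a\<in>D. el a) < card D" by linarith
    show "degree (1 :: 'k poly) < card D" using \<open>card D > 0\<close> by simp
  qed
  moreover have "\<exists>c. [:-a, 1:] * el a = smult c (root_poly D)" if "a \<in> D" for a
  proof -
    have "root_poly D = [:-a, 1:] * root_poly (D - {a})"
      unfolding root_poly_def using D(1) that by (simp add: prod.remove del: mult_pCons_left)
    then have "[:-a, 1:] * el a = smult (inverse (poly (root_poly (D - {a})) a)) (root_poly D)"
      by (simp add: el_def del: mult_pCons_left)
    then show ?thesis by blast
  qed
  ultimately show ?thesis using that by blast
qed

text \<open>
  Orthogonality of characters of a cyclic group.
\<close>

lemma sum_powers_root_of_unity:
  fixes w :: "'k::field_char_0"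
  assumes "w ^ m = 1"
  shows "(\<Sum>j\<in>{0..<int m}. w powi j) = (if w = 1 then of_nat m else 0)"
proof -
  have "(\<Sum>j\<in>{0..<int m}. w powi j) = (\<Sum>j<m. w ^ j)"
    by (rule sum.reindex_bij_witness[of _ int nat]) (auto simp: power_int_def)
  also have "\<dots> = (if w = 1 then of_nat m else 0)"
    using geometric_sum[of w m] assms by auto
  finally show ?thesis .
qed

section \<open>The group action\<close>

sublocale multiloop \<subseteq> fd_lie_algebra scale bracket
  by unfold_locales (rule finite_dimensional)

section \<open>Regular maps and averaging\<close>

context multiloop
begin

abbreviation "ginv c \<equiv> inv\<^bsub>\<Gamma>\<^esub> c"
abbreviation "g_rep \<equiv> fd_rep scale bracket UNIV"
abbreviation "M_rep \<equiv> fd_rep M_scale M_bracket M"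
abbreviation "g_class \<equiv> rep_class scale bracket UNIV"
abbreviation "M_class \<equiv> rep_class M_scale M_bracket M"
abbreviation "g_irreps \<equiv> irrep_classes scale bracket UNIV"

lemma carrier_\<Gamma>: "carrier \<Gamma> = (\<Pi>\<^sub>E i\<in>{..<n}. {0..<int (m i)})"
proof -
  have "carrier (integer_mod_group (m i)) = {0..<int (m i)}" if "i \<in> {..<n}" for i
    using m_pos[of i] that by (simp add: carrier_integer_mod_group)
  then show ?thesis unfolding \<Gamma>_def carrier_product_group by (rule PiE_cong)
qed

lemma carrier_\<Gamma>D:
  assumes "c \<in> carrier \<Gamma>"
  shows "i < n \<Longrightarrow> 0 \<le> c i" "i < n \<Longrightarrow> c i < int (m i)" "\<not> i < n \<Longrightarrow> c i = undefined"
proof -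
  have c: "c \<in> (\<Pi>\<^sub>E i\<in>{..<n}. {0..<int (m i)})" using assms by (simp only: carrier_\<Gamma>)
  have "c i \<in> {0..<int (m i)}" if "i < n" using PiE_mem[OF c, of i] that by simp
  then show "i < n \<Longrightarrow> 0 \<le> c i" "i < n \<Longrightarrow> c i < int (m i)" by simp_all
  show "\<not> i < n \<Longrightarrow> c i = undefined" using PiE_arb[OF c, of i] by simp
qed

lemma mult_\<Gamma>: "c \<otimes>\<^bsub>\<Gamma>\<^esub> d = (\<lambda>i\<in>{..<n}. (c i + d i) mod int (m i))"
  by (simp add: \<Gamma>_def)

lemma one_\<Gamma>: "\<one>\<^bsub>\<Gamma>\<^esub> = (\<lambda>i\<in>{..<n}. 0)"
  by (simp add: \<Gamma>_def)

sublocale \<Gamma>: group \<Gamma>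
  unfolding \<Gamma>_def by (rule product_group) simp

lemma finite_\<Gamma>: "finite (carrier \<Gamma>)"
  by (auto simp: carrier_\<Gamma> intro!: finite_PiE)

lemma root_power: "i < n \<Longrightarrow> \<xi> i ^ m i = 1"
  using primitive_root by (auto simp: primitive_root_of_unity_def)

lemma root_nonzero: "i < n \<Longrightarrow> \<xi> i \<noteq> 0"
  using root_power[of i] m_pos[of i] by (auto simp: zero_power)

lemma root_powi_mod: "i < n \<Longrightarrow> \<xi> i powi (a mod int (m i)) = \<xi> i powi a"
proof -
  assume i: "i < n"
  have "\<xi> i powi a = \<xi> i powi (int (m i) * (a div int (m i)) + a mod int (m i))" by simp
  also have "\<dots> = (\<xi> i powi int (m i)) powi (a div int (m i)) * \<xi> i powi (a mod int (m i))"
    using root_nonzero[OF i] by (subst power_int_add) (simp_all only: power_int_mult simp_thms not_False_eq_True)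
  finally show ?thesis using root_power[OF i] by simp
qed

lemma root_powi_eq_1:
  assumes "i < n" "0 \<le> a" "a < int (m i)" "\<xi> i powi a = 1"
  shows "a = 0"
proof (rule ccontr)
  assume "a \<noteq> 0"
  then have "0 < nat a" "nat a < m i" "\<xi> i ^ nat a = 1" using assms by (auto simp: power_int_def)
  then show False using primitive_root[OF assms(1)] by (auto simp: primitive_root_of_unity_def)
qed

lemma X_iff: "z \<in> X \<longleftrightarrow> z \<in> extensional {..<n} \<and> (\<forall>i<n. z i \<noteq> 0)"
  by (auto simp: X_def PiE_iff)

lemma act_X_apply: "i < n \<Longrightarrow> act_X c z i = \<xi> i powi c i * z i"
  by (simp add: act_X_def)

lemma act_X_in: "z \<in> X \<Longrightarrow> act_X c z \<in> X"
  using root_nonzero by (auto simp: X_iff act_X_def)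

lemma act_X_mult: "act_X (c \<otimes>\<^bsub>\<Gamma>\<^esub> d) z = act_X c (act_X d z)"
  using root_nonzero
  by (auto simp: act_X_def fun_eq_iff mult_\<Gamma> root_powi_mod power_int_add)

lemma act_X_one: "z \<in> X \<Longrightarrow> act_X \<one>\<^bsub>\<Gamma>\<^esub> z = z"
  by (auto simp: act_X_def fun_eq_iff one_\<Gamma> X_iff extensional_def)

text \<open>
  The action on the torus is free, since \<open>\<xi>\<^sub>i\<close> has exact order \<open>m\<^sub>i\<close>.
\<close>

lemma act_X_fixed:
  assumes "c \<in> carrier \<Gamma>" "z \<in> X" "act_X c z = z"
  shows "c = \<one>\<^bsub>\<Gamma>\<^esub>"
proof
  fix i
  show "c i = \<one>\<^bsub>\<Gamma>\<^esub> i"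
  proof (cases "i < n")
    case True
    have "\<xi> i powi c i * z i = z i" using fun_cong[OF assms(3), of i] True by (simp add: act_X_apply)
    then have "\<xi> i powi c i = 1" using assms(2) True by (simp add: X_iff)
    then show ?thesis
      using root_powi_eq_1[OF True] carrier_\<Gamma>D(1,2)[OF assms(1) True] True by (simp add: one_\<Gamma>)
  next
    case False
    then show ?thesis using carrier_\<Gamma>D(3)[OF assms(1) False] by (simp add: one_\<Gamma>)
  qed
qed

text \<open>
  Two points with equal coordinates of \<open>t\<^sub>i ^ m\<^sub>i\<close> differ by roots of unity.
\<close>

lemma same_orbitI:
  assumes "x \<in> X" "y \<in> X" "\<And>i. i < n \<Longrightarrow> x i ^ m i = y i ^ m i"
  obtains c where "c \<in> carrier \<Gamma>" "y = act_X c x"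
proof -
  have "\<forall>i\<in>{..<n}. \<exists>j. j < m i \<and> y i = \<xi> i ^ j * x i"
  proof
    fix i assume i: "i \<in> {..<n}"
    have "(y i / x i) ^ m i = 1" using assms i by (simp add: power_divide X_iff)
    then obtain j where "j < m i" "y i / x i = \<xi> i ^ j"
      using root_of_unity_power[OF primitive_root m_pos, of i] i by blast
    then show "\<exists>j. j < m i \<and> y i = \<xi> i ^ j * x i" using assms(1) i by (auto simp: X_iff field_simps)
  qed
  from bchoice[OF this] obtain j where "\<forall>i\<in>{..<n}. j i < m i \<and> y i = \<xi> i ^ j i * x i" ..
  then have j: "\<And>i. i < n \<Longrightarrow> j i < m i \<and> y i = \<xi> i ^ j i * x i" by simp
  let ?c = "\<lambda>i\<in>{..<n}. int (j i)"
  have "?c \<in> carrier \<Gamma>" using j by (auto simp: carrier_\<Gamma>)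
  moreover have "y = act_X ?c x"
    using j assms(2) by (auto simp: act_X_def fun_eq_iff X_iff extensional_def)
  ultimately show ?thesis using that by blast
qed

lemma act_X_power: "i < n \<Longrightarrow> (act_X c z i) ^ m i = z i ^ m i"
proof -
  assume i: "i < n"
  have "(\<xi> i powi c i) ^ m i = (\<xi> i ^ m i) powi c i"
    by (simp add: power_int_power power_int_power' mult.commute)
  then show ?thesis using root_power[OF i] i by (simp add: act_X_apply power_mult_distrib)
qed

subsection \<open>action on g\<close>

lemma funpow_commute2:
  assumes "f \<circ> g = g \<circ> f" shows "(f ^^ k) \<circ> (g ^^ l) = (g ^^ l) \<circ> (f ^^ k)"
proof -
  have "f (g x) = g (f x)" for x using fun_cong[OF assms, of x] by simp
  then have 1: "(f ^^ k) (g x) = g ((f ^^ k) x)" for x by (induction k) auto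
  have "(f ^^ k) ((g ^^ l) x) = (g ^^ l) ((f ^^ k) x)" for x by (induction l) (auto simp: 1)
  then show ?thesis by auto
qed

text \<open>
  \<open>act_g\<close> with exponents that need not be reduced, applied to a part of the indices; with it the action
  law can be proved by induction on the list of indices.
\<close>

definition gact :: "(nat \<Rightarrow> nat) \<Rightarrow> nat list \<Rightarrow> 'g \<Rightarrow> 'g" where
  "gact a xs = foldr (\<lambda>i f. (\<sigma> i ^^ a i) \<circ> f) xs id"

lemma act_g_gact: "act_g c = gact (\<lambda>i. nat (c i)) [0..<n]"
  by (simp add: act_g_def gact_def)

lemma gact_commute:
  "j < n \<Longrightarrow> set xs \<subseteq> {..<n} \<Longrightarrow> (\<sigma> j ^^ k) (gact a xs u) = gact a xs ((\<sigma> j ^^ k) u)"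
proof (induction xs arbitrary: u)
  case (Cons i xs)
  have "(\<sigma> j ^^ k) ((\<sigma> i ^^ a i) v) = (\<sigma> i ^^ a i) ((\<sigma> j ^^ k) v)" for v
    using fun_cong[OF funpow_commute2[OF commute[of j i], of k "a i"], of v] Cons.prems by simp
  then show ?case using Cons by (simp add: gact_def)
qed (simp add: gact_def)

lemma gact_add: "set xs \<subseteq> {..<n} \<Longrightarrow> gact (\<lambda>i. a i + b i) xs u = gact a xs (gact b xs u)"
proof (induction xs arbitrary: u)
  case (Cons i xs)
  then have i: "i < n" "set xs \<subseteq> {..<n}" by auto
  have "gact (\<lambda>i. a i + b i) (i # xs) u = (\<sigma> i ^^ a i) ((\<sigma> i ^^ b i) (gact a xs (gact b xs u)))"
    using Cons.IH[OF i(2)] by (simp add: gact_def funpow_add)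
  also have "\<dots> = gact a (i # xs) (gact b (i # xs) u)"
    using gact_commute[OF i] by (simp add: gact_def)
  finally show ?case .
qed (simp add: gact_def)

lemma gact_cong: "(\<And>i. i \<in> set xs \<Longrightarrow> (\<sigma> i ^^ a i) = (\<sigma> i ^^ b i)) \<Longrightarrow> gact a xs = gact b xs"
  by (induction xs) (auto simp: gact_def)

lemma act_g_mult:
  assumes "c \<in> carrier \<Gamma>" "d \<in> carrier \<Gamma>"
  shows "act_g (c \<otimes>\<^bsub>\<Gamma>\<^esub> d) u = act_g c (act_g d u)"
proof -
  have "act_g (c \<otimes>\<^bsub>\<Gamma>\<^esub> d) = gact (\<lambda>i. nat (c i) + nat (d i)) [0..<n]"
    unfolding act_g_gact
  proof (rule gact_cong)
    fix i assume "i \<in> set [0..<n]"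
    then have i: "i < n" by simp
    have nn: "0 \<le> c i" "0 \<le> d i" using carrier_\<Gamma>D(1) assms i by blast+
    have "nat ((c \<otimes>\<^bsub>\<Gamma>\<^esub> d) i) = (nat (c i) + nat (d i)) mod m i"
      using i nn by (simp add: mult_\<Gamma> nat_mod_distrib nat_add_distrib)
    moreover have "(\<sigma> i ^^ (k mod m i)) v = (\<sigma> i ^^ k) v" for k v
      by (rule funpow_mod_eq) (simp add: finite_order[OF i])
    ultimately show "(\<sigma> i ^^ nat ((c \<otimes>\<^bsub>\<Gamma>\<^esub> d) i)) = (\<sigma> i ^^ (nat (c i) + nat (d i)))"
      by (simp add: fun_eq_iff)
  qed
  then show ?thesis using gact_add[of "[0..<n]"] by (simp add: act_g_gact atLeast0LessThan)
qed

lemma act_g_one: "act_g \<one>\<^bsub>\<Gamma>\<^esub> u = u"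
proof -
  have "set xs \<subseteq> {..<n} \<Longrightarrow> gact (\<lambda>i. nat (\<one>\<^bsub>\<Gamma>\<^esub> i)) xs = id" for xs
    by (induction xs) (auto simp: gact_def one_\<Gamma>)
  then show ?thesis unfolding act_g_gact by (simp add: atLeast0LessThan)
qed

lemma act_g_inv:
  assumes "c \<in> carrier \<Gamma>"
  shows "act_g c (act_g (ginv c) u) = u" "act_g (ginv c) (act_g c u) = u"
  using act_g_mult[OF assms \<Gamma>.inv_closed[OF assms], of u] act_g_mult[OF \<Gamma>.inv_closed[OF assms] assms, of u]
    assms by (simp_all add: act_g_one)

lemma gact_hom:
  "set xs \<subseteq> {..<n} \<Longrightarrow> linear_op scale (gact a xs) \<and>
    (\<forall>u v. gact a xs (bracket u v) = bracket (gact a xs u) (gact a xs v))"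
proof (induction xs)
  case Nil
  then show ?case by (auto simp: gact_def intro!: linearI)
next
  case (Cons i xs)
  have i: "linear_op scale (\<sigma> i)" "\<And>a b. \<sigma> i (bracket a b) = bracket (\<sigma> i a) (\<sigma> i b)"
    using automorphism[of i] Cons.prems by (auto simp: lie_automorphism_def)
  have b: "(\<sigma> i ^^ k) (bracket u v) = bracket ((\<sigma> i ^^ k) u) ((\<sigma> i ^^ k) v)" for k u v
    by (induction k) (auto simp: i)
  have e: "gact a (i # xs) u = (\<sigma> i ^^ a i) (gact a xs u)" for u by (simp add: gact_def)
  note IH = Cons.IH[THEN conjunct1] Cons.IH[THEN conjunct2]
  have xs: "set xs \<subseteq> {..<n}" using Cons.prems by simp
  have "gact a (i # xs) = (\<lambda>u. (\<sigma> i ^^ a i) (gact a xs u))" using e by blast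
  then have "linear_op scale (gact a (i # xs))"
    using linear_comp[OF linear_funpow[OF i(1)] IH(1)[OF xs]] by simp
  moreover have "gact a (i # xs) (bracket u v) = bracket (gact a (i # xs) u) (gact a (i # xs) v)" for u v
    unfolding e by (simp add: b IH(2)[OF xs, rule_format])
  ultimately show ?case by blast
qed

lemma act_g_linear: "linear_op scale (act_g c)"
  unfolding act_g_gact by (rule gact_hom[THEN conjunct1]) auto

lemma act_g_bracket: "act_g c (bracket u v) = bracket (act_g c u) (act_g c v)"
  unfolding act_g_gact by (rule gact_hom[THEN conjunct2, rule_format]) auto

lemma g_at_X: "x \<in> X \<Longrightarrow> g_at x = UNIV"
  using act_X_fixed act_g_one by (auto simp: g_at_def stabilizer_def)

end

context multiloop
begin

abbreviation fs :: "'k \<Rightarrow> ((nat \<Rightarrow> 'k) \<Rightarrow> 'k) \<Rightarrow> (nat \<Rightarrow> 'k) \<Rightarrow> 'k" where "fs \<equiv> fun_scale (*)"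

lemma lin_space_fs: "lin_space fs"
  by (auto simp: lin_space_def intro!: vector_space_fun_scale) (unfold_locales, auto simp: algebra_simps)

lemma lin_space_gs: "lin_space (fun_scale scale :: 'k \<Rightarrow> ((nat \<Rightarrow> 'k) \<Rightarrow> 'g) \<Rightarrow> _)"
  by (auto simp: lin_space_def intro!: vector_space_fun_scale vector_space_axioms)

sublocale F: lin_space fs by (rule lin_space_fs)
sublocale G: lin_space "fun_scale scale :: 'k \<Rightarrow> ((nat \<Rightarrow> 'k) \<Rightarrow> 'g) \<Rightarrow> _" by (rule lin_space_gs)

abbreviation A where "A \<equiv> regular_functions"
abbreviation Reg where "Reg \<equiv> regular_maps"

lemma subspace_A: "F.subspace A" by (simp add: regular_functions_def)
lemma subspace_Reg: "G.subspace Reg" by (simp add: regular_maps_def)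

lemma A_induct [consumes 1, case_names zero add]:
  assumes "f \<in> A" "P (\<lambda>z. 0)" "\<And>c e f. f \<in> A \<Longrightarrow> P f \<Longrightarrow> P (\<lambda>z. c * monomial e z + f z)"
  shows "P f"
proof -
  have "f \<in> A \<and> P f" using assms(1) unfolding regular_functions_def
  proof (induction f rule: F.span_induct_alt)
    case base
    then show ?case using assms(2) F.span_zero by (simp add: zero_fun_def)
  next
    case (step c x f)
    then obtain e where e: "x = monomial e" by blast
    have "fs c x + f = (\<lambda>z. c * monomial e z + f z)" by (auto simp: e fun_scale_def)
    moreover have "fs c x + f \<in> F.span (range monomial)"
      by (rule F.span_add[OF F.span_scale[OF F.span_base]]) (use step e in auto)
    ultimately show ?case using assms(3)[of f c e] step by (simp add: regular_functions_def)
  qed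
  then show ?thesis by blast
qed

lemma A_add: "f \<in> A \<Longrightarrow> h \<in> A \<Longrightarrow> (\<lambda>z. f z + h z) \<in> A"
  using F.subspace_add[OF subspace_A] by (simp add: plus_fun_def)

lemma A_scale: "f \<in> A \<Longrightarrow> (\<lambda>z. c * f z) \<in> A"
  using F.subspace_scale[OF subspace_A] by (simp add: fun_scale_def)

lemma A_zero: "(\<lambda>z. 0) \<in> A"
  using F.subspace_0[OF subspace_A] by (simp add: zero_fun_def)

lemma A_monomial: "monomial e \<in> A"
  unfolding regular_functions_def by (rule F.span_base) simp

lemma monomial_mult: "monomial e z * monomial e' z = monomial (\<lambda>i. e i + e' i) z"
  by (auto simp: monomial_def X_iff prod.distrib[symmetric] power_int_add intro!: prod.cong)

lemma A_mult: "f \<in> A \<Longrightarrow> h \<in> A \<Longrightarrow> (\<lambda>z. f z * h z) \<in> A"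
proof (induction f rule: A_induct)
  case (add c e f)
  have "(\<lambda>z. monomial e z * h z) \<in> A" using add.prems
  proof (induction h rule: A_induct)
    case (add c' e' h)
    have "(\<lambda>z. c' * monomial (\<lambda>i. e i + e' i) z + monomial e z * h z) \<in> A"
      by (intro A_add A_scale A_monomial add.IH)
    then show ?case by (simp add: algebra_simps flip: monomial_mult)
  qed (simp add: A_zero)
  then have "(\<lambda>z. c * (monomial e z * h z) + f z * h z) \<in> A" by (intro A_add A_scale add.IH add.prems)
  then show ?case by (simp add: algebra_simps)
qed (simp add: A_zero)

lemma A_vanish: "f \<in> A \<Longrightarrow> z \<notin> X \<Longrightarrow> f z = 0"
  by (induction f rule: A_induct) (auto simp: monomial_def)

definition const_fun :: "'k \<Rightarrow> (nat \<Rightarrow> 'k) \<Rightarrow> 'k" where "const_fun c = (\<lambda>z. if z \<in> X then c else 0)"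

lemma A_const_fun: "const_fun c \<in> A"
proof -
  have "const_fun c = (\<lambda>z. c * monomial (\<lambda>i. 0) z)" by (auto simp: const_fun_def monomial_def)
  then show ?thesis using A_scale[OF A_monomial] by metis
qed

lemma A_prod: "finite K \<Longrightarrow> (\<And>k. k \<in> K \<Longrightarrow> f k \<in> A) \<Longrightarrow> (\<lambda>z. if z \<in> X then \<Prod>k\<in>K. f k z else 0) \<in> A"
proof (induction K rule: finite_induct)
  case empty
  then show ?case using A_const_fun[of 1] by (simp add: const_fun_def cong: if_cong)
next
  case (insert k K)
  then have "(\<lambda>z. f k z * (if z \<in> X then \<Prod>k\<in>K. f k z else 0)) \<in> A" by (intro A_mult) auto
  moreover have "(\<lambda>z. f k z * (if z \<in> X then \<Prod>k\<in>K. f k z else 0)) = (\<lambda>z. if z \<in> X then \<Prod>k\<in>insert k K. f k z else 0)"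
    using insert.hyps by auto
  ultimately show ?case by simp
qed

lemma monomial_act: "z \<in> X \<Longrightarrow> monomial e (act_X c z) = (\<Prod>i<n. \<xi> i powi (c i * e i)) * monomial e z"
  by (auto simp: monomial_def act_X_in act_X_apply power_int_mult_distrib power_int_mult prod.distrib[symmetric] intro!: prod.cong)

lemma A_act: "f \<in> A \<Longrightarrow> (\<lambda>z. if z \<in> X then f (act_X c z) else 0) \<in> A"
proof (induction f rule: A_induct)
  case (add r e f)
  have "(\<lambda>z. (r * (\<Prod>i<n. \<xi> i powi (c i * e i))) * monomial e z + (if z \<in> X then f (act_X c z) else 0)) \<in> A"
    by (intro A_add A_scale A_monomial add.IH)
  moreover have "(\<lambda>z. (r * (\<Prod>i<n. \<xi> i powi (c i * e i))) * monomial e z + (if z \<in> X then f (act_X c z) else 0))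
    = (\<lambda>z. if z \<in> X then r * monomial e (act_X c z) + f (act_X c z) else 0)"
  proof
    fix z
    show "(r * (\<Prod>i<n. \<xi> i powi (c i * e i))) * monomial e z + (if z \<in> X then f (act_X c z) else 0)
      = (if z \<in> X then r * monomial e (act_X c z) + f (act_X c z) else 0)"
    proof (cases "z \<in> X")
      case True
      then show ?thesis by (simp add: monomial_act mult_ac)
    next
      case False
      then show ?thesis by (simp add: monomial_def)
    qed
  qed
  ultimately show ?case by simp
qed (simp add: A_zero)

lemma Reg_add: "f \<in> Reg \<Longrightarrow> h \<in> Reg \<Longrightarrow> (\<lambda>z. f z + h z) \<in> Reg"
  using G.subspace_add[OF subspace_Reg] by (simp add: plus_fun_def)

lemma Reg_scale: "f \<in> Reg \<Longrightarrow> (\<lambda>z. scale c (f z)) \<in> Reg"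
  using G.subspace_scale[OF subspace_Reg] by (simp add: fun_scale_def)

lemma Reg_zero: "(\<lambda>z. 0) \<in> Reg"
  using G.subspace_0[OF subspace_Reg] by (simp add: zero_fun_def)

lemma Reg_sum: "(\<And>k. k \<in> K \<Longrightarrow> f k \<in> Reg) \<Longrightarrow> (\<lambda>z. \<Sum>k\<in>K. f k z) \<in> Reg"
  by (induction K rule: infinite_finite_induct) (auto intro: Reg_add Reg_zero)

lemma Reg_base: "f \<in> A \<Longrightarrow> (\<lambda>z. scale (f z) u) \<in> Reg"
  unfolding regular_maps_def by (rule G.span_base) blast

lemma Reg_induct [consumes 1, case_names zero add]:
  assumes "\<gamma> \<in> Reg" "P (\<lambda>z. 0)"
    "\<And>f u \<gamma>. f \<in> A \<Longrightarrow> \<gamma> \<in> Reg \<Longrightarrow> P \<gamma> \<Longrightarrow> P (\<lambda>z. scale (f z) u + \<gamma> z)"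
  shows "P \<gamma>"
proof -
  have "\<gamma> \<in> Reg \<and> P \<gamma>" using assms(1) unfolding regular_maps_def
  proof (induction \<gamma> rule: G.span_induct_alt)
    case base
    then show ?case using assms(2) G.span_zero by (simp add: zero_fun_def)
  next
    case (step c x \<gamma>)
    then obtain f u where f: "x = (\<lambda>z. scale (f z) u)" "f \<in> A" by blast
    have eq: "fun_scale scale c x + \<gamma> = (\<lambda>z. scale (c * f z) u + \<gamma> z)" by (auto simp: f fun_scale_def)
    have "(\<lambda>z. scale (c * f z) u + \<gamma> z) \<in> Reg"
      using step by (intro Reg_add Reg_base A_scale f) (simp add: regular_maps_def)
    then show ?case
      using assms(3)[of "\<lambda>z. c * f z" \<gamma> u] A_scale[OF f(2)] step unfolding eq by (simp add: regular_maps_def)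
  qed
  then show ?thesis by blast
qed

lemma Reg_mult: "\<gamma> \<in> Reg \<Longrightarrow> f \<in> A \<Longrightarrow> (\<lambda>z. scale (f z) (\<gamma> z)) \<in> Reg"
proof (induction \<gamma> rule: Reg_induct)
  case (add h u \<gamma>)
  have "(\<lambda>z. scale (f z * h z) u + scale (f z) (\<gamma> z)) \<in> Reg"
    by (intro Reg_add Reg_base A_mult add)
  then show ?case by (simp add: scale_right_distrib)
qed (simp add: Reg_zero)

lemma Reg_map: "\<gamma> \<in> Reg \<Longrightarrow> linear_op scale T \<Longrightarrow> (\<lambda>z. T (\<gamma> z)) \<in> Reg"
proof (induction \<gamma> rule: Reg_induct)
  case (add h u \<gamma>)
  have "(\<lambda>z. scale (h z) (T u) + T (\<gamma> z)) \<in> Reg" by (intro Reg_add Reg_base add)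
  then show ?case by (simp add: linearD[OF add.prems])
qed (simp add: Reg_zero linearD)

lemma Reg_bracket: "\<gamma> \<in> Reg \<Longrightarrow> \<delta> \<in> Reg \<Longrightarrow> (\<lambda>z. bracket (\<gamma> z) (\<delta> z)) \<in> Reg"
proof (induction \<gamma> rule: Reg_induct)
  case (add h u \<gamma>)
  have "(\<lambda>z. scale (h z) (bracket u (\<delta> z)) + bracket (\<gamma> z) (\<delta> z)) \<in> Reg"
    by (rule Reg_add[OF Reg_mult[OF Reg_map[OF add.prems ad_linear] add.hyps(1)] add.IH[OF add.prems]])
  then show ?case by (simp add: bracket_simps)
qed (simp add: Reg_zero bracket_simps)

lemma Reg_functional: "\<gamma> \<in> Reg \<Longrightarrow> Vector_Spaces.linear scale (*) \<phi> \<Longrightarrow> (\<lambda>z. \<phi> (\<gamma> z)) \<in> A"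
proof (induction \<gamma> rule: Reg_induct)
  case zero
  then have "\<phi> 0 = 0" using module_hom.zero[of scale "(*)" \<phi>] by (simp add: module_hom_iff_linear)
  then show ?case by (simp add: A_zero)
next
  case (add h u \<gamma>)
  have "(\<lambda>z. \<phi> u * h z + \<phi> (\<gamma> z)) \<in> A" by (intro A_add A_scale add)
  moreover have "\<phi> (scale (h z) u + \<gamma> z) = \<phi> u * h z + \<phi> (\<gamma> z)" for z
    using add.prems by (simp add: Vector_Spaces.linear_iff mult.commute)
  ultimately show ?case by simp
qed

lemma Reg_vanish: "\<gamma> \<in> Reg \<Longrightarrow> z \<notin> X \<Longrightarrow> \<gamma> z = 0"
  by (induction \<gamma> rule: Reg_induct) (auto simp: A_vanish)

lemma Reg_act: "\<gamma> \<in> Reg \<Longrightarrow> (\<lambda>z. if z \<in> X then \<gamma> (act_X c z) else 0) \<in> Reg"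
proof (induction \<gamma> rule: Reg_induct)
  case (add h u \<gamma>)
  have "(\<lambda>z. scale (if z \<in> X then h (act_X c z) else 0) u + (if z \<in> X then \<gamma> (act_X c z) else 0)) \<in> Reg"
    by (intro Reg_add Reg_base A_act add)
  moreover have "(\<lambda>z. scale (if z \<in> X then h (act_X c z) else 0) u + (if z \<in> X then \<gamma> (act_X c z) else 0))
    = (\<lambda>z. if z \<in> X then scale (h (act_X c z)) u + \<gamma> (act_X c z) else 0)" by auto
  ultimately show ?case by simp
qed (simp add: Reg_zero)

text \<open>
  The projection of regular maps onto equivariant ones.
\<close>

definition avg :: "((nat \<Rightarrow> 'k) \<Rightarrow> 'g) \<Rightarrow> (nat \<Rightarrow> 'k) \<Rightarrow> 'g" where
  "avg \<gamma> z = (if z \<in> X then scale (inverse (of_nat (card (carrier \<Gamma>))))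
     (\<Sum>c\<in>carrier \<Gamma>. act_g (ginv c) (\<gamma> (act_X c z))) else 0)"

lemma card_\<Gamma>: "(of_nat (card (carrier \<Gamma>)) :: 'k) \<noteq> 0"
  using finite_\<Gamma> by (auto simp: card_eq_0_iff)

lemma avg_Reg: "\<gamma> \<in> Reg \<Longrightarrow> avg \<gamma> \<in> Reg"
proof -
  assume \<gamma>: "\<gamma> \<in> Reg"
  have 1: "(\<lambda>z. act_g (ginv c) (if z \<in> X then \<gamma> (act_X c z) else 0)) \<in> Reg" for c
    by (rule Reg_map[OF Reg_act[OF \<gamma>] act_g_linear])
  have "(\<lambda>z. scale (inverse (of_nat (card (carrier \<Gamma>))))
     (\<Sum>c\<in>carrier \<Gamma>. act_g (ginv c) (if z \<in> X then \<gamma> (act_X c z) else 0))) \<in> Reg" (is "?f \<in> _")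
    by (rule Reg_scale[OF Reg_sum[OF 1]])
  moreover have "avg \<gamma> = ?f" by (auto simp: avg_def linearD[OF act_g_linear])
  ultimately show ?thesis by simp
qed

lemma M_iff: "\<alpha> \<in> M \<longleftrightarrow> \<alpha> \<in> Reg \<and> (\<forall>c\<in>carrier \<Gamma>. \<forall>z\<in>X. \<alpha> (act_X c z) = act_g c (\<alpha> z))"
  by (simp add: M_def)

lemma M_Reg: "\<alpha> \<in> M \<Longrightarrow> \<alpha> \<in> Reg" by (simp add: M_iff)

lemma M_act: "\<alpha> \<in> M \<Longrightarrow> c \<in> carrier \<Gamma> \<Longrightarrow> z \<in> X \<Longrightarrow> \<alpha> (act_X c z) = act_g c (\<alpha> z)"
  by (simp add: M_iff)

lemma avg_M: assumes \<gamma>: "\<gamma> \<in> Reg" shows "avg \<gamma> \<in> M"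
  unfolding M_iff
proof (intro conjI ballI avg_Reg \<gamma>)
  fix d z assume d: "d \<in> carrier \<Gamma>" and z: "z \<in> X"
  have "(\<Sum>c\<in>carrier \<Gamma>. act_g (ginv c) (\<gamma> (act_X c (act_X d z))))
    = (\<Sum>c\<in>carrier \<Gamma>. act_g d (act_g (ginv c) (\<gamma> (act_X c z))))"
  proof (rule sum.reindex_bij_witness[of _ "\<lambda>c. c \<otimes>\<^bsub>\<Gamma>\<^esub> ginv d" "\<lambda>c. c \<otimes>\<^bsub>\<Gamma>\<^esub> d"])
    fix c assume c: "c \<in> carrier \<Gamma>"
    show "c \<otimes>\<^bsub>\<Gamma>\<^esub> d \<otimes>\<^bsub>\<Gamma>\<^esub> ginv d = c" "c \<otimes>\<^bsub>\<Gamma>\<^esub> d \<in> carrier \<Gamma>"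
      "c \<otimes>\<^bsub>\<Gamma>\<^esub> ginv d \<otimes>\<^bsub>\<Gamma>\<^esub> d = c" "c \<otimes>\<^bsub>\<Gamma>\<^esub> ginv d \<in> carrier \<Gamma>"
      using c d by (simp_all add: \<Gamma>.m_assoc)
    have "act_g d (act_g (ginv (c \<otimes>\<^bsub>\<Gamma>\<^esub> d)) v) = act_g (ginv c) v" for v
      using c d by (simp add: \<Gamma>.inv_mult_group act_g_mult act_g_inv)
    then show "act_g d (act_g (ginv (c \<otimes>\<^bsub>\<Gamma>\<^esub> d)) (\<gamma> (act_X (c \<otimes>\<^bsub>\<Gamma>\<^esub> d) z)))
        = act_g (ginv c) (\<gamma> (act_X c (act_X d z)))"
      by (simp add: act_X_mult)
  qed
  then show "avg \<gamma> (act_X d z) = act_g d (avg \<gamma> z)"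
    using z by (simp add: avg_def act_X_in linearD[OF act_g_linear])
qed

lemma avg_ident: assumes \<alpha>: "\<alpha> \<in> M" shows "avg \<alpha> = \<alpha>"
proof
  fix z
  show "avg \<alpha> z = \<alpha> z"
  proof (cases "z \<in> X")
    case True
    have "(\<Sum>c\<in>carrier \<Gamma>. act_g (ginv c) (\<alpha> (act_X c z))) = (\<Sum>c\<in>carrier \<Gamma>. \<alpha> z)"
      by (rule sum.cong) (use M_act[OF \<alpha>] True in \<open>auto simp: act_g_inv\<close>)
    then show ?thesis using True card_\<Gamma> by (simp add: avg_def sum_constant_scale)
  qed (use Reg_vanish[OF M_Reg[OF \<alpha>]] in \<open>simp add: avg_def\<close>)
qed

text \<open>
  The ring of invariant regular functions, over which \<open>M\<close> is a module.
\<close>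

definition B :: "((nat \<Rightarrow> 'k) \<Rightarrow> 'k) set" where
  "B = {b \<in> A. \<forall>c\<in>carrier \<Gamma>. \<forall>z\<in>X. b (act_X c z) = b z}"

lemma avg_B: assumes "b \<in> B" shows "avg (\<lambda>z. scale (b z) (\<gamma> z)) = (\<lambda>z. scale (b z) (avg \<gamma> z))"
proof
  fix z
  show "avg (\<lambda>z. scale (b z) (\<gamma> z)) z = scale (b z) (avg \<gamma> z)"
  proof (cases "z \<in> X")
    case True
    have "(\<Sum>c\<in>carrier \<Gamma>. act_g (ginv c) (scale (b (act_X c z)) (\<gamma> (act_X c z))))
      = scale (b z) (\<Sum>c\<in>carrier \<Gamma>. act_g (ginv c) (\<gamma> (act_X c z)))"
      unfolding scale_sum_right using assms True
      by (intro sum.cong) (auto simp: B_def linearD[OF act_g_linear])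
    then show ?thesis using True by (simp add: avg_def mult.commute)
  qed (simp add: avg_def)
qed

lemma avg_bracket: assumes \<alpha>: "\<alpha> \<in> M"
  shows "avg (\<lambda>z. bracket (\<alpha> z) (\<gamma> z)) = (\<lambda>z. bracket (\<alpha> z) (avg \<gamma> z))"
proof
  fix z
  show "avg (\<lambda>z. bracket (\<alpha> z) (\<gamma> z)) z = bracket (\<alpha> z) (avg \<gamma> z)"
  proof (cases "z \<in> X")
    case True
    have "(\<Sum>c\<in>carrier \<Gamma>. act_g (ginv c) (bracket (\<alpha> (act_X c z)) (\<gamma> (act_X c z))))
      = bracket (\<alpha> z) (\<Sum>c\<in>carrier \<Gamma>. act_g (ginv c) (\<gamma> (act_X c z)))"
      unfolding bracket_simps using M_act[OF \<alpha>] True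
      by (intro sum.cong) (auto simp: act_g_bracket act_g_inv)
    then show ?thesis using True by (simp add: avg_def bracket_simps)
  qed (simp add: avg_def bracket_simps)
qed

lemma avg_sum: "avg (\<lambda>z. \<Sum>k\<in>K. \<gamma> k z) = (\<lambda>z. \<Sum>k\<in>K. avg (\<gamma> k) z)"
proof
  fix z
  show "avg (\<lambda>z. \<Sum>k\<in>K. \<gamma> k z) z = (\<Sum>k\<in>K. avg (\<gamma> k) z)"
    by (cases "z \<in> X") (simp_all add: avg_def linearD[OF act_g_linear] sum.swap[of _ K] scale_sum_right[symmetric])
qed

text \<open>
  The equivariant part of \<open>t\<^sup>e u\<close>.
\<close>

definition gen :: "(nat \<Rightarrow> int) \<Rightarrow> 'g \<Rightarrow> (nat \<Rightarrow> 'k) \<Rightarrow> 'g" where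
  "gen e u = avg (\<lambda>z. scale (monomial e z) u)"

lemma gen_M: "gen e u \<in> M"
  unfolding gen_def by (intro avg_M Reg_base A_monomial)

lemma sum_characters:
  assumes c: "c \<in> carrier \<Gamma>"
  shows "(\<Sum>e\<in>carrier \<Gamma>. \<Prod>i<n. \<xi> i powi (c i * e i)) = (if c = \<one>\<^bsub>\<Gamma>\<^esub> then of_nat (card (carrier \<Gamma>)) else 0)"
proof -
  have "(\<Sum>e\<in>carrier \<Gamma>. \<Prod>i<n. \<xi> i powi (c i * e i)) = (\<Prod>i<n. \<Sum>j\<in>{0..<int (m i)}. \<xi> i powi (c i * j))"
    unfolding carrier_\<Gamma> by (rule prod_sum_PiE[symmetric]) auto
  also have "\<dots> = (\<Prod>i<n. if \<xi> i powi c i = 1 then of_nat (m i) else 0)"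
  proof (rule prod.cong[OF refl])
    fix i assume i: "i \<in> {..<n}"
    have "(\<xi> i powi c i) ^ m i = (\<xi> i ^ m i) powi c i"
      by (simp add: power_int_power power_int_power' mult.commute)
    then show "(\<Sum>j\<in>{0..<int (m i)}. \<xi> i powi (c i * j)) = (if \<xi> i powi c i = 1 then of_nat (m i) else 0)"
      using sum_powers_root_of_unity[of "\<xi> i powi c i" "m i"] root_power[of i] i by (simp add: power_int_mult)
  qed
  also have "\<dots> = (if c = \<one>\<^bsub>\<Gamma>\<^esub> then of_nat (card (carrier \<Gamma>)) else 0)"
  proof (cases "c = \<one>\<^bsub>\<Gamma>\<^esub>")
    case True
    then have "\<And>i. i < n \<Longrightarrow> c i = 0" by (simp add: one_\<Gamma>)
    then show ?thesis using True by (simp add: carrier_\<Gamma> card_PiE)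
  next
    case False
    have "\<exists>i<n. c i \<noteq> 0"
    proof (rule ccontr)
      assume "\<not> ?thesis"
      then have "c = \<one>\<^bsub>\<Gamma>\<^esub>" using carrier_\<Gamma>D(3)[OF c] by (auto simp: one_\<Gamma> fun_eq_iff)
      then show False using False by blast
    qed
    then obtain i where "i < n" "\<xi> i powi c i \<noteq> 1"
      using root_powi_eq_1 carrier_\<Gamma>D(1,2)[OF c] by blast
    then have "(\<Prod>i<n. if \<xi> i powi c i = 1 then of_nat (m i) else (0::'k)) = 0"
      by (intro prod_zero) auto
    then show ?thesis using False by simp
  qed
  finally show ?thesis .
qed

text \<open>
  Orthogonality of characters isolates the identity element among the translates in the averages.
  Hence the values of finitely many elements of \<open>M\<close> span \<open>\<gg>\<close> at every point, with regular coefficients.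
\<close>

lemma descent:
  assumes z: "z \<in> X"
  shows "u = (\<Sum>e\<in>carrier \<Gamma>. scale (monomial (\<lambda>i. - e i) z) (gen e u z))"
proof -
  let ?N = "of_nat (card (carrier \<Gamma>)) :: 'k"
  have inv: "monomial (\<lambda>i. - e i) z * monomial e (act_X c z) = (\<Prod>i<n. \<xi> i powi (c i * e i))" for c e
  proof -
    have "monomial (\<lambda>i. - e i) z * monomial e z = 1"
      unfolding monomial_mult using z by (simp add: monomial_def)
    then show ?thesis using z by (simp add: monomial_act mult_ac)
  qed
  have g: "scale (monomial (\<lambda>i. - e i) z) (gen e u z)
    = (\<Sum>c\<in>carrier \<Gamma>. scale (inverse ?N * (\<Prod>i<n. \<xi> i powi (c i * e i))) (act_g (ginv c) u))" for e
    using z by (simp add: gen_def avg_def linearD[OF act_g_linear] scale_sum_right flip: inv)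
      (simp add: mult_ac)
  have "(\<Sum>e\<in>carrier \<Gamma>. scale (monomial (\<lambda>i. - e i) z) (gen e u z))
    = (\<Sum>c\<in>carrier \<Gamma>. \<Sum>e\<in>carrier \<Gamma>. scale (inverse ?N * (\<Prod>i<n. \<xi> i powi (c i * e i))) (act_g (ginv c) u))"
    unfolding g by (rule sum.swap)
  also have "\<dots> = (\<Sum>c\<in>carrier \<Gamma>. if c = \<one>\<^bsub>\<Gamma>\<^esub> then u else 0)"
  proof (rule sum.cong[OF refl])
    fix c assume c: "c \<in> carrier \<Gamma>"
    have "(\<Sum>e\<in>carrier \<Gamma>. scale (inverse ?N * (\<Prod>i<n. \<xi> i powi (c i * e i))) (act_g (ginv c) u))
      = scale (inverse ?N * (\<Sum>e\<in>carrier \<Gamma>. \<Prod>i<n. \<xi> i powi (c i * e i))) (act_g (ginv c) u)"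
      by (simp add: scale_sum_left sum_distrib_left)
    also have "\<dots> = (if c = \<one>\<^bsub>\<Gamma>\<^esub> then u else 0)"
      using card_\<Gamma> by (simp add: sum_characters[OF c] act_g_one)
    finally show "(\<Sum>e\<in>carrier \<Gamma>. scale (inverse ?N * (\<Prod>i<n. \<xi> i powi (c i * e i))) (act_g (ginv c) u))
      = (if c = \<one>\<^bsub>\<Gamma>\<^esub> then u else 0)" .
  qed
  also have "\<dots> = u" using finite_\<Gamma> by simp
  finally show ?thesis by simp
qed

lemma M_add: "\<alpha> \<in> M \<Longrightarrow> \<beta> \<in> M \<Longrightarrow> (\<lambda>z. \<alpha> z + \<beta> z) \<in> M"
  by (simp add: M_iff Reg_add linearD[OF act_g_linear])

lemma M_scl: "\<alpha> \<in> M \<Longrightarrow> (\<lambda>z. scale c (\<alpha> z)) \<in> M"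
  by (simp add: M_iff Reg_scale linearD[OF act_g_linear])

lemma M_zero: "(\<lambda>z. 0) \<in> M"
  by (simp add: M_iff Reg_zero linearD[OF act_g_linear])

lemma M_sum: "(\<And>k. k \<in> K \<Longrightarrow> \<alpha> k \<in> M) \<Longrightarrow> (\<lambda>z. \<Sum>k\<in>K. \<alpha> k z) \<in> M"
  by (induction K rule: infinite_finite_induct) (auto intro: M_add M_zero)

lemma M_br: "\<alpha> \<in> M \<Longrightarrow> \<beta> \<in> M \<Longrightarrow> (\<lambda>z. bracket (\<alpha> z) (\<beta> z)) \<in> M"
  by (simp add: M_iff Reg_bracket act_g_bracket)

lemma M_mult: "\<alpha> \<in> M \<Longrightarrow> b \<in> B \<Longrightarrow> (\<lambda>z. scale (b z) (\<alpha> z)) \<in> M"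
  by (simp add: M_iff B_def Reg_mult linearD[OF act_g_linear])

text \<open>
  Perfectness of \<open>\<gg>\<close>, applied to the finitely many coefficients: each is a sum of brackets \<open>[u, w]\<close>
  with \<open>u\<close> in the fixed basis.
\<close>

lemma Reg_perfect:
  assumes "\<gamma> \<in> Reg"
  shows "\<exists>\<delta>. (\<forall>u. \<delta> u \<in> Reg) \<and> \<gamma> = (\<lambda>z. \<Sum>u\<in>basis0. bracket u (\<delta> u z))"
proof -
  let ?Q = "\<lambda>\<gamma>. \<exists>\<delta>. (\<forall>u. \<delta> u \<in> Reg) \<and> \<gamma> = (\<lambda>z. \<Sum>u\<in>basis0. bracket u (\<delta> u z))"
  have Q0: "?Q (\<lambda>z. 0)" by (rule exI[of _ "\<lambda>u z. 0"]) (simp add: Reg_zero bracket_simps)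
  have Qadd: "?Q (\<lambda>z. \<gamma> z + \<gamma>' z)" if "?Q \<gamma>" "?Q \<gamma>'" for \<gamma> \<gamma>'
  proof -
    from that obtain \<delta> \<delta>' where d: "\<forall>u. \<delta> u \<in> Reg" "\<gamma> = (\<lambda>z. \<Sum>u\<in>basis0. bracket u (\<delta> u z))"
      "\<forall>u. \<delta>' u \<in> Reg" "\<gamma>' = (\<lambda>z. \<Sum>u\<in>basis0. bracket u (\<delta>' u z))" by blast
    show ?thesis
      by (rule exI[of _ "\<lambda>u z. \<delta> u z + \<delta>' u z"]) (auto simp: d bracket_simps sum.distrib intro: Reg_add)
  qed
  have Qbase: "?Q (\<lambda>z. scale (f z) w)" if f: "f \<in> A" for f w
  proof -
    have "w \<in> span {bracket a b |a b. True}" using semisimple_perfect[OF semisimple] by simp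
    then show ?thesis
    proof (induction w rule: span_induct_alt)
      case base
      then show ?case using Q0 by simp
    next
      case (step c x y)
      then obtain a b where x: "x = bracket a b" by blast
      let ?r = "representation basis0 a"
      have "a = (\<Sum>u\<in>basis0. scale (?r u) u)"
        using sum_representation_eq[OF basis0(2) _ basis0(1)] basis0(3) by simp
      then have "x = bracket (\<Sum>u\<in>basis0. scale (?r u) u) b" using x by simp
      then have "x = (\<Sum>u\<in>basis0. scale (?r u) (bracket u b))" by (simp only: bracket_simps)
      then have "(\<lambda>z. scale (f z) (scale c x)) = (\<lambda>z. \<Sum>u\<in>basis0. bracket u (scale (?r u * c * f z) b))"
        by (auto simp: scale_sum_right bracket_simps mult_ac)
      moreover have "(\<lambda>z. scale (?r u * c * f z) b) \<in> Reg" for u by (intro Reg_base A_scale f)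
      ultimately have "?Q (\<lambda>z. scale (f z) (scale c x))" by (intro exI[of _ "\<lambda>u z. scale (?r u * c * f z) b"]) blast
      from Qadd[OF this step(2)] show ?case by (simp add: scale_right_distrib)
    qed
  qed
  from assms show ?thesis
    by (induction \<gamma> rule: Reg_induct) (intro Q0 Qadd Qbase; assumption)+
qed

text \<open>
  \<open>M\<close> is a sum of the subspaces \<open>[\<alpha>\<^sub>k, M]\<close> for finitely many fixed \<open>\<alpha>\<^sub>k \<in> M\<close>, uniformly in \<open>\<beta>\<close>.  In
  \<open>\<beta> = \<Sum> [u, \<delta> u]\<close> substitute the expansion of \<open>u\<close> given by \<open>descent\<close>, move the coefficients to the
  second entry, and average: \<open>avg\<close> commutes with bracketing by equivariant maps.
\<close>

lemma strong_perfect: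
  assumes \<beta>: "\<beta> \<in> M"
  shows "\<exists>\<delta>. (\<forall>u e. \<delta> u e \<in> M) \<and> \<beta> = (\<lambda>z. \<Sum>u\<in>basis0. \<Sum>e\<in>carrier \<Gamma>. bracket (gen e u z) (\<delta> u e z))"
proof -
  obtain \<delta> where d: "\<And>u. \<delta> u \<in> Reg" "\<beta> = (\<lambda>z. \<Sum>u\<in>basis0. bracket u (\<delta> u z))"
    using Reg_perfect[OF M_Reg[OF \<beta>]] by blast
  define \<epsilon> where "\<epsilon> = (\<lambda>u e z. scale (monomial (\<lambda>i. - e i) z) (\<delta> u z))"
  have eps: "\<epsilon> u e \<in> Reg" for u e unfolding \<epsilon>_def by (intro Reg_mult A_monomial d)
  have "\<beta> z = (\<Sum>u\<in>basis0. \<Sum>e\<in>carrier \<Gamma>. bracket (gen e u z) (\<epsilon> u e z))" for z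
  proof (cases "z \<in> X")
    case True
    have "bracket u (\<delta> u z) = (\<Sum>e\<in>carrier \<Gamma>. bracket (gen e u z) (\<epsilon> u e z))" for u
      by (subst descent[OF True, of u]) (simp add: bracket_simps \<epsilon>_def)
    then show ?thesis using d(2) by simp
  next
    case False
    then show ?thesis using Reg_vanish[OF M_Reg[OF \<beta>]] Reg_vanish[OF eps] by (simp add: bracket_simps)
  qed
  then have b: "\<beta> = (\<lambda>z. \<Sum>u\<in>basis0. \<Sum>e\<in>carrier \<Gamma>. bracket (gen e u z) (\<epsilon> u e z))" by blast
  have "\<beta> = avg \<beta>" using avg_ident[OF \<beta>] by simp
  also have "\<dots> = (\<lambda>z. \<Sum>u\<in>basis0. \<Sum>e\<in>carrier \<Gamma>. bracket (gen e u z) (avg (\<epsilon> u e) z))"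
    by (subst b) (simp add: avg_sum avg_bracket[OF gen_M])
  finally show ?thesis using avg_M[OF eps] by (intro exI[of _ "\<lambda>u e. avg (\<epsilon> u e)"]) blast
qed

text \<open>
  Freezing the coefficients of \<open>descent\<close> at \<open>x\<close> gives an equivariant map with an arbitrary value at \<open>x\<close>.
\<close>

lemma ev_surj:
  assumes x: "x \<in> X"
  shows "(\<lambda>z. \<Sum>e\<in>carrier \<Gamma>. scale (monomial (\<lambda>i. - e i) x) (gen e u z)) \<in> M"
    "(\<lambda>z. \<Sum>e\<in>carrier \<Gamma>. scale (monomial (\<lambda>i. - e i) x) (gen e u z)) x = u"
  using descent[OF x, of u] by (auto intro: M_sum[OF M_scl[OF gen_M]])

end

context multiloop
begin

section \<open>Functions vanishing on a finite grid\<close>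

text \<open>
  The function \<open>t\<^sub>i\<^sup>k\<close> on the torus.
\<close>

definition coord :: "nat \<Rightarrow> int \<Rightarrow> (nat \<Rightarrow> 'k) \<Rightarrow> 'k" where
  "coord i k = monomial (\<lambda>j. if j = i then k else 0)"

lemma coord_apply: "i < n \<Longrightarrow> z \<in> X \<Longrightarrow> coord i k z = z i powi k"
proof -
  assume i: "i < n" and z: "z \<in> X"
  have "(\<Prod>j<n. z j powi (if j = i then k else 0)) = (\<Prod>j<n. if j = i then z i powi k else 1)"
    by (rule prod.cong) auto
  then show ?thesis using i z by (simp add: coord_def monomial_def)
qed

lemma A_coord: "coord i k \<in> A"
  unfolding coord_def by (rule A_monomial)

text \<open>
  The polynomial \<open>q\<close> evaluated at \<open>t\<^sub>i\<close>.
\<close>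

definition coord_poly :: "nat \<Rightarrow> 'k poly \<Rightarrow> (nat \<Rightarrow> 'k) \<Rightarrow> 'k" where
  "coord_poly i q z = (if z \<in> X then poly q (z i) else 0)"

lemma A_coord_poly: "i < n \<Longrightarrow> coord_poly i q \<in> A"
proof (induction q)
  case 0
  have "coord_poly i 0 = (\<lambda>z. 0)" by (auto simp: coord_poly_def)
  then show ?case by (simp add: A_zero)
next
  case (pCons a q)
  have "(\<lambda>z. const_fun a z + coord i 1 z * coord_poly i q z) \<in> A"
    by (intro A_add A_const_fun A_mult A_coord pCons.IH pCons.prems)
  moreover have "coord_poly i (pCons a q) = (\<lambda>z. const_fun a z + coord i 1 z * coord_poly i q z)"
    using pCons.prems by (auto simp: coord_poly_def const_fun_def coord_apply)
  ultimately show ?case by simp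
qed

text \<open>
  The polynomial \<open>q\<close> evaluated at \<open>t\<^sub>i ^ m\<^sub>i\<close>; unlike \<open>coord_poly i q\<close> it is an invariant function.
\<close>

definition power_poly :: "nat \<Rightarrow> 'k poly \<Rightarrow> (nat \<Rightarrow> 'k) \<Rightarrow> 'k" where
  "power_poly i q z = (if z \<in> X then poly q (z i ^ m i) else 0)"

lemma power_poly_coord_poly: "power_poly i q = coord_poly i (pcompose q (monom 1 (m i)))"
  by (auto simp: power_poly_def coord_poly_def poly_pcompose poly_monom)

lemma B_power_poly: "i < n \<Longrightarrow> power_poly i q \<in> B"
  using A_coord_poly[of i "pcompose q (monom 1 (m i))"]
  by (auto simp: B_def power_poly_coord_poly[symmetric]) (auto simp: power_poly_def act_X_in act_X_power)

lemma B_mult: "b \<in> B \<Longrightarrow> b' \<in> B \<Longrightarrow> (\<lambda>z. b z * b' z) \<in> B"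
  by (simp add: B_def A_mult)

lemma B_const_fun: "const_fun c \<in> B"
  by (simp add: B_def A_const_fun) (simp add: const_fun_def act_X_in)

text \<open>
  Regular functions on the torus vanishing on a finite grid are generated by the univariate polynomials
  defining the grid.  Products of Lagrange polynomials form a partition of unity \<open>L y\<close> indexed by the
  grid points, and modulo the ideal multiplication by \<open>f\<close> acts on \<open>L y\<close> as the scalar \<open>f y\<close>.
\<close>

theorem grid_ideal:
  assumes Rs: "\<And>i. i < n \<Longrightarrow> finite (Rs i)" "\<And>i. i < n \<Longrightarrow> 0 \<notin> Rs i"
    and f: "f \<in> A" and van: "\<And>z. z \<in> X \<Longrightarrow> (\<And>i. i < n \<Longrightarrow> z i ^ m i \<in> Rs i) \<Longrightarrow> f z = 0"
  shows "\<exists>h. (\<forall>i. h i \<in> A) \<and> f = (\<lambda>z. \<Sum>i<n. power_poly i (root_poly (Rs i)) z * h i z)"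
proof -
  define I where "I = {f. \<exists>h. (\<forall>i. h i \<in> A) \<and> f = (\<lambda>z. \<Sum>i<n. power_poly i (root_poly (Rs i)) z * h i z)}"
  define D where "D = (\<lambda>i. {a. a ^ m i \<in> Rs i})"
  have D: "finite (D i)" "pcompose (root_poly (Rs i)) (monom 1 (m i)) = root_poly (D i)" if "i < n" for i
    unfolding D_def using root_poly_pcompose_power[OF primitive_root m_pos Rs] that by blast+
  have power_polyD: "power_poly i (root_poly (Rs i)) = coord_poly i (root_poly (D i))" if "i < n" for i
    using D(2)[OF that] by (simp add: power_poly_coord_poly)
  have I0: "(\<lambda>z. 0) \<in> I" unfolding I_def using A_zero by (intro CollectI exI[of _ "\<lambda>i z. 0"]) auto
  have Iadd: "(\<lambda>z. f z + g z) \<in> I" if "f \<in> I" "g \<in> I" for f g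
  proof -
    from that obtain h h' where h: "\<forall>i. h i \<in> A" "f = (\<lambda>z. \<Sum>i<n. power_poly i (root_poly (Rs i)) z * h i z)"
      "\<forall>i. h' i \<in> A" "g = (\<lambda>z. \<Sum>i<n. power_poly i (root_poly (Rs i)) z * h' i z)" unfolding I_def by blast
    have "(\<lambda>z. f z + g z) = (\<lambda>z. \<Sum>i<n. power_poly i (root_poly (Rs i)) z * (h i z + h' i z))"
      by (simp add: h distrib_left sum.distrib)
    then show ?thesis unfolding I_def using h A_add by (intro CollectI exI[of _ "\<lambda>i z. h i z + h' i z"]) auto
  qed
  have Imult: "(\<lambda>z. f z * g z) \<in> I" if "f \<in> A" "g \<in> I" for f g
  proof -
    from that obtain h where h: "\<forall>i. h i \<in> A" "g = (\<lambda>z. \<Sum>i<n. power_poly i (root_poly (Rs i)) z * h i z)"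
      unfolding I_def by blast
    have "(\<lambda>z. f z * g z) = (\<lambda>z. \<Sum>i<n. power_poly i (root_poly (Rs i)) z * (f z * h i z))"
      by (simp add: h sum_distrib_left mult_ac)
    then show ?thesis unfolding I_def using h A_mult[OF that(1)] by (intro CollectI exI[of _ "\<lambda>i z. f z * h i z"]) auto
  qed
  have Igen: "(\<lambda>z. power_poly i (root_poly (Rs i)) z * g z) \<in> I" if "i < n" "g \<in> A" for i g
  proof -
    have "(\<Sum>j<n. power_poly j (root_poly (Rs j)) z * (if j = i then g else (\<lambda>z. 0)) z) = power_poly i (root_poly (Rs i)) z * g z" for z
    proof -
      have "(\<Sum>j<n. power_poly j (root_poly (Rs j)) z * (if j = i then g else (\<lambda>z. 0)) z)
        = (\<Sum>j<n. if j = i then power_poly i (root_poly (Rs i)) z * g z else 0)" by (rule sum.cong) auto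
      then show ?thesis using that(1) by simp
    qed
    then show ?thesis unfolding I_def using that(2) A_zero
      by (intro CollectI exI[of _ "\<lambda>j. if j = i then g else (\<lambda>z. 0)"]) auto
  qed
  have Isum: "finite K \<Longrightarrow> (\<And>k. k \<in> K \<Longrightarrow> f k \<in> I) \<Longrightarrow> (\<lambda>z. \<Sum>k\<in>K. f k z) \<in> I"
    for K :: "(nat \<Rightarrow> 'k) set" and f
    by (induction K rule: finite_induct) (auto intro: I0 Iadd)
  have "f \<in> I"
  proof (cases "\<exists>i<n. D i = {}")
    case True
    then obtain i where i: "i < n" "D i = {}" by blast
    have "(\<lambda>z. power_poly i (root_poly (Rs i)) z * f z) = f"
    proof
      fix z show "power_poly i (root_poly (Rs i)) z * f z = f z"
      unfolding power_polyD[OF i(1)] i(2) using A_vanish[OF f] by (cases "z \<in> X") (auto simp: coord_poly_def root_poly_def)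
    qed
    then show ?thesis using Igen[OF i(1) f] by simp
  next
    case False
    have "\<exists>el. (\<Sum>a\<in>D i. el a) = 1 \<and> (\<forall>a\<in>D i. \<exists>c. [:-a, 1:] * el a = smult c (root_poly (D i)))" if i: "i < n" for i
    proof -
      have ne: "D i \<noteq> {}" using False i by blast
      obtain el where "(\<Sum>a\<in>D i. el a) = 1" "\<And>a. a \<in> D i \<Longrightarrow> \<exists>c. [:-a, 1:] * el a = smult c (root_poly (D i))"
        by (rule lagrange_idempotents[OF D(1)[OF i] ne]) (rule that)
      then show ?thesis by blast
    qed
    then obtain el where el: "\<And>i. i < n \<Longrightarrow> (\<Sum>a\<in>D i. el i a) = 1"
      "\<And>i a. i < n \<Longrightarrow> a \<in> D i \<Longrightarrow> \<exists>c. [:-a, 1:] * el i a = smult c (root_poly (D i))" by metis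
    define G where "G = Pi\<^sub>E {..<n} D"
    have finG: "finite G" unfolding G_def using D(1) by (intro finite_PiE) auto
    have GD: "y i \<in> D i" if "y \<in> G" "i < n" for y i using that by (auto simp: G_def)
    have GX: "y \<in> X" if "y \<in> G" for y
    proof -
      have "y i \<noteq> 0" if "i < n" for i
      proof
        assume "y i = 0"
        then have "0 ^ m i \<in> Rs i" using GD[OF \<open>y \<in> G\<close> that] by (simp add: D_def)
        then show False using Rs(2)[OF that] m_pos[OF that] by (simp add: zero_power)
      qed
      then show ?thesis using that by (auto simp: X_iff G_def PiE_def)
    qed
    define L where "L = (\<lambda>y z. if z \<in> X then \<Prod>i<n. coord_poly i (el i (y i)) z else 0)"
    have L_sum: "(\<Sum>y\<in>G. L y z) = (if z \<in> X then 1 else 0)" for z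
    proof (cases "z \<in> X")
      case True
      have "(\<Sum>y\<in>G. \<Prod>i<n. poly (el i (y i)) (z i)) = (\<Prod>i<n. \<Sum>a\<in>D i. poly (el i a) (z i))"
        unfolding G_def using D(1) by (intro prod_sum_PiE[symmetric]) auto
      also have "\<dots> = 1" by (rule prod.neutral) (simp flip: poly_sum add: el)
      finally show ?thesis using True by (simp add: L_def coord_poly_def)
    qed (simp add: L_def)
    \<comment> \<open>the functions with this property form a subring containing all \<open>t\<^sub>i\<close> and their inverses\<close>
    have C: "(\<lambda>z. (f z - f y) * L y z) \<in> I" if y: "y \<in> G" and f: "f \<in> A" for y f
    proof -
      let ?C = "\<lambda>f. f \<in> A \<and> (\<lambda>z. (f z - f y) * L y z) \<in> I"
      have LA: "L y \<in> A" unfolding L_def by (rule A_prod) (auto intro: A_coord_poly)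
      have Cmult: "?C (\<lambda>z. f z * g z)" if "?C f" "?C g" for f g
      proof -
        have "(\<lambda>z. f z * ((g z - g y) * L y z) + const_fun (g y) z * ((f z - f y) * L y z)) \<in> I"
          by (rule Iadd[OF Imult[OF conjunct1[OF that(1)] conjunct2[OF that(2)]] Imult[OF A_const_fun conjunct2[OF that(1)]]])
        moreover have "(\<lambda>z. f z * ((g z - g y) * L y z) + const_fun (g y) z * ((f z - f y) * L y z))
          = (\<lambda>z. (f z * g z - f y * g y) * L y z)"
          by (auto simp: const_fun_def L_def algebra_simps)
        ultimately show ?thesis using that A_mult by simp
      qed
      have yi: "y i \<noteq> 0" if "i < n" for i using GX[OF y] that by (simp add: X_iff)
      have C1: "(\<lambda>z. (coord i 1 z - y i) * L y z) \<in> I" if i: "i < n" for i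
      proof -
        obtain c where c: "[:-(y i), 1:] * el i (y i) = smult c (root_poly (D i))"
          using el(2)[OF i GD[OF y i]] by blast
        have R: "(\<lambda>z. if z \<in> X then \<Prod>i'\<in>{..<n} - {i}. coord_poly i' (el i' (y i')) z else 0) \<in> A" (is "?R \<in> A")
          by (rule A_prod) (auto intro: A_coord_poly)
        have "(\<lambda>z. (coord i 1 z - y i) * L y z) = (\<lambda>z. power_poly i (root_poly (Rs i)) z * (c * ?R z))"
        proof
          fix z
          show "(coord i 1 z - y i) * L y z = power_poly i (root_poly (Rs i)) z * (c * ?R z)"
          proof (cases "z \<in> X")
            case True
            have "(z i - y i) * poly (el i (y i)) (z i) = poly ([:-(y i), 1:] * el i (y i)) (z i)"
              unfolding poly_mult by simp
            also have "\<dots> = c * poly (root_poly (D i)) (z i)" unfolding c by simp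
            finally have e: "(z i - y i) * poly (el i (y i)) (z i) = c * poly (root_poly (D i)) (z i)" .
            have "L y z = coord_poly i (el i (y i)) z * ?R z"
              using True i prod.remove[of "{..<n}" i "\<lambda>i. coord_poly i (el i (y i)) z"] by (simp add: L_def)
            then have "(coord i 1 z - y i) * L y z = ((z i - y i) * poly (el i (y i)) (z i)) * ?R z"
              using True i by (simp add: coord_apply coord_poly_def)
            also have "\<dots> = power_poly i (root_poly (Rs i)) z * (c * ?R z)"
              unfolding e using True by (simp add: power_polyD[OF i] coord_poly_def)
            finally show ?thesis .
          qed (simp add: L_def)
        qed
        then show ?thesis using Igen[OF i A_scale[OF R, of c]] by simp
      qed
      have Cc1: "?C (coord i 1)" if i: "i < n" for i
        using C1[OF i] A_coord coord_apply[OF i GX[OF y], of 1] by simp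
      have Cc2: "?C (coord i (-1))" if i: "i < n" for i
      proof -
        have "(\<lambda>z. (- inverse (y i) * coord i (-1) z) * ((coord i 1 z - y i) * L y z)) \<in> I"
          by (rule Imult[OF A_scale[OF A_coord] C1[OF i]])
        moreover have "(\<lambda>z. (- inverse (y i) * coord i (-1) z) * ((coord i 1 z - y i) * L y z))
          = (\<lambda>z. (coord i (-1) z - coord i (-1) y) * L y z)"
        proof
          fix z
          show "(- inverse (y i) * coord i (-1) z) * ((coord i 1 z - y i) * L y z)
            = (coord i (-1) z - coord i (-1) y) * L y z"
          proof (cases "z \<in> X")
            case True
            then have "z i \<noteq> 0" using i by (simp add: X_iff)
            then show ?thesis using True GX[OF y] i yi[OF i]
              by (simp add: coord_apply power_int_minus field_simps)
          qed (simp add: L_def)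
        qed
        ultimately show ?thesis using A_coord by simp
      qed
      have coord_add: "coord i (k + l) = (\<lambda>z. coord i k z * coord i l z)" for i k l
        unfolding coord_def monomial_mult by (rule arg_cong[of _ _ monomial]) auto
      have coord0: "?C (coord i 0)" for i
      proof -
        have "coord i 0 = const_fun 1" by (auto simp: coord_def const_fun_def monomial_def)
        moreover have "(\<lambda>z. (const_fun 1 z - const_fun 1 y) * L y z) = (\<lambda>z. 0)"
          using GX[OF y] by (auto simp: const_fun_def L_def)
        ultimately show ?thesis using A_const_fun I0 by simp
      qed
      have Cpow: "?C (coord i (int k)) \<and> ?C (coord i (- int k))" if i: "i < n" for i k
      proof (induction k)
        case 0
        then show ?case using coord0 by simp
      next
        case (Suc k)
        have 1: "coord i (int (Suc k)) = (\<lambda>z. coord i 1 z * coord i (int k) z)"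
          using coord_add[of i 1 "int k"] by simp
        have 2: "coord i (- int (Suc k)) = (\<lambda>z. coord i (-1) z * coord i (- int k) z)"
          using coord_add[of i "-1" "- int k"] by simp
        show ?case unfolding 1 2
          by (rule conjI[OF Cmult[OF Cc1[OF i] conjunct1[OF Suc]] Cmult[OF Cc2[OF i] conjunct2[OF Suc]]])
      qed
      have Ck: "?C (coord i k)" if i: "i < n" for i k
        using Cpow[OF i, of "nat k"] Cpow[OF i, of "nat (- k)"] by (cases "k \<ge> 0") auto
      have Cmon: "?C (monomial e)" for e
      proof -
        have "?C (monomial (\<lambda>i. if i \<in> J then e i else 0))" if "finite J" "J \<subseteq> {..<n}" for J
          using that
        proof (induction J rule: finite_induct)
          case empty
          then show ?case using coord0[of 0] by (simp add: coord_def cong: if_cong)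
        next
          case (insert j J)
          have "(\<lambda>i. if i \<in> insert j J then e i else 0) = (\<lambda>i. (if i = j then e j else 0) + (if i \<in> J then e i else 0))"
            using insert.hyps by auto
          then have "monomial (\<lambda>i. if i \<in> insert j J then e i else 0)
            = (\<lambda>z. coord j (e j) z * monomial (\<lambda>i. if i \<in> J then e i else 0) z)"
            by (auto simp: coord_def monomial_mult)
          then show ?case using insert Ck[of j "e j"] Cmult by simp
        qed
        note all = this[OF finite_lessThan subset_refl]
        have eq: "monomial (\<lambda>i. if i \<in> {..<n} then e i else 0) = monomial e"
          by (auto simp: monomial_def fun_eq_iff intro!: prod.cong)
        show ?thesis using all unfolding eq .
      qed
      from f have "?C f"
      proof (induction f rule: A_induct)
        case zero
        then show ?case using A_zero I0 by simp
      next
        case (add c e f)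
        have "(\<lambda>z. const_fun c z * ((monomial e z - monomial e y) * L y z) + (f z - f y) * L y z) \<in> I"
          by (rule Iadd[OF Imult[OF A_const_fun conjunct2[OF Cmon]] conjunct2[OF add.IH]])
        moreover have "(\<lambda>z. const_fun c z * ((monomial e z - monomial e y) * L y z) + (f z - f y) * L y z)
          = (\<lambda>z. (c * monomial e z + f z - (c * monomial e y + f y)) * L y z)"
          by (auto simp: const_fun_def L_def algebra_simps)
        ultimately show ?case using add.IH A_add A_scale A_monomial by simp
      qed
      then show ?thesis by blast
    qed
    have "f y = 0" if "y \<in> G" for y
      using van[OF GX[OF that]] GD[OF that] by (simp add: D_def)
    then have "(\<lambda>z. f z * L y z) \<in> I" if "y \<in> G" for y using C[OF that f] that by simp
    then have "(\<lambda>z. \<Sum>y\<in>G. f z * L y z) \<in> I" by (rule Isum[OF finG])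
    moreover have "(\<lambda>z. \<Sum>y\<in>G. f z * L y z) = f"
      using A_vanish[OF f] by (auto simp: sum_distrib_left[symmetric] L_sum)
    ultimately show ?thesis by simp
  qed
  then show ?thesis unfolding I_def by blast
qed

text \<open>
  Apply \<open>grid_ideal\<close> to the coordinates of \<open>\<alpha>\<close> and average; the generators are invariant, so they come
  out of the average.
\<close>

theorem M_grid:
  assumes Rs: "\<And>i. i < n \<Longrightarrow> finite (Rs i)" "\<And>i. i < n \<Longrightarrow> 0 \<notin> Rs i"
    and \<alpha>: "\<alpha> \<in> M" and van: "\<And>z. z \<in> X \<Longrightarrow> (\<And>i. i < n \<Longrightarrow> z i ^ m i \<in> Rs i) \<Longrightarrow> \<alpha> z = 0"
  shows "\<exists>\<gamma>. (\<forall>i. \<gamma> i \<in> M) \<and> \<alpha> = (\<lambda>z. \<Sum>i<n. scale (power_poly i (root_poly (Rs i)) z) (\<gamma> i z))"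
proof -
  let ?P = "\<lambda>i. power_poly i (root_poly (Rs i))"
  let ?r = "\<lambda>u v. representation basis0 v u"
  have vs: "vector_space ((*)::'k \<Rightarrow> 'k \<Rightarrow> 'k)" by unfold_locales (auto simp: algebra_simps)
  have r: "Vector_Spaces.linear scale (*) (?r u)" for u
    unfolding Vector_Spaces.linear_iff using basis0(2,3)
    by (auto simp: vs vector_space_axioms representation_add representation_scale)
  have "\<forall>u. \<exists>h. (\<forall>i. h i \<in> A) \<and> (\<lambda>z. ?r u (\<alpha> z)) = (\<lambda>z. \<Sum>i<n. ?P i z * h i z)"
  proof
    fix u
    have "?r u 0 = 0" by (simp add: representation_zero)
    then show "\<exists>h. (\<forall>i. h i \<in> A) \<and> (\<lambda>z. ?r u (\<alpha> z)) = (\<lambda>z. \<Sum>i<n. ?P i z * h i z)"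
      using van by (intro grid_ideal[OF Rs Reg_functional[OF M_Reg[OF \<alpha>] r]]) auto
  qed
  then obtain h where h0: "\<And>u. (\<forall>i. h u i \<in> A) \<and> (\<lambda>z. ?r u (\<alpha> z)) = (\<lambda>z. \<Sum>i<n. ?P i z * h u i z)"
    unfolding choice_iff by blast
  have h: "\<And>u i. h u i \<in> A" "\<And>u. (\<lambda>z. ?r u (\<alpha> z)) = (\<lambda>z. \<Sum>i<n. ?P i z * h u i z)" using h0 by blast+
  define \<gamma> where "\<gamma> = (\<lambda>i z. \<Sum>u\<in>basis0. scale (h u i z) u)"
  have \<gamma>: "\<gamma> i \<in> Reg" for i unfolding \<gamma>_def by (rule Reg_sum[OF Reg_base[OF h(1)]])
  have "\<alpha> z = (\<Sum>i<n. scale (?P i z) (\<gamma> i z))" for z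
  proof -
    have "\<alpha> z = (\<Sum>u\<in>basis0. scale (?r u (\<alpha> z)) u)"
      using sum_representation_eq[OF basis0(2) _ basis0(1)] basis0(3) by simp
    also have "\<dots> = (\<Sum>u\<in>basis0. \<Sum>i<n. scale (?P i z * h u i z) u)"
      using fun_cong[OF h(2), of z] by (simp add: scale_sum_left)
    also have "\<dots> = (\<Sum>i<n. scale (?P i z) (\<gamma> i z))"
      by (subst sum.swap) (simp add: \<gamma>_def scale_sum_right)
    finally show ?thesis .
  qed
  then have e: "\<alpha> = (\<lambda>z. \<Sum>i<n. scale (?P i z) (\<gamma> i z))" by blast
  have "\<alpha> = avg \<alpha>" using avg_ident[OF \<alpha>] by simp
  also have "\<dots> = (\<lambda>z. \<Sum>i<n. scale (?P i z) (avg (\<gamma> i) z))"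
    by (subst e) (simp add: avg_sum avg_B[OF B_power_poly])
  finally show ?thesis using avg_M[OF \<gamma>] by (intro exI[of _ "\<lambda>i. avg (\<gamma> i)"]) blast
qed

section \<open>Separating orbits\<close>

definition orbit_free :: "(nat \<Rightarrow> 'k) set \<Rightarrow> bool" where
  "orbit_free xs \<longleftrightarrow> xs \<subseteq> X \<and> (\<forall>x\<in>xs. \<forall>c\<in>carrier \<Gamma>. act_X c x \<in> xs \<longrightarrow> act_X c x = x)"

definition transversal :: "(nat \<Rightarrow> 'k) set \<Rightarrow> bool" where
  "transversal O' \<longleftrightarrow> O' \<subseteq> X \<and> (\<forall>x\<in>X. \<exists>!y. y \<in> O' \<and> y \<in> orbit \<Gamma> act_X x)"

lemma transversal_orbit_free:
  assumes "transversal O'" "xs \<subseteq> O'" shows "orbit_free xs"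
  unfolding orbit_free_def
proof (intro conjI ballI impI)
  show "xs \<subseteq> X" using assms by (auto simp: transversal_def)
  fix x c assume x: "x \<in> xs" "c \<in> carrier \<Gamma>" "act_X c x \<in> xs"
  have xX: "x \<in> X" using assms x(1) by (auto simp: transversal_def)
  have "x \<in> orbit \<Gamma> act_X x" unfolding orbit_def using act_X_one[OF xX] by (force intro: sym)
  moreover have "act_X c x \<in> orbit \<Gamma> act_X x" using x(2) by (auto simp: orbit_def)
  ultimately show "act_X c x = x" using assms x xX unfolding transversal_def by blast
qed

text \<open>
  Distinct orbits are separated by some \<open>t\<^sub>i ^ m\<^sub>i\<close>; multiply the corresponding linear polynomials.
\<close>

lemma separate_points:
  assumes xs: "finite xs" "orbit_free xs" and x: "x \<in> xs"
  shows "\<exists>b\<in>B. b x = 1 \<and> (\<forall>y\<in>xs. y \<noteq> x \<longrightarrow> b y = 0)"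
proof -
  have xX: "x \<in> X" using xs(2) x by (auto simp: orbit_free_def)
  have "\<exists>b\<in>B. b x = 1 \<and> (\<forall>y\<in>Y. b y = 0)" if "finite Y" "Y \<subseteq> xs - {x}" for Y
    using that
  proof (induction Y rule: finite_induct)
    case empty
    show ?case using B_const_fun[of 1] xX by (intro bexI[of _ "const_fun 1"]) (auto simp: const_fun_def)
  next
    case (insert y Y)
    then obtain b where b: "b \<in> B" "b x = 1" "\<forall>y\<in>Y. b y = 0" by blast
    have y: "y \<in> xs" "y \<noteq> x" using insert.prems by auto
    have yX: "y \<in> X" using xs(2) y(1) by (auto simp: orbit_free_def)
    have "\<exists>i<n. x i ^ m i \<noteq> y i ^ m i"
    proof (rule ccontr)
      assume "\<not> ?thesis"
      then obtain c where c: "c \<in> carrier \<Gamma>" "y = act_X c x" using same_orbitI[OF xX yX] by blast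
      then show False using xs(2) x y unfolding orbit_free_def by blast
    qed
    then obtain i where i: "i < n" "x i ^ m i \<noteq> y i ^ m i" by blast
    define d where "d = inverse (x i ^ m i - y i ^ m i)"
    let ?b = "\<lambda>z. power_poly i (smult d [:-(y i ^ m i), 1:]) z * b z"
    have "?b \<in> B" by (intro B_mult B_power_poly i b)
    moreover have "?b x = 1"
    proof -
      have "?b x = d * (x i ^ m i - y i ^ m i)" using b(2) xX by (simp add: power_poly_def algebra_simps)
      also have "\<dots> = 1" using i(2) by (simp add: d_def)
      finally show ?thesis .
    qed
    moreover have "\<forall>y\<in>insert y Y. ?b y = 0" using b(3) by (auto simp: power_poly_def)
    ultimately show ?case by (intro bexI[of _ ?b] conjI)
  qed
  from this[of "xs - {x}"] show ?thesis using xs(1) by auto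
qed

text \<open>
  Multiply the equivariant maps of \<open>ev_surj\<close> by the invariant functions of \<open>separate_points\<close>.
\<close>

lemma site_elements:
  assumes xs: "finite xs" "orbit_free xs"
  obtains \<delta> where "\<And>x u. x \<in> xs \<Longrightarrow> \<delta> x u \<in> M" "\<And>x u. x \<in> xs \<Longrightarrow> \<delta> x u x = u"
    "\<And>x u y. x \<in> xs \<Longrightarrow> y \<in> xs \<Longrightarrow> y \<noteq> x \<Longrightarrow> \<delta> x u y = 0"
proof -
  have "\<forall>x\<in>xs. \<exists>b. b \<in> B \<and> b x = 1 \<and> (\<forall>y\<in>xs. y \<noteq> x \<longrightarrow> b y = 0)"
    using separate_points[OF xs] by blast
  from bchoice[OF this] obtain b where b: "\<And>x. x \<in> xs \<Longrightarrow> b x \<in> B \<and> b x x = 1 \<and> (\<forall>y\<in>xs. y \<noteq> x \<longrightarrow> b x y = 0)"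
    by blast
  have xX: "x \<in> X" if "x \<in> xs" for x using xs(2) that by (auto simp: orbit_free_def)
  define \<delta> where "\<delta> = (\<lambda>x u z. scale (b x z) (\<Sum>e\<in>carrier \<Gamma>. scale (monomial (\<lambda>i. - e i) x) (gen e u z)))"
  show ?thesis
  proof (rule that[of \<delta>])
    fix x u assume x: "x \<in> xs"
    show "\<delta> x u \<in> M" unfolding \<delta>_def by (rule M_mult[OF ev_surj(1)[OF xX[OF x]]]) (use b x in blast)
    show "\<delta> x u x = u" unfolding \<delta>_def using b[OF x] ev_surj(2)[OF xX[OF x]] by simp
    show "\<delta> x u y = 0" if "y \<in> xs" "y \<noteq> x" for y unfolding \<delta>_def using b[OF x] that by simp
  qed
qed

end

section \<open>The kernel of an irreducible representation\<close>

text \<open>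
  Coordinates with respect to a basis, extended by zero.
\<close>

lemma seq_model:
  fixes s :: "'k::field \<Rightarrow> 'v::ab_group_add \<Rightarrow> 'v"
  assumes s: "vector_space s" and V: "fin_dim s V"
  obtains \<iota> \<kappa> and V' :: "'k seq set" where "fin_dim seq_scale V'" "linear_on s seq_scale V V' \<iota>"
    "linear_on seq_scale s V' V \<kappa>" "\<And>v. v \<in> V \<Longrightarrow> \<kappa> (\<iota> v) = v" "\<And>y. y \<in> V' \<Longrightarrow> \<iota> (\<kappa> y) = y"
proof -
  interpret lin_space s using s by (simp add: lin_space_def)
  interpret q: lin_space "seq_scale :: 'k \<Rightarrow> _" using vector_space_seq by (simp add: lin_space_def)
  interpret vp: vector_space_pair s "seq_scale :: 'k \<Rightarrow> _" by unfold_locales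
  obtain B where B: "finite B" "independent B" "span B = V" "B \<subseteq> V" using V by (rule fin_dim_basis)
  obtain g :: "'v \<Rightarrow> nat" where g: "inj_on g B" using finite_imp_inj_to_nat_seg[OF B(1)] by blast
  define e where "e = (\<lambda>b j. if j = g b then (1::'k) else 0)"
  obtain \<iota> where i: "Vector_Spaces.linear s seq_scale \<iota>" "\<And>b. b \<in> B \<Longrightarrow> \<iota> b = e b"
    using vp.linear_independent_extend[OF B(2), of e] by blast
  interpret i: Vector_Spaces.linear s "seq_scale :: 'k \<Rightarrow> _" \<iota> by (rule i(1))
  have inj0: "v = 0" if v: "v \<in> V" "\<iota> v = 0" for v
  proof -
    have v_eq: "v = (\<Sum>b\<in>B. s (representation B v b) b)"
      using sum_representation_eq[OF B(2) _ B(1)] v(1) B(3) by simp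
    have "\<iota> v = (\<Sum>b\<in>B. seq_scale (representation B v b) (e b))"
      by (subst v_eq) (simp add: i.sum i.scale i(2))
    then have s0: "(\<Sum>b\<in>B. seq_scale (representation B v b) (e b)) = 0" using v(2) by metis
    have 0: "(\<Sum>b\<in>B. representation B v b * e b j) = 0" for j
    proof -
      have "(\<Sum>b\<in>B. representation B v b * e b j) = (\<Sum>b\<in>B. seq_scale (representation B v b) (e b)) j"
        by (simp only: sum_fun_apply fun_scale_def)
      then show ?thesis unfolding s0 by simp
    qed
    have "representation B v b = 0" if b: "b \<in> B" for b
    proof -
      have "(\<Sum>b'\<in>B. representation B v b' * e b' (g b)) = (\<Sum>b'\<in>B. if b' = b then representation B v b else 0)"
        by (rule sum.cong) (use g b in \<open>auto simp: e_def inj_on_def\<close>)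
      then show ?thesis using 0[of "g b"] b B(1) by simp
    qed
    then show ?thesis by (subst v_eq) simp
  qed
  have subV: "subspace V" using V by (rule fin_dim_subspace)
  have inj: "inj_on \<iota> V"
  proof (rule inj_onI)
    fix u v assume "u \<in> V" "v \<in> V" "\<iota> u = \<iota> v"
    then have "u - v = 0" using subspace_diff[OF subV] by (intro inj0) (auto simp: i.diff)
    then show "u = v" by simp
  qed
  define \<kappa> where "\<kappa> = inv_into V \<iota>"
  have \<kappa>\<iota>: "\<kappa> (\<iota> v) = v" if "v \<in> V" for v using inv_into_f_f[OF inj that] by (simp add: \<kappa>_def)
  have "q.span (\<iota> ` B) = \<iota> ` V" using i.span_image[of B] B(3) by simp
  then have "fin_dim seq_scale (\<iota> ` V)" unfolding fin_dim_def using B(1) by blast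
  moreover have "linear_on s seq_scale V (\<iota> ` V) \<iota>" by (auto simp: linear_on_def i.add i.scale)
  moreover have "linear_on seq_scale s (\<iota> ` V) V \<kappa>"
    unfolding linear_on_def
  proof (intro conjI ballI allI)
    fix y assume "y \<in> \<iota> ` V"
    then obtain v where v: "v \<in> V" "y = \<iota> v" by blast
    show "\<kappa> y \<in> V" using v \<kappa>\<iota> by simp
    show "\<kappa> (seq_scale c y) = s c (\<kappa> y)" for c
      using \<kappa>\<iota>[of "s c v"] subspace_scale[OF subV v(1)] v \<kappa>\<iota> by (simp add: i.scale)
    fix y' assume "y' \<in> \<iota> ` V"
    then obtain v' where v': "v' \<in> V" "y' = \<iota> v'" by blast
    show "\<kappa> (y + y') = \<kappa> y + \<kappa> y'"
      using \<kappa>\<iota>[of "v + v'"] subspace_add[OF subV v(1) v'(1)] v v' \<kappa>\<iota> by (simp add: i.add)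
  qed
  moreover have "\<iota> (\<kappa> y) = y" if "y \<in> \<iota> ` V" for y using that \<kappa>\<iota> by auto
  ultimately show ?thesis using that \<kappa>\<iota> by blast
qed

locale multiloop_irrep = multiloop scale bracket n m \<sigma> \<xi> + W: alg_closed_space sW
  for scale :: "'k::{alg_closed_field, field_char_0} \<Rightarrow> 'g::ab_group_add \<Rightarrow> 'g" and bracket n m \<sigma> \<xi>
    and sW :: "'k \<Rightarrow> 'w::ab_group_add \<Rightarrow> 'w" +
  fixes W :: "'w set" and \<tau> :: "((nat \<Rightarrow> 'k) \<Rightarrow> 'g) \<Rightarrow> 'w \<Rightarrow> 'w"
  assumes rep: "lie_rep M_scale M_bracket M sW (W, \<tau>)" and fdW: "fin_dim sW W"
    and irr: "irreducible_rep M sW (W, \<tau>)"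
begin

lemma subW: "W.subspace W" by (rule W.fin_dim_subspace[OF fdW])

lemma \<tau>_on:
  "\<alpha> \<in> M \<Longrightarrow> w \<in> W \<Longrightarrow> \<tau> \<alpha> w \<in> W" "\<alpha> \<in> M \<Longrightarrow> v \<in> W \<Longrightarrow> w \<in> W \<Longrightarrow> \<tau> \<alpha> (v + w) = \<tau> \<alpha> v + \<tau> \<alpha> w"
  "\<alpha> \<in> M \<Longrightarrow> w \<in> W \<Longrightarrow> \<tau> \<alpha> (sW c w) = sW c (\<tau> \<alpha> w)"
  "\<alpha> \<in> M \<Longrightarrow> \<beta> \<in> M \<Longrightarrow> w \<in> W \<Longrightarrow> \<tau> (\<lambda>z. \<alpha> z + \<beta> z) w = \<tau> \<alpha> w + \<tau> \<beta> w"
  "\<alpha> \<in> M \<Longrightarrow> w \<in> W \<Longrightarrow> \<tau> (\<lambda>z. scale c (\<alpha> z)) w = sW c (\<tau> \<alpha> w)"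
  "\<alpha> \<in> M \<Longrightarrow> \<beta> \<in> M \<Longrightarrow> w \<in> W \<Longrightarrow> \<tau> (\<lambda>z. bracket (\<alpha> z) (\<beta> z)) w = \<tau> \<alpha> (\<tau> \<beta> w) - \<tau> \<beta> (\<tau> \<alpha> w)"
  using rep unfolding lie_rep_def linear_on_def M_scale_def M_bracket_def fun_scale_def plus_fun_def by auto

text \<open>
  A projection onto \<open>W\<close>.  It turns the operators of the representation, meaningful on \<open>W\<close> only, into
  total linear operators \<open>T \<alpha>\<close>.
\<close>

definition p where "p = (SOME p. linear_op sW p \<and> (\<forall>v. p v \<in> W) \<and> (\<forall>w\<in>W. p w = w))"

lemma p: "linear_op sW p" "p v \<in> W" "w \<in> W \<Longrightarrow> p w = w"
proof -
  obtain q where "linear_op sW q" "\<And>v. q v \<in> W" "\<And>w. w \<in> W \<Longrightarrow> q w = w"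
    using subW by (rule W.subspace_projection) (rule that)
  then have "\<exists>p. linear_op sW p \<and> (\<forall>v. p v \<in> W) \<and> (\<forall>w\<in>W. p w = w)" by blast
  then have "linear_op sW p \<and> (\<forall>v. p v \<in> W) \<and> (\<forall>w\<in>W. p w = w)"
    unfolding p_def by (rule someI_ex)
  then show "linear_op sW p" "p v \<in> W" "w \<in> W \<Longrightarrow> p w = w" by auto
qed

definition T where "T \<alpha> w = \<tau> \<alpha> (p w)"

lemma T_linear: "\<alpha> \<in> M \<Longrightarrow> linear_op sW (T \<alpha>)"
  by (rule W.linearI) (auto simp: T_def W.linearD[OF p(1)] \<tau>_on p(2))

lemma T_in: "\<alpha> \<in> M \<Longrightarrow> T \<alpha> w \<in> W" by (simp add: T_def \<tau>_on p(2))

lemma T_\<tau>: "w \<in> W \<Longrightarrow> T \<alpha> w = \<tau> \<alpha> w" by (simp add: T_def p(3))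

lemma T_add: "\<alpha> \<in> M \<Longrightarrow> \<beta> \<in> M \<Longrightarrow> T (\<lambda>z. \<alpha> z + \<beta> z) w = T \<alpha> w + T \<beta> w"
  by (simp add: T_def \<tau>_on p(2))

lemma T_scale: "\<alpha> \<in> M \<Longrightarrow> T (\<lambda>z. scale c (\<alpha> z)) w = sW c (T \<alpha> w)"
  by (simp add: T_def \<tau>_on p(2))

lemma T_bracket: "\<alpha> \<in> M \<Longrightarrow> \<beta> \<in> M \<Longrightarrow> T (\<lambda>z. bracket (\<alpha> z) (\<beta> z)) w = T \<alpha> (T \<beta> w) - T \<beta> (T \<alpha> w)"
  by (simp add: T_def \<tau>_on p)

lemma T_zero: "T (\<lambda>z. 0) w = 0"
  using T_scale[OF M_zero, of 0 w] by simp

lemma T_sum: "(\<And>k. k \<in> K \<Longrightarrow> \<alpha> k \<in> M) \<Longrightarrow> T (\<lambda>z. \<Sum>k\<in>K. \<alpha> k z) w = (\<Sum>k\<in>K. T (\<alpha> k) w)"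
  by (induction K rule: infinite_finite_induct) (auto simp: T_zero T_add M_sum)

lemma T_diff: "\<alpha> \<in> M \<Longrightarrow> \<beta> \<in> M \<Longrightarrow> T (\<lambda>z. \<alpha> z - \<beta> z) w = T \<alpha> w - T \<beta> w"
  using T_add[OF _ M_scl[of \<beta> "-1"], of \<alpha> w] T_scale[of \<beta> "-1" w] by simp

lemma M_diff: "\<alpha> \<in> M \<Longrightarrow> \<beta> \<in> M \<Longrightarrow> (\<lambda>z. \<alpha> z - \<beta> z) \<in> M"
  using M_add[OF _ M_scl[of \<beta> "-1"], of \<alpha>] by simp

lemma W_ne: "W \<noteq> {0}" using irr by (simp add: irreducible_rep_def)

lemma W_irr:
  assumes "W.subspace U" "U \<subseteq> W" "\<And>\<alpha> u. \<alpha> \<in> M \<Longrightarrow> u \<in> U \<Longrightarrow> T \<alpha> u \<in> U" "u \<in> U" "u \<noteq> 0"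
  shows "U = W"
proof -
  have "\<tau> \<alpha> u \<in> U" if "\<alpha> \<in> M" "u \<in> U" for \<alpha> u using assms(3)[OF that] assms(2) that(2) T_\<tau> by auto
  then show ?thesis using irr assms unfolding irreducible_rep_def by blast
qed

text \<open>
  The kernel of the representation.
\<close>

definition K where "K = {\<alpha> \<in> M. \<forall>w. T \<alpha> w = 0}"

lemma K_T: "\<alpha> \<in> K \<Longrightarrow> T \<alpha> w = 0" by (auto simp: K_def)

lemma K_sum: "(\<And>k. k \<in> I \<Longrightarrow> \<alpha> k \<in> K) \<Longrightarrow> (\<lambda>z. \<Sum>k\<in>I. \<alpha> k z) \<in> K"
  by (auto simp: K_def T_sum intro: M_sum)

lemma K_bracket: "\<alpha> \<in> K \<Longrightarrow> \<beta> \<in> M \<Longrightarrow> (\<lambda>z. bracket (\<alpha> z) (\<beta> z)) \<in> K"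
  by (auto simp: K_def T_bracket M_br W.linearD[OF T_linear])

text \<open>
  If \<open>T \<nu>\<close> commutes with its commutator with \<open>T x\<close>, then \<open>T x\<close> raises the nilpotency exponent of
  \<open>T \<nu> - a\<close> by at most one.
\<close>

lemma gen_eig_ad_invariant:
  assumes x: "x \<in> M" and \<nu>: "\<nu> \<in> M" and Q: "\<And>w. T (\<lambda>z. bracket (x z) (\<nu> z)) (T \<nu> w) = T \<nu> (T (\<lambda>z. bracket (x z) (\<nu> z)) w)"
  shows "(W.shift (T \<nu>) a ^^ k) w = 0 \<Longrightarrow> w \<in> W \<Longrightarrow> (W.shift (T \<nu>) a ^^ Suc k) (T x w) = 0"
proof (induction k arbitrary: w)
  case 0
  then show ?case using W.linearD(3)[OF T_linear[OF x]] W.linearD(3)[OF W.linear_shift[OF T_linear[OF \<nu>]]] by simp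
next
  case (Suc k)
  let ?D = "W.shift (T \<nu>) a" and ?Q = "T (\<lambda>z. bracket (x z) (\<nu> z))"
  note lD = W.linear_shift[OF T_linear[OF \<nu>], of a]
  have lQ: "linear_op sW ?Q" by (rule T_linear[OF M_br[OF x \<nu>]])
  have D: "?D (T x w) = T x (?D w) - ?Q w"
    by (simp add: W.shift_def T_bracket[OF x \<nu>] W.linearD[OF T_linear[OF x]])
  have QD: "?D (?Q v) = ?Q (?D v)" for v by (simp add: W.shift_def Q W.linearD[OF lQ])
  have QDk: "(?D ^^ j) (?Q v) = ?Q ((?D ^^ j) v)" for j v by (induction j) (auto simp: QD)
  have "?D w \<in> W" using Suc.prems(2) T_in[OF \<nu>] subW by (auto simp: W.shift_def intro: W.subspace_diff W.subspace_scale)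
  moreover have "(?D ^^ k) (?D w) = 0" using Suc.prems(1) by (simp add: funpow_swap1)
  ultimately have 1: "(?D ^^ Suc k) (T x (?D w)) = 0" by (rule Suc.IH[rotated])
  have "(?D ^^ Suc (Suc k)) (T x w) = (?D ^^ Suc k) (T x (?D w) - ?Q w)"
    by (simp only: funpow_Suc_right comp_apply D)
  also have "\<dots> = (?D ^^ Suc k) (T x (?D w)) - (?D ^^ Suc k) (?Q w)"
    by (rule W.linearD(5)[OF W.linear_funpow[OF lD]])
  also have "\<dots> = 0" unfolding 1 QDk Suc.prems(1) by (simp add: W.linearD[OF lQ])
  finally show ?case .
qed

text \<open>
  An ideal \<open>N\<close> with commuting image acts by zero provided it is spanned by commutators with \<open>M\<close>.  Each
  generalized eigenspace of \<open>T \<nu>\<close> is stable under \<open>M\<close>, so \<open>T \<nu>\<close> has a single eigenvalue; it is zero since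
  \<open>T \<nu>\<close> is a sum of commutators and has trace zero.  A commuting family of nilpotent operators has a
  nonzero common kernel, which is stable under \<open>M\<close>.
\<close>

lemma abelian_ideal_trivial:
  fixes Ks :: "'c set"
  assumes N: "N \<subseteq> M" "\<And>\<alpha> \<nu>. \<alpha> \<in> M \<Longrightarrow> \<nu> \<in> N \<Longrightarrow> (\<lambda>z. bracket (\<alpha> z) (\<nu> z)) \<in> N"
    and ab: "\<And>\<nu> \<nu>'. \<nu> \<in> N \<Longrightarrow> \<nu>' \<in> N \<Longrightarrow> (\<lambda>z. bracket (\<nu> z) (\<nu>' z)) \<in> K"
    and perf: "\<And>\<nu>. \<nu> \<in> N \<Longrightarrow> \<exists>\<alpha> \<mu>. (\<forall>k\<in>Ks. \<alpha> k \<in> M \<and> \<mu> k \<in> N) \<and> \<nu> = (\<lambda>z. \<Sum>k\<in>Ks. bracket (\<alpha> k z) (\<mu> k z))"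
  shows "N \<subseteq> K"
proof -
  have NM: "\<nu> \<in> M" if "\<nu> \<in> N" for \<nu> using N(1) that by blast
  have comm: "T \<nu> (T \<nu>' w) = T \<nu>' (T \<nu> w)" if "\<nu> \<in> N" "\<nu>' \<in> N" for \<nu> \<nu>' w
    using K_T[OF ab[OF that], of w] T_bracket[OF NM[OF that(1)] NM[OF that(2)]] by simp
  obtain C where C: "finite C" "W.independent C" "W.span C = W" "C \<subseteq> W" using fdW by (rule W.fin_dim_basis)
  have C_ne: "card C \<noteq> 0" using C W_ne by (auto simp: card_eq_0_iff)
  have nil: "\<exists>k. (T \<nu> ^^ k) w = 0" if \<nu>: "\<nu> \<in> N" and w: "w \<in> W" for \<nu> w
  proof -
    note lT = T_linear[OF NM[OF \<nu>]]
    obtain a v where av: "v \<in> W" "v \<noteq> 0" "T \<nu> v = sW a v"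
      using lT fdW T_in[OF NM[OF \<nu>]] W_ne by (rule W.eigenvector_exists) (rule that)
    let ?U = "W \<inter> W.gen_eig (T \<nu>) a"
    have "?U = W"
    proof (rule W_irr[of _ v])
      show "W.subspace ?U" by (rule W.subspace_inter[OF subW W.subspace_gen_eig[OF lT]])
      have "W.shift (T \<nu>) a v = 0" using av by (simp add: W.shift_def)
      then show "v \<in> ?U" using av(1) by (auto simp: W.gen_eig_def intro!: exI[of _ 1])
      fix x u assume x: "x \<in> M" and u: "u \<in> ?U"
      from u obtain k where "(W.shift (T \<nu>) a ^^ k) u = 0" by (auto simp: W.gen_eig_def)
      then have "(W.shift (T \<nu>) a ^^ Suc k) (T x u) = 0"
        using gen_eig_ad_invariant[OF x NM[OF \<nu>] comm[OF N(2)[OF x \<nu>] \<nu>]] u by blast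
      then have "T x u \<in> W.gen_eig (T \<nu>) a" unfolding W.gen_eig_def by blast
      then show "T x u \<in> ?U" using T_in[OF x] by blast
    qed (use av in auto)
    then have WU: "W \<subseteq> W.gen_eig (T \<nu>) a" by blast
    have "W.tr C (T \<nu>) = a * of_nat (card C)"
      by (rule W.tr_gen_eig[OF lT C(1,2)]) (use C T_in[OF NM[OF \<nu>]] WU in auto)
    moreover have "W.tr C (T \<nu>) = 0"
    proof -
      obtain \<alpha> \<mu> where am: "\<And>k. k \<in> Ks \<Longrightarrow> \<alpha> k \<in> M \<and> \<mu> k \<in> N" "\<nu> = (\<lambda>z. \<Sum>k\<in>Ks. bracket (\<alpha> k z) (\<mu> k z))"
        using perf[OF \<nu>] by blast
      have tr0: "W.tr C (T (\<lambda>z. bracket (\<alpha> k z) (\<mu> k z))) = 0" if k: "k \<in> Ks" for k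
      proof -
        have M: "\<alpha> k \<in> M" "\<mu> k \<in> M" using am(1)[OF k] NM by auto
        let ?c = "\<lambda>v. T (\<alpha> k) (T (\<mu> k) v)" and ?d = "\<lambda>v. T (\<mu> k) (T (\<alpha> k) v)"
        have e: "T (\<lambda>z. bracket (\<alpha> k z) (\<mu> k z)) = (\<lambda>v. ?c v + sW (-1) (?d v))"
          by (auto simp: T_bracket[OF M])
        have "W.tr C (\<lambda>v. ?c v + sW (-1) (?d v)) = W.tr C ?c + W.tr C (\<lambda>v. sW (-1) (?d v))"
          by (rule W.tr_add[OF C(1,2)]) (use T_in M C(3) subW in \<open>auto intro: W.subspace_neg\<close>)
        also have "W.tr C (\<lambda>v. sW (-1) (?d v)) = - 1 * W.tr C ?d"
          by (rule W.tr_scale[OF C(1,2)]) (use T_in M C(3) in auto)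
        also have "W.tr C ?d = W.tr C ?c"
          by (rule W.tr_comp_commute[OF C(1,2)]) (use T_in T_linear M C(3) in auto)
        finally show ?thesis unfolding e by simp
      qed
      have "T \<nu> = (\<lambda>w. \<Sum>k\<in>Ks. T (\<lambda>z. bracket (\<alpha> k z) (\<mu> k z)) w)"
      proof
        fix w show "T \<nu> w = (\<Sum>k\<in>Ks. T (\<lambda>z. bracket (\<alpha> k z) (\<mu> k z)) w)"
          unfolding am(2) by (rule T_sum) (use am(1) NM M_br in blast)
      qed
      moreover have "W.tr C (\<lambda>w. \<Sum>k\<in>Q. T (\<lambda>z. bracket (\<alpha> k z) (\<mu> k z)) w) = 0" if "Q \<subseteq> Ks" for Q
        using that
      proof (induction Q rule: infinite_finite_induct)
        case (insert k Q)
        have M': "(\<lambda>z. bracket (\<alpha> k z) (\<mu> k z)) \<in> M" if "k \<in> Ks" for k using am(1)[OF that] NM M_br by blast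
        have "W.tr C (\<lambda>w. T (\<lambda>z. bracket (\<alpha> k z) (\<mu> k z)) w + (\<Sum>k\<in>Q. T (\<lambda>z. bracket (\<alpha> k z) (\<mu> k z)) w))
          = W.tr C (T (\<lambda>z. bracket (\<alpha> k z) (\<mu> k z))) + W.tr C (\<lambda>w. \<Sum>k\<in>Q. T (\<lambda>z. bracket (\<alpha> k z) (\<mu> k z)) w)"
          by (rule W.tr_add[OF C(1,2)]) (use insert.prems T_in[OF M'] C(3) subW in \<open>auto intro!: W.subspace_sum\<close>)
        then show ?case using insert tr0 by simp
      qed (auto simp: W.tr_def W.representation_zero)
      ultimately show ?thesis by simp
    qed
    ultimately have "a = 0" using C_ne by simp
    then have "w \<in> W.gen_eig (T \<nu>) 0" using WU w by blast
    moreover have "W.shift (T \<nu>) 0 = T \<nu>" by (auto simp: W.shift_def)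
    ultimately show ?thesis by (simp add: W.gen_eig_def)
  qed
  let ?inv = "\<lambda>Z. \<forall>\<nu>\<in>N. \<forall>z\<in>Z. T \<nu> z \<in> Z"
  obtain Z where Z: "W.subspace Z" "Z \<subseteq> W" "Z \<noteq> {0}" "?inv Z"
    "\<And>Z'. W.subspace Z' \<Longrightarrow> Z' \<subseteq> Z \<Longrightarrow> Z' \<noteq> {0} \<Longrightarrow> ?inv Z' \<Longrightarrow> Z' = Z"
  proof (rule W.fin_dim_minimal_subspace[OF fdW W_ne, of ?inv])
    show "?inv W" using T_in NM by blast
  qed (rule that)
  have kill: "T \<nu> z = 0" if \<nu>: "\<nu> \<in> N" and z: "z \<in> Z" for \<nu> z
  proof -
    let ?Z' = "{z \<in> Z. T \<nu> z = 0}"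
    note lT = T_linear[OF NM[OF \<nu>]]
    have "?Z' = Z"
    proof (rule Z(5))
      show "W.subspace ?Z'"
        by (rule W.subspaceI) (use Z(1) in \<open>auto simp: W.linearD[OF lT] W.subspace_0 W.subspace_add W.subspace_scale\<close>)
      show "?inv ?Z'" using Z(4) comm[OF _ \<nu>] W.linearD(3)[OF T_linear[OF NM]] \<nu> by (auto simp: comm[OF \<nu>])
      obtain z0 where z0: "z0 \<in> Z" "z0 \<noteq> 0" using Z(1,3) W.subspace_0 by blast
      obtain k where "(T \<nu> ^^ k) z0 = 0" using nil[OF \<nu>] z0 Z(2) by blast
      then show "?Z' \<noteq> {0}" using z0
      proof (induction k arbitrary: z0)
        case (Suc k)
        show ?case
        proof (cases "T \<nu> z0 = 0")
          case False
          then show ?thesis using Suc.IH[of "T \<nu> z0"] Suc.prems Z(4) \<nu> by (auto simp: funpow_swap1)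
        qed (use Suc.prems in auto)
      qed simp
    qed auto
    then show ?thesis using z by blast
  qed
  let ?U = "{w \<in> W. \<forall>\<nu>\<in>N. T \<nu> w = 0}"
  obtain z0 where z0: "z0 \<in> Z" "z0 \<noteq> 0" using Z(1,3) W.subspace_0 by blast
  have "?U = W"
  proof (rule W_irr[of _ z0])
    show "W.subspace ?U"
      by (rule W.subspaceI) (use subW NM in \<open>auto simp: W.linearD[OF T_linear] W.subspace_0 W.subspace_add W.subspace_scale\<close>)
    show "z0 \<in> ?U" using z0 Z(2) kill by blast
    fix \<alpha> u assume \<alpha>: "\<alpha> \<in> M" and u: "u \<in> ?U"
    have "T \<nu> (T \<alpha> u) = 0" if \<nu>: "\<nu> \<in> N" for \<nu>
    proof -
      have "T (\<lambda>z. bracket (\<alpha> z) (\<nu> z)) u = 0" using u N(2)[OF \<alpha> \<nu>] by blast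
      then show ?thesis using T_bracket[OF \<alpha> NM[OF \<nu>], of u] u \<nu> W.linearD(3)[OF T_linear[OF \<alpha>]] by simp
    qed
    then show "T \<alpha> u \<in> ?U" using T_in[OF \<alpha>] by blast
  qed (use z0 in auto)
  then have "T \<nu> w = 0" if "\<nu> \<in> N" "w \<in> W" for \<nu> w using that by blast
  then have "T \<nu> w = 0" if "\<nu> \<in> N" for \<nu> w using that p(2,3) unfolding T_def by metis
  then show ?thesis using NM by (auto simp: K_def)
qed

text \<open>
  The largest ideal of \<open>B\<close> that multiplies \<open>M\<close> into the kernel.
\<close>

definition J where "J = {b \<in> B. \<forall>\<alpha>\<in>M. (\<lambda>z. scale (b z) (\<alpha> z)) \<in> K}"

lemma J_mult: "b \<in> J \<Longrightarrow> c \<in> B \<Longrightarrow> (\<lambda>z. c z * b z) \<in> J"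
  unfolding J_def using B_mult M_mult by (auto simp: mult.commute[of "c _"] simp flip: scale_scale)

text \<open>
  For \<open>b\<^sup>2 \<in> J\<close> the ideal \<open>b M\<close> has commuting image, and \<open>strong_perfect\<close> exhibits it as \<open>[M, b M]\<close>.
\<close>

lemma J_radical:
  assumes b: "b \<in> B" and b2: "(\<lambda>z. b z * b z) \<in> J"
  shows "b \<in> J"
proof -
  let ?N = "{\<lambda>z. scale (b z) (\<alpha> z) | \<alpha>. \<alpha> \<in> M}"
  have "?N \<subseteq> K"
  proof (rule abelian_ideal_trivial)
    show "?N \<subseteq> M" using M_mult[OF _ b] by blast
    show "(\<lambda>z. bracket (\<alpha> z) (\<nu> z)) \<in> ?N" if "\<alpha> \<in> M" "\<nu> \<in> ?N" for \<alpha> \<nu>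
    proof -
      from that(2) obtain \<beta> where "\<nu> = (\<lambda>z. scale (b z) (\<beta> z))" "\<beta> \<in> M" by blast
      then have "(\<lambda>z. bracket (\<alpha> z) (\<nu> z)) = (\<lambda>z. scale (b z) (bracket (\<alpha> z) (\<beta> z)))" "(\<lambda>z. bracket (\<alpha> z) (\<beta> z)) \<in> M"
        using M_br that(1) by (auto simp: bracket_simps)
      then show ?thesis by (intro CollectI exI[of _ "\<lambda>z. bracket (\<alpha> z) (\<beta> z)"] conjI)
    qed
    show "(\<lambda>z. bracket (\<nu> z) (\<nu>' z)) \<in> K" if "\<nu> \<in> ?N" "\<nu>' \<in> ?N" for \<nu> \<nu>'
    proof -
      from that obtain \<alpha> \<beta> where n: "\<nu> = (\<lambda>z. scale (b z) (\<alpha> z))" "\<alpha> \<in> M" "\<nu>' = (\<lambda>z. scale (b z) (\<beta> z))" "\<beta> \<in> M" by blast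
      have "(\<lambda>z. scale (b z * b z) (bracket (\<alpha> z) (\<beta> z))) \<in> K"
      proof -
        have "\<forall>\<alpha>\<in>M. (\<lambda>z. scale (b z * b z) (\<alpha> z)) \<in> K" using b2 by (simp add: J_def)
        from bspec[OF this M_br[OF n(2,4)]] show ?thesis .
      qed
      then show ?thesis by (simp add: n bracket_simps)
    qed
    fix \<nu> assume "\<nu> \<in> ?N"
    then obtain \<beta> where n: "\<nu> = (\<lambda>z. scale (b z) (\<beta> z))" "\<beta> \<in> M" by blast
    obtain \<delta> where d: "\<And>u e. \<delta> u e \<in> M" "\<beta> = (\<lambda>z. \<Sum>u\<in>basis0. \<Sum>e\<in>carrier \<Gamma>. bracket (gen e u z) (\<delta> u e z))"
      using strong_perfect[OF n(2)] by blast
    show "\<exists>\<alpha> \<mu>. (\<forall>k\<in>basis0 \<times> carrier \<Gamma>. \<alpha> k \<in> M \<and> \<mu> k \<in> ?N) \<and> \<nu> = (\<lambda>z. \<Sum>k\<in>basis0 \<times> carrier \<Gamma>. bracket (\<alpha> k z) (\<mu> k z))"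
    proof (intro exI conjI)
      let ?\<alpha> = "\<lambda>k. gen (snd k) (fst k)" and ?\<mu> = "\<lambda>k z. scale (b z) (\<delta> (fst k) (snd k) z)"
      show "\<forall>k\<in>basis0 \<times> carrier \<Gamma>. ?\<alpha> k \<in> M \<and> ?\<mu> k \<in> ?N" using gen_M d(1) by blast
      show "\<nu> = (\<lambda>z. \<Sum>k\<in>basis0 \<times> carrier \<Gamma>. bracket (?\<alpha> k z) (?\<mu> k z))"
        by (simp add: n(1) d(2) scale_sum_right bracket_simps sum.cartesian_product case_prod_beta)
    qed
  qed
  then show ?thesis using b unfolding J_def by blast
qed

lemma power_poly_mult: "power_poly i (q * r) = (\<lambda>z. power_poly i q z * power_poly i r z)"
  by (auto simp: power_poly_def)

lemma power_poly_power_J: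
  assumes i: "i < n" and N: "N > 0" "power_poly i (q ^ N) \<in> J"
  shows "power_poly i q \<in> J"
  using N
proof (induction N rule: less_induct)
  case (less N)
  show ?case
  proof (cases "N = 1")
    case True
    then show ?thesis using less.prems by simp
  next
    case False
    define k where "k = (N + 1) div 2"
    have k: "k < N" "k > 0" "2 * k \<ge> N" using False less.prems(1) by (auto simp: k_def)
    have "q ^ k * q ^ k = q ^ (2 * k - N) * q ^ N" using k(3) by (simp add: mult_2 flip: power_add)
    then have "power_poly i (q ^ k * q ^ k) = power_poly i (q ^ (2 * k - N) * q ^ N)" by (rule arg_cong)
    then have "(\<lambda>z. power_poly i (q ^ k) z * power_poly i (q ^ k) z) = (\<lambda>z. power_poly i (q ^ (2 * k - N)) z * power_poly i (q ^ N) z)"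
      unfolding power_poly_mult .
    then have "(\<lambda>z. power_poly i (q ^ k) z * power_poly i (q ^ k) z) \<in> J"
      using J_mult[OF less.prems(2) B_power_poly[OF i, of "q ^ (2 * k - N)"]] by (simp only:)
    then have "power_poly i (q ^ k) \<in> J" by (rule J_radical[OF B_power_poly[OF i]])
    then show ?thesis using less.IH[OF k(1,2)] by blast
  qed
qed

text \<open>
  The condition that \<open>q\<close>, evaluated at \<open>t\<^sub>i ^ m\<^sub>i\<close>, multiplies each of the finitely many fixed elements of
  \<open>strong_perfect\<close> into the kernel amounts to finitely many linear equations for the coefficients of \<open>q\<close>.
  Since \<open>K\<close> is an ideal, it is enough to meet these.
\<close>

lemma finite_codim:
  assumes i: "i < n"
  obtains q where "q \<noteq> 0" "power_poly i q \<in> J"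
proof -
  obtain C where C: "finite C" "W.independent C" "W.span C = W" "C \<subseteq> W" using fdW by (rule W.fin_dim_basis)
  obtain D :: "'w set" and \<phi> where D: "finite D" "\<And>c. Vector_Spaces.linear sW (*) (\<phi> c)"
    "\<And>w. w \<in> W \<Longrightarrow> (\<And>c. c \<in> D \<Longrightarrow> \<phi> c w = (0::'k)) \<Longrightarrow> w = 0"
    using W.coordinate_functionals[OF fdW] by metis
  have vs: "vector_space ((*)::'k \<Rightarrow> 'k \<Rightarrow> 'k)" by unfold_locales (auto simp: algebra_simps)
  have pg: "(\<lambda>z. scale (power_poly i q z) (gen e u z)) \<in> M" for q e u by (rule M_mult[OF gen_M B_power_poly[OF i]])
  let ?F = "basis0 \<times> carrier \<Gamma> \<times> C \<times> D"
  let ?\<psi> = "\<lambda>(u, e, w, c) q. \<phi> c (T (\<lambda>z. scale (power_poly i q z) (gen e u z)) w)"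
  have lin: "Vector_Spaces.linear smult (*) (?\<psi> k)" for k
  proof -
    obtain u e w c where k: "k = (u, e, w, c)" by (cases k)
    have 1: "T (\<lambda>z. scale (power_poly i (q + r) z) (gen e u z)) w
      = T (\<lambda>z. scale (power_poly i q z) (gen e u z)) w + T (\<lambda>z. scale (power_poly i r z) (gen e u z)) w" for q r
    proof -
      have "(\<lambda>z. scale (power_poly i (q + r) z) (gen e u z)) = (\<lambda>z. scale (power_poly i q z) (gen e u z) + scale (power_poly i r z) (gen e u z))"
        by (auto simp: power_poly_def scale_left_distrib)
      then show ?thesis using T_add[OF pg pg] by simp
    qed
    have 2: "T (\<lambda>z. scale (power_poly i (smult a q) z) (gen e u z)) w = sW a (T (\<lambda>z. scale (power_poly i q z) (gen e u z)) w)" for a q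
    proof -
      have "(\<lambda>z. scale (power_poly i (smult a q) z) (gen e u z)) = (\<lambda>z. scale a (scale (power_poly i q z) (gen e u z)))"
        by (auto simp: power_poly_def)
      then show ?thesis using T_scale[OF pg] by simp
    qed
    show ?thesis unfolding Vector_Spaces.linear_iff using D(2)[of c]
      by (auto simp: k 1 2 vs vector_space_smult Vector_Spaces.linear_iff)
  qed
  have finF: "finite ?F" using basis0(1) finite_\<Gamma> C(1) D(1) by blast
  obtain q where q: "q \<noteq> 0" "\<And>k. k \<in> ?F \<Longrightarrow> ?\<psi> k q = 0"
    by (rule finite_functionals_poly[OF finF lin]) (rule that)
  have genK: "(\<lambda>z. scale (power_poly i q z) (gen e u z)) \<in> K" if "u \<in> basis0" "e \<in> carrier \<Gamma>" for u e
  proof -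
    let ?T = "T (\<lambda>z. scale (power_poly i q z) (gen e u z))"
    have "?T w = 0" if "w \<in> C" for w
      by (rule D(3)[OF T_in[OF pg]]) (use q(2)[of "(u, e, w, _)"] that \<open>u \<in> basis0\<close> \<open>e \<in> carrier \<Gamma>\<close> in auto)
    then have "?T w = 0" if "w \<in> W" for w
      using W.linear_expand[OF C(1,2) T_linear[OF pg], of w] that C(3) by simp
    then have "?T w = 0" for w using p(2,3) unfolding T_def by metis
    then show ?thesis using pg by (simp add: K_def)
  qed
  have "(\<lambda>z. scale (power_poly i q z) (\<beta> z)) \<in> K" if \<beta>: "\<beta> \<in> M" for \<beta>
  proof -
    obtain \<delta> where d: "\<And>u e. \<delta> u e \<in> M" "\<beta> = (\<lambda>z. \<Sum>u\<in>basis0. \<Sum>e\<in>carrier \<Gamma>. bracket (gen e u z) (\<delta> u e z))"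
      using strong_perfect[OF \<beta>] by blast
    have "(\<lambda>z. \<Sum>u\<in>basis0. \<Sum>e\<in>carrier \<Gamma>. bracket (scale (power_poly i q z) (gen e u z)) (\<delta> u e z)) \<in> K"
      by (rule K_sum, rule K_sum, rule K_bracket[OF genK d(1)])
    then show ?thesis by (simp add: d(2) scale_sum_right bracket_simps)
  qed
  then have "power_poly i q \<in> J" using B_power_poly[OF i] by (simp add: J_def)
  then show ?thesis using that q(1) by blast
qed

lemma poly_dvd_root_poly_power:
  assumes "q \<noteq> (0 :: 'k poly)" "finite R" "\<And>x. poly q x = 0 \<Longrightarrow> x \<in> R"
  shows "q dvd root_poly R ^ degree q"
proof -
  obtain A where A: "size A = degree q" "q = smult (lead_coeff q) (\<Prod>x\<in>#A. [:-x, 1:])"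
    using alg_closed_imp_factorization[OF assms(1)] by blast
  have lc: "lead_coeff q \<noteq> 0" using assms(1) by simp
  have "x \<in> R" if "x \<in># A" for x
  proof (rule assms(3))
    have "[:-x, 1:] dvd (\<Prod>x\<in>#A. [:-x, 1:])" using that by (intro dvd_prod_mset) auto
    then have "[:-x, 1:] dvd q" using A(2) by (metis dvd_smult)
    then show "poly q x = 0" by (simp add: poly_eq_0_iff_dvd)
  qed
  then have "(\<Prod>x\<in>#A. [:-x, 1:]) dvd root_poly R ^ size A"
  proof (induction A)
    case (add x A)
    have "[:-x, 1:] dvd root_poly R" unfolding root_poly_def using add.prems assms(2) by (intro dvd_prodI) auto
    moreover have "(\<Prod>x\<in>#A. [:-x, 1:]) dvd root_poly R ^ size A" by (rule add.IH) (use add.prems in auto)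
    ultimately show ?case using mult_dvd_mono by (simp del: mult_pCons_left) blast
  qed simp
  then show ?thesis using A lc by (metis smult_dvd_iff)
qed

text \<open>
  Radicality replaces the polynomial by one with simple roots; the factor belonging to the root \<open>0\<close> can
  be dropped because \<open>t\<^sub>i\<close> is invertible.
\<close>

lemma root_poly_J:
  assumes i: "i < n"
  obtains S where "finite S" "0 \<notin> S" "power_poly i (root_poly S) \<in> J"
proof -
  obtain q where q: "q \<noteq> 0" "power_poly i q \<in> J" by (rule finite_codim[OF i])
  define R where "R = insert 0 {x. poly q x = 0}"
  have fR: "finite R" using poly_roots_finite[OF q(1)] by (simp add: R_def)
  obtain r where r: "root_poly R ^ Suc (degree q) = q * r"
    using dvd_trans[OF poly_dvd_root_poly_power[OF q(1) fR] le_imp_power_dvd[of "degree q" "Suc (degree q)"]]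
    by (auto simp: R_def elim: dvdE)
  have "power_poly i (root_poly R ^ Suc (degree q)) \<in> J"
    unfolding r using J_mult[OF q(2) B_power_poly[OF i, of r]] by (simp add: power_poly_mult mult.commute)
  then have J: "power_poly i (root_poly R) \<in> J" by (rule power_poly_power_J[OF i zero_less_Suc])
  define S where "S = R - {0}"
  have "root_poly R = [:0, 1:] * root_poly S"
    unfolding root_poly_def S_def using fR prod.remove[of R 0 "\<lambda>r. [:-r, 1:]"] by (simp add: R_def)
  then have e: "power_poly i (root_poly R) = (\<lambda>z. power_poly i [:0, 1:] z * power_poly i (root_poly S) z)" by (simp only: power_poly_mult)
  have inv: "coord i (- int (m i)) \<in> B"
  proof -
    have "z i powi - int (m i) = inverse (z i ^ m i)" for z :: "nat \<Rightarrow> 'k" by (simp add: power_int_minus)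
    then show ?thesis using i by (simp add: B_def A_coord) (simp add: coord_apply act_X_in act_X_power)
  qed
  have "power_poly i (root_poly S) = (\<lambda>z. coord i (- int (m i)) z * power_poly i (root_poly R) z)"
  proof
    fix z show "power_poly i (root_poly S) z = coord i (- int (m i)) z * power_poly i (root_poly R) z"
      unfolding e using i by (cases "z \<in> X") (auto simp: power_poly_def coord_apply power_int_minus X_iff)
  qed
  then have "power_poly i (root_poly S) \<in> J" using J_mult[OF J inv] by simp
  then show ?thesis using that fR by (auto simp: S_def)
qed

text \<open>
  By the previous lemma and \<open>M_grid\<close> an element vanishing at the representatives of the orbits in the
  grid lies in \<open>K\<close>.  The set \<open>xs\<close> is chosen with the least cardinality, so that no point of it is superfluous.
\<close>

theorem factor_through_points:
  assumes O': "transversal O'"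
  obtains xs where "finite xs" "xs \<subseteq> O'" "\<And>\<alpha>. \<alpha> \<in> M \<Longrightarrow> (\<forall>x\<in>xs. \<alpha> x = 0) \<Longrightarrow> \<alpha> \<in> K"
    "\<And>x. x \<in> xs \<Longrightarrow> \<exists>\<alpha>\<in>M. (\<forall>y\<in>xs - {x}. \<alpha> y = 0) \<and> \<alpha> \<notin> K"
proof -
  have "\<forall>i\<in>{..<n}. \<exists>S. finite S \<and> 0 \<notin> S \<and> power_poly i (root_poly S) \<in> J" using root_poly_J by (metis lessThan_iff)
  from bchoice[OF this] obtain S where "\<forall>i\<in>{..<n}. finite (S i) \<and> 0 \<notin> S i \<and> power_poly i (root_poly (S i)) \<in> J" ..
  then have S: "\<And>i. i < n \<Longrightarrow> finite (S i)" "\<And>i. i < n \<Longrightarrow> 0 \<notin> S i" "\<And>i. i < n \<Longrightarrow> power_poly i (root_poly (S i)) \<in> J" by auto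
  define G where "G = (\<Pi>\<^sub>E i\<in>{..<n}. {a. a ^ m i \<in> S i})"
  have finG: "finite G" unfolding G_def
    using root_poly_pcompose_power(1)[OF primitive_root m_pos S(1,2)] by (intro finite_PiE) auto
  have "\<forall>x\<in>X. \<exists>y. y \<in> O' \<and> y \<in> orbit \<Gamma> act_X x" using O' by (auto simp: transversal_def)
  from bchoice[OF this] obtain r where "\<forall>x\<in>X. r x \<in> O' \<and> r x \<in> orbit \<Gamma> act_X x" ..
  then have r: "r x \<in> O' \<and> r x \<in> orbit \<Gamma> act_X x" if "x \<in> X" for x using that by blast
  let ?P = "\<lambda>xs. finite xs \<and> xs \<subseteq> O' \<and> (\<forall>\<alpha>\<in>M. (\<forall>x\<in>xs. \<alpha> x = 0) \<longrightarrow> \<alpha> \<in> K)"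
  have "?P (r ` (G \<inter> X))"
  proof (intro conjI ballI impI)
    show "finite (r ` (G \<inter> X))" using finG by simp
    show "r ` (G \<inter> X) \<subseteq> O'" using r by blast
    fix \<alpha> assume \<alpha>: "\<alpha> \<in> M" and 0: "\<forall>x\<in>r ` (G \<inter> X). \<alpha> x = 0"
    have "\<alpha> z = 0" if z: "z \<in> X" "\<And>i. i < n \<Longrightarrow> z i ^ m i \<in> S i" for z
    proof -
      have "z \<in> G" using z by (auto simp: G_def X_iff PiE_def)
      then have "\<alpha> (r z) = 0" using 0 z(1) by blast
      moreover obtain c where c: "c \<in> carrier \<Gamma>" "r z = act_X c z" using r[OF z(1)] by (auto simp: orbit_def)
      ultimately have "act_g c (\<alpha> z) = 0" using M_act[OF \<alpha> c(1) z(1)] by simp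
      then have "act_g (ginv c) (act_g c (\<alpha> z)) = 0" using linearD(3)[OF act_g_linear] by simp
      then show ?thesis using act_g_inv(2)[OF c(1)] by simp
    qed
    then have "\<exists>\<gamma>. (\<forall>i. \<gamma> i \<in> M) \<and> \<alpha> = (\<lambda>z. \<Sum>i<n. scale (power_poly i (root_poly (S i)) z) (\<gamma> i z))"
      using S(1,2) \<alpha> by (intro M_grid[where Rs = S]) auto
    then obtain \<gamma> where g: "\<And>i. \<gamma> i \<in> M" "\<alpha> = (\<lambda>z. \<Sum>i<n. scale (power_poly i (root_poly (S i)) z) (\<gamma> i z))"
      by blast
    have "(\<lambda>z. scale (power_poly i (root_poly (S i)) z) (\<gamma> i z)) \<in> K" if "i \<in> {..<n}" for i
      using S(3)[of i] that g(1) unfolding J_def by blast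
    then show "\<alpha> \<in> K" unfolding g(2) by (rule K_sum)
  qed
  then obtain xs where xs: "?P xs" and min: "\<And>ys. ?P ys \<Longrightarrow> card xs \<le> card ys"
    using ex_has_least_nat[of ?P "r ` (G \<inter> X)" card] by blast
  show ?thesis
  proof (rule that[of xs])
    show "\<exists>\<alpha>\<in>M. (\<forall>y\<in>xs - {x}. \<alpha> y = 0) \<and> \<alpha> \<notin> K" if x: "x \<in> xs" for x
    proof (rule ccontr)
      assume "\<not> ?thesis"
      then have "?P (xs - {x})" using xs by blast
      then have "card xs \<le> card (xs - {x})" by (rule min)
      moreover have "card (xs - {x}) < card xs" using xs x by (intro card_Diff1_less) auto
      ultimately show False by simp
    qed
  qed (use xs in blast)+
qed

end

section \<open>Irreducible representations are evaluation representations\<close>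

context multiloop_irrep
begin

text \<open>
  Modulo the kernel an element \<open>\<alpha>\<close> of \<open>M\<close> is the sum of the elements \<open>\<delta> x (\<alpha> x)\<close> concentrated at the points
  \<open>x \<in> xs\<close>, and elements concentrated at different points commute modulo the kernel.  Thus the tensor
  decomposition for commuting families applies, and the factor at \<open>x\<close> carries the representation
  \<open>u \<mapsto> T (\<delta> x u)\<close> of \<open>\<gg>\<close>.  Minimality of \<open>xs\<close> makes all of these nontrivial.
\<close>

theorem is_evaluation:
  assumes O': "transversal O'"
  shows "\<exists>xs R. finite xs \<and> xs \<subseteq> O' \<and> (\<forall>x\<in>xs. g_rep (R x) \<and> irreducible_rep UNIV seq_scale (R x)
      \<and> (\<exists>u. \<exists>y\<in>fst (R x). snd (R x) u y \<noteq> 0)) \<and> is_evaluation_rep sW xs R (W, \<tau>)"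
proof -
  obtain xs where xs: "finite xs" "xs \<subseteq> O'"
    and fac: "\<And>\<alpha>. \<alpha> \<in> M \<Longrightarrow> (\<forall>x\<in>xs. \<alpha> x = 0) \<Longrightarrow> \<alpha> \<in> K"
    and min: "\<And>x. x \<in> xs \<Longrightarrow> \<exists>\<alpha>\<in>M. (\<forall>y\<in>xs - {x}. \<alpha> y = 0) \<and> \<alpha> \<notin> K"
    by (rule factor_through_points[OF O']) (rule that)
  have of: "orbit_free xs" by (rule transversal_orbit_free[OF O' xs(2)])
  obtain \<delta> where \<delta>: "\<And>x u. x \<in> xs \<Longrightarrow> \<delta> x u \<in> M" "\<And>x u. x \<in> xs \<Longrightarrow> \<delta> x u x = u"
    "\<And>x u y. x \<in> xs \<Longrightarrow> y \<in> xs \<Longrightarrow> y \<noteq> x \<Longrightarrow> \<delta> x u y = 0"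
    by (rule site_elements[OF xs(1) of]) (rule that)
  have agree: "T \<alpha> w = T \<beta> w" if "\<alpha> \<in> M" "\<beta> \<in> M" "\<And>x. x \<in> xs \<Longrightarrow> \<alpha> x = \<beta> x" for \<alpha> \<beta> w
    using K_T[OF fac[OF M_diff[OF that(1,2)]], of w] T_diff[OF that(1,2)] that(3) by simp
  have decomp: "T \<alpha> w = (\<Sum>x\<in>xs. T (\<delta> x (\<alpha> x)) w)" if \<alpha>: "\<alpha> \<in> M" for \<alpha> w
  proof -
    have "T \<alpha> w = T (\<lambda>z. \<Sum>x\<in>xs. \<delta> x (\<alpha> x) z) w"
    proof (rule agree[OF \<alpha> M_sum[OF \<delta>(1)]])
      fix y assume y: "y \<in> xs"
      have "(\<Sum>x\<in>xs. \<delta> x (\<alpha> x) y) = (\<Sum>x\<in>xs. if x = y then \<alpha> y else 0)"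
        by (rule sum.cong) (use \<delta> y in auto)
      then show "\<alpha> y = (\<Sum>x\<in>xs. \<delta> x (\<alpha> x) y)" using xs(1) y by simp
    qed
    then show ?thesis using T_sum[OF \<delta>(1)] by simp
  qed
  define \<Phi> where "\<Phi> = (\<lambda>x. range (\<lambda>u. T (\<delta> x u)))"
  have \<Phi>lin: "linear_op sW \<phi>" if "x \<in> xs" "\<phi> \<in> \<Phi> x" for x \<phi>
    using that T_linear \<delta>(1) by (auto simp: \<Phi>_def)
  have comm: "\<phi> (\<psi> w) = \<psi> (\<phi> w)" if h: "x \<in> xs" "y \<in> xs" "x \<noteq> y" "\<phi> \<in> \<Phi> x" "\<psi> \<in> \<Phi> y" for x y \<phi> \<psi> w
  proof -
    from h(4,5) obtain u v where uv: "\<phi> = T (\<delta> x u)" "\<psi> = T (\<delta> y v)" by (auto simp: \<Phi>_def)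
    have "bracket (\<delta> x u z) (\<delta> y v z) = 0" if "z \<in> xs" for z
      using \<delta>(3)[OF h(1) that, of u] \<delta>(3)[OF h(2) that, of v] h(3) by (cases "z = x") (auto simp: bracket_simps)
    then have "T (\<lambda>z. bracket (\<delta> x u z) (\<delta> y v z)) w = T (\<lambda>z. 0) w"
      using h \<delta>(1) by (intro agree M_br M_zero) auto
    then show ?thesis using T_bracket[OF \<delta>(1)[OF h(1)] \<delta>(1)[OF h(2)], of u v w] uv by (simp add: T_zero)
  qed
  have irrW: "W.irreducible_under (\<Union>x\<in>xs. \<Phi> x) W"
    unfolding W.irreducible_under_def
  proof (intro conjI allI impI subW W_ne)
    show "W.invariant (\<Union>x\<in>xs. \<Phi> x) W" using T_in \<delta>(1) by (auto simp: W.invariant_def \<Phi>_def)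
    fix U assume U: "W.subspace U \<and> U \<subseteq> W \<and> W.invariant (\<Union>x\<in>xs. \<Phi> x) U"
    have "U = W" if ne: "U \<noteq> {0}"
    proof -
      have "0 \<in> U" using U W.subspace_0 by simp
      then obtain u0 where u0: "u0 \<in> U" "u0 \<noteq> 0" using ne by auto
      show ?thesis
      proof (rule W_irr[OF _ _ _ u0])
        fix \<alpha> u assume "\<alpha> \<in> M" "u \<in> U"
        then show "T \<alpha> u \<in> U"
        proof -
          have "T (\<delta> x (\<alpha> x)) u \<in> U" if "x \<in> xs" for x
            using U \<open>u \<in> U\<close> that unfolding W.invariant_def \<Phi>_def by blast
          then show ?thesis unfolding decomp[OF \<open>\<alpha> \<in> M\<close>, of u] using U by (intro W.subspace_sum) auto
        qed
      qed (use U in auto)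
    qed
    then show "U = {0} \<or> U = W" by blast
  qed
  have "\<exists>V B t. (\<forall>i\<in>xs. W.irreducible_under (\<Phi> i) (V i) \<and> V i \<subseteq> W \<and> finite (B i) \<and> W.independent (B i)
        \<and> W.span (B i) = V i) \<and>
      multilinear_on xs sW sW V W t \<and> free_family sW (Pi\<^sub>E xs B) t \<and> W \<subseteq> W.span (t ` Pi\<^sub>E xs B) \<and>
      (\<forall>i\<in>xs. \<forall>\<phi>\<in>\<Phi> i. \<forall>v\<in>Pi\<^sub>E xs V. \<phi> (t v) = t (v(i := \<phi> (v i))))"
    by (rule W.commuting_tensor_decomposition[where \<Phi> = \<Phi>, OF xs(1) fdW]) (use \<Phi>lin comm irrW in blast)+
  then obtain V B t where D0: "\<forall>i\<in>xs. W.irreducible_under (\<Phi> i) (V i) \<and> V i \<subseteq> W \<and> finite (B i) \<and> W.independent (B i)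
        \<and> W.span (B i) = V i"
      and tm: "multilinear_on xs sW sW V W t" and free: "free_family sW (Pi\<^sub>E xs B) t"
      and tspan: "W \<subseteq> W.span (t ` Pi\<^sub>E xs B)"
      and act0: "\<forall>i\<in>xs. \<forall>\<phi>\<in>\<Phi> i. \<forall>v\<in>Pi\<^sub>E xs V. \<phi> (t v) = t (v(i := \<phi> (v i)))"
    by (elim exE conjE) (rule that)
  have irrV: "W.irreducible_under (\<Phi> x) (V x)" and VW: "V x \<subseteq> W" and BV: "finite (B x)" "W.independent (B x)" "W.span (B x) = V x"
    if "x \<in> xs" for x using D0 that by auto
  have act: "T (\<delta> x u) (t v) = t (v(x := T (\<delta> x u) (v x)))" if "x \<in> xs" "v \<in> Pi\<^sub>E xs V" for x u v
    using act0 that by (auto simp: \<Phi>_def)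
  have fdV: "fin_dim sW (V x)" if "x \<in> xs" for x using BV[OF that] by (auto simp: fin_dim_def)
  have TV: "T (\<delta> x u) v \<in> V x" if "x \<in> xs" "v \<in> V x" for x u v
    using W.irreducible_underD(3)[OF irrV[OF that(1)], of "T (\<delta> x u)"] that(2) by (auto simp: \<Phi>_def)
  have sW: "vector_space sW" by (rule W.vector_space_axioms)
  let ?model = "\<lambda>x (\<iota>, \<kappa>, V' :: 'k seq set). fin_dim seq_scale V' \<and> linear_on sW seq_scale (V x) V' \<iota> \<and>
    linear_on seq_scale sW V' (V x) \<kappa> \<and> (\<forall>v\<in>V x. \<kappa> (\<iota> v) = v) \<and> (\<forall>y\<in>V'. \<iota> (\<kappa> y) = y)"
  have "\<forall>x\<in>xs. \<exists>q. ?model x q"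
  proof
    fix x assume x: "x \<in> xs"
    obtain \<iota> \<kappa> and V' :: "'k seq set" where "fin_dim seq_scale V'" "linear_on sW seq_scale (V x) V' \<iota>"
    "linear_on seq_scale sW V' (V x) \<kappa>" "\<And>v. v \<in> V x \<Longrightarrow> \<kappa> (\<iota> v) = v" "\<And>y. y \<in> V' \<Longrightarrow> \<iota> (\<kappa> y) = y"
      by (rule seq_model[OF sW fdV[OF x]]) (rule that)
    then have "?model x (\<iota>, \<kappa>, V')" by simp
    then show "\<exists>q. ?model x q" by blast
  qed
  from bchoice[OF this] obtain q where q: "\<forall>x\<in>xs. ?model x (q x)" ..
  define \<iota> \<kappa> V' where "\<iota> = (\<lambda>x. fst (q x))" and "\<kappa> = (\<lambda>x. fst (snd (q x)))" and "V' = (\<lambda>x. snd (snd (q x)))"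
  have fdV': "fin_dim seq_scale (V' x)" and lin\<iota>: "linear_on sW seq_scale (V x) (V' x) (\<iota> x)"
    and lin\<kappa>: "linear_on seq_scale sW (V' x) (V x) (\<kappa> x)"
    and \<kappa>\<iota>: "\<And>v. v \<in> V x \<Longrightarrow> \<kappa> x (\<iota> x v) = v" and \<iota>\<kappa>: "\<And>y. y \<in> V' x \<Longrightarrow> \<iota> x (\<kappa> x y) = y" if "x \<in> xs" for x
    using q that by (auto simp: \<iota>_def \<kappa>_def V'_def case_prod_beta)
  interpret s: lin_space "seq_scale :: 'k \<Rightarrow> _" using vector_space_seq by (simp add: lin_space_def)
  have \<iota>1: "\<iota> x v \<in> V' x" and \<iota>3: "\<iota> x (sW c v) = seq_scale c (\<iota> x v)"
    if "x \<in> xs" "v \<in> V x" for x v c using lin\<iota>[OF that(1)] that(2) by (auto simp: linear_on_def)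
  have \<iota>2: "\<iota> x (v + w) = \<iota> x v + \<iota> x w"
    if "x \<in> xs" "v \<in> V x" "w \<in> V x" for x v w using lin\<iota>[OF that(1)] that(2,3) by (auto simp: linear_on_def)
  have \<kappa>1: "\<kappa> x v \<in> V x" and \<kappa>3: "\<kappa> x (seq_scale c v) = sW c (\<kappa> x v)"
    if "x \<in> xs" "v \<in> V' x" for x v c using lin\<kappa>[OF that(1)] that(2) by (auto simp: linear_on_def)
  have \<kappa>2: "\<kappa> x (v + w) = \<kappa> x v + \<kappa> x w"
    if "x \<in> xs" "v \<in> V' x" "w \<in> V' x" for x v w using lin\<kappa>[OF that(1)] that(2,3) by (auto simp: linear_on_def)
  have subV: "W.subspace (V x)" if "x \<in> xs" for x by (rule W.fin_dim_subspace[OF fdV[OF that]])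
  have subV': "s.subspace (V' x)" if "x \<in> xs" for x by (rule s.fin_dim_subspace[OF fdV'[OF that]])
  have \<iota>0: "\<iota> x 0 = 0" if "x \<in> xs" for x
    using \<iota>3[OF that W.subspace_0[OF subV[OF that]], of 0] by simp
  have \<kappa>0: "\<kappa> x 0 = 0" if "x \<in> xs" for x
    using \<kappa>3[OF that s.subspace_0[OF subV'[OF that]], of 0] by simp
  \<comment> \<open>the factors of the decomposition live in \<open>W\<close>; copy them to spaces of sequences\<close>
  define R where "R = (\<lambda>x. (V' x, \<lambda>u y. \<iota> x (T (\<delta> x u) (\<kappa> x y))))"
  have Tadd: "T (\<delta> x (u + v)) w = T (\<delta> x u) w + T (\<delta> x v) w" if x: "x \<in> xs" for x u v w
  proof -
    have "T (\<delta> x (u + v)) w = T (\<lambda>z. \<delta> x u z + \<delta> x v z) w"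
    proof (rule agree)
      show "\<delta> x (u + v) y = \<delta> x u y + \<delta> x v y" if "y \<in> xs" for y using \<delta>(2)[OF x] \<delta>(3)[OF x that] by (cases "y = x") auto
    qed (use \<delta>(1)[OF x] M_add in auto)
    then show ?thesis using T_add[OF \<delta>(1)[OF x] \<delta>(1)[OF x]] by simp
  qed
  have Tscale: "T (\<delta> x (scale c u)) w = sW c (T (\<delta> x u) w)" if x: "x \<in> xs" for x u c w
  proof -
    have "T (\<delta> x (scale c u)) w = T (\<lambda>z. scale c (\<delta> x u z)) w"
    proof (rule agree)
      show "\<delta> x (scale c u) y = scale c (\<delta> x u y)" if "y \<in> xs" for y using \<delta>(2)[OF x] \<delta>(3)[OF x that] by (cases "y = x") auto
    qed (use \<delta>(1)[OF x] M_scl in auto)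
    then show ?thesis using T_scale[OF \<delta>(1)[OF x]] by simp
  qed
  have Tbr: "T (\<delta> x (bracket u v)) w = T (\<delta> x u) (T (\<delta> x v) w) - T (\<delta> x v) (T (\<delta> x u) w)" if x: "x \<in> xs" for x u v w
  proof -
    have "T (\<delta> x (bracket u v)) w = T (\<lambda>z. bracket (\<delta> x u z) (\<delta> x v z)) w"
    proof (rule agree)
      show "\<delta> x (bracket u v) y = bracket (\<delta> x u y) (\<delta> x v y)" if "y \<in> xs" for y
        using \<delta>(2)[OF x] \<delta>(3)[OF x that] by (cases "y = x") (auto simp: bracket_simps)
    qed (use \<delta>(1)[OF x] M_br in auto)
    then show ?thesis using T_bracket[OF \<delta>(1)[OF x] \<delta>(1)[OF x]] by simp
  qed
  have \<iota>diff: "\<iota> x (v - w) = \<iota> x v - \<iota> x w" if "x \<in> xs" "v \<in> V x" "w \<in> V x" for x v w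
    using \<iota>2[OF that(1,2) W.subspace_neg[OF subV[OF that(1)] that(3)]] \<iota>3[OF that(1,3), of "-1"] by simp
  have repR: "g_rep (R x)" if x: "x \<in> xs" for x
  proof -
    note l = W.linearD[OF T_linear[OF \<delta>(1)[OF x]]]
    have "seq_linear_on (V' x) (V' x) (\<lambda>y. \<iota> x (T (\<delta> x u) (\<kappa> x y)))" for u
      unfolding linear_on_def using \<iota>1[OF x TV[OF x]] \<iota>2[OF x TV[OF x] TV[OF x]] \<iota>3[OF x TV[OF x]] \<kappa>1[OF x] \<kappa>2[OF x] \<kappa>3[OF x] l by auto
    moreover have "linear_on scale seq_scale UNIV (V' x) (\<lambda>u. \<iota> x (T (\<delta> x u) (\<kappa> x y)))" if "y \<in> V' x" for y
      unfolding linear_on_def using \<iota>1[OF x TV[OF x]] \<iota>2[OF x TV[OF x] TV[OF x]] \<iota>3[OF x TV[OF x]] \<kappa>1[OF x that] Tadd[OF x] Tscale[OF x] by auto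
    moreover have "\<iota> x (T (\<delta> x (bracket a b)) (\<kappa> x y)) =
      \<iota> x (T (\<delta> x a) (\<kappa> x (\<iota> x (T (\<delta> x b) (\<kappa> x y))))) - \<iota> x (T (\<delta> x b) (\<kappa> x (\<iota> x (T (\<delta> x a) (\<kappa> x y)))))"
      if "y \<in> V' x" for a b y
      using \<kappa>1[OF x that] \<kappa>\<iota>[OF x TV[OF x]] Tbr[OF x] \<iota>diff[OF x TV[OF x TV[OF x]] TV[OF x TV[OF x]]] by simp
    ultimately show ?thesis
      using subV'[OF x] fdV'[OF x] vector_space_seq unfolding fd_rep_def lie_rep_def R_def by simp
  qed
  have irrR: "irreducible_rep UNIV seq_scale (R x)" if x: "x \<in> xs" for x
  proof -
    obtain v where v: "v \<in> V x" "v \<noteq> 0"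
      using W.irreducible_underD(2)[OF irrV[OF x]] W.subspace_0[OF subV[OF x]] by blast
    have "\<iota> x v \<noteq> 0"
    proof
      assume "\<iota> x v = 0"
      then have "v = 0" using \<kappa>\<iota>[OF x v(1)] \<kappa>0[OF x] by simp
      then show False using v(2) by blast
    qed
    then have ne: "V' x \<noteq> {0}" using \<iota>1[OF x v(1)] by blast
    have "U = {0} \<or> U = V' x" if U: "s.subspace U" "U \<subseteq> V' x"
      "\<forall>a\<in>UNIV. \<forall>u\<in>U. \<iota> x (T (\<delta> x a) (\<kappa> x u)) \<in> U" for U
    proof (cases "U = {0}")
      case False
      then obtain u0 where u0: "u0 \<in> U" "u0 \<noteq> 0" using s.subspace_0[OF U(1)] by blast
      have "\<kappa> x ` U = V x"
      proof (rule W.irreducible_underD(4)[OF irrV[OF x]])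
        show "W.subspace (\<kappa> x ` U)"
        proof (rule W.subspaceI)
          show "0 \<in> \<kappa> x ` U" using \<kappa>0[OF x] s.subspace_0[OF U(1)] by force
          fix a b assume "a \<in> \<kappa> x ` U" "b \<in> \<kappa> x ` U"
          then obtain a' b' where ab: "a = \<kappa> x a'" "b = \<kappa> x b'" "a' \<in> U" "b' \<in> U" by blast
          then have "a + b = \<kappa> x (a' + b')" using \<kappa>2[OF x subsetD[OF U(2) ab(3)] subsetD[OF U(2) ab(4)]] by simp
          then show "a + b \<in> \<kappa> x ` U" using s.subspace_add[OF U(1) ab(3,4)] by blast
        next
          fix c a assume "a \<in> \<kappa> x ` U"
          then obtain a' where a: "a = \<kappa> x a'" "a' \<in> U" by blast
          then have "sW c a = \<kappa> x (seq_scale c a')" using \<kappa>3[OF x subsetD[OF U(2) a(2)]] by simp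
          then show "sW c a \<in> \<kappa> x ` U" using s.subspace_scale[OF U(1) a(2)] by blast
        qed
        show "\<kappa> x ` U \<subseteq> V x" using \<kappa>1[OF x] U(2) by blast
        show "\<phi> u \<in> \<kappa> x ` U" if "\<phi> \<in> \<Phi> x" "u \<in> \<kappa> x ` U" for \<phi> u
        proof -
          from that obtain a u' where a: "\<phi> = T (\<delta> x a)" "u = \<kappa> x u'" "u' \<in> U" by (auto simp: \<Phi>_def)
          have "\<phi> u = \<kappa> x (\<iota> x (T (\<delta> x a) (\<kappa> x u')))"
            using a \<kappa>\<iota>[OF x TV[OF x \<kappa>1[OF x subsetD[OF U(2) a(3)]]]] by simp
          then show ?thesis using U(3) a(3) by blast
        qed
        show "\<kappa> x u0 \<in> \<kappa> x ` U" using u0 by blast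
        show "\<kappa> x u0 \<noteq> 0" using \<iota>\<kappa>[OF x, of u0] \<iota>0[OF x] u0 U(2) by auto
      qed
      then have "\<iota> x ` V x = \<iota> x ` \<kappa> x ` U" by simp
      also have "\<dots> = U" using \<iota>\<kappa>[OF x] U(2) by (force simp: image_image)
      finally have "V' x \<subseteq> U" using \<iota>\<kappa>[OF x] \<kappa>1[OF x] by (metis image_eqI subsetI)
      then show ?thesis using U(2) by blast
    qed simp
    then show ?thesis using ne unfolding irreducible_rep_def R_def by simp
  qed
  have sub_tP: "Pi\<^sub>E xs B \<subseteq> Pi\<^sub>E xs V" using BV(3) W.span_superset by (intro PiE_mono) blast
  have ntR: "\<exists>u. \<exists>y\<in>fst (R x). snd (R x) u y \<noteq> 0" if x: "x \<in> xs" for x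
  proof (rule ccontr)
    assume "\<not> ?thesis"
    then have z: "\<iota> x (T (\<delta> x u) (\<kappa> x y)) = 0" if "y \<in> V' x" for u y using that by (auto simp: R_def)
    have z2: "T (\<delta> x u) v = 0" if v: "v \<in> V x" for u v
    proof -
      have "\<iota> x (T (\<delta> x u) v) = 0" using z[OF \<iota>1[OF x v]] \<kappa>\<iota>[OF x v] by simp
      then show ?thesis using \<kappa>\<iota>[OF x TV[OF x v]] \<kappa>0[OF x] by metis
    qed
    have z3: "T (\<delta> x u) w = 0" if w: "w \<in> W" for u w
    proof -
      have "T (\<delta> x u) b = 0" if "b \<in> t ` Pi\<^sub>E xs B" for b
      proof -
        from that obtain v where v: "v \<in> Pi\<^sub>E xs V" "b = t v" using sub_tP by blast
        have "T (\<delta> x u) b = t (v(x := 0))" using act[OF x v(1)] z2 v x by (metis PiE_mem)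
        also have "\<dots> = 0"
          by (rule multilinear_zero[OF tm sW sW _ x]) (use v(1) x W.subspace_0[OF subV[OF x]] in \<open>auto simp: PiE_iff extensional_def\<close>)
        finally show ?thesis .
      qed
      then show ?thesis
        using module_hom.eq_0_on_span[of sW sW "T (\<delta> x u)" "t ` Pi\<^sub>E xs B" w] T_linear[OF \<delta>(1)[OF x]] tspan w
        by (auto simp: module_hom_iff_linear)
    qed
    obtain \<alpha> where \<alpha>: "\<alpha> \<in> M" "\<forall>y\<in>xs - {x}. \<alpha> y = 0" "\<alpha> \<notin> K" using min[OF x] by blast
    have d0: "T (\<delta> y 0) w = 0" if "y \<in> xs" for y w using Tscale[OF that, of 0 0 w] by simp
    have "T \<alpha> w = 0" for w
    proof -
      have "T \<alpha> w = T \<alpha> (p w)" by (simp add: T_def p)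
      also have "\<dots> = (\<Sum>y\<in>xs. T (\<delta> y (\<alpha> y)) (p w))" by (rule decomp[OF \<alpha>(1)])
      also have "\<dots> = 0"
      proof (rule sum.neutral, rule ballI)
        fix y assume "y \<in> xs"
        then show "T (\<delta> y (\<alpha> y)) (p w) = 0" using z3[OF p(2)] d0 \<alpha>(2) by (cases "y = x") auto
      qed
      finally show ?thesis .
    qed
    then show False using \<alpha>(1,3) by (simp add: K_def)
  qed
  define t' where "t' = (\<lambda>y. t (\<lambda>x\<in>xs. \<kappa> x (y x)))"
  have tp: "is_tensor_product xs sW sW V W t"
    by (rule tensor_product_of_basis[OF sW sW xs(1) BV(1,3) tm subW free tspan])
  have tp': "is_tensor_product xs seq_scale sW V' W t'"
    unfolding t'_def
    by (rule tensor_product_reindex[where p = "\<lambda>x. x" and q = "\<lambda>x. x" and T = \<iota> and T' = \<kappa>, OF _ _ lin\<iota> lin\<kappa> \<kappa>\<iota> \<iota>\<kappa> tp]) auto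
  define \<tau>' where "\<tau>' = (\<lambda>a w. \<Sum>x\<in>xs. T (\<delta> x (a x)) w)"
  have "is_evaluation_rep sW xs R (W, \<tau>)"
    unfolding is_evaluation_rep_def is_tensor_rep_def prod.case
  proof (intro exI[of _ \<tau>'] conjI exI[of _ t'] ballI)
    show "is_tensor_product xs seq_scale sW (\<lambda>i. fst (R i)) W t'" using tp' by (simp add: R_def)
    show "\<tau> \<alpha> w = \<tau>' (restrict \<alpha> xs) w" if "\<alpha> \<in> M" "w \<in> W" for \<alpha> w
      using decomp[OF that(1), of w] T_\<tau>[OF that(2)] by (simp add: \<tau>'_def)
    fix a
    show "linear_on sW sW W W (\<tau>' a)"
      unfolding linear_on_def \<tau>'_def
    proof (intro conjI ballI allI)
      show "(\<Sum>x\<in>xs. T (\<delta> x (a x)) w) \<in> W" for w using T_in \<delta>(1) by (intro W.subspace_sum[OF subW]) auto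
      show "(\<Sum>x\<in>xs. T (\<delta> x (a x)) (v + w)) = (\<Sum>x\<in>xs. T (\<delta> x (a x)) v) + (\<Sum>x\<in>xs. T (\<delta> x (a x)) w)" for v w
        unfolding sum.distrib[symmetric] by (rule sum.cong) (auto simp: W.linearD[OF T_linear[OF \<delta>(1)]])
      show "(\<Sum>x\<in>xs. T (\<delta> x (a x)) (sW c w)) = sW c (\<Sum>x\<in>xs. T (\<delta> x (a x)) w)" for c w
        unfolding W.scale_sum_right by (rule sum.cong) (auto simp: W.linearD[OF T_linear[OF \<delta>(1)]])
    qed
    fix y assume "y \<in> (\<Pi>\<^sub>E i\<in>xs. fst (R i))"
    then have y: "y x \<in> V' x" if "x \<in> xs" for x using that by (auto simp: R_def)
    let ?v = "\<lambda>x\<in>xs. \<kappa> x (y x)"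
    have v: "?v \<in> Pi\<^sub>E xs V" using \<kappa>1 y by auto
    show "\<tau>' a (t' y) = (\<Sum>x\<in>xs. t' (y(x := snd (R x) (a x) (y x))))"
      unfolding \<tau>'_def
    proof (rule sum.cong[OF refl])
      fix x assume x: "x \<in> xs"
      have "T (\<delta> x (a x)) (t' y) = t (?v(x := T (\<delta> x (a x)) (\<kappa> x (y x))))"
        using act[OF x v] x by (simp add: t'_def)
      also have "?v(x := T (\<delta> x (a x)) (\<kappa> x (y x))) = (\<lambda>x'\<in>xs. \<kappa> x' ((y(x := snd (R x) (a x) (y x))) x'))"
        using x \<kappa>\<iota>[OF x TV[OF x \<kappa>1[OF x y[OF x]]]] by (auto simp: R_def restrict_def)
      also have "t \<dots> = t' (y(x := snd (R x) (a x) (y x)))" unfolding t'_def ..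
      finally show "T (\<delta> x (a x)) (t' y) = t' (y(x := snd (R x) (a x) (y x)))" .
    qed
  qed
  with xs repR irrR ntR show ?thesis by (intro exI[of _ xs] exI[of _ R] conjI ballI)
qed

end

section \<open>Isomorphism classes of representations\<close>

lemma linear_onD:
  assumes "linear_on sV sW V W f"
  shows "v \<in> V \<Longrightarrow> f v \<in> W" "u \<in> V \<Longrightarrow> v \<in> V \<Longrightarrow> f (u + v) = f u + f v" "v \<in> V \<Longrightarrow> f (sV c v) = sW c (f v)"
  using assms by (auto simp: linear_on_def)

lemma linear_on_UNIV: "linear_on sV sW V W f \<Longrightarrow> linear_on sV sW V UNIV f"
  by (auto simp: linear_on_def)

lemma multilinear_on_UNIV: "multilinear_on I sV sW V W f \<Longrightarrow> multilinear_on I sV sW V UNIV f"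
  unfolding multilinear_on_def using linear_on_UNIV by blast

lemma linear_on_zero:
  assumes "vector_space sV" "vector_space sW" "module.subspace sV V" "linear_on sV sW V W f"
  shows "f 0 = 0"
proof -
  interpret v: lin_space sV using assms(1) by (simp add: lin_space_def)
  interpret w: lin_space sW using assms(2) by (simp add: lin_space_def)
  show ?thesis using linear_onD(3)[OF assms(4) v.subspace_0[OF assms(3)], of 0] by simp
qed

lemma linear_on_sum:
  assumes "vector_space sV" "vector_space sW" "module.subspace sV V" "linear_on sV sW V W f" "\<And>k. k \<in> K \<Longrightarrow> g k \<in> V"
  shows "f (\<Sum>k\<in>K. g k) = (\<Sum>k\<in>K. f (g k))"
proof -
  interpret v: lin_space sV using assms(1) by (simp add: lin_space_def)
  note 0 = linear_on_zero[OF assms(1-4)]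
  show ?thesis using assms(5)
  proof (induction K rule: infinite_finite_induct)
    case (insert k K)
    then have "(\<Sum>k\<in>K. g k) \<in> V" "g k \<in> V" by (auto intro: v.subspace_sum[OF assms(3)])
    then show ?case using insert linear_onD(2)[OF assms(4)] by simp
  qed (simp_all add: 0)
qed

lemma linear_on_span_in:
  assumes s: "vector_space s" and W: "module.subspace s W" and h: "linear_on s s W U h"
    and G: "G \<subseteq> W" "\<And>g. g \<in> G \<Longrightarrow> h g \<in> W" and w: "w \<in> module.span s G"
  shows "h w \<in> W"
proof -
  interpret v: lin_space s using s by (simp add: lin_space_def)
  have "w \<in> W \<and> h w \<in> W" using w
  proof (induction w rule: v.span_induct_alt)
    case base
    show ?case using linear_on_zero[OF s s W h] v.subspace_0[OF W] by simp
  next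
    case (step c x y)
    then have x: "x \<in> W" using G(1) by blast
    have cx: "s c x \<in> W" by (rule v.subspace_scale[OF W x])
    have "h (s c x + y) = s c (h x) + h y"
      using linear_onD(2)[OF h cx] linear_onD(3)[OF h x] step by simp
    then show ?case using step cx G(2) v.subspace_add[OF W] v.subspace_scale[OF W] by simp
  qed
  then show ?thesis by blast
qed

lemma lie_repD:
  assumes "lie_rep sL br L sV (V, \<rho>)"
  shows "vector_space sV" "module.subspace sV V" "a \<in> L \<Longrightarrow> linear_on sV sV V V (\<rho> a)"
    "v \<in> V \<Longrightarrow> linear_on sL sV L V (\<lambda>a. \<rho> a v)"
    "a \<in> L \<Longrightarrow> b \<in> L \<Longrightarrow> v \<in> V \<Longrightarrow> \<rho> (br a b) v = \<rho> a (\<rho> b v) - \<rho> b (\<rho> a v)"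
  using assms by (auto simp: lie_rep_def)

lemma iso_repE:
  assumes iso: "iso_rep L sV sW (V, \<rho>) (W, \<tau>)" and V: "lie_rep sL br L sV (V, \<rho>)"
  obtains T T' where "linear_on sV sW V W T" "linear_on sW sV W V T'" "\<And>v. v \<in> V \<Longrightarrow> T' (T v) = v"
    "\<And>w. w \<in> W \<Longrightarrow> T (T' w) = w" "\<And>a v. a \<in> L \<Longrightarrow> v \<in> V \<Longrightarrow> T (\<rho> a v) = \<tau> a (T v)"
    "\<And>a w. a \<in> L \<Longrightarrow> w \<in> W \<Longrightarrow> T' (\<tau> a w) = \<rho> a (T' w)"
proof -
  interpret v: lin_space sV using lie_repD(1)[OF V] by (simp add: lin_space_def)
  note sub = lie_repD(2)[OF V]
  obtain T where T: "linear_on sV sW V W T" "bij_betw T V W" "\<And>a v. a \<in> L \<Longrightarrow> v \<in> V \<Longrightarrow> T (\<rho> a v) = \<tau> a (T v)"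
    using iso by (auto simp: iso_rep_def)
  define T' where "T' = inv_into V T"
  have inj: "inj_on T V" and im: "T ` V = W" using T(2) by (auto simp: bij_betw_def)
  have T'T: "T' (T v) = v" if "v \<in> V" for v using inv_into_f_f[OF inj that] by (simp add: T'_def)
  have obt: "\<exists>v\<in>V. w = T v" if "w \<in> W" for w using im that by blast
  have "linear_on sW sV W V T'"
    unfolding linear_on_def
  proof (intro conjI ballI allI)
    fix w assume "w \<in> W"
    then obtain v where v: "v \<in> V" "w = T v" using obt by blast
    show "T' w \<in> V" using v T'T by simp
    show "T' (sW c w) = sV c (T' w)" for c
      using v T'T linear_onD(3)[OF T(1) v(1), of c] T'T[OF v.subspace_scale[OF sub v(1)], of c] by simp
    fix w' assume "w' \<in> W"
    then obtain v' where v': "v' \<in> V" "w' = T v'" using obt by blast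
    show "T' (w + w') = T' w + T' w'"
      using v v' T'T linear_onD(2)[OF T(1) v(1) v'(1)] T'T[OF v.subspace_add[OF sub v(1) v'(1)]] by simp
  qed
  moreover have "T (T' w) = w" if "w \<in> W" for w using obt[OF that] T'T by auto
  moreover have "T' (\<tau> a w) = \<rho> a (T' w)" if aw: "a \<in> L" "w \<in> W" for a w
  proof -
    obtain v where v: "v \<in> V" "w = T v" using obt[OF aw(2)] by blast
    have "\<rho> a v \<in> V" using linear_onD(1)[OF lie_repD(3)[OF V aw(1)] v(1)] .
    then show ?thesis using T'T T(3)[OF aw(1) v(1)] v by metis
  qed
  ultimately show ?thesis by (intro that[of T T'] T(1,3) T'T)
qed

lemma iso_repI:
  assumes "linear_on sV sW V W T" "linear_on sW sV W V T'" "\<And>v. v \<in> V \<Longrightarrow> T' (T v) = v"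
    "\<And>w. w \<in> W \<Longrightarrow> T (T' w) = w" "\<And>a v. a \<in> L \<Longrightarrow> v \<in> V \<Longrightarrow> T (\<rho> a v) = \<tau> a (T v)"
  shows "iso_rep L sV sW (V, \<rho>) (W, \<tau>)"
proof -
  have "bij_betw T V W"
    by (rule bij_betw_byWitness[where f' = T']) (use assms linear_onD(1)[OF assms(1)] linear_onD(1)[OF assms(2)] in auto)
  then show ?thesis using assms unfolding iso_rep_def by auto
qed

lemma iso_rep_sym:
  assumes "iso_rep L sV sW R R'" "lie_rep sL br L sV R"
  shows "iso_rep L sW sV R' R"
proof -
  obtain V \<rho> W \<tau> where R: "R = (V, \<rho>)" "R' = (W, \<tau>)" by (cases R, cases R') auto
  obtain T T' where T: "linear_on sV sW V W T" "linear_on sW sV W V T'" "\<And>v. v \<in> V \<Longrightarrow> T' (T v) = v"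
    "\<And>w. w \<in> W \<Longrightarrow> T (T' w) = w" "\<And>a v. a \<in> L \<Longrightarrow> v \<in> V \<Longrightarrow> T (\<rho> a v) = \<tau> a (T v)"
    "\<And>a w. a \<in> L \<Longrightarrow> w \<in> W \<Longrightarrow> T' (\<tau> a w) = \<rho> a (T' w)"
    by (rule iso_repE[OF assms[unfolded R]]) (rule that)
  show ?thesis unfolding R by (rule iso_repI[where T = T' and T' = T and \<rho> = \<tau> and \<tau> = \<rho>]) (use T in blast)+
qed

lemma iso_rep_refl: "iso_rep L s s R R"
  unfolding iso_rep_def
  by (cases R) (auto simp: linear_on_def bij_betw_def inj_on_def intro!: exI[of _ "\<lambda>v. v"])

lemma iso_rep_trans:
  assumes "iso_rep L sV sW R R'" "iso_rep L sW sU R' R''"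
  shows "iso_rep L sV sU R R''"
proof -
  obtain V \<rho> W \<tau> U \<upsilon> where R: "R = (V, \<rho>)" "R' = (W, \<tau>)" "R'' = (U, \<upsilon>)" by (cases R, cases R', cases R'') auto
  obtain T where T: "linear_on sV sW V W T" "bij_betw T V W" "\<And>a v. a \<in> L \<Longrightarrow> v \<in> V \<Longrightarrow> T (\<rho> a v) = \<tau> a (T v)"
    using assms(1) by (auto simp: R iso_rep_def)
  obtain T' where T': "linear_on sW sU W U T'" "bij_betw T' W U" "\<And>a v. a \<in> L \<Longrightarrow> v \<in> W \<Longrightarrow> T' (\<tau> a v) = \<upsilon> a (T' v)"
    using assms(2) by (auto simp: R iso_rep_def)
  have "linear_on sV sU V U (T' \<circ> T)" using T(1) T'(1) by (auto simp: linear_on_def)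
  moreover have "bij_betw (T' \<circ> T) V U" by (rule bij_betw_trans[OF T(2) T'(2)])
  ultimately show ?thesis unfolding R iso_rep_def using T(3) T'(3) linear_onD(1)[OF T(1)]
    by (auto intro!: exI[of _ "T' \<circ> T"])
qed

lemma irreducible_rep_iso:
  assumes iso: "iso_rep L sV sW R R'" and R: "lie_rep sL br L sV R" "irreducible_rep L sV R"
    and sW: "vector_space sW"
  shows "irreducible_rep L sW R'"
proof -
  obtain V \<rho> W \<tau> where e: "R = (V, \<rho>)" "R' = (W, \<tau>)" by (cases R, cases R') auto
  obtain T T' where T: "linear_on sV sW V W T" "linear_on sW sV W V T'" "\<And>v. v \<in> V \<Longrightarrow> T' (T v) = v"
    "\<And>w. w \<in> W \<Longrightarrow> T (T' w) = w" "\<And>a v. a \<in> L \<Longrightarrow> v \<in> V \<Longrightarrow> T (\<rho> a v) = \<tau> a (T v)"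
    "\<And>a w. a \<in> L \<Longrightarrow> w \<in> W \<Longrightarrow> T' (\<tau> a w) = \<rho> a (T' w)"
    by (rule iso_repE[OF iso[unfolded e] R(1)[unfolded e]]) (rule that)
  note V = lie_repD[OF R(1)[unfolded e]]
  interpret v: lin_space sV using V(1) by (simp add: lin_space_def)
  interpret w: lin_space sW using sW by (simp add: lin_space_def)
  have T0: "T 0 = 0" by (rule linear_on_zero[OF V(1) sW V(2) T(1)])
  have "W \<noteq> {0}"
  proof
    assume "W = {0}"
    then have "T v = 0" if "v \<in> V" for v using linear_onD(1)[OF T(1) that] by simp
    then have "v = T' 0" if "v \<in> V" for v using T(3)[OF that] that by simp
    then have "V \<subseteq> {0}" using v.subspace_0[OF V(2)] by (metis insertI1 subsetI)
    then show False using R(2) v.subspace_0[OF V(2)] by (auto simp: e irreducible_rep_def)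
  qed
  moreover have "U = {0} \<or> U = W" if U: "w.subspace U" "U \<subseteq> W" "\<forall>a\<in>L. \<forall>u\<in>U. \<tau> a u \<in> U" for U
  proof -
    let ?U = "{v \<in> V. T v \<in> U}"
    have "v.subspace ?U"
      by (rule v.subspaceI) (use V(2) U(1) T0 linear_onD[OF T(1)] in
        \<open>auto simp: v.subspace_0 v.subspace_add v.subspace_scale w.subspace_0 w.subspace_add w.subspace_scale\<close>)
    moreover have "\<rho> a u \<in> ?U" if "a \<in> L" "u \<in> ?U" for a u
      using that T(5) U(3) linear_onD(1)[OF V(3)[OF that(1)]] by auto
    ultimately have "?U = {0} \<or> ?U = V" using R(2) unfolding e irreducible_rep_def by auto
    then show ?thesis
    proof
      assume 0: "?U = {0}"
      have "u = 0" if "u \<in> U" for u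
      proof -
        have "T' u \<in> ?U" using that U(2) T(4) linear_onD(1)[OF T(2)] by auto
        then have "T' u = 0" using 0 by blast
        then show ?thesis using T(4)[of u] that U(2) T0 by auto
      qed
      then show ?thesis using w.subspace_0[OF U(1)] by blast
    next
      assume V': "?U = V"
      have "u \<in> U" if "u \<in> W" for u
      proof -
        have "T' u \<in> ?U" using linear_onD(1)[OF T(2) that] V' by blast
        then show ?thesis using T(4)[OF that] by auto
      qed
      then show ?thesis using U(2) by blast
    qed
  qed
  ultimately show ?thesis unfolding e irreducible_rep_def by auto
qed

lemma rep_class_eqI:
  assumes "fd_rep sL br L R" "iso_rep L seq_scale seq_scale R R'"
  shows "rep_class sL br L R = rep_class sL br L R'"
proof -
  have "iso_rep L seq_scale seq_scale R' R" using iso_rep_sym[OF assms(2)] assms(1) by (auto simp: fd_rep_def)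
  then show ?thesis using assms(2) iso_rep_trans unfolding rep_class_def by blast
qed

lemma irrep_classD:
  assumes "C \<in> irrep_classes sL br L" "R \<in> C"
  shows "fd_rep sL br L R" "irreducible_rep L seq_scale R" "C = rep_class sL br L R"
proof -
  obtain R0 where R0: "C = rep_class sL br L R0" "fd_rep sL br L R0" "irreducible_rep L seq_scale R0"
    using assms(1) by (auto simp: irrep_classes_def)
  have R: "fd_rep sL br L R" "iso_rep L seq_scale seq_scale R0 R" using assms(2) R0(1) by (auto simp: rep_class_def)
  then show "fd_rep sL br L R" "irreducible_rep L seq_scale R" "C = rep_class sL br L R"
    using irreducible_rep_iso[OF R(2) _ R0(3) vector_space_seq] R0 rep_class_eqI[OF R0(2) R(2)]
    by (auto simp: fd_rep_def)
qed

lemma rep_class_self: "fd_rep sL br L R \<Longrightarrow> R \<in> rep_class sL br L R"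
  by (simp add: rep_class_def iso_rep_refl)

lemma irrep_class_nonempty: "C \<in> irrep_classes sL br L \<Longrightarrow> \<exists>R. R \<in> C"
  unfolding irrep_classes_def using rep_class_self by blast

context multiloop
begin

section \<open>Evaluation representations\<close>

text \<open>
  \<open>Q\<close> is the evaluation representation at the points \<open>xs\<close> with factors \<open>R\<close>, and \<open>t\<close> exhibits its space as
  the tensor product.  In contrast to \<open>is_evaluation_rep\<close> the action is expressed in terms of \<open>M\<close> itself.
\<close>

definition ev_struct where
  "ev_struct xs R Q t \<longleftrightarrow> is_tensor_product xs seq_scale (seq_scale :: 'k \<Rightarrow> _) (\<lambda>x. fst (R x)) (fst Q) t \<and>
    (\<forall>\<alpha>\<in>M. seq_linear_on (fst Q) (fst Q) (snd Q \<alpha>) \<and>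
      (\<forall>v\<in>(\<Pi>\<^sub>E x\<in>xs. fst (R x)). snd Q \<alpha> (t v) = (\<Sum>x\<in>xs. t (v(x := snd (R x) (\<alpha> x) (v x))))))"

lemma ev_structD:
  assumes "ev_struct xs R Q t"
  shows "is_tensor_product xs seq_scale (seq_scale :: 'k \<Rightarrow> _) (\<lambda>x. fst (R x)) (fst Q) t"
    "multilinear_on xs seq_scale seq_scale (\<lambda>x. fst (R x)) (fst Q) t"
    "\<alpha> \<in> M \<Longrightarrow> seq_linear_on (fst Q) (fst Q) (snd Q \<alpha>)"
    "\<alpha> \<in> M \<Longrightarrow> v \<in> (\<Pi>\<^sub>E x\<in>xs. fst (R x)) \<Longrightarrow> snd Q \<alpha> (t v) = (\<Sum>x\<in>xs. t (v(x := snd (R x) (\<alpha> x) (v x))))"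
  using assms by (auto simp: ev_struct_def is_tensor_product_def)

lemma fd_repD:
  assumes "fd_rep sL br L Q"
  shows "module.subspace seq_scale (fst Q)" "lie_rep sL br L seq_scale (fst Q, snd Q)" "fin_dim seq_scale (fst Q)"
  using assms by (auto simp: fd_rep_def lie_rep_def case_prod_beta)

lemma ev_struct_of_evaluation:
  assumes xs: "xs \<subseteq> X" and Q: "module.subspace seq_scale (fst Q)" and ev: "is_evaluation_rep seq_scale xs R Q"
  shows "\<exists>t. ev_struct xs R Q t"
proof -
  interpret s: lin_space "seq_scale :: 'k \<Rightarrow> _" using vector_space_seq by (simp add: lin_space_def)
  obtain W \<tau> where e: "Q = (W, \<tau>)" by (cases Q)
  from ev obtain \<tau>' where tr: "is_tensor_rep xs g_at seq_scale seq_scale R (W, \<tau>')"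
    and \<tau>0: "\<forall>\<alpha>\<in>M. \<forall>w\<in>W. \<tau> \<alpha> w = \<tau>' (restrict \<alpha> xs) w"
    unfolding e is_evaluation_rep_def prod.case by blast
  from tr obtain t where tp: "is_tensor_product xs seq_scale seq_scale (\<lambda>i. fst (R i)) W t"
    and a0: "\<forall>a\<in>Pi\<^sub>E xs g_at. seq_linear_on W W (\<tau>' a) \<and>
      (\<forall>v\<in>(\<Pi>\<^sub>E i\<in>xs. fst (R i)). \<tau>' a (t v) = (\<Sum>i\<in>xs. t (v(i := snd (R i) (a i) (v i)))))"
    unfolding is_tensor_rep_def prod.case by blast
  note a = bspec[OF a0] and \<tau> = \<tau>0[rule_format]
  have r: "restrict \<alpha> xs \<in> Pi\<^sub>E xs g_at" for \<alpha> using g_at_X xs by auto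
  have W: "s.subspace W" using Q by (simp add: e)
  have tW: "t v \<in> W" if "v \<in> (\<Pi>\<^sub>E i\<in>xs. fst (R i))" for v
    using tp that by (auto simp: is_tensor_product_def multilinear_on_def)
  have "seq_linear_on W W (\<tau> \<alpha>)" if "\<alpha> \<in> M" for \<alpha>
    using a[OF r[of \<alpha>]] \<tau>[OF that] s.subspace_add[OF W] s.subspace_scale[OF W] by (simp add: linear_on_def)
  moreover have "\<tau> \<alpha> (t v) = (\<Sum>i\<in>xs. t (v(i := snd (R i) (\<alpha> i) (v i))))"
    if "\<alpha> \<in> M" "v \<in> (\<Pi>\<^sub>E i\<in>xs. fst (R i))" for \<alpha> v
    using a[OF r[of \<alpha>]] \<tau>[OF that(1) tW[OF that(2)]] that(2) by simp
  ultimately show ?thesis using tp unfolding ev_struct_def e by (intro exI[of _ t]) auto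
qed

lemma ev_struct_unique:
  assumes st: "ev_struct xs R Q t" and Q: "module.subspace seq_scale (fst Q)"
    and h: "seq_linear_on (fst Q) U h" "seq_linear_on (fst Q) U' h'"
    and eq: "\<And>v. v \<in> (\<Pi>\<^sub>E x\<in>xs. fst (R x)) \<Longrightarrow> h (t v) = h' (t v)" and w: "w \<in> fst Q"
  shows "h w = h' w"
  by (rule tensor_hom_unique[OF vector_space_seq Q ev_structD(1)[OF st] linear_on_UNIV[OF h(1)] linear_on_UNIV[OF h(2)] eq w])

text \<open>
  Elements of \<open>M\<close> realize every tuple of values on \<open>xs\<close>, so the action of \<open>M\<close> induces one of the direct sum.
\<close>

lemma evaluation_of_ev_struct:
  assumes xs: "finite xs" "orbit_free xs" and Q: "module.subspace seq_scale (fst Q)" and st: "ev_struct xs R Q t"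
  shows "is_evaluation_rep seq_scale xs R Q"
proof -
  obtain \<delta> where \<delta>: "\<And>x u. x \<in> xs \<Longrightarrow> \<delta> x u \<in> M" "\<And>x u. x \<in> xs \<Longrightarrow> \<delta> x u x = u"
    "\<And>x u y. x \<in> xs \<Longrightarrow> y \<in> xs \<Longrightarrow> y \<noteq> x \<Longrightarrow> \<delta> x u y = 0"
    by (rule site_elements[OF xs]) (rule that)
  obtain W \<tau> where e: "Q = (W, \<tau>)" by (cases Q)
  define el where "el = (\<lambda>a z. \<Sum>x\<in>xs. \<delta> x (a x) z)"
  have elM: "el a \<in> M" for a unfolding el_def by (rule M_sum[OF \<delta>(1)])
  have el: "el a y = a y" if y: "y \<in> xs" for a y
  proof -
    have "(\<Sum>x\<in>xs. \<delta> x (a x) y) = (\<Sum>x\<in>xs. if x = y then a y else 0)"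
      by (rule sum.cong) (use \<delta> y in auto)
    then show ?thesis using xs(1) y by (simp add: el_def)
  qed
  have tau: "snd Q \<alpha> w = snd Q (el (restrict \<alpha> xs)) w" if \<alpha>: "\<alpha> \<in> M" and w: "w \<in> fst Q" for \<alpha> w
  proof (rule ev_struct_unique[OF st Q ev_structD(3)[OF st \<alpha>] ev_structD(3)[OF st elM] _ w])
    fix v assume v: "v \<in> (\<Pi>\<^sub>E x\<in>xs. fst (R x))"
    show "snd Q \<alpha> (t v) = snd Q (el (restrict \<alpha> xs)) (t v)"
      using ev_structD(4)[OF st \<alpha> v] ev_structD(4)[OF st elM v, of "restrict \<alpha> xs"] el by simp
  qed
  then have tau: "\<tau> \<alpha> w = \<tau> (el (restrict \<alpha> xs)) w" if "\<alpha> \<in> M" "w \<in> W" for \<alpha> w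
    using that by (simp add: e)
  show ?thesis
    unfolding e is_evaluation_rep_def is_tensor_rep_def prod.case
  proof (intro exI[of _ "\<lambda>a. \<tau> (el a)"] conjI exI[of _ t] ballI)
    show "is_tensor_product xs seq_scale seq_scale (\<lambda>i. fst (R i)) W t" using ev_structD(1)[OF st] by (simp add: e)
    show "seq_linear_on W W (\<tau> (el a))" for a using ev_structD(3)[OF st elM] by (simp add: e)
    show "\<tau> (el a) (t v) = (\<Sum>i\<in>xs. t (v(i := snd (R i) (a i) (v i))))" if "v \<in> (\<Pi>\<^sub>E i\<in>xs. fst (R i))" for a v
      using ev_structD(4)[OF st elM that] el by (simp add: e)
  qed (rule tau)
qed

lemma ev_struct_vanish:
  assumes Q: "module.subspace seq_scale (fst Q)" and st: "ev_struct xs R Q t"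
    and R: "\<And>x. x \<in> xs \<Longrightarrow> g_rep (R x)"
    and \<alpha>: "\<alpha> \<in> M" "\<And>x. x \<in> xs \<Longrightarrow> \<alpha> x = 0" and w: "w \<in> fst Q"
  shows "snd Q \<alpha> w = 0"
proof -
  interpret s: lin_space "seq_scale :: 'k \<Rightarrow> _" using vector_space_seq by (simp add: lin_space_def)
  have "snd Q \<alpha> w = (\<lambda>_. 0) w"
  proof (rule ev_struct_unique[OF st Q ev_structD(3)[OF st \<alpha>(1)] _ _ w])
    show "seq_linear_on (fst Q) UNIV (\<lambda>_. 0)" by (auto simp: linear_on_def)
    fix v assume v: "v \<in> (\<Pi>\<^sub>E x\<in>xs. fst (R x))"
    have "t (v(x := snd (R x) (\<alpha> x) (v x))) = 0" if x: "x \<in> xs" for x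
    proof -
      have "snd (R x) 0 (v x) = 0"
        using linear_on_zero[OF vector_space_axioms vector_space_seq subspace_UNIV lie_repD(4)[OF fd_repD(2)[OF R[OF x]]]] v x by blast
      then have z: "snd (R x) (\<alpha> x) (v x) = 0" using \<alpha>(2)[OF x] by simp
      show ?thesis unfolding z
        by (rule multilinear_zero[OF ev_structD(2)[OF st] vector_space_seq vector_space_seq _ x])
          (use v x s.subspace_0[OF fd_repD(1)[OF R[OF x]]] in \<open>auto simp: PiE_iff extensional_def\<close>)
    qed
    then show "snd Q \<alpha> (t v) = 0" using ev_structD(4)[OF st \<alpha>(1) v] by simp
  qed
  then show ?thesis by simp
qed

text \<open>
  Both spaces satisfy the same universal property, and the induced maps commute with \<open>M\<close> on pure tensors.
\<close>

lemma ev_struct_iso: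
  assumes Q: "M_rep Q" "ev_struct xs R Q t"
    and Q': "M_rep Q'" "ev_struct xs R Q' t'"
    and R: "\<And>x. x \<in> xs \<Longrightarrow> g_rep (R x)"
  shows "iso_rep M seq_scale seq_scale Q Q'"
proof -
  let ?V = "\<lambda>x. fst (R x)"
  have ex: "\<exists>h. seq_linear_on (fst Q) (fst Q') h \<and> (\<forall>v\<in>Pi\<^sub>E xs ?V. h (t v) = t' v)"
    if Q: "M_rep Q" "ev_struct xs R Q t"
    and Q': "M_rep Q'" "ev_struct xs R Q' t'" for Q Q' t t'
  proof -
    interpret s: lin_space "seq_scale :: 'k \<Rightarrow> _" using vector_space_seq by (simp add: lin_space_def)
    obtain p where p: "linear_op seq_scale p" "\<And>v. p v \<in> fst Q'" "\<And>w. w \<in> fst Q' \<Longrightarrow> p w = w"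
      using fd_repD(1)[OF Q'(1)] by (rule s.subspace_projection) (rule that)
    have "multilinear_on xs seq_scale seq_scale ?V UNIV t'"
      using ev_structD(2)[OF Q'(2)] by (rule multilinear_on_UNIV)
    then obtain h where h: "seq_linear_on (fst Q) UNIV h" "\<And>v. v \<in> Pi\<^sub>E xs ?V \<Longrightarrow> h (t v) = t' v"
      using tensor_hom_exists[OF ev_structD(1)[OF Q(2)]] by blast
    have "seq_linear_on (fst Q) (fst Q') (\<lambda>w. p (h w))"
      using h(1) p by (auto simp: linear_on_def s.linearD[OF p(1)])
    moreover have "p (h (t v)) = t' v" if "v \<in> Pi\<^sub>E xs ?V" for v
      using h(2)[OF that] p(3) multilinear_onD(1)[OF ev_structD(2)[OF Q'(2)] that] by simp
    ultimately show ?thesis by (intro exI[of _ "\<lambda>w. p (h w)"]) auto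
  qed
  obtain h where h: "seq_linear_on (fst Q) (fst Q') h" "\<And>v. v \<in> Pi\<^sub>E xs ?V \<Longrightarrow> h (t v) = t' v"
    using ex[OF Q Q'] by blast
  obtain k where k: "seq_linear_on (fst Q') (fst Q) k" "\<And>v. v \<in> Pi\<^sub>E xs ?V \<Longrightarrow> k (t' v) = t v"
    using ex[OF Q' Q] by blast
  note sQ = fd_repD(1)[OF Q(1)] and sQ' = fd_repD(1)[OF Q'(1)]
  have comp: "seq_linear_on U1 U3 (\<lambda>w. g (f w))"
    if "seq_linear_on U1 U2 f" "seq_linear_on U2 U3 g" for f g and U1 U2 U3 :: "'k seq set"
    using that by (auto simp: linear_on_def)
  have idl: "seq_linear_on U U (\<lambda>w. w)" for U :: "'k seq set" by (simp add: linear_on_def)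
  have kh: "k (h w) = w" if "w \<in> fst Q" for w
    by (rule ev_struct_unique[OF Q(2) sQ comp[OF h(1) k(1)] idl _ that]) (simp add: h k)
  have hk: "h (k w) = w" if "w \<in> fst Q'" for w
    by (rule ev_struct_unique[OF Q'(2) sQ' comp[OF k(1) h(1)] idl _ that]) (simp add: h k)
  have eqv: "h (snd Q \<alpha> w) = snd Q' \<alpha> (h w)" if \<alpha>: "\<alpha> \<in> M" and w: "w \<in> fst Q" for \<alpha> w
  proof (rule ev_struct_unique[OF Q(2) sQ comp[OF ev_structD(3)[OF Q(2) \<alpha>] h(1)] comp[OF h(1) ev_structD(3)[OF Q'(2) \<alpha>]] _ w])
    fix v assume v: "v \<in> Pi\<^sub>E xs ?V"
    show "h (snd Q \<alpha> (t v)) = snd Q' \<alpha> (h (t v))"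
    proof -
      have up: "v(x := snd (R x) (\<alpha> x) (v x)) \<in> Pi\<^sub>E xs ?V" if x: "x \<in> xs" for x
        using v x linear_onD(1)[OF lie_repD(3)[OF fd_repD(2)[OF R[OF x]]], of "\<alpha> x" "v x"]
        by (auto simp: PiE_iff extensional_def)
      have "h (snd Q \<alpha> (t v)) = (\<Sum>x\<in>xs. h (t (v(x := snd (R x) (\<alpha> x) (v x)))))"
        unfolding ev_structD(4)[OF Q(2) \<alpha> v]
        by (rule linear_on_sum[OF vector_space_seq vector_space_seq sQ h(1)])
          (rule multilinear_onD(1)[OF ev_structD(2)[OF Q(2)] up])
      also have "\<dots> = (\<Sum>x\<in>xs. t' (v(x := snd (R x) (\<alpha> x) (v x))))"
        by (rule sum.cong[OF refl], rule h(2)[OF up])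
      also have "\<dots> = snd Q' \<alpha> (h (t v))" using ev_structD(4)[OF Q'(2) \<alpha> v] h(2)[OF v] by simp
      finally show ?thesis .
    qed
  qed
  show ?thesis
    using iso_repI[where T = h and T' = k and \<rho> = "snd Q" and \<tau> = "snd Q'", OF h(1) k(1) kh hk eqv] by simp
qed

end

context multiloop
begin

lemma lin_space_seq: "lin_space (seq_scale :: 'k \<Rightarrow> _)"
  using vector_space_seq by (simp add: lin_space_def)

lemma ev_struct_transfer:
  assumes st: "ev_struct xs R Q t" and Q: "M_rep Q" and Q': "M_rep Q'"
    and iso: "iso_rep M seq_scale seq_scale Q Q'" and R: "\<And>x. x \<in> xs \<Longrightarrow> g_rep (R x)"
  shows "\<exists>t'. ev_struct xs R Q' t'"
proof -
  obtain T T' where T: "seq_linear_on (fst Q) (fst Q') T" "seq_linear_on (fst Q') (fst Q) T'"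
    "\<And>v. v \<in> fst Q \<Longrightarrow> T' (T v) = v" "\<And>w. w \<in> fst Q' \<Longrightarrow> T (T' w) = w"
    "\<And>a v. a \<in> M \<Longrightarrow> v \<in> fst Q \<Longrightarrow> T (snd Q a v) = snd Q' a (T v)"
    "\<And>a w. a \<in> M \<Longrightarrow> w \<in> fst Q' \<Longrightarrow> T' (snd Q' a w) = snd Q a (T' w)"
    using iso fd_repD(2)[OF Q] by (elim iso_repE[rotated, of _ _ _ _ "fst Q" "snd Q" _ "fst Q'" "snd Q'"]) simp_all
  let ?V = "\<lambda>x. fst (R x)"
  note sQ = fd_repD(1)[OF Q] and sQ' = fd_repD(1)[OF Q']
  have tm: "multilinear_on xs seq_scale seq_scale ?V (fst Q) t" by (rule ev_structD(2)[OF st])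
  have tp: "is_tensor_product xs seq_scale seq_scale ?V (fst Q') (\<lambda>v. T (t v))"
    unfolding is_tensor_product_def
  proof (intro conjI allI impI)
    show "multilinear_on xs seq_scale seq_scale ?V (fst Q') (\<lambda>v. T (t v))" by (rule multilinear_compose[OF tm T(1)])
    fix f assume f: "multilinear_on xs seq_scale seq_scale ?V UNIV f"
    obtain h where h: "seq_linear_on (fst Q) UNIV h" "\<And>v. v \<in> Pi\<^sub>E xs ?V \<Longrightarrow> h (t v) = f v"
      using tensor_hom_exists[OF ev_structD(1)[OF st] f] by blast
    let ?h = "restrict (\<lambda>w. h (T' w)) (fst Q')"
    have lh: "seq_linear_on (fst Q') UNIV (\<lambda>w. h (T' w))" using h(1) T(2) by (auto simp: linear_on_def)
    show "\<exists>!h. h \<in> extensional (fst Q') \<and> seq_linear_on (fst Q') UNIV h \<and>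
              (\<forall>v\<in>Pi\<^sub>E xs ?V. h (T (t v)) = f v)"
    proof (rule ex1I[of _ ?h])
      have "?h (T (t v)) = f v" if "v \<in> Pi\<^sub>E xs ?V" for v
        using h(2)[OF that] multilinear_onD(1)[OF tm that] T(3) linear_onD(1)[OF T(1)] by simp
      then show "?h \<in> extensional (fst Q') \<and> seq_linear_on (fst Q') UNIV ?h \<and>
          (\<forall>v\<in>Pi\<^sub>E xs ?V. ?h (T (t v)) = f v)"
        using linear_on_restrict[OF vector_space_seq sQ' lh] by auto
      fix k assume k: "k \<in> extensional (fst Q') \<and> seq_linear_on (fst Q') UNIV k \<and>
          (\<forall>v\<in>Pi\<^sub>E xs ?V. k (T (t v)) = f v)"
      have lk: "seq_linear_on (fst Q) UNIV (\<lambda>w. k (T w))" using k T(1) by (auto simp: linear_on_def)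
      have kh: "k (T w) = h w" if "w \<in> fst Q" for w
        by (rule tensor_hom_unique[OF vector_space_seq sQ ev_structD(1)[OF st] lk h(1) _ that]) (use k h(2) in auto)
      have "k w = ?h w" for w
      proof (cases "w \<in> fst Q'")
        case True
        then show ?thesis using kh[OF linear_onD(1)[OF T(2) True]] T(4)[OF True] by simp
      next
        case False
        then show ?thesis using k by (auto simp: extensional_def)
      qed
      then show "k = ?h" by blast
    qed
  qed
  have "snd Q' \<alpha> (T (t v)) = (\<Sum>x\<in>xs. T (t (v(x := snd (R x) (\<alpha> x) (v x)))))"
    if \<alpha>: "\<alpha> \<in> M" and v: "v \<in> Pi\<^sub>E xs ?V" for \<alpha> v
  proof -
    have up: "v(x := snd (R x) (\<alpha> x) (v x)) \<in> Pi\<^sub>E xs ?V" if x: "x \<in> xs" for x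
      using v x linear_onD(1)[OF lie_repD(3)[OF fd_repD(2)[OF R[OF x]]], of "\<alpha> x" "v x"]
      by (auto simp: PiE_iff extensional_def)
    have "snd Q' \<alpha> (T (t v)) = T (\<Sum>x\<in>xs. t (v(x := snd (R x) (\<alpha> x) (v x))))"
      using T(5)[OF \<alpha> multilinear_onD(1)[OF tm v]] ev_structD(4)[OF st \<alpha> v] by simp
    also have "\<dots> = (\<Sum>x\<in>xs. T (t (v(x := snd (R x) (\<alpha> x) (v x)))))"
      by (rule linear_on_sum[OF vector_space_seq vector_space_seq sQ T(1)]) (rule multilinear_onD(1)[OF tm up])
    finally show ?thesis .
  qed
  then show ?thesis using tp lie_repD(3)[OF fd_repD(2)[OF Q']] unfolding ev_struct_def
    by (intro exI[of _ "\<lambda>v. T (t v)"]) auto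
qed

lemma E_D:
  assumes "\<Psi> \<in> E"
  shows "x \<in> X \<Longrightarrow> \<Psi> x \<in> g_irreps" "finite (supp \<Psi>)"
    "c \<in> carrier \<Gamma> \<Longrightarrow> x \<in> X \<Longrightarrow> \<Psi> (act_X c x) = act_class c (\<Psi> x)" "\<Psi> \<in> extensional X"
proof -
  have P: "\<Psi> \<in> Pi\<^sub>E X R_at" using assms by (simp add: E_def)
  show "x \<in> X \<Longrightarrow> \<Psi> x \<in> g_irreps" using PiE_mem[OF P] by (simp add: R_at_def g_at_X)
  show "\<Psi> \<in> extensional X" using P by (simp add: PiE_def)
qed (use assms in \<open>auto simp: E_def\<close>)

lemma supp_X: "supp \<Psi> \<subseteq> X" by (auto simp: supp_def)

lemma same_class_iso:
  assumes "C \<in> irrep_classes sL br L" "R \<in> C" "R' \<in> C"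
  shows "iso_rep L seq_scale seq_scale R R'"
  using irrep_classD(3)[OF assms(1,2)] assms(3) by (auto simp: rep_class_def)

text \<open>
  By equivariance \<open>\<alpha> (c x)\<close> is \<open>\<alpha> x\<close> twisted by \<open>c\<close>, and the class of \<open>\<Psi>\<close> at \<open>c x\<close> is twisted by the inverse, so
  that \<open>M\<close> acts in isomorphic ways through the values at \<open>x\<close> and at \<open>c x\<close>.
\<close>

lemma orbit_iso:
  assumes \<Psi>: "\<Psi> \<in> E" and x: "x \<in> X" and c: "c \<in> carrier \<Gamma>" and R: "R \<in> \<Psi> x" and R': "R' \<in> \<Psi> (act_X c x)"
  shows "\<exists>S S'. seq_linear_on (fst R) (fst R') S \<and> seq_linear_on (fst R') (fst R) S' \<and>
    (\<forall>v\<in>fst R. S' (S v) = v) \<and> (\<forall>w\<in>fst R'. S (S' w) = w) \<and>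
    (\<forall>\<alpha>\<in>M. \<forall>w\<in>fst R'. S' (snd R' (\<alpha> (act_X c x)) w) = snd R (\<alpha> x) (S' w))"
proof -
  have "R' \<in> act_class c (\<Psi> x)" using E_D(3)[OF \<Psi> c x] R' by simp
  then obtain V0 \<rho>0 where R0: "(V0, \<rho>0) \<in> \<Psi> x" "R' = (V0, \<lambda>u. \<rho>0 (act_g (ginv c) u))"
    unfolding act_class_def by auto
  note cl = E_D(1)[OF \<Psi> x]
  have iso: "iso_rep UNIV seq_scale seq_scale (fst R, snd R) (V0, \<rho>0)" using same_class_iso[OF cl R R0(1)] by simp
  obtain S S' where S: "seq_linear_on (fst R) V0 S" "seq_linear_on V0 (fst R) S'"
    "\<And>v. v \<in> fst R \<Longrightarrow> S' (S v) = v" "\<And>w. w \<in> V0 \<Longrightarrow> S (S' w) = w"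
    "\<And>a v. a \<in> UNIV \<Longrightarrow> v \<in> fst R \<Longrightarrow> S (snd R a v) = \<rho>0 a (S v)"
    "\<And>a w. a \<in> UNIV \<Longrightarrow> w \<in> V0 \<Longrightarrow> S' (\<rho>0 a w) = snd R a (S' w)"
    by (rule iso_repE[OF iso fd_repD(2)[OF irrep_classD(1)[OF cl R]]]) (rule that)
  have "S' (snd R' (\<alpha> (act_X c x)) w) = snd R (\<alpha> x) (S' w)" if "\<alpha> \<in> M" "w \<in> V0" for \<alpha> w
    using S(6)[of "\<alpha> x" w] that(2) M_act[OF that(1) c x] act_g_inv(2)[OF c] by (simp add: R0(2))
  then show ?thesis using S by (intro exI[of _ S] exI[of _ S']) (auto simp: R0(2))
qed

text \<open>
  Reindex the tensor product along the bijection of the points, using the isomorphisms of \<open>orbit_iso\<close> for the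
  factors; the action of \<open>M\<close> on pure tensors is unchanged.
\<close>

lemma ev_struct_move:
  assumes \<Psi>: "\<Psi> \<in> E" and xs: "xs \<subseteq> X" and st: "ev_struct xs R Q t"
    and p: "\<And>x. x \<in> xs \<Longrightarrow> p x \<in> ys \<and> q (p x) = x" "\<And>y. y \<in> ys \<Longrightarrow> q y \<in> xs \<and> p (q y) = y"
    and c: "\<And>x. x \<in> xs \<Longrightarrow> c x \<in> carrier \<Gamma> \<and> p x = act_X (c x) x"
    and R: "\<And>x. x \<in> xs \<Longrightarrow> R x \<in> \<Psi> x" and R': "\<And>y. y \<in> ys \<Longrightarrow> R' y \<in> \<Psi> y"
  shows "\<exists>t'. ev_struct ys R' Q t'"
proof -
  let ?P = "\<lambda>x (S, S'). seq_linear_on (fst (R x)) (fst (R' (p x))) S \<and>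
    seq_linear_on (fst (R' (p x))) (fst (R x)) S' \<and>
    (\<forall>v\<in>fst (R x). S' (S v) = v) \<and> (\<forall>w\<in>fst (R' (p x)). S (S' w) = w) \<and>
    (\<forall>\<alpha>\<in>M. \<forall>w\<in>fst (R' (p x)). S' (snd (R' (p x)) (\<alpha> (p x)) w) = snd (R x) (\<alpha> x) (S' w))"
  have "\<forall>x\<in>xs. \<exists>SS. ?P x SS"
  proof
    fix x assume x: "x \<in> xs"
    then have xX: "x \<in> X" using xs by blast
    have px: "p x = act_X (c x) x" "c x \<in> carrier \<Gamma>" using c[OF x] by auto
    have "R' (p x) \<in> \<Psi> (act_X (c x) x)" using R' p(1)[OF x] px(1) by metis
    from orbit_iso[OF \<Psi> xX px(2) R[OF x] this] show "\<exists>SS. ?P x SS" unfolding px(1) by auto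
  qed
  from bchoice[OF this] obtain SS where SS: "\<forall>x\<in>xs. ?P x (SS x)" ..
  define S S' where "S = (\<lambda>x. fst (SS x))" and "S' = (\<lambda>y. snd (SS (q y)))"
  have S: "seq_linear_on (fst (R x)) (fst (R' (p x))) (S x)"
    "seq_linear_on (fst (R' (p x))) (fst (R x)) (S' (p x))"
    "\<And>v. v \<in> fst (R x) \<Longrightarrow> S' (p x) (S x v) = v" "\<And>w. w \<in> fst (R' (p x)) \<Longrightarrow> S x (S' (p x) w) = w"
    "\<And>\<alpha> w. \<alpha> \<in> M \<Longrightarrow> w \<in> fst (R' (p x)) \<Longrightarrow> S' (p x) (snd (R' (p x)) (\<alpha> (p x)) w) = snd (R x) (\<alpha> x) (S' (p x) w)"
    if "x \<in> xs" for x
    using bspec[OF SS that] p(1)[OF that] by (auto simp: S_def S'_def case_prod_beta)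
  let ?t = "\<lambda>u. t (\<lambda>i\<in>xs. S' (p i) (u (p i)))"
  have lS': "seq_linear_on (fst (R' y)) (fst (R (q y))) (S' y)" if "y \<in> ys" for y
    using S(2)[of "q y"] p(2)[OF that] by simp
  have S4: "S (q y) (S' y u) = u" if "y \<in> ys" "u \<in> fst (R' y)" for y u
    using S(4)[of "q y" u] p(2)[OF that(1)] that(2) by simp
  have tp: "is_tensor_product ys seq_scale seq_scale (\<lambda>y. fst (R' y)) (fst Q) ?t"
    by (rule tensor_product_reindex[where V = "\<lambda>x. fst (R x)" and T = S and p = p and q = q and T' = S' and U = "\<lambda>y. fst (R' y)",
      OF p S(1) lS' S(3) S4 ev_structD(1)[OF st]])
  have "snd Q \<alpha> (?t u) = (\<Sum>y\<in>ys. ?t (u(y := snd (R' y) (\<alpha> y) (u y))))"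
    if \<alpha>: "\<alpha> \<in> M" and u: "u \<in> (\<Pi>\<^sub>E y\<in>ys. fst (R' y))" for \<alpha> u
  proof -
    let ?v = "\<lambda>i\<in>xs. S' (p i) (u (p i))"
    have uV: "u (p x) \<in> fst (R' (p x))" if "x \<in> xs" for x using u p(1)[OF that] by auto
    have v: "?v \<in> (\<Pi>\<^sub>E x\<in>xs. fst (R x))" using linear_onD(1)[OF S(2)] uV by auto
    have "snd Q \<alpha> (?t u) = (\<Sum>x\<in>xs. t (?v(x := snd (R x) (\<alpha> x) (?v x))))" by (rule ev_structD(4)[OF st \<alpha> v])
    also have "\<dots> = (\<Sum>x\<in>xs. ?t (u(p x := snd (R' (p x)) (\<alpha> (p x)) (u (p x)))))"
    proof (rule sum.cong[OF refl])
      fix x assume x: "x \<in> xs"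
      have "?v(x := snd (R x) (\<alpha> x) (?v x)) = (\<lambda>i\<in>xs. S' (p i) ((u(p x := snd (R' (p x)) (\<alpha> (p x)) (u (p x)))) (p i)))"
      proof
        fix i
        have "i \<in> xs \<Longrightarrow> p i = p x \<longleftrightarrow> i = x" using p(1) x by metis
        then show "(?v(x := snd (R x) (\<alpha> x) (?v x))) i
          = (\<lambda>i\<in>xs. S' (p i) ((u(p x := snd (R' (p x)) (\<alpha> (p x)) (u (p x)))) (p i))) i"
          using x S(5)[OF x \<alpha> uV[OF x]] by (cases "i \<in> xs") auto
      qed
      then show "t (?v(x := snd (R x) (\<alpha> x) (?v x))) = ?t (u(p x := snd (R' (p x)) (\<alpha> (p x)) (u (p x))))" by simp
    qed
    also have "\<dots> = (\<Sum>y\<in>ys. ?t (u(y := snd (R' y) (\<alpha> y) (u y))))"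
      by (rule sum.reindex_bij_witness[of _ q p]) (use p in auto)
    finally show ?thesis .
  qed
  then show ?thesis using tp ev_structD(3)[OF st] unfolding ev_struct_def by (intro exI[of _ ?t]) auto
qed

lemma trivial_fd_rep: "g_rep trivial_rep"
proof -
  interpret s: lin_space "seq_scale :: 'k \<Rightarrow> _" by (rule lin_space_seq)
  show ?thesis
    unfolding fd_rep_def lie_rep_def trivial_rep_def prod.case fin_dim_def fst_conv
    using s.span_zero by (auto simp: vector_space_seq linear_on_def)
qed

text \<open>
  An irreducible representation on which \<open>\<gg>\<close> acts by zero has dimension one.
\<close>

lemma zero_class_iff:
  assumes x: "x \<in> X" and C: "C \<in> g_irreps" and R: "R \<in> C"
  shows "C = zero_at x \<longleftrightarrow> (\<forall>u. \<forall>v\<in>fst R. snd R u v = 0)"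
proof -
  interpret s: lin_space "seq_scale :: 'k \<Rightarrow> _" by (rule lin_space_seq)
  let ?t0 = "trivial_rep :: ('g, 'k) seq_rep"
  let ?e = "\<lambda>i::nat. if i = 0 then 1 else (0::'k)"
  obtain V \<rho> where e: "R = (V, \<rho>)" by (cases R)
  have z: "zero_at x = g_class trivial_rep" by (simp add: zero_at_def g_at_X[OF x])
  note fR = irrep_classD(1)[OF C R] and iR = irrep_classD(2)[OF C R]
  show ?thesis
  proof
    assume "C = zero_at x"
    then have "iso_rep UNIV seq_scale seq_scale trivial_rep (V, \<rho>)"
      using R unfolding z rep_class_def e by blast
    then have "iso_rep UNIV seq_scale seq_scale (fst ?t0, snd ?t0) (V, \<rho>)"
      by (simp only: prod.collapse)
    then obtain T T' where T: "seq_linear_on (fst ?t0) V T"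
        "\<And>w. w \<in> V \<Longrightarrow> T (T' w) = w" "seq_linear_on V (fst ?t0) T'"
        "\<And>a v. a \<in> UNIV \<Longrightarrow> v \<in> fst ?t0 \<Longrightarrow> T (snd ?t0 a v) = \<rho> a (T v)"
      by (rule iso_repE[OF _ fd_repD(2)[OF trivial_fd_rep]]) (rule that)
    have "\<rho> u v = 0" if v: "v \<in> V" for u v
    proof -
      have "\<rho> u (T (T' v)) = T (snd ?t0 u (T' v))" using T(4)[of u "T' v"] linear_onD(1)[OF T(3) v] by simp
      also have "snd ?t0 u (T' v) = 0" by (simp add: trivial_rep_def)
      also have "T 0 = 0" by (rule linear_on_zero[OF vector_space_seq vector_space_seq fd_repD(1)[OF trivial_fd_rep] T(1)])
      finally show ?thesis using T(2)[OF v] by simp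
    qed
    then show "\<forall>u. \<forall>v\<in>fst R. snd R u v = 0" by (simp add: e)
  next
    assume 0: "\<forall>u. \<forall>v\<in>fst R. snd R u v = 0"
    have sV: "s.subspace V" using fd_repD(1)[OF fR] by (simp add: e)
    obtain v where v: "v \<in> V" "v \<noteq> 0" using iR s.subspace_0[OF sV] by (auto simp: e irreducible_rep_def)
    have "s.span {v} \<subseteq> V" by (rule s.span_minimal[OF _ sV]) (use v in auto)
    moreover have "\<forall>a\<in>UNIV. \<forall>u\<in>s.span {v}. \<rho> a u \<in> s.span {v}"
      using 0 \<open>s.span {v} \<subseteq> V\<close> s.span_zero[of "{v}"] by (auto simp: e subset_iff)
    ultimately have "s.span {v} = {0} \<or> s.span {v} = V" using iR by (auto simp: e irreducible_rep_def)
    then have V: "V = range (\<lambda>k. seq_scale k v)" using v(2) s.span_base[of v "{v}"] by (auto simp: s.span_singleton)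
    have tr: "fst trivial_rep = range (\<lambda>k. seq_scale k ?e)" by (simp add: trivial_rep_def s.span_singleton)
    have e0: "seq_scale k ?e 0 = k" for k by (simp add: fun_scale_def)
    have "iso_rep UNIV seq_scale seq_scale trivial_rep R"
      unfolding iso_rep_def trivial_rep_def e prod.case
    proof (intro exI[of _ "\<lambda>y. seq_scale (y 0) v"] conjI ballI)
      show "seq_linear_on (s.span {?e}) V (\<lambda>y. seq_scale (y 0) v)"
        using V by (auto simp: linear_on_def fun_scale_def fun_eq_iff distrib_right)
      show "bij_betw (\<lambda>y. seq_scale (y 0) v) (s.span {?e}) V"
        unfolding bij_betw_def
      proof (intro conjI inj_onI)
        fix y y' assume "y \<in> s.span {?e}" "y' \<in> s.span {?e}" "seq_scale (y 0) v = seq_scale (y' 0) v"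
        then show "y = y'" using v(2) e0 by (auto simp: s.span_singleton)
      next
        show "(\<lambda>y. seq_scale (y 0) v) ` s.span {?e} = V" using e0 by (auto simp: s.span_singleton V image_image)
      qed
      fix a y assume "y \<in> s.span {?e}"
      show "seq_scale ((0 :: 'k seq) 0) v = \<rho> a (seq_scale (y 0) v)" using 0 V by (auto simp: e)
    qed
    then show "C = zero_at x" unfolding z irrep_classD(3)[OF C R] using rep_class_eqI[OF trivial_fd_rep] by blast
  qed
qed

lemma supp_act:
  assumes \<Psi>: "\<Psi> \<in> E" and x: "x \<in> X" and c: "c \<in> carrier \<Gamma>"
  shows "act_X c x \<in> supp \<Psi> \<longleftrightarrow> x \<in> supp \<Psi>"
proof -
  note cl = E_D(1)[OF \<Psi> x] and cl' = E_D(1)[OF \<Psi> act_X_in[OF x, of c]]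
  obtain R where R: "R \<in> \<Psi> x" using irrep_class_nonempty[OF cl] by blast
  obtain V \<rho> where e: "R = (V, \<rho>)" by (cases R)
  have R': "(V, \<lambda>u. \<rho> (act_g (ginv c) u)) \<in> \<Psi> (act_X c x)"
    unfolding E_D(3)[OF \<Psi> c x] act_class_def using R by (auto simp: e intro!: image_eqI[of _ _ R])
  have "(\<forall>u. \<forall>v\<in>V. \<rho> (act_g (ginv c) u) v = 0) \<longleftrightarrow> (\<forall>u. \<forall>v\<in>V. \<rho> u v = 0)"
    using act_g_inv(2)[OF c] by metis
  then have "\<Psi> (act_X c x) = zero_at (act_X c x) \<longleftrightarrow> \<Psi> x = zero_at x"
    using zero_class_iff[OF x cl R] zero_class_iff[OF act_X_in[OF x] cl' R'] by (simp add: e)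
  then show ?thesis using x act_X_in by (simp add: supp_def)
qed

end

context multiloop
begin

text \<open>
  On pure tensors the action of \<open>\<alpha>\<close> is the sum over \<open>x\<close> of the action of \<open>\<alpha> x\<close> on the factor at \<open>x\<close>; this is
  multilinear, hence extends.  In the bracket relation the terms for two different sites cancel.
  Irreducibility holds because the elements concentrated at one point act on one factor only.
\<close>

lemma ev_struct_exists:
  assumes xs: "finite xs" "orbit_free xs"
    and R: "\<And>x. x \<in> xs \<Longrightarrow> g_rep (R x)" "\<And>x. x \<in> xs \<Longrightarrow> irreducible_rep UNIV seq_scale (R x)"
  shows "\<exists>Q t. M_rep Q \<and> irreducible_rep M seq_scale Q \<and> ev_struct xs R Q t"
proof -
  interpret s: lin_space "seq_scale :: 'k \<Rightarrow> _" by (rule lin_space_seq)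
  interpret s: alg_closed_space "seq_scale :: 'k \<Rightarrow> _" ..
  note vs = vector_space_seq
  define V \<rho> where "V = (\<lambda>x. fst (R x))" and "\<rho> = (\<lambda>x. snd (R x))"
  have rep: "lie_rep scale bracket UNIV seq_scale (V x, \<rho> x)" and subV: "s.subspace (V x)" and fdV: "fin_dim seq_scale (V x)"
    if "x \<in> xs" for x using fd_repD[OF R(1)[OF that]] by (auto simp: V_def \<rho>_def)
  have lr: "seq_linear_on (V x) (V x) (\<rho> x u)" if "x \<in> xs" for x u
    using lie_repD(3)[OF rep[OF that]] by blast
  have lu: "linear_on scale seq_scale UNIV (V x) (\<lambda>u. \<rho> x u v)" if "x \<in> xs" "v \<in> V x" for x v
    using lie_repD(4)[OF rep[OF that(1)] that(2)] .
  have "\<forall>x\<in>xs. \<exists>B. finite B \<and> s.independent B \<and> s.span B = V x"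
    using fdV s.fin_dim_basis by metis
  from bchoice[OF this] obtain B where B0: "\<forall>x\<in>xs. finite (B x) \<and> s.independent (B x) \<and> s.span (B x) = V x" ..
  then have B: "\<And>x. x \<in> xs \<Longrightarrow> finite (B x)" "\<And>x. x \<in> xs \<Longrightarrow> s.independent (B x)" "\<And>x. x \<in> xs \<Longrightarrow> s.span (B x) = V x"
    by auto
  obtain W :: "'k seq set" and t where fdW: "fin_dim seq_scale W" and tm: "multilinear_on xs seq_scale seq_scale V W t"
    and free: "free_family seq_scale (Pi\<^sub>E xs B) t" and Wspan: "W = s.span (t ` Pi\<^sub>E xs B)"
    by (rule tensor_exists[where B = B and V = V, OF vs xs(1) B]) (assumption | rule that)+
  have subW: "s.subspace W" by (rule s.fin_dim_subspace[OF fdW])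
  have tp: "is_tensor_product xs seq_scale seq_scale V W t"
    by (rule tensor_product_of_basis[where B = B, OF vs vs xs(1) B(1,3) tm subW free]) (assumption | rule equalityD1[OF Wspan])+
  have BV: "Pi\<^sub>E xs B \<subseteq> Pi\<^sub>E xs V" using B(3) s.span_superset by (intro PiE_mono) blast
  have tW: "t v \<in> W" if "v \<in> Pi\<^sub>E xs V" for v by (rule multilinear_onD(1)[OF tm that])
  have tl: "seq_linear_on (V x) W (\<lambda>a. t (v(x := a)))" if "v \<in> Pi\<^sub>E xs V" "x \<in> xs" for v x
    by (rule multilinear_onD(2)[OF tm that])
  have up: "v(x := a) \<in> Pi\<^sub>E xs V" if "v \<in> Pi\<^sub>E xs V" "x \<in> xs" "a \<in> V x" for v x a
    using that by (auto simp: PiE_iff extensional_def)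
  have vV: "v x \<in> V x" if "v \<in> Pi\<^sub>E xs V" "x \<in> xs" for v x using that by blast
  have rV: "\<rho> x u v \<in> V x" if "x \<in> xs" "v \<in> V x" for x u v using linear_onD(1)[OF lr[OF that(1)] that(2)] .
  define D where "D = (\<lambda>\<alpha> v. \<Sum>x\<in>xs. t (v(x := \<rho> x (\<alpha> x) (v x))))"
  have "multilinear_on xs seq_scale seq_scale V W (D \<alpha>)" for \<alpha>
    unfolding D_def by (rule multilinear_sum[OF vs subW]) (rule multilinear_single_site[OF tm _ lr])
  then have mD: "multilinear_on xs seq_scale seq_scale V UNIV (D \<alpha>)" for \<alpha> by (rule multilinear_on_UNIV)
  have "\<forall>\<alpha>. \<exists>h. seq_linear_on W UNIV h \<and> (\<forall>v\<in>Pi\<^sub>E xs V. h (t v) = D \<alpha> v)"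
    using tensor_hom_exists[OF tp mD] by metis
  from choice[OF this] obtain \<tau> where
    \<tau>: "\<forall>\<alpha>. seq_linear_on W UNIV (\<tau> \<alpha>) \<and> (\<forall>v\<in>Pi\<^sub>E xs V. \<tau> \<alpha> (t v) = D \<alpha> v)" ..
  have \<tau>1: "seq_linear_on W UNIV (\<tau> \<alpha>)" and \<tau>2: "v \<in> Pi\<^sub>E xs V \<Longrightarrow> \<tau> \<alpha> (t v) = D \<alpha> v" for \<alpha> v
    using \<tau> by auto
  have DW: "D \<alpha> v \<in> W" if "v \<in> Pi\<^sub>E xs V" for \<alpha> v
    unfolding D_def by (rule s.subspace_sum[OF subW]) (rule tW[OF up[OF that _ rV[OF _ vV[OF that]]]])
  have \<tau>W: "\<tau> \<alpha> w \<in> W" if w: "w \<in> W" for \<alpha> w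
    by (rule linear_on_span_in[OF vs subW \<tau>1, where G = "t ` Pi\<^sub>E xs B"]) (use BV tW DW \<tau>2 w Wspan in auto)
  then have \<tau>l: "seq_linear_on W W (\<tau> \<alpha>)" for \<alpha> using \<tau>1[of \<alpha>] by (simp add: linear_on_def)
  have \<tau>\<tau>: "seq_linear_on W W (\<lambda>w. \<tau> \<alpha> (\<tau> \<beta> w))" for \<alpha> \<beta>
    using \<tau>l[of \<alpha>] \<tau>l[of \<beta>] by (simp add: linear_on_def)
  have ladd: "seq_linear_on W UNIV (\<lambda>w. f w + g w)"
    and ldiff: "seq_linear_on W UNIV (\<lambda>w. f w - g w)"
    and lscl: "seq_linear_on W UNIV (\<lambda>w. seq_scale c (f w))"
    if "seq_linear_on W W f" "seq_linear_on W W g" for f g and c :: 'k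
    using that by (auto simp: linear_on_def s.scale_right_distrib s.scale_right_diff_distrib mult.commute)
  note uq = tensor_hom_unique[OF vs subW tp]
  have lA: "t (v(x := \<rho> x (a + b) (v x))) = t (v(x := \<rho> x a (v x))) + t (v(x := \<rho> x b (v x)))"
    and lS: "t (v(x := \<rho> x (scale c a) (v x))) = seq_scale c (t (v(x := \<rho> x a (v x))))"
    and lB: "t (v(x := \<rho> x (bracket a b) (v x))) = t (v(x := \<rho> x a (\<rho> x b (v x)))) - t (v(x := \<rho> x b (\<rho> x a (v x))))"
    if v: "v \<in> Pi\<^sub>E xs V" and x: "x \<in> xs" for v x a b c
  proof -
    note vx = vV[OF v x] and l = linear_onD[OF tl[OF v x]] and l' = linear_onD[OF lu[OF x vV[OF v x]]]
    note r = rV[OF x vV[OF v x]]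
    show "t (v(x := \<rho> x (a + b) (v x))) = t (v(x := \<rho> x a (v x))) + t (v(x := \<rho> x b (v x)))"
      using l'(2)[of a b] l(2)[OF r r, of a b] by simp
    show "t (v(x := \<rho> x (scale c a) (v x))) = seq_scale c (t (v(x := \<rho> x a (v x))))"
      using l'(3)[of a c] l(3)[OF r, of c a] by simp
    have "t (v(x := \<rho> x (bracket a b) (v x) + \<rho> x b (\<rho> x a (v x))))
      = t (v(x := \<rho> x (bracket a b) (v x))) + t (v(x := \<rho> x b (\<rho> x a (v x))))" by (rule l(2)[OF r rV[OF x r]])
    then show "t (v(x := \<rho> x (bracket a b) (v x))) = t (v(x := \<rho> x a (\<rho> x b (v x)))) - t (v(x := \<rho> x b (\<rho> x a (v x))))"
      using lie_repD(5)[OF rep[OF x] UNIV_I UNIV_I vx, of a b] by simp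
  qed
  have radd: "\<tau> (\<alpha> + \<beta>) w = \<tau> \<alpha> w + \<tau> \<beta> w" if w: "w \<in> W" for \<alpha> \<beta> w
  proof (rule uq[OF \<tau>1 ladd[OF \<tau>l \<tau>l] _ w])
    fix v assume v: "v \<in> Pi\<^sub>E xs V"
    show "\<tau> (\<alpha> + \<beta>) (t v) = \<tau> \<alpha> (t v) + \<tau> \<beta> (t v)"
      unfolding \<tau>2[OF v] D_def sum.distrib[symmetric] by (rule sum.cong[OF refl]) (simp add: lA[OF v])
  qed
  have rscl: "\<tau> (M_scale c \<alpha>) w = seq_scale c (\<tau> \<alpha> w)" if w: "w \<in> W" for c \<alpha> w
  proof (rule uq[OF \<tau>1 lscl[OF \<tau>l \<tau>l] _ w])
    fix v assume v: "v \<in> Pi\<^sub>E xs V"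
    show "\<tau> (M_scale c \<alpha>) (t v) = seq_scale c (\<tau> \<alpha> (t v))"
      unfolding \<tau>2[OF v] D_def s.scale_sum_right
      by (rule sum.cong[OF refl]) (simp only: lS[OF v] M_scale_def fun_scale_def[of scale])
  qed
  \<comment> \<open>expand both products as double sums over the sites and exchange the summations in one of them\<close>
  have rbr: "\<tau> (M_bracket \<alpha> \<beta>) w = \<tau> \<alpha> (\<tau> \<beta> w) - \<tau> \<beta> (\<tau> \<alpha> w)" if w: "w \<in> W" for \<alpha> \<beta> w
  proof (rule uq[OF \<tau>1 ldiff[OF \<tau>\<tau> \<tau>\<tau>] _ w])
    fix v assume v: "v \<in> Pi\<^sub>E xs V"
    let ?u = "\<lambda>\<alpha> x v. v(x := \<rho> x (\<alpha> x) (v x))"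
    have u: "?u \<alpha> x v \<in> Pi\<^sub>E xs V" if "x \<in> xs" for \<alpha> x using up[OF v that rV[OF that vV[OF v that]]] .
    have tt: "\<tau> \<alpha> (\<tau> \<beta> (t v)) = (\<Sum>y\<in>xs. \<Sum>x\<in>xs. t (?u \<alpha> x (?u \<beta> y v)))" for \<alpha> \<beta>
    proof -
      have "\<tau> \<alpha> (\<tau> \<beta> (t v)) = (\<Sum>y\<in>xs. \<tau> \<alpha> (t (?u \<beta> y v)))"
        unfolding \<tau>2[OF v] D_def by (rule linear_on_sum[OF vs vs subW \<tau>l]) (rule tW[OF u])
      then show ?thesis using \<tau>2[OF u] by (simp add: D_def)
    qed
    have "\<tau> \<alpha> (\<tau> \<beta> (t v)) - \<tau> \<beta> (\<tau> \<alpha> (t v))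
      = (\<Sum>y\<in>xs. \<Sum>x\<in>xs. t (?u \<alpha> x (?u \<beta> y v)) - t (?u \<beta> y (?u \<alpha> x v)))"
      unfolding tt sum_subtractf by (subst (2) sum.swap) (rule refl)
    also have "\<dots> = (\<Sum>y\<in>xs. \<Sum>x\<in>xs. if x = y then t (v(y := \<rho> y (bracket (\<alpha> y) (\<beta> y)) (v y))) else 0)"
    proof (intro sum.cong refl)
      fix x y assume x: "x \<in> xs" and y: "y \<in> xs"
      show "t (?u \<alpha> x (?u \<beta> y v)) - t (?u \<beta> y (?u \<alpha> x v))
        = (if x = y then t (v(y := \<rho> y (bracket (\<alpha> y) (\<beta> y)) (v y))) else 0)"
      proof (cases "x = y")
        case True
        then show ?thesis using lB[OF v y, of "\<alpha> y" "\<beta> y"] by simp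
      next
        case False
        then have "?u \<alpha> x (?u \<beta> y v) = ?u \<beta> y (?u \<alpha> x v)" by (auto simp: fun_upd_twist)
        then show ?thesis using False by simp
      qed
    qed
    also have "\<dots> = (\<Sum>y\<in>xs. t (v(y := \<rho> y (bracket (\<alpha> y) (\<beta> y)) (v y))))"
      by (rule sum.cong[OF refl]) (simp add: xs(1))
    finally show "\<tau> (M_bracket \<alpha> \<beta>) (t v) = \<tau> \<alpha> (\<tau> \<beta> (t v)) - \<tau> \<beta> (\<tau> \<alpha> (t v))"
      unfolding M_bracket_def \<tau>2[OF v, of "\<lambda>z. bracket (\<alpha> z) (\<beta> z)"] D_def by simp
  qed
  have fd: "M_rep (W, \<tau>)"
    unfolding fd_rep_def lie_rep_def prod.case fst_conv
  proof (intro conjI ballI vs subW fdW)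
    show "seq_linear_on W W (\<tau> \<alpha>)" for \<alpha> by (rule \<tau>l)
    show "linear_on M_scale seq_scale M W (\<lambda>\<alpha>. \<tau> \<alpha> w)" if "w \<in> W" for w
      using \<tau>W radd rscl that by (simp add: linear_on_def)
    show "\<tau> (M_bracket \<alpha> \<beta>) w = \<tau> \<alpha> (\<tau> \<beta> w) - \<tau> \<beta> (\<tau> \<alpha> w)" if "w \<in> W" for \<alpha> \<beta> w by (rule rbr[OF that])
  qed
  have irr: "irreducible_rep M seq_scale (W, \<tau>)"
    unfolding irreducible_rep_def prod.case
  proof (intro conjI allI impI)
    have finP: "finite (Pi\<^sub>E xs B)" using xs(1) B(1) by (rule finite_PiE)
    have "B x \<noteq> {}" if "x \<in> xs" for x
      using B(3)[OF that] R(2)[OF that] by (auto simp: irreducible_rep_def V_def case_prod_beta)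
    then obtain b where b: "b \<in> Pi\<^sub>E xs B" using PiE_eq_empty_iff[of xs B] by blast
    have "t b \<noteq> 0" using free_family_inj(2)[OF vs finP free] b s.dependent_zero by (metis imageI)
    moreover have "t b \<in> W" using b BV tW by blast
    ultimately show "W \<noteq> {0}" by blast
    fix U assume U: "s.subspace U \<and> U \<subseteq> W \<and> (\<forall>\<alpha>\<in>M. \<forall>u\<in>U. \<tau> \<alpha> u \<in> U)"
    show "U = {0} \<or> U = W"
    proof (rule disjCI)
      assume U0: "U \<noteq> W"
      show "U = {0}"
      proof (rule ccontr)
        assume ne: "U \<noteq> {0}"
        have "\<forall>x\<in>xs. \<exists>p. linear_op seq_scale p \<and> (\<forall>v. p v \<in> V x) \<and> (\<forall>v\<in>V x. p v = v)"
          using s.subspace_projection[OF subV] by metis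
        from bchoice[OF this] obtain p where
          p0: "\<forall>x\<in>xs. linear_op seq_scale (p x) \<and> (\<forall>v. p x v \<in> V x) \<and> (\<forall>v\<in>V x. p x v = v)" ..
        then have p: "linear_op seq_scale (p x)" "\<And>v. p x v \<in> V x" "\<And>v. v \<in> V x \<Longrightarrow> p x v = v"
          if "x \<in> xs" for x using that by auto
        obtain \<delta> where \<delta>: "\<And>x u. x \<in> xs \<Longrightarrow> \<delta> x u \<in> M" "\<And>x u. x \<in> xs \<Longrightarrow> \<delta> x u x = u"
          "\<And>x u y. x \<in> xs \<Longrightarrow> y \<in> xs \<Longrightarrow> y \<noteq> x \<Longrightarrow> \<delta> x u y = 0"
          by (rule site_elements[OF xs]) (rule that)
        define \<Phi> where "\<Phi> = (\<lambda>x. range (\<lambda>u v. \<rho> x u (p x v)))"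
        have "U = W"
        proof (rule s.tensor_irreducible[where B = B and V = V and \<Phi> = \<Phi> and t = t, OF vs xs(1) B(1) B(2) B(3) _ _ tm subW _ _ _ ne])
          show "W \<subseteq> s.span (t ` Pi\<^sub>E xs B)" by (rule equalityD1[OF Wspan])
          show "s.subspace U" "U \<subseteq> W" using U by auto
          fix x assume x: "x \<in> xs"
          have rest: "\<rho> x u v \<in> Z" if Z: "Z \<subseteq> V x" "s.invariant (\<Phi> x) Z" "v \<in> Z" for Z u v
            using Z p(3)[OF x, of v] unfolding s.invariant_def \<Phi>_def by fastforce
          show "s.irreducible_under (\<Phi> x) (V x)"
            unfolding s.irreducible_under_def
          proof (intro conjI subV[OF x] allI impI)
            show "V x \<noteq> {0}" using R(2)[OF x] by (auto simp: irreducible_rep_def V_def case_prod_beta)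
            show "s.invariant (\<Phi> x) (V x)" using rV[OF x p(2)[OF x]] by (auto simp: s.invariant_def \<Phi>_def)
            fix Z assume Z: "s.subspace Z \<and> Z \<subseteq> V x \<and> s.invariant (\<Phi> x) Z"
            then have "\<forall>a\<in>UNIV. \<forall>u\<in>Z. \<rho> x a u \<in> Z" using rest by blast
            then show "Z = {0} \<or> Z = V x"
              using Z R(2)[OF x] unfolding irreducible_rep_def V_def \<rho>_def case_prod_beta by blast
          qed
          fix \<phi> assume "\<phi> \<in> \<Phi> x"
          then obtain a where \<phi>: "\<phi> = (\<lambda>v. \<rho> x a (p x v))" by (auto simp: \<Phi>_def)
          show "linear_op seq_scale \<phi>"
            by (rule s.linearI) (simp_all add: \<phi> s.linearD[OF p(1)[OF x]] linear_onD(2,3)[OF lr[OF x]] p(2)[OF x])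
          have "\<tau> (\<delta> x a) (t v) = t (v(x := \<phi> (v x)))" if v: "v \<in> Pi\<^sub>E xs V" for v
          proof -
            have z: "t (v(y := \<rho> y (\<delta> x a y) (v y))) = (if y = x then t (v(x := \<phi> (v x))) else 0)" if y: "y \<in> xs" for y
            proof (cases "y = x")
              case True
              then show ?thesis using \<delta>(2)[OF x] p(3)[OF x vV[OF v x]] by (simp add: \<phi>)
            next
              case False
              then have "\<delta> x a y = 0" using \<delta>(3)[OF x y] by blast
              then have "t (v(y := \<rho> y (\<delta> x a y) (v y))) = t (v(y := \<rho> y (scale 0 0) (v y)))" by simp
              also have "\<dots> = 0" by (subst lS[OF v y]) simp
              finally show ?thesis using False by simp
            qed
            show ?thesis unfolding \<tau>2[OF v] D_def using z x xs(1) by simp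
          qed
          then show "\<exists>h. seq_linear_on W W h \<and>
            (\<forall>v\<in>Pi\<^sub>E xs V. h (t v) = t (v(x := \<phi> (v x)))) \<and> (\<forall>u\<in>U. h u \<in> U)"
            using \<tau>l U \<delta>(1)[OF x] by (intro exI[of _ "\<tau> (\<delta> x a)"]) auto
        qed
        then show False using U0 by blast
      qed
    qed
  qed
  have "ev_struct xs R (W, \<tau>) t"
    unfolding ev_struct_def using tp \<tau>l \<tau>2 by (simp add: V_def D_def \<rho>_def)
  with fd irr show ?thesis by blast
qed

end

section \<open>Well-definedness and surjectivity\<close>

context multiloop
begin

lemma orbit_self: "x \<in> X \<Longrightarrow> x \<in> orbit \<Gamma> act_X x"
  unfolding orbit_def using act_X_one by (force intro: sym)

lemma orbitD: "y \<in> orbit \<Gamma> act_X x \<Longrightarrow> \<exists>c\<in>carrier \<Gamma>. y = act_X c x"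
  by (auto simp: orbit_def)

lemma orbitI: "c \<in> carrier \<Gamma> \<Longrightarrow> act_X c x \<in> orbit \<Gamma> act_X x"
  by (auto simp: orbit_def)

lemma act_X_inv: "c \<in> carrier \<Gamma> \<Longrightarrow> x \<in> X \<Longrightarrow> act_X (ginv c) (act_X c x) = x"
  by (simp add: act_X_mult[symmetric] act_X_one)

lemma orbit_eq:
  assumes "x \<in> X" "y \<in> orbit \<Gamma> act_X x" shows "orbit \<Gamma> act_X y = orbit \<Gamma> act_X x"
proof -
  obtain c where c: "c \<in> carrier \<Gamma>" "y = act_X c x" using orbitD[OF assms(2)] by blast
  have "act_X d y \<in> orbit \<Gamma> act_X x" if "d \<in> carrier \<Gamma>" for d
    using orbitI[of "d \<otimes>\<^bsub>\<Gamma>\<^esub> c" x] that c by (simp add: act_X_mult)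
  moreover have "act_X d x \<in> orbit \<Gamma> act_X y" if "d \<in> carrier \<Gamma>" for d
    using orbitI[of "d \<otimes>\<^bsub>\<Gamma>\<^esub> ginv c" y] that c act_X_inv[OF c(1) assms(1)] by (simp add: act_X_mult)
  ultimately show ?thesis by (auto dest!: orbitD)
qed

lemma transversal_containing:
  assumes "x \<in> X" shows "\<exists>O'. transversal O' \<and> x \<in> O'"
proof -
  define r where "r = (\<lambda>A. if x \<in> A then x else (SOME y. y \<in> A))"
  have r: "r (orbit \<Gamma> act_X z) \<in> orbit \<Gamma> act_X z" if "z \<in> X" for z
    using orbit_self[OF that] someI[of "\<lambda>y. y \<in> orbit \<Gamma> act_X z" z] by (simp add: r_def)
  have oX: "y \<in> X" if "z \<in> X" "y \<in> orbit \<Gamma> act_X z" for z y using orbitD[OF that(2)] act_X_in that(1) by blast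
  let ?O = "(\<lambda>z. r (orbit \<Gamma> act_X z)) ` X"
  have ex: "\<exists>!y. y \<in> ?O \<and> y \<in> orbit \<Gamma> act_X z" if z: "z \<in> X" for z
  proof (rule ex1I[of _ "r (orbit \<Gamma> act_X z)"])
    show "r (orbit \<Gamma> act_X z) \<in> ?O \<and> r (orbit \<Gamma> act_X z) \<in> orbit \<Gamma> act_X z" using z r by blast
    fix y assume "y \<in> ?O \<and> y \<in> orbit \<Gamma> act_X z"
    then obtain z' where z': "z' \<in> X" "y = r (orbit \<Gamma> act_X z')" "y \<in> orbit \<Gamma> act_X z" by blast
    have "orbit \<Gamma> act_X z' = orbit \<Gamma> act_X y" unfolding z'(2) by (rule orbit_eq[OF z'(1) r[OF z'(1)], symmetric])
    also have "\<dots> = orbit \<Gamma> act_X z" by (rule orbit_eq[OF z z'(3)])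
    finally have "orbit \<Gamma> act_X z' = orbit \<Gamma> act_X z" .
    then show "y = r (orbit \<Gamma> act_X z)" using z'(2) by simp
  qed
  have "?O \<subseteq> X" using r oX by blast
  then have "transversal ?O" unfolding transversal_def by (intro conjI ballI ex)
  moreover have "x \<in> ?O" using assms orbit_self[OF assms] by (intro image_eqI[of _ _ x]) (simp_all add: r_def)
  ultimately show ?thesis by (intro exI conjI)
qed

lemma transversal_exists: "\<exists>O'. transversal O'"
proof -
  have "(\<lambda>i\<in>{..<n}. 1) \<in> X" by (simp add: X_iff)
  then show ?thesis using transversal_containing by blast
qed

lemma E_rep:
  assumes "\<Psi> \<in> E" "x \<in> X" "R \<in> \<Psi> x"
  shows "g_rep R" "irreducible_rep UNIV seq_scale R"
  using irrep_classD[OF E_D(1)[OF assms(1,2)] assms(3)] by auto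

lemma supp_transversal:
  assumes \<Psi>: "\<Psi> \<in> E" and O': "transversal O'" and x: "x \<in> supp \<Psi>"
  shows "\<exists>!y. y \<in> O' \<inter> supp \<Psi> \<and> y \<in> orbit \<Gamma> act_X x"
proof -
  have xX: "x \<in> X" using x supp_X by blast
  have "y \<in> supp \<Psi>" if "y \<in> orbit \<Gamma> act_X x" for y using orbitD[OF that] supp_act[OF \<Psi> xX] x by blast
  then show ?thesis using O' xX unfolding transversal_def by blast
qed

text \<open>
  A model at any other choice \<open>xs\<close> of representatives is moved along the orbits to the representatives in
  \<open>O'\<close>, where it is isomorphic to \<open>Q\<close> by uniqueness.
\<close>

theorem ev_class_eq:
  assumes \<Psi>: "\<Psi> \<in> E" and O': "transversal O'" and Q: "M_rep Q"
    and R: "\<And>y. y \<in> O' \<inter> supp \<Psi> \<Longrightarrow> R y \<in> \<Psi> y" and st: "ev_struct (O' \<inter> supp \<Psi>) R Q t"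
  shows "ev_class \<Psi> = M_class Q"
proof (intro equalityI subsetI)
  let ?ys = "O' \<inter> supp \<Psi>"
  have finy: "finite ?ys" using E_D(2)[OF \<Psi>] by simp
  have fR: "g_rep (R y)" if "y \<in> ?ys" for y using E_rep(1)[OF \<Psi> _ R[OF that]] that supp_X by blast
  fix Q'
  {
    assume "Q' \<in> ev_class \<Psi>"
    then obtain xs R' where fQ: "M_rep Q'" and xs: "xs \<subseteq> supp \<Psi>"
      and un: "\<forall>x\<in>supp \<Psi>. \<exists>!y. y \<in> xs \<and> y \<in> orbit \<Gamma> act_X x" and R': "\<forall>x\<in>xs. R' x \<in> \<Psi> x"
      and ev: "is_evaluation_rep seq_scale xs R' Q'" unfolding ev_class_def by blast
    have xX: "xs \<subseteq> X" using xs supp_X by blast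
    obtain t' where t': "ev_struct xs R' Q' t'"
      using ev_struct_of_evaluation[OF xX fd_repD(1)[OF fQ] ev] by blast
    have "\<forall>x\<in>xs. \<exists>c. c \<in> carrier \<Gamma> \<and> act_X c x \<in> ?ys"
    proof
      fix x assume "x \<in> xs"
      then have x: "x \<in> supp \<Psi>" using xs by blast
      obtain y where y: "y \<in> ?ys" "y \<in> orbit \<Gamma> act_X x" using ex1_implies_ex[OF supp_transversal[OF \<Psi> O' x]] by blast
      then show "\<exists>c. c \<in> carrier \<Gamma> \<and> act_X c x \<in> ?ys" using orbitD[OF y(2)] y(1) by auto
    qed
    from bchoice[OF this] obtain c where c: "\<forall>x\<in>xs. c x \<in> carrier \<Gamma> \<and> act_X (c x) x \<in> ?ys" ..
    have "\<forall>y\<in>?ys. \<exists>x. x \<in> xs \<and> x \<in> orbit \<Gamma> act_X y" using un by blast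
    from bchoice[OF this] obtain q where q: "\<forall>y\<in>?ys. q y \<in> xs \<and> q y \<in> orbit \<Gamma> act_X y" ..
    define p where "p = (\<lambda>x. act_X (c x) x)"
    have p1: "p x \<in> ?ys \<and> q (p x) = x" if x: "x \<in> xs" for x
    proof
      show px: "p x \<in> ?ys" using c x by (simp add: p_def)
      have "p x \<in> orbit \<Gamma> act_X x" using c x orbitI by (simp add: p_def)
      then have "orbit \<Gamma> act_X (p x) = orbit \<Gamma> act_X x" using orbit_eq xX x by blast
      then show "q (p x) = x" using un q px x orbit_self xX by (metis IntD2 subsetD)
    qed
    have p2: "q y \<in> xs \<and> p (q y) = y" if y: "y \<in> ?ys" for y
    proof
      show qy: "q y \<in> xs" using q y by blast
      have yX: "y \<in> X" using y supp_X by blast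
      have "orbit \<Gamma> act_X (q y) = orbit \<Gamma> act_X y" using q y orbit_eq[OF yX] by blast
      moreover have "p (q y) \<in> orbit \<Gamma> act_X (q y)" using c qy orbitI by (simp add: p_def)
      ultimately show "p (q y) = y"
        using supp_transversal[OF \<Psi> O', of y] y p1[OF qy] orbit_self[OF yX] by blast
    qed
    have "\<exists>t''. ev_struct ?ys R Q' t''"
      by (rule ev_struct_move[where p = p and q = q and c = c and R = R' and xs = xs, OF \<Psi> xX t' p1 p2 _ _ R])
        (use c R' p_def in auto)
    then obtain t'' where "ev_struct ?ys R Q' t''" ..
    from ev_struct_iso[OF Q st fQ this fR] fQ show "Q' \<in> M_class Q"
      by (simp add: rep_class_def)
  }
  assume "Q' \<in> M_class Q"
  then have Q': "M_rep Q'" and iso: "iso_rep M seq_scale seq_scale Q Q'"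
    by (auto simp: rep_class_def)
  obtain t' where t': "ev_struct ?ys R Q' t'" using ev_struct_transfer[OF st Q Q' iso fR] by blast
  have "is_evaluation_rep seq_scale ?ys R Q'"
    by (rule evaluation_of_ev_struct[OF finy transversal_orbit_free[OF O'] fd_repD(1)[OF Q'] t']) simp
  then show "Q' \<in> ev_class \<Psi>"
    unfolding ev_class_def using Q' supp_transversal[OF \<Psi> O'] R
    by (intro CollectI conjI exI[of _ ?ys] exI[of _ R]) auto
qed

lemma ev_class_model:
  assumes \<Psi>: "\<Psi> \<in> E" and O': "transversal O'"
  shows "\<exists>Q R t. M_rep Q \<and> irreducible_rep M seq_scale Q \<and>
    (\<forall>y\<in>O' \<inter> supp \<Psi>. R y \<in> \<Psi> y) \<and> ev_struct (O' \<inter> supp \<Psi>) R Q t \<and> ev_class \<Psi> = M_class Q"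
proof -
  let ?ys = "O' \<inter> supp \<Psi>"
  have fin: "finite ?ys" using E_D(2)[OF \<Psi>] by simp
  have "\<forall>y\<in>?ys. \<exists>R. R \<in> \<Psi> y" using irrep_class_nonempty[OF E_D(1)[OF \<Psi>]] supp_X by blast
  from bchoice[OF this] obtain R where R: "\<forall>y\<in>?ys. R y \<in> \<Psi> y" ..
  have rR: "g_rep (R y)" "irreducible_rep UNIV seq_scale (R y)" if "y \<in> ?ys" for y
    using E_rep[OF \<Psi>, of y "R y"] R that supp_X by blast+
  have of: "orbit_free ?ys" by (rule transversal_orbit_free[OF O']) simp
  have "\<exists>Q t. M_rep Q \<and> irreducible_rep M seq_scale Q \<and> ev_struct ?ys R Q t"
    by (rule ev_struct_exists[OF fin of rR])
  then obtain Q t where Q: "M_rep Q" "irreducible_rep M seq_scale Q" "ev_struct ?ys R Q t"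
    by blast
  have "ev_class \<Psi> = M_class Q" by (rule ev_class_eq[OF \<Psi> O' Q(1) _ Q(3)]) (use R in blast)
  then show ?thesis using Q R by blast
qed

text \<open>
  A representation of \<open>\<gg>\<close> composed with \<open>f\<close>; the action of \<open>\<Gamma>\<close> on classes is twisting by automorphisms.
\<close>

definition twist :: "('g \<Rightarrow> 'g) \<Rightarrow> ('g, 'k) seq_rep \<Rightarrow> ('g, 'k) seq_rep" where
  "twist f = (\<lambda>(V, \<rho>). (V, \<lambda>u. \<rho> (f u)))"

lemma act_class_twist: "act_class c C = twist (act_g (ginv c)) ` C"
  by (simp add: act_class_def twist_def)

lemma twist_twist: "twist f (twist g R) = twist (\<lambda>u. g (f u)) R"
  by (simp add: twist_def case_prod_beta)

lemma twist_id: "(\<And>u. f u = u) \<Longrightarrow> twist f R = R"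
  by (simp add: twist_def case_prod_beta)

lemma twist_rep:
  assumes "g_rep R"
  shows "g_rep (twist (act_g c) R)"
proof -
  obtain V \<rho> where e: "R = (V, \<rho>)" by (cases R)
  show ?thesis
    using assms unfolding e twist_def fd_rep_def lie_rep_def
    by (simp add: linear_on_def linearD[OF act_g_linear] act_g_bracket)
qed

lemma twist_irreducible:
  assumes c: "c \<in> carrier \<Gamma>" and R: "irreducible_rep UNIV seq_scale R"
  shows "irreducible_rep UNIV seq_scale (twist (act_g (ginv c)) R)"
proof -
  obtain V \<rho> where e: "R = (V, \<rho>)" by (cases R)
  have "(\<forall>a. \<forall>u\<in>U. \<rho> (act_g (ginv c) a) u \<in> U) \<longleftrightarrow> (\<forall>a. \<forall>u\<in>U. \<rho> a u \<in> U)" for U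
    using act_g_inv(2)[OF c] by metis
  then show ?thesis using R unfolding e twist_def irreducible_rep_def by simp
qed

lemma twist_iso: "iso_rep UNIV seq_scale seq_scale R R' \<Longrightarrow> iso_rep UNIV seq_scale seq_scale (twist f R) (twist f R')"
  unfolding iso_rep_def twist_def case_prod_beta by auto

lemma act_class_rep_class:
  assumes c: "c \<in> carrier \<Gamma>"
  shows "act_class c (g_class R) = g_class (twist (act_g (ginv c)) R)"
proof -
  let ?f = "act_g (ginv c)"
  note i = act_g_inv[OF c]
  show ?thesis
  proof (intro equalityI subsetI)
    fix R' assume "R' \<in> act_class c (g_class R)"
    then show "R' \<in> g_class (twist ?f R)"
      by (auto simp: act_class_twist rep_class_def intro: twist_rep twist_iso)
  next
    fix R' assume "R' \<in> g_class (twist ?f R)"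
    then have R': "g_rep R'" "iso_rep UNIV seq_scale seq_scale (twist ?f R) R'"
      by (auto simp: rep_class_def)
    have "iso_rep UNIV seq_scale seq_scale R (twist (act_g c) R')"
      using twist_iso[OF R'(2), of "act_g c"] i by (simp add: twist_twist twist_id)
    then have "twist (act_g c) R' \<in> g_class R" using twist_rep[OF R'(1)] by (simp add: rep_class_def)
    moreover have "R' = twist ?f (twist (act_g c) R')" using i by (simp add: twist_twist twist_id)
    ultimately show "R' \<in> act_class c (g_class R)" unfolding act_class_twist by blast
  qed
qed

lemma act_class_irrep:
  assumes "c \<in> carrier \<Gamma>" "C \<in> g_irreps"
  shows "act_class c C \<in> g_irreps"
proof -
  obtain R where R: "C = g_class R" "g_rep R" "irreducible_rep UNIV seq_scale R"
    using assms(2) by (auto simp: irrep_classes_def)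
  show ?thesis unfolding R(1) act_class_rep_class[OF assms(1)] irrep_classes_def
    using twist_rep[OF R(2)] twist_irreducible[OF assms(1) R(3)] by blast
qed

lemma act_class_mult:
  assumes "c \<in> carrier \<Gamma>" "d \<in> carrier \<Gamma>"
  shows "act_class (c \<otimes>\<^bsub>\<Gamma>\<^esub> d) C = act_class c (act_class d C)"
proof -
  have "(\<lambda>u. act_g (ginv d) (act_g (ginv c) u)) = act_g (ginv (c \<otimes>\<^bsub>\<Gamma>\<^esub> d))"
    using assms by (intro ext) (simp add: \<Gamma>.inv_mult_group act_g_mult)
  then show ?thesis unfolding act_class_twist image_image twist_twist by simp
qed

lemma act_class_one: "act_class \<one>\<^bsub>\<Gamma>\<^esub> C = C"
  by (simp add: act_class_twist twist_id act_g_one)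

lemma trivial_irreducible: "irreducible_rep UNIV seq_scale (trivial_rep :: ('g, 'k) seq_rep)"
proof -
  interpret s: lin_space "seq_scale :: 'k \<Rightarrow> _" by (rule lin_space_seq)
  let ?e = "\<lambda>i::nat. if i = 0 then 1 else (0::'k)"
  have e: "?e \<noteq> 0"
  proof
    assume "?e = 0"
    from fun_cong[OF this, of 0] show False by simp
  qed
  have "U = s.span {?e}" if U: "s.subspace U" "U \<subseteq> s.span {?e}" "U \<noteq> {0}" for U
  proof -
    obtain u where u: "u \<in> U" "u \<noteq> 0" using U s.subspace_0 by blast
    then obtain k where k: "u = seq_scale k ?e" using U(2) by (auto simp: s.span_singleton)
    have "k \<noteq> 0" using u(2) k by (intro notI) simp
    then have "?e = seq_scale (inverse k) u" by (auto simp: k fun_scale_def fun_eq_iff)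
    then have "?e \<in> U" using s.subspace_scale[OF U(1) u(1)] by metis
    then show ?thesis using U s.span_minimal[of "{?e}" U] by blast
  qed
  moreover have "s.span {?e} \<noteq> {0}" using e s.span_base[of ?e "{?e}"] by blast
  ultimately show ?thesis unfolding irreducible_rep_def trivial_rep_def by auto
qed

text \<open>
  The representation is an evaluation representation at representatives \<open>xs\<close> of some orbits.  Put its
  factors at these points, the zero class at the other representatives, and extend equivariantly: every
  point is the translate of a representative by exactly one element of \<open>\<Gamma>\<close>.  The support meets the set of
  representatives exactly in \<open>xs\<close> because the factors are nontrivial.
\<close>

theorem ev_class_surj:
  assumes "C \<in> S" shows "\<exists>\<Psi>\<in>E. ev_class \<Psi> = C"
proof -
  have C: "C \<in> irrep_classes M_scale M_bracket M" using assms by (simp add: S_def)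
  obtain Q where Q: "Q \<in> C" using irrep_class_nonempty[OF C] by blast
  note fQ = irrep_classD(1)[OF C Q]
  interpret s: lin_space "seq_scale :: 'k \<Rightarrow> _" by (rule lin_space_seq)
  interpret I: multiloop_irrep scale bracket n m \<sigma> \<xi> seq_scale "fst Q" "snd Q"
    by unfold_locales (use fd_repD[OF fQ] irrep_classD(2)[OF C Q] in simp_all)
  obtain O' where O': "transversal O'" using transversal_exists by blast
  obtain xs R where xs: "finite xs" "xs \<subseteq> O'"
    and R0: "\<forall>x\<in>xs. g_rep (R x) \<and> irreducible_rep UNIV seq_scale (R x)
      \<and> (\<exists>u. \<exists>y\<in>fst (R x). snd (R x) u y \<noteq> 0)"
    and ev0: "is_evaluation_rep seq_scale xs R (fst Q, snd Q)"
    using I.is_evaluation[OF O'] by blast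
  have R: "g_rep (R x)" "irreducible_rep UNIV seq_scale (R x)"
    "\<exists>u. \<exists>y\<in>fst (R x). snd (R x) u y \<noteq> 0" if "x \<in> xs" for x using R0 that by auto
  have ev: "is_evaluation_rep seq_scale xs R Q" using ev0 by simp
  have OX: "O' \<subseteq> X" using O' by (simp add: transversal_def)
  let ?Z = "g_class trivial_rep"
  define G where "G = (\<lambda>y. if y \<in> xs then g_class (R y) else ?Z)"
  have Zi: "?Z \<in> g_irreps" unfolding irrep_classes_def using trivial_fd_rep trivial_irreducible by blast
  have Gi: "G y \<in> g_irreps" for y
  proof (cases "y \<in> xs")
    case True
    have "g_class (R y) \<in> g_irreps"
      unfolding irrep_classes_def using R(1,2)[OF True] by blast
    then show ?thesis using True by (simp add: G_def)
  qed (simp add: G_def Zi)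
  have actZ: "act_class c ?Z = ?Z" if "c \<in> carrier \<Gamma>" for c
    using act_class_rep_class[OF that, of trivial_rep] by (simp add: trivial_rep_def twist_def)
  have zero: "zero_at x = ?Z" if "x \<in> X" for x using that by (simp add: zero_at_def g_at_X)
  have "\<forall>x\<in>X. \<exists>cy. fst cy \<in> carrier \<Gamma> \<and> snd cy \<in> O' \<and> x = act_X (fst cy) (snd cy)"
  proof
    fix x assume x: "x \<in> X"
    then obtain y where y: "y \<in> O'" "y \<in> orbit \<Gamma> act_X x" using O' by (auto simp: transversal_def)
    have "x \<in> orbit \<Gamma> act_X y" using orbit_eq[OF x y(2)] orbit_self[OF x] by simp
    then obtain c where "c \<in> carrier \<Gamma>" "x = act_X c y" using orbitD by blast
    then show "\<exists>cy. fst cy \<in> carrier \<Gamma> \<and> snd cy \<in> O' \<and> x = act_X (fst cy) (snd cy)"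
      using y(1) by (intro exI[of _ "(c, y)"]) simp
  qed
  from bchoice[OF this] obtain cy where
    cy: "\<forall>x\<in>X. fst (cy x) \<in> carrier \<Gamma> \<and> snd (cy x) \<in> O' \<and> x = act_X (fst (cy x)) (snd (cy x))" ..
  define cc r where "cc = (\<lambda>x. fst (cy x))" and "r = (\<lambda>x. snd (cy x))"
  have cr: "cc x \<in> carrier \<Gamma>" "r x \<in> O'" "r x \<in> X" "act_X (cc x) (r x) = x" if "x \<in> X" for x
    using cy that OX by (auto simp: cc_def r_def)
  have cun: "cc x = c \<and> r x = y" if c: "c \<in> carrier \<Gamma>" and y: "y \<in> O'" and x: "x = act_X c y" for c x y
  proof -
    have yX: "y \<in> X" using y OX by blast
    then have xX: "x \<in> X" using x act_X_in by simp
    have "r x \<in> orbit \<Gamma> act_X x" using orbitI[of "ginv (cc x)" x] act_X_inv[OF cr(1,3), of x x] cr(1,4)[OF xX] xX by simp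
    moreover have "y \<in> orbit \<Gamma> act_X x" using orbitI[of "ginv c" x] act_X_inv[OF c yX] c x by simp
    ultimately have ry: "r x = y" using O' y cr(2)[OF xX] xX unfolding transversal_def by blast
    have "act_X (ginv c \<otimes>\<^bsub>\<Gamma>\<^esub> cc x) y = y"
      using act_X_inv[OF c yX] cr(4)[OF xX] ry x by (simp add: act_X_mult)
    then have "ginv c \<otimes>\<^bsub>\<Gamma>\<^esub> cc x = \<one>\<^bsub>\<Gamma>\<^esub>" using act_X_fixed[OF _ yX] c cr(1)[OF xX] by simp
    then have "cc x = c" using c cr(1)[OF xX] by (metis \<Gamma>.inv_closed \<Gamma>.inv_equality \<Gamma>.inv_inv)
    then show ?thesis using ry by blast
  qed
  define \<Psi> where "\<Psi> = (\<lambda>x\<in>X. act_class (cc x) (G (r x)))"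
  have out: "\<Psi> x = zero_at x" if x: "x \<in> X" "r x \<notin> xs" for x
    using x cr(1) actZ zero by (simp add: \<Psi>_def G_def)
  have \<Psi>E: "\<Psi> \<in> E"
    unfolding E_def
  proof (intro CollectI conjI ballI)
    show "\<Psi> \<in> Pi\<^sub>E X R_at" using act_class_irrep[OF cr(1) Gi] by (auto simp: \<Psi>_def R_at_def g_at_X)
    have "supp \<Psi> \<subseteq> (\<lambda>(c, x). act_X c x) ` (carrier \<Gamma> \<times> xs)"
    proof
      fix x assume "x \<in> supp \<Psi>"
      then have x: "x \<in> X" "r x \<in> xs" using out by (auto simp: supp_def)
      show "x \<in> (\<lambda>(c, x). act_X c x) ` (carrier \<Gamma> \<times> xs)"
        using x cr(1,4)[OF x(1)] by (intro image_eqI[of _ _ "(cc x, r x)"]) auto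
    qed
    then show "finite (supp \<Psi>)" using finite_subset finite_\<Gamma> xs(1) by blast
    fix c x assume c: "c \<in> carrier \<Gamma>" and x: "x \<in> X"
    have "act_X c x = act_X (c \<otimes>\<^bsub>\<Gamma>\<^esub> cc x) (r x)" using cr(4)[OF x] by (simp add: act_X_mult)
    then have "cc (act_X c x) = c \<otimes>\<^bsub>\<Gamma>\<^esub> cc x \<and> r (act_X c x) = r x"
      using c cr(1,2)[OF x] by (intro cun) auto
    then show "\<Psi> (act_X c x) = act_class c (\<Psi> x)"
      using x act_X_in[OF x] by (simp add: \<Psi>_def act_class_mult[OF c cr(1)[OF x]])
  qed
  have on: "\<Psi> y = G y" if y: "y \<in> O'" for y
  proof -
    have yX: "y \<in> X" using y OX by blast
    have "cc y = \<one>\<^bsub>\<Gamma>\<^esub> \<and> r y = y" using y act_X_one[OF yX] by (intro cun) auto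
    then show ?thesis using yX by (simp add: \<Psi>_def act_class_one)
  qed
  have s: "O' \<inter> supp \<Psi> = xs"
  proof (intro equalityI subsetI)
    fix y assume "y \<in> O' \<inter> supp \<Psi>"
    then show "y \<in> xs" using on[of y] zero[of y] by (auto simp: supp_def G_def split: if_splits)
  next
    fix y assume y: "y \<in> xs"
    then have yO: "y \<in> O'" "y \<in> X" using xs(2) OX by auto
    have "G y \<noteq> zero_at y"
    proof -
      have "R y \<in> G y" unfolding G_def using rep_class_self[OF R(1)[OF y]] y by simp
      from zero_class_iff[OF yO(2) Gi this] R(3)[OF y] show ?thesis by blast
    qed
    then show "y \<in> O' \<inter> supp \<Psi>" using on yO by (simp add: supp_def)
  qed
  have RG: "R y \<in> \<Psi> y" if y: "y \<in> xs" for y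
    using rep_class_self[OF R(1)[OF y]] on[of y] y xs(2) by (auto simp only: G_def if_True)
  obtain t where "ev_struct xs R Q t"
    using ev_struct_of_evaluation[OF _ fd_repD(1)[OF fQ] ev] xs(2) OX by blast
  then have "ev_class \<Psi> = M_class Q"
    by (intro ev_class_eq[OF \<Psi>E O' fQ]) (auto simp: s RG)
  then show ?thesis using \<Psi>E irrep_classD(3)[OF C Q] by blast
qed

lemma ev_class_in_S: assumes "\<Psi> \<in> E" shows "ev_class \<Psi> \<in> S"
proof -
  obtain O' where O': "transversal O'" using transversal_exists by blast
  show ?thesis using ev_class_model[OF assms O'] unfolding S_def irrep_classes_def by blast
qed

end

section \<open>Injectivity\<close>

lemma fd_rep_maps:
  assumes "fd_rep sL br L Q"
  shows "module.subspace seq_scale (fst Q)" "\<And>a v. a \<in> L \<Longrightarrow> v \<in> fst Q \<Longrightarrow> snd Q a v \<in> fst Q"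
    "\<And>a. a \<in> L \<Longrightarrow> snd Q a 0 = 0"
proof -
  have r: "lie_rep sL br L seq_scale (fst Q, snd Q)" using assms by (simp add: fd_rep_def)
  note l = lie_repD[OF r]
  show "module.subspace seq_scale (fst Q)" by (rule l(2))
  show "\<And>a v. a \<in> L \<Longrightarrow> v \<in> fst Q \<Longrightarrow> snd Q a v \<in> fst Q" using linear_onD(1)[OF l(3)] .
  show "\<And>a. a \<in> L \<Longrightarrow> snd Q a 0 = 0" using linear_on_zero[OF vector_space_seq vector_space_seq l(2) l(3)] .
qed

text \<open>
  Schur's lemma: kernel and image of \<open>\<theta>\<close> are subrepresentations.
\<close>

lemma irreducible_hom_iso:
  assumes P: "fd_rep sL br L P" "irreducible_rep L seq_scale P"
    and P': "fd_rep sL br L P'" "irreducible_rep L seq_scale P'"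
    and \<theta>: "seq_linear_on (fst P) (fst P') \<theta>"
    and eqv: "\<And>a v. a \<in> L \<Longrightarrow> v \<in> fst P \<Longrightarrow> \<theta> (snd P a v) = snd P' a (\<theta> v)"
    and v0: "v0 \<in> fst P" "\<theta> v0 \<noteq> 0"
  shows "iso_rep L seq_scale seq_scale P P'"
proof -
  obtain V \<rho> V' \<rho>' where e: "P = (V, \<rho>)" "P' = (V', \<rho>')" by (cases P, cases P') auto
  interpret s: lin_space "seq_scale :: 'a \<Rightarrow> _" using vector_space_seq by (simp add: lin_space_def)
  have sV: "s.subspace V" and r: "\<And>a v. a \<in> L \<Longrightarrow> v \<in> V \<Longrightarrow> \<rho> a v \<in> V"
    using fd_rep_maps[OF P(1)] by (auto simp: e)
  note l = linear_onD[OF \<theta>[unfolded e fst_conv]] and eqv = eqv[unfolded e fst_conv snd_conv]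
    and v0 = v0[unfolded e fst_conv]
  have \<theta>0: "\<theta> 0 = 0" using l(3)[OF s.subspace_0[OF sV], of 0] by simp
  have irr: "U = {0} \<or> U = V" if "s.subspace U" "U \<subseteq> V" "\<forall>a\<in>L. \<forall>u\<in>U. \<rho> a u \<in> U" for U
    using P(2) that by (simp add: e irreducible_rep_def)
  have irr': "U = {0} \<or> U = V'" if "s.subspace U" "U \<subseteq> V'" "\<forall>a\<in>L. \<forall>u\<in>U. \<rho>' a u \<in> U" for U
    using P'(2) that by (simp add: e irreducible_rep_def)
  let ?N = "{v \<in> V. \<theta> v = 0}"
  have N: "?N = {0} \<or> ?N = V"
  proof (rule irr)
    show "s.subspace ?N"
      by (rule s.subspaceI) (use sV l \<theta>0 in \<open>auto simp: s.subspace_0 s.subspace_add s.subspace_scale\<close>)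
    have "\<rho>' a 0 = 0" if "a \<in> L" for a using fd_rep_maps(3)[OF P'(1) that] by (simp add: e)
    then show "\<forall>a\<in>L. \<forall>u\<in>?N. \<rho> a u \<in> ?N" using r eqv by auto
  qed blast
  then have N0: "?N = {0}" using v0 by blast
  have inj: "inj_on \<theta> V"
  proof (rule inj_onI)
    fix u v assume u: "u \<in> V" "v \<in> V" "\<theta> u = \<theta> v"
    have "\<theta> (u + seq_scale (-1) v) = \<theta> u + seq_scale (-1) (\<theta> v)"
      using l(2)[OF u(1) s.subspace_scale[OF sV u(2), of "-1"]] l(3)[OF u(2), of "-1"] by simp
    then have "\<theta> (u - v) = 0" using u(3) by simp
    then have "u - v \<in> ?N" using s.subspace_diff[OF sV u(1,2)] by blast
    then have "u - v = 0" using N0 by blast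
    then show "u = v" by simp
  qed
  have "\<theta> ` V = {0} \<or> \<theta> ` V = V'"
  proof (rule irr')
    show "s.subspace (\<theta> ` V)"
    proof (rule s.subspaceI)
      show "0 \<in> \<theta> ` V" using \<theta>0 s.subspace_0[OF sV] by (metis imageI)
      show "x + y \<in> \<theta> ` V" if xy: "x \<in> \<theta> ` V" "y \<in> \<theta> ` V" for x y
      proof -
        obtain u v where "u \<in> V" "x = \<theta> u" "v \<in> V" "y = \<theta> v" using xy by blast
        then show ?thesis using l(2) s.subspace_add[OF sV] by (metis imageI)
      qed
      show "seq_scale c x \<in> \<theta> ` V" if x: "x \<in> \<theta> ` V" for c x
      proof -
        obtain u where "u \<in> V" "x = \<theta> u" using x by blast
        then show ?thesis using l(3) s.subspace_scale[OF sV] by (metis imageI)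
      qed
    qed
    show "\<theta> ` V \<subseteq> V'" using l(1) by blast
    show "\<forall>a\<in>L. \<forall>u\<in>\<theta> ` V. \<rho>' a u \<in> \<theta> ` V" using r eqv by (metis (no_types, lifting) imageE imageI)
  qed
  then have "\<theta> ` V = V'" using v0 by blast
  then have "bij_betw \<theta> V V'" using inj by (simp add: bij_betw_def)
  then show ?thesis unfolding e iso_rep_def prod.case using \<theta> eqv by (intro exI[of _ \<theta>]) (simp add: e)
qed

context multiloop
begin

lemma outside_support:
  assumes \<Psi>: "\<Psi> \<in> E" and x: "x \<in> X" "x \<notin> supp \<Psi>"
  shows "\<exists>P\<in>\<Psi> x. (\<exists>v\<in>fst P. v \<noteq> 0) \<and> (\<forall>u. \<forall>v\<in>fst P. snd P u v = 0)"
proof -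
  interpret s: lin_space "seq_scale :: 'k \<Rightarrow> _" by (rule lin_space_seq)
  note cl = E_D(1)[OF \<Psi> x(1)]
  obtain P where P: "P \<in> \<Psi> x" using irrep_class_nonempty[OF cl] by blast
  have "\<Psi> x = zero_at x" using x by (simp add: supp_def)
  then have "\<forall>u. \<forall>v\<in>fst P. snd P u v = 0" using zero_class_iff[OF x(1) cl P] by blast
  moreover have "\<exists>v\<in>fst P. v \<noteq> 0"
    using E_rep(2)[OF \<Psi> x(1) P] s.subspace_0[OF fd_repD(1)[OF E_rep(1)[OF \<Psi> x(1) P]]]
    by (auto simp: irreducible_rep_def case_prod_beta)
  ultimately show ?thesis using P by blast
qed

lemma fd_rep_zero:
  assumes R: "g_rep (R y)" and v: "v \<in> fst (R y)" shows "snd (R y) 0 v = 0"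
  by (rule linear_on_zero[OF vector_space_axioms vector_space_seq subspace_UNIV lie_repD(4)[OF fd_repD(2)[OF R] v]])

text \<open>
  Fix a pure tensor \<open>v\<close> with nonzero image and vary its factor at \<open>x\<close>.  Elements of \<open>M\<close> vanishing at the other
  points act on the result through the factor at \<open>x\<close> only.  If \<open>x\<close> is outside the support, such elements
  act by zero, as \<open>\<gg>\<close> does on a representation in the zero class, and any linear map will do.
\<close>

lemma site_embedding:
  assumes \<Psi>: "\<Psi> \<in> E" and x: "x \<in> X" and ys: "finite ys" "ys \<subseteq> supp \<Psi>" "x \<in> supp \<Psi> \<Longrightarrow> x \<in> ys"
    and R: "\<And>y. y \<in> ys \<Longrightarrow> R y \<in> \<Psi> y" and Q: "M_rep Q" "fst Q \<noteq> {0}"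
    and st: "ev_struct ys R Q t"
  shows "\<exists>P\<in>\<Psi> x. \<exists>H. seq_linear_on (fst P) (fst Q) H \<and> (\<exists>v\<in>fst P. H v \<noteq> 0) \<and>
    (\<forall>\<alpha>\<in>M. (\<forall>y\<in>ys - {x}. \<alpha> y = 0) \<longrightarrow> (\<forall>v\<in>fst P. snd Q \<alpha> (H v) = H (snd P (\<alpha> x) v)))"
proof (cases "x \<in> ys")
  interpret s: lin_space "seq_scale :: 'k \<Rightarrow> _" by (rule lin_space_seq)
  let ?V = "\<lambda>y. fst (R y)"
  note sQ = fd_repD(1)[OF Q(1)] and tm = ev_structD(2)[OF st]
  have fR: "g_rep (R y)" if "y \<in> ys" for y using E_rep(1)[OF \<Psi> _ R[OF that]] that ys(2) supp_X by blast
  case True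
  obtain v where v: "v \<in> Pi\<^sub>E ys ?V" "t v \<noteq> 0"
    by (rule tensor_product_nonzero[OF ev_structD(1)[OF st] sQ Q(2)]) (rule that)
  let ?H = "\<lambda>a. t (v(x := a))"
  have "snd Q \<alpha> (?H a) = ?H (snd (R x) (\<alpha> x) a)"
    if \<alpha>: "\<alpha> \<in> M" "\<forall>y\<in>ys - {x}. \<alpha> y = 0" and a: "a \<in> ?V x" for \<alpha> a
  proof -
    have w: "v(x := a) \<in> Pi\<^sub>E ys ?V" using v(1) a True by (auto simp: PiE_iff extensional_def)
    have "snd Q \<alpha> (?H a) = (\<Sum>y\<in>ys. t ((v(x := a))(y := snd (R y) (\<alpha> y) ((v(x := a)) y))))"
      by (rule ev_structD(4)[OF st \<alpha>(1) w])
    also have "\<dots> = (\<Sum>y\<in>ys. if y = x then ?H (snd (R x) (\<alpha> x) a) else 0)"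
    proof (rule sum.cong[OF refl])
      fix y assume y: "y \<in> ys"
      show "t ((v(x := a))(y := snd (R y) (\<alpha> y) ((v(x := a)) y))) = (if y = x then ?H (snd (R x) (\<alpha> x) a) else 0)"
      proof (cases "y = x")
        case False
        then have z: "snd (R y) (\<alpha> y) ((v(x := a)) y) = 0"
          using \<alpha>(2) y fd_rep_zero[of R, OF fR[OF y]] PiE_mem[OF w y] by simp
        have "t ((v(x := a))(y := 0)) = 0"
          by (rule multilinear_zero[OF tm vector_space_seq vector_space_seq _ y])
            (use w y s.subspace_0[OF fd_repD(1)[OF fR[OF y]]] in \<open>auto simp: PiE_iff extensional_def\<close>)
        then show ?thesis using z False by simp
      qed simp
    qed
    also have "\<dots> = ?H (snd (R x) (\<alpha> x) a)" using ys(1) True by simp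
    finally show ?thesis .
  qed
  moreover have "seq_linear_on (?V x) (fst Q) ?H" by (rule multilinear_onD(2)[OF tm v(1) True])
  moreover have "\<exists>a\<in>?V x. ?H a \<noteq> 0" using v True by (intro bexI[of _ "v x"]) auto
  ultimately show ?thesis using R[OF True] by (intro bexI[of _ "R x"] exI[of _ ?H]) auto
next
  interpret s: lin_space "seq_scale :: 'k \<Rightarrow> _" by (rule lin_space_seq)
  note sQ = fd_repD(1)[OF Q(1)]
  have fR: "g_rep (R y)" if "y \<in> ys" for y using E_rep(1)[OF \<Psi> _ R[OF that]] that ys(2) supp_X by blast
  case False
  then have "x \<notin> supp \<Psi>" using ys(3) by blast
  then obtain P v where P: "P \<in> \<Psi> x" "v \<in> fst P" "v \<noteq> 0" "\<forall>u. \<forall>v\<in>fst P. snd P u v = 0"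
    using outside_support[OF \<Psi> x] by blast
  obtain i where i: "v i \<noteq> 0" using P(3) by (auto simp: fun_eq_iff)
  obtain w where w: "w \<in> fst Q" "w \<noteq> 0" using Q(2) s.subspace_0[OF sQ] by blast
  let ?H = "\<lambda>v :: 'k seq. seq_scale (v i) w"
  have wQ: "?H v \<in> fst Q" for v by (rule s.subspace_scale[OF sQ w(1)])
  have "snd Q \<alpha> (?H v) = ?H (snd P (\<alpha> x) v)"
    if \<alpha>: "\<alpha> \<in> M" "\<forall>y\<in>ys - {x}. \<alpha> y = 0" and v: "v \<in> fst P" for \<alpha> v
  proof -
    have "snd Q \<alpha> (?H v) = 0" by (rule ev_struct_vanish[OF sQ st fR \<alpha>(1) _ wQ]) (use \<alpha>(2) False in auto)
    then show ?thesis using P(4) v by simp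
  qed
  moreover have "seq_linear_on (fst P) (fst Q) ?H"
    using wQ by (auto simp: linear_on_def fun_scale_def fun_eq_iff algebra_simps)
  moreover have "?H v \<noteq> 0" using i w(2) by simp
  ultimately show ?thesis using P(1,2) by (intro bexI[of _ P] exI[of _ ?H]) auto
qed

text \<open>
  Contract all factors except the one at \<open>x\<close> with a coordinate of the sequence space; the coordinates are
  chosen so that a given nonzero pure tensor is not mapped to zero.
\<close>

lemma site_quotient:
  assumes \<Psi>: "\<Psi> \<in> E" and x: "x \<in> X" and ys: "finite ys" "ys \<subseteq> supp \<Psi>" "x \<in> supp \<Psi> \<Longrightarrow> x \<in> ys"
    and R: "\<And>y. y \<in> ys \<Longrightarrow> R y \<in> \<Psi> y" and Q: "M_rep Q" "fst Q \<noteq> {0}"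
    and st: "ev_struct ys R Q t"
  shows "\<exists>P\<in>\<Psi> x. \<exists>\<pi>. seq_linear_on (fst Q) (fst P) \<pi> \<and> (\<exists>w\<in>fst Q. \<pi> w \<noteq> 0) \<and>
    (\<forall>\<alpha>\<in>M. (\<forall>y\<in>ys - {x}. \<alpha> y = 0) \<longrightarrow> (\<forall>w\<in>fst Q. \<pi> (snd Q \<alpha> w) = snd P (\<alpha> x) (\<pi> w)))"
proof (cases "x \<in> ys")
  interpret s: lin_space "seq_scale :: 'k \<Rightarrow> _" by (rule lin_space_seq)
  let ?V = "\<lambda>y. fst (R y)"
  note sQ = fd_repD(1)[OF Q(1)] and tm = ev_structD(2)[OF st]
  have fR: "g_rep (R y)" if "y \<in> ys" for y using E_rep(1)[OF \<Psi> _ R[OF that]] that ys(2) supp_X by blast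
  case True
  obtain v0 where v0: "v0 \<in> Pi\<^sub>E ys ?V" "t v0 \<noteq> 0"
    by (rule tensor_product_nonzero[OF ev_structD(1)[OF st] sQ Q(2)]) (rule that)
  have ne: "v0 y \<noteq> 0" if "y \<in> ys" for y
    using multilinear_zero[OF tm vector_space_seq vector_space_seq v0(1) that] v0(2) by blast
  then have "\<forall>y\<in>ys. \<exists>i. v0 y i \<noteq> 0" by (auto simp: fun_eq_iff)
  from bchoice[OF this] obtain i where i: "\<forall>y\<in>ys. v0 y (i y) \<noteq> 0" ..
  define f where "f = (\<lambda>v :: _ \<Rightarrow> 'k seq. seq_scale (\<Prod>y\<in>ys - {x}. v y (i y)) (v x))"
  have fx: "f (v(x := a)) = seq_scale (\<Prod>y\<in>ys - {x}. v y (i y)) a" for v a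
  proof -
    have "(\<Prod>y\<in>ys - {x}. (v(x := a)) y (i y)) = (\<Prod>y\<in>ys - {x}. v y (i y))" by (rule prod.cong) auto
    then show ?thesis by (simp add: f_def)
  qed
  have fy: "f (v(y := a)) = seq_scale (a (i y)) (seq_scale (\<Prod>y\<in>ys - {x} - {y}. v y (i y)) (v x))"
    if y: "y \<in> ys" "y \<noteq> x" for v y a
  proof -
    have "(\<Prod>z\<in>ys - {x}. (v(y := a)) z (i z)) = a (i y) * (\<Prod>z\<in>ys - {x} - {y}. (v(y := a)) z (i z))"
      by (subst prod.remove[of _ y]) (use y ys(1) in auto)
    also have "(\<Prod>z\<in>ys - {x} - {y}. (v(y := a)) z (i z)) = (\<Prod>z\<in>ys - {x} - {y}. v z (i z))"
      by (rule prod.cong) auto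
    finally show ?thesis using y(2) by (simp add: f_def fun_scale_def mult.assoc)
  qed
  have fm: "multilinear_on ys seq_scale seq_scale ?V UNIV f"
    unfolding multilinear_on_def
  proof (intro conjI ballI)
    fix v y assume y: "y \<in> ys"
    show "seq_linear_on (?V y) UNIV (\<lambda>a. f (v(y := a)))"
    proof (cases "y = x")
      case True
      then show ?thesis by (simp add: fx linear_on_def s.scale_right_distrib mult.commute)
    next
      case False
      show ?thesis unfolding linear_on_def fy[OF y False]
        by (auto simp: fun_eq_iff fun_scale_def algebra_simps)
    qed
  qed simp
  obtain h where h: "seq_linear_on (fst Q) UNIV h" "\<And>v. v \<in> Pi\<^sub>E ys ?V \<Longrightarrow> h (t v) = f v"
    using tensor_hom_exists[OF ev_structD(1)[OF st] fm] by blast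
  obtain p where p: "linear_op seq_scale p" "\<And>v. p v \<in> ?V x" "\<And>w. w \<in> ?V x \<Longrightarrow> p w = w"
    using fd_repD(1)[OF fR[OF True]] by (rule s.subspace_projection) (rule that)
  let ?\<pi> = "\<lambda>w. p (h w)"
  have l\<pi>: "seq_linear_on (fst Q) (?V x) ?\<pi>"
    using h(1) p(2) by (auto simp: linear_on_def s.linearD[OF p(1)])
  have fV: "f v \<in> ?V x" if "v \<in> Pi\<^sub>E ys ?V" for v
    unfolding f_def by (rule s.subspace_scale[OF fd_repD(1)[OF fR[OF True]]]) (use that True in auto)
  have \<pi>t: "?\<pi> (t v) = f v" if "v \<in> Pi\<^sub>E ys ?V" for v using h(2)[OF that] p(3)[OF fV[OF that]] by simp
  have "?\<pi> (snd Q \<alpha> w) = snd (R x) (\<alpha> x) (?\<pi> w)"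
    if \<alpha>: "\<alpha> \<in> M" "\<forall>y\<in>ys - {x}. \<alpha> y = 0" and w: "w \<in> fst Q" for \<alpha> w
  proof (rule ev_struct_unique[OF st sQ, where h = "\<lambda>w. ?\<pi> (snd Q \<alpha> w)" and h' = "\<lambda>w. snd (R x) (\<alpha> x) (?\<pi> w)", OF _ _ _ w])
    note lx = lie_repD(3)[OF fd_repD(2)[OF fR[OF True]] UNIV_I, of "\<alpha> x"]
    show "seq_linear_on (fst Q) (?V x) (\<lambda>w. ?\<pi> (snd Q \<alpha> w))"
      using ev_structD(3)[OF st \<alpha>(1)] l\<pi> by (simp add: linear_on_def)
    show "seq_linear_on (fst Q) (?V x) (\<lambda>w. snd (R x) (\<alpha> x) (?\<pi> w))"
      using lx l\<pi> by (simp add: linear_on_def)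
    fix v assume v: "v \<in> Pi\<^sub>E ys ?V"
    have up: "v(y := snd (R y) (\<alpha> y) (v y)) \<in> Pi\<^sub>E ys ?V" if y: "y \<in> ys" for y
      using v y linear_onD(1)[OF lie_repD(3)[OF fd_repD(2)[OF fR[OF y]]], of "\<alpha> y" "v y"]
      by (auto simp: PiE_iff extensional_def)
    have "?\<pi> (snd Q \<alpha> (t v)) = (\<Sum>y\<in>ys. ?\<pi> (t (v(y := snd (R y) (\<alpha> y) (v y)))))"
      unfolding ev_structD(4)[OF st \<alpha>(1) v]
      by (rule linear_on_sum[OF vector_space_seq vector_space_seq sQ l\<pi>]) (rule multilinear_onD(1)[OF tm up])
    also have "\<dots> = (\<Sum>y\<in>ys. if y = x then f (v(x := snd (R x) (\<alpha> x) (v x))) else 0)"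
    proof (rule sum.cong[OF refl])
      fix y assume y: "y \<in> ys"
      have "f (v(y := snd (R y) (\<alpha> y) (v y))) = 0" if yx: "y \<noteq> x"
        using fy[OF y yx] \<alpha>(2) y yx fd_rep_zero[of R, OF fR[OF y] PiE_mem[OF v y]] by simp
      then show "?\<pi> (t (v(y := snd (R y) (\<alpha> y) (v y)))) = (if y = x then f (v(x := snd (R x) (\<alpha> x) (v x))) else 0)"
        unfolding \<pi>t[OF up[OF y]] by auto
    qed
    also have "\<dots> = f (v(x := snd (R x) (\<alpha> x) (v x)))" using ys(1) True by simp
    also have "\<dots> = snd (R x) (\<alpha> x) (f v)"
      unfolding fx f_def using linear_onD(3)[OF lx PiE_mem[OF v True]] by simp
    finally show "?\<pi> (snd Q \<alpha> (t v)) = snd (R x) (\<alpha> x) (?\<pi> (t v))" unfolding \<pi>t[OF v] .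
  qed
  moreover have "?\<pi> (t v0) \<noteq> 0"
  proof -
    have "(\<Prod>y\<in>ys - {x}. v0 y (i y)) \<noteq> 0" using i ys(1) by simp
    then show ?thesis unfolding \<pi>t[OF v0(1)] f_def using ne[OF True] by simp
  qed
  moreover have "t v0 \<in> fst Q" by (rule multilinear_onD(1)[OF tm v0(1)])
  ultimately show ?thesis using R[OF True] l\<pi> by (intro bexI[of _ "R x"] exI[of _ ?\<pi>]) auto
next
  interpret s: lin_space "seq_scale :: 'k \<Rightarrow> _" by (rule lin_space_seq)
  note sQ = fd_repD(1)[OF Q(1)]
  have fR: "g_rep (R y)" if "y \<in> ys" for y using E_rep(1)[OF \<Psi> _ R[OF that]] that ys(2) supp_X by blast
  case False
  then have "x \<notin> supp \<Psi>" using ys(3) by blast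
  then obtain P v where P: "P \<in> \<Psi> x" "v \<in> fst P" "v \<noteq> 0" "\<forall>u. \<forall>v\<in>fst P. snd P u v = 0"
    using outside_support[OF \<Psi> x] by blast
  obtain w where w: "w \<in> fst Q" "w \<noteq> 0" using Q(2) s.subspace_0[OF sQ] by blast
  then obtain i where i: "w i \<noteq> 0" by (auto simp: fun_eq_iff)
  let ?\<pi> = "\<lambda>w :: 'k seq. seq_scale (w i) v"
  have vP: "?\<pi> w \<in> fst P" for w by (rule s.subspace_scale[OF fd_repD(1)[OF E_rep(1)[OF \<Psi> x P(1)]] P(2)])
  have "?\<pi> (snd Q \<alpha> w) = snd P (\<alpha> x) (?\<pi> w)"
    if \<alpha>: "\<alpha> \<in> M" "\<forall>y\<in>ys - {x}. \<alpha> y = 0" and w: "w \<in> fst Q" for \<alpha> w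
  proof -
    have "snd Q \<alpha> w = 0" by (rule ev_struct_vanish[OF sQ st fR \<alpha>(1) _ w]) (use \<alpha>(2) False in auto)
    then show ?thesis using P(4) vP by simp
  qed
  moreover have "seq_linear_on (fst Q) (fst P) ?\<pi>"
    using vP by (auto simp: linear_on_def fun_scale_def fun_eq_iff algebra_simps)
  moreover have "?\<pi> w \<noteq> 0" using i P(3) by simp
  ultimately show ?thesis using P(1) w(1) by (intro bexI[of _ P] exI[of _ ?\<pi>]) auto
qed


text \<open>
  The equivariant maps from \<open>Q\<close> to \<open>P'\<close> form a space stable under composition with those elements of \<open>M\<close>
  that vanish at \<open>x\<close>, because these commute with the elements concentrated at \<open>x\<close>.  Hence the common
  kernel \<open>N\<close> of all equivariant maps is a subrepresentation.  It is proper, so it is zero, and some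
  equivariant map does not kill the image of \<open>H\<close>.  Composing the two gives a nonzero map from \<open>P\<close> to \<open>P'\<close>.
\<close>

lemma site_determined:
  assumes Q: "M_rep Q" "irreducible_rep M seq_scale Q"
    and F: "finite F" "orbit_free F" and x: "x \<in> F"
    and van: "\<And>\<alpha> w. \<alpha> \<in> M \<Longrightarrow> \<forall>y\<in>F. \<alpha> y = 0 \<Longrightarrow> w \<in> fst Q \<Longrightarrow> snd Q \<alpha> w = 0"
    and P: "g_rep P" "irreducible_rep UNIV seq_scale P"
    and P': "g_rep P'" "irreducible_rep UNIV seq_scale P'"
    and H: "seq_linear_on (fst P) (fst Q) H" "v0 \<in> fst P" "H v0 \<noteq> 0"
      "\<And>\<alpha> v. \<alpha> \<in> M \<Longrightarrow> \<forall>y\<in>F - {x}. \<alpha> y = 0 \<Longrightarrow> v \<in> fst P \<Longrightarrow> snd Q \<alpha> (H v) = H (snd P (\<alpha> x) v)"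
    and \<pi>0: "seq_linear_on (fst Q) (fst P') \<pi>0" "w0 \<in> fst Q" "\<pi>0 w0 \<noteq> 0"
      "\<And>\<alpha> w. \<alpha> \<in> M \<Longrightarrow> \<forall>y\<in>F - {x}. \<alpha> y = 0 \<Longrightarrow> w \<in> fst Q \<Longrightarrow> \<pi>0 (snd Q \<alpha> w) = snd P' (\<alpha> x) (\<pi>0 w)"
  shows "iso_rep UNIV seq_scale seq_scale P P'"
proof -
  interpret s: lin_space "seq_scale :: 'k \<Rightarrow> _" by (rule lin_space_seq)
  obtain \<delta> where \<delta>: "\<And>x u. x \<in> F \<Longrightarrow> \<delta> x u \<in> M" "\<And>x u. x \<in> F \<Longrightarrow> \<delta> x u x = u"
    "\<And>x u y. x \<in> F \<Longrightarrow> y \<in> F \<Longrightarrow> y \<noteq> x \<Longrightarrow> \<delta> x u y = 0"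
    by (rule site_elements[OF F]) (rule that)
  note \<delta>x = \<delta>(1)[OF x] and \<delta>u = \<delta>(2)[OF x]
  have \<delta>0: "\<forall>y\<in>F - {x}. \<delta> x u y = 0" for u using \<delta>(3)[OF x] by blast
  define W where "W = fst Q"
  define A where "A = (\<lambda>u. snd Q (\<delta> x u))"
  have rep: "lie_rep M_scale M_bracket M seq_scale (W, snd Q)" using fd_repD(2)[OF Q(1)] by (simp add: W_def)
  note sW = lie_repD(2)[OF rep] and lQ = lie_repD(3)[OF rep] and lin = linear_onD[OF lie_repD(4)[OF rep]]
    and br = lie_repD(5)[OF rep]
  have QW: "snd Q \<alpha> w \<in> W" if "\<alpha> \<in> M" "w \<in> W" for \<alpha> w using linear_onD(1)[OF lQ[OF that(1)] that(2)] .
  define Eq where "Eq = {\<pi>. seq_linear_on W (fst P') \<pi> \<and> (\<forall>u. \<forall>w\<in>W. \<pi> (A u w) = snd P' u (\<pi> w))}"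
  have Eq: "seq_linear_on W (fst P') \<pi>" "w \<in> W \<Longrightarrow> \<pi> (A u w) = snd P' u (\<pi> w)" if "\<pi> \<in> Eq" for \<pi> u w
    using that by (auto simp: Eq_def)
  have z: "\<pi> 0 = 0" if "\<pi> \<in> Eq" for \<pi> using linear_on_zero[OF vector_space_seq vector_space_seq sW Eq(1)[OF that]] .
  define N where "N = {w \<in> W. \<forall>\<pi>\<in>Eq. \<pi> w = 0}"
  have sN: "s.subspace N"
    unfolding N_def by (rule s.subspaceI)
      (use sW z linear_onD(2,3)[OF Eq(1)] in \<open>auto simp: s.subspace_0 s.subspace_add s.subspace_scale\<close>)
  have inv: "snd Q \<alpha> w \<in> N" if \<alpha>: "\<alpha> \<in> M" and w: "w \<in> N" for \<alpha> w
  proof -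
    have wW: "w \<in> W" using w by (simp add: N_def)
    let ?d = "\<delta> x (\<alpha> x)"
    \<comment> \<open>split \<open>\<alpha>\<close> into a part concentrated at \<open>x\<close> and a part vanishing at \<open>x\<close>\<close>
    define \<beta> where "\<beta> = (\<lambda>z. \<alpha> z + scale (-1) (?d z))"
    have \<beta>: "\<beta> \<in> M" "\<beta> x = 0" unfolding \<beta>_def by (rule M_add[OF \<alpha> M_scl[OF \<delta>x]]) (simp add: \<delta>u)
    have "\<alpha> = ?d + \<beta>" by (auto simp: \<beta>_def)
    then have split: "snd Q \<alpha> w = A (\<alpha> x) w + snd Q \<beta> w" using lin(2)[OF wW \<delta>x \<beta>(1), of "\<alpha> x"] by (simp add: A_def)
    have com: "snd Q \<beta> (A u v) = A u (snd Q \<beta> v)" if v: "v \<in> W" for u v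
    proof -
      have "M_bracket \<beta> (\<delta> x u) \<in> M" using M_br[OF \<beta>(1) \<delta>x] by (simp add: M_bracket_def)
      moreover have "\<forall>y\<in>F. M_bracket \<beta> (\<delta> x u) y = 0"
      proof
        fix y assume "y \<in> F"
        then show "M_bracket \<beta> (\<delta> x u) y = 0"
          using \<beta>(2) \<delta>0[of u] by (cases "y = x") (auto simp: M_bracket_def bracket_simps)
      qed
      ultimately have "snd Q (M_bracket \<beta> (\<delta> x u)) v = 0" by (rule van) (use v W_def in simp)
      then show ?thesis using br[OF \<beta>(1) \<delta>x v, of u] by (simp add: A_def)
    qed
    have "\<pi> (snd Q \<alpha> w) = 0" if \<pi>: "\<pi> \<in> Eq" for \<pi>
    proof -
      have "seq_linear_on W (fst P') (\<lambda>w. \<pi> (snd Q \<beta> w))"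
        using Eq(1)[OF \<pi>] lQ[OF \<beta>(1)] by (simp add: linear_on_def)
      then have "(\<lambda>w. \<pi> (snd Q \<beta> w)) \<in> Eq" using Eq(2)[OF \<pi> QW[OF \<beta>(1)]] com by (simp add: Eq_def)
      then have "\<pi> (snd Q \<beta> w) = 0" using w by (auto simp: N_def)
      moreover have "\<pi> (A (\<alpha> x) w) = 0"
        using Eq(2)[OF \<pi> wW] w \<pi> fd_rep_maps(3)[OF P'(1) UNIV_I] unfolding N_def by (metis (mono_tags, lifting) mem_Collect_eq)
      ultimately show ?thesis
        unfolding split using linear_onD(2)[OF Eq(1)[OF \<pi>] _ QW[OF \<beta>(1) wW], of "A (\<alpha> x) w"] QW[OF \<delta>x wW] by (simp add: A_def)
    qed
    then show ?thesis using QW[OF \<alpha> wW] unfolding N_def by blast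
  qed
  have "\<pi>0 \<in> Eq" unfolding Eq_def A_def using \<pi>0(1) \<pi>0(4)[OF \<delta>x \<delta>0] \<delta>u by (simp add: W_def)
  then have "N \<noteq> W" using \<pi>0(2,3) by (auto simp: N_def W_def)
  moreover have "N \<subseteq> W" by (auto simp: N_def)
  ultimately have "N = {0}"
    using Q(2) sN inv unfolding irreducible_rep_def case_prod_beta W_def[symmetric] by blast
  then have "H v0 \<notin> N" using H(3) by blast
  then obtain \<pi> where \<pi>: "\<pi> \<in> Eq" "\<pi> (H v0) \<noteq> 0" using linear_onD(1)[OF H(1,2)] by (auto simp: N_def W_def)
  note HW = linear_onD(1)[OF H(1), folded W_def]
  show ?thesis
  proof (rule irreducible_hom_iso[OF P P', where \<theta> = "\<lambda>v. \<pi> (H v)" and ?v0.0 = v0])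
    show "seq_linear_on (fst P) (fst P') (\<lambda>v. \<pi> (H v))"
      using Eq(1)[OF \<pi>(1)] H(1) by (simp add: linear_on_def W_def)
    show "\<pi> (H (snd P a v)) = snd P' a (\<pi> (H v))" if v: "v \<in> fst P" for a v
      using Eq(2)[OF \<pi>(1) HW[OF v], of a] H(4)[OF \<delta>x \<delta>0 v, of a] \<delta>u by (simp add: A_def)
  qed (use H(2) \<pi>(2) in auto)
qed

text \<open>
  Compare \<open>\<Psi>\<close> and \<open>\<Psi>'\<close> at \<open>x\<close> on one common model \<open>Q\<close>, evaluated at representatives of the orbits among
  which \<open>x\<close> is.
\<close>

theorem ev_class_inj:
  assumes \<Psi>: "\<Psi> \<in> E" and \<Psi>': "\<Psi>' \<in> E" and eq: "ev_class \<Psi> = ev_class \<Psi>'"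
  shows "\<Psi> = \<Psi>'"
proof (rule extensionalityI[OF E_D(4)[OF \<Psi>] E_D(4)[OF \<Psi>']])
  fix x assume x: "x \<in> X"
  interpret s: lin_space "seq_scale :: 'k \<Rightarrow> _" by (rule lin_space_seq)
  obtain O' where O': "transversal O'" "x \<in> O'" using transversal_containing[OF x] by blast
  let ?ys = "O' \<inter> supp \<Psi>" and ?ys' = "O' \<inter> supp \<Psi>'"
  obtain Q R t where Q: "M_rep Q" "irreducible_rep M seq_scale Q"
    and R: "\<forall>y\<in>?ys. R y \<in> \<Psi> y" and st: "ev_struct ?ys R Q t" and cl: "ev_class \<Psi> = M_class Q"
    using ev_class_model[OF \<Psi> O'(1)] by blast
  obtain Q' R' t' where Q': "M_rep Q'" "irreducible_rep M seq_scale Q'"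
    and R': "\<forall>y\<in>?ys'. R' y \<in> \<Psi>' y" and st': "ev_struct ?ys' R' Q' t'"
    and cl': "ev_class \<Psi>' = M_class Q'"
    using ev_class_model[OF \<Psi>' O'(1)] by blast
  have fR: "g_rep (R y)" if "y \<in> ?ys" for y
    using E_rep(1)[OF \<Psi> _ bspec[OF R that]] that supp_X by blast
  have fR': "g_rep (R' y)" if "y \<in> ?ys'" for y
    using E_rep(1)[OF \<Psi>' _ bspec[OF R' that]] that supp_X by blast
  have "Q \<in> M_class Q'" using rep_class_self[OF Q(1)] cl cl' eq by simp
  then have "iso_rep M seq_scale seq_scale Q' Q" by (simp add: rep_class_def)
  from ev_struct_transfer[OF st' Q'(1) Q(1) this fR'] obtain t'' where st'': "ev_struct ?ys' R' Q t''" by blast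
  have ne: "fst Q \<noteq> {0}" using Q(2) by (simp add: irreducible_rep_def case_prod_beta)
  have fin: "finite ?ys" "finite ?ys'" using E_D(2)[OF \<Psi>] E_D(2)[OF \<Psi>'] by auto
  obtain P H v0 where P: "P \<in> \<Psi> x" and H: "seq_linear_on (fst P) (fst Q) H" "v0 \<in> fst P" "H v0 \<noteq> 0"
    "\<forall>\<alpha>\<in>M. (\<forall>y\<in>?ys - {x}. \<alpha> y = 0) \<longrightarrow> (\<forall>v\<in>fst P. snd Q \<alpha> (H v) = H (snd P (\<alpha> x) v))"
    using site_embedding[OF \<Psi> x fin(1) _ _ _ Q(1) ne st] R O'(2) by blast
  obtain P' \<pi> w0 where P': "P' \<in> \<Psi>' x" and \<pi>: "seq_linear_on (fst Q) (fst P') \<pi>" "w0 \<in> fst Q" "\<pi> w0 \<noteq> 0"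
    "\<forall>\<alpha>\<in>M. (\<forall>y\<in>?ys' - {x}. \<alpha> y = 0) \<longrightarrow> (\<forall>w\<in>fst Q. \<pi> (snd Q \<alpha> w) = snd P' (\<alpha> x) (\<pi> w))"
    using site_quotient[OF \<Psi>' x fin(2) _ _ _ Q(1) ne st''] R' O'(2) by blast
  let ?F = "insert x (?ys \<union> ?ys')"
  have F: "finite ?F" "orbit_free ?F" using fin transversal_orbit_free[OF O'(1), of ?F] O'(2) by auto
  note rP = E_rep[OF \<Psi> x P] and rP' = E_rep[OF \<Psi>' x P']
  have "iso_rep UNIV seq_scale seq_scale P P'"
  proof (rule site_determined[OF Q F insertI1 _ rP rP' H(1-3) _ \<pi>(1-3)])
    show "snd Q \<alpha> w = 0" if "\<alpha> \<in> M" "\<forall>y\<in>?F. \<alpha> y = 0" "w \<in> fst Q" for \<alpha> w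
      by (rule ev_struct_vanish[OF fd_repD(1)[OF Q(1)] st fR that(1) _ that(3)]) (use that(2) in auto)
    show "snd Q \<alpha> (H v) = H (snd P (\<alpha> x) v)" if "\<alpha> \<in> M" "\<forall>y\<in>?F - {x}. \<alpha> y = 0" "v \<in> fst P" for \<alpha> v
      using H(4) that by blast
    show "\<pi> (snd Q \<alpha> w) = snd P' (\<alpha> x) (\<pi> w)" if "\<alpha> \<in> M" "\<forall>y\<in>?F - {x}. \<alpha> y = 0" "w \<in> fst Q" for \<alpha> w
      using \<pi>(4) that by blast
  qed
  then have "g_class P = g_class P'" by (rule rep_class_eqI[OF rP(1)])
  then show "\<Psi> x = \<Psi>' x" using irrep_classD(3)[OF E_D(1)[OF \<Psi> x] P] irrep_classD(3)[OF E_D(1)[OF \<Psi>' x] P'] by simp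
qed

end

theorem corollary6p1:
  fixes scale :: "'k::{alg_closed_field, field_char_0} \<Rightarrow> 'g::ab_group_add \<Rightarrow> 'g"
    and bracket :: "'g \<Rightarrow> 'g \<Rightarrow> 'g"
    and n :: nat and m :: "nat \<Rightarrow> nat" and \<sigma> :: "nat \<Rightarrow> 'g \<Rightarrow> 'g" and \<xi> :: "nat \<Rightarrow> 'k"
    and sW :: "'k \<Rightarrow> 'w::ab_group_add \<Rightarrow> 'w"
  assumes "multiloop scale bracket n m \<sigma> \<xi>"
  shows "bij_betw (multiloop.ev_class scale bracket n m \<sigma> \<xi>)
           (multiloop.E scale bracket n m \<sigma> \<xi>)
           (multiloop.S scale bracket n m \<sigma> \<xi>) \<and>
         (\<forall>W \<tau>.
           lie_rep (multiloop.M_scale scale) (multiloop.M_bracket bracket)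
             (multiloop.M scale n m \<sigma> \<xi>) sW (W, \<tau>) \<and>
           fin_dim sW W \<and>
           irreducible_rep (multiloop.M scale n m \<sigma> \<xi>) sW (W, \<tau>) \<longrightarrow>
           (\<exists>xs R. finite xs \<and> xs \<subseteq> multiloop.X n \<and>
              (\<forall>x\<in>xs. lie_rep scale bracket (multiloop.g_at n m \<sigma> \<xi> x) seq_scale (R x)) \<and>
              multiloop.is_evaluation_rep scale n m \<sigma> \<xi> sW xs R (W, \<tau>)))"
proof -
  interpret multiloop scale bracket n m \<sigma> \<xi> by fact
  have "bij_betw ev_class E S"
    using ev_class_inj ev_class_in_S ev_class_surj by (auto simp: bij_betw_def inj_on_def image_iff) (metis)
  moreover have "\<exists>xs R. finite xs \<and> xs \<subseteq> X \<and> (\<forall>x\<in>xs. lie_rep scale bracket (g_at x) seq_scale (R x)) \<and>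
      is_evaluation_rep sW xs R (W, \<tau>)"
    if W: "lie_rep M_scale M_bracket M sW (W, \<tau>) \<and> fin_dim sW W \<and> irreducible_rep M sW (W, \<tau>)" for W \<tau>
  proof -
    have "vector_space sW" using W lie_repD(1) by blast
    then interpret w: lin_space sW by (simp add: lin_space_def)
    interpret I: multiloop_irrep scale bracket n m \<sigma> \<xi> sW W \<tau>
      by unfold_locales (use W in auto)
    obtain O' where O': "transversal O'" using transversal_exists by blast
    then have OX: "O' \<subseteq> X" by (simp add: transversal_def)
    obtain xs R where xs: "finite xs" "xs \<subseteq> O'" "\<forall>x\<in>xs. g_rep (R x)"
      "is_evaluation_rep sW xs R (W, \<tau>)" using I.is_evaluation[OF O'] by blast
    have "lie_rep scale bracket (g_at x) seq_scale (R x)" if "x \<in> xs" for x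
      using xs(2,3) OX that g_at_X[of x] by (auto simp: fd_rep_def)
    then show ?thesis using xs OX by (intro exI[of _ xs] exI[of _ R]) auto
  qed
  ultimately show ?thesis by blast
qed

end
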